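(* Let $(M,\omega)$ be a compact Kähler manifold and let $u\in PSH(M,\omega)$. Then there exists a sequence of smooth $\omega$-plurisubharmonic functions $\{u_k\}$ on $M$ such that $u_k$ converges decreasingly to $u$ a.e.
   Context: A function $u:M\to[-\infty,\infty)$ is called $\omega$-plurisubharmonic if it is integrable, upper semicontinuous, and $\omega_u=\omega+\sqrt{-1}\,\partial\bar\partial u\ge0$ in the sense of distributions (currents). $PSH(M,\omega)$ is the set of all $\omega$-plurisubharmonic functions on $M$. *)

theory Defs
  imports "HOL-Analysis.Analysis"
begin

section \<open>Smooth functions and Wirtinger derivatives\<close>

text \<open>Meant for open \<open>S\<close>; differentiability is real differentiability.\<close>

primrec Ck_on :: "nat \<Rightarrow> 'a::real_normed_vector set \<Rightarrow> ('a \<Rightarrow> 'b::real_normed_vector) \<Rightarrow> bool" where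
  "Ck_on 0 S f \<longleftrightarrow> continuous_on S f"
| "Ck_on (Suc k) S f \<longleftrightarrow> (\<forall>x\<in>S. f differentiable (at x)) \<and>
     (\<forall>v. Ck_on k S (\<lambda>x. frechet_derivative f (at x) v))"

definition smooth_on :: "'a::real_normed_vector set \<Rightarrow> ('a \<Rightarrow> 'b::real_normed_vector) \<Rightarrow> bool" where
  "smooth_on S f \<longleftrightarrow> (\<forall>k. Ck_on k S f)"

definition holomorphic_map_on ::
    "(complex^'n) set \<Rightarrow> (complex^'n \<Rightarrow> complex^'m) \<Rightarrow> bool" where
  "holomorphic_map_on S f \<longleftrightarrow>
     (\<forall>z\<in>S. \<exists>f'. (f has_derivative f') (at z) \<and> (\<forall>c v. f' (c *s v) = c *s f' v))"

text \<open>\<open>dz j f\<close> is \<open>\<partial>f/\<partial>z\<^sub>j\<close> and \<open>dzbar j f\<close> is its conjugate counterpart.\<close>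

definition dz :: "'n \<Rightarrow> (complex^'n \<Rightarrow> complex) \<Rightarrow> complex^'n \<Rightarrow> complex" where
  "dz j f z = (frechet_derivative f (at z) (axis j 1)
     - \<i> * frechet_derivative f (at z) (axis j \<i>)) / 2"

definition dzbar :: "'n \<Rightarrow> (complex^'n \<Rightarrow> complex) \<Rightarrow> complex^'n \<Rightarrow> complex" where
  "dzbar j f z = (frechet_derivative f (at z) (axis j 1)
     + \<i> * frechet_derivative f (at z) (axis j \<i>)) / 2"

section \<open>Hermitian matrices\<close>

definition hermitian :: "complex^'n^'n \<Rightarrow> bool" where
  "hermitian H \<longleftrightarrow> (\<forall>j k. H $ k $ j = cnj (H $ j $ k))"

definition hermitian_form :: "complex^'n^'n \<Rightarrow> complex^'n \<Rightarrow> complex" where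
  "hermitian_form H v = (\<Sum>j\<in>UNIV. \<Sum>k\<in>UNIV. H $ j $ k * v $ j * cnj (v $ k))"

definition pos_definite :: "complex^'n^'n \<Rightarrow> bool" where
  "pos_definite H \<longleftrightarrow> hermitian H \<and> (\<forall>v. v \<noteq> 0 \<longrightarrow> 0 < Re (hermitian_form H v))"

definition pos_semidefinite :: "complex^'n^'n \<Rightarrow> bool" where
  "pos_semidefinite H \<longleftrightarrow> hermitian H \<and> (\<forall>v. 0 \<le> Re (hermitian_form H v))"

section \<open>Compact Kaehler manifolds\<close>

text \<open>A chart is a pair of its domain and its coordinate map; the values of the coordinate
  map outside the domain are irrelevant. A manifold is a Hausdorff second countable type
  with a holomorphic atlas (not required to be maximal).\<close>

type_synonym ('a, 'n) chart = "'a set \<times> ('a \<Rightarrow> complex^'n)"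

definition chart_image :: "('a, 'n::finite) chart \<Rightarrow> (complex^'n) set" where
  "chart_image c = snd c ` fst c"

definition chart_inv :: "('a, 'n::finite) chart \<Rightarrow> complex^'n \<Rightarrow> 'a" where
  "chart_inv c = inv_into (fst c) (snd c)"

definition transition :: "('a, 'n::finite) chart \<Rightarrow> ('a, 'n) chart \<Rightarrow> complex^'n \<Rightarrow> complex^'n" where
  "transition c d = snd d \<circ> chart_inv c"

locale complex_manifold =
  fixes atlas :: "('a::{t2_space, second_countable_topology}, 'n::finite) chart set"
  assumes open_domain: "c \<in> atlas \<Longrightarrow> open (fst c)"
    and open_image: "c \<in> atlas \<Longrightarrow> open (chart_image c)"
    and chart_homeomorphism:
      "c \<in> atlas \<Longrightarrow> homeomorphism (fst c) (chart_image c) (snd c) (chart_inv c)"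
    and charts_cover: "(\<Union>c\<in>atlas. fst c) = UNIV"
    and holomorphic_transition:
      "c \<in> atlas \<Longrightarrow> d \<in> atlas \<Longrightarrow>
       holomorphic_map_on (snd c ` (fst c \<inter> fst d)) (transition c d)"

text \<open>A Kaehler form \<open>\<omega>\<close> is given by its coefficient matrices \<open>g c\<close> in the charts \<open>c\<close>,
  \<open>\<omega> = \<i> \<Sum>\<^sub>j\<^sub>k g\<^sub>j\<^sub>k dz\<^sub>j \<and> dzbar\<^sub>k\<close>. Assumption \<open>coefficient_transform\<close> says that they glue to a
  global form; \<open>closed_dz\<close> and \<open>closed_dzbar\<close> are the (2,1)- and (1,2)-part of \<open>d\<omega> = 0\<close>.\<close>

locale compact_kaehler_manifold = complex_manifold atlas
  for atlas :: "('a::{t2_space, second_countable_topology}, 'n::finite) chart set" +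
  fixes g :: "('a, 'n) chart \<Rightarrow> complex^'n \<Rightarrow> complex^'n^'n"
  assumes compact_space: "compact (UNIV :: 'a set)"
    and smooth_coefficients: "c \<in> atlas \<Longrightarrow> smooth_on (chart_image c) (g c)"
    and coefficients_pos_definite:
      "c \<in> atlas \<Longrightarrow> z \<in> chart_image c \<Longrightarrow> pos_definite (g c z)"
    and coefficient_transform:
      "c \<in> atlas \<Longrightarrow> d \<in> atlas \<Longrightarrow> z \<in> snd c ` (fst c \<inter> fst d) \<Longrightarrow>
       g c z $ j $ k =
         (\<Sum>a\<in>UNIV. \<Sum>b\<in>UNIV. g d (transition c d z) $ a $ b
            * dz j (\<lambda>w. transition c d w $ a) z * cnj (dz k (\<lambda>w. transition c d w $ b) z))"
    and closed_dz:
      "c \<in> atlas \<Longrightarrow> z \<in> chart_image c \<Longrightarrow>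
       dz l (\<lambda>w. g c w $ j $ k) z = dz j (\<lambda>w. g c w $ l $ k) z"
    and closed_dzbar:
      "c \<in> atlas \<Longrightarrow> z \<in> chart_image c \<Longrightarrow>
       dzbar l (\<lambda>w. g c w $ j $ k) z = dzbar k (\<lambda>w. g c w $ j $ l) z"

text \<open>The Borel measure of the volume form \<open>\<omega>\<^sup>n / n!\<close>, which in a chart equals
  \<open>2\<^sup>n det g\<close> times Lebesgue measure because \<open>\<i> dz \<and> dzbar = 2 dx \<and> dy\<close>. On a Kaehler manifold the
  chart formulas agree on overlaps and countably many charts cover, so there is exactly
  one such measure.\<close>

definition kaehler_volume ::
    "('a::topological_space, 'n::finite) chart set \<Rightarrow>
     (('a, 'n) chart \<Rightarrow> complex^'n \<Rightarrow> complex^'n^'n) \<Rightarrow> 'a measure" where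
  "kaehler_volume atlas g = (THE \<mu>. sets \<mu> = sets borel \<and>
     (\<forall>c\<in>atlas. \<forall>B\<in>sets borel. B \<subseteq> fst c \<longrightarrow>
        emeasure \<mu> B =
          (\<integral>\<^sup>+ z\<in>snd c ` B. ennreal (2 ^ CARD('n) * Re (det (g c z))) \<partial>lborel)))"

section \<open>Omega-plurisubharmonic functions\<close>

definition upper_semicontinuous :: "('a::topological_space \<Rightarrow> ereal) \<Rightarrow> bool" where
  "upper_semicontinuous u \<longleftrightarrow> (\<forall>a. open {x. u x < a})"

text \<open>Test forms of bidegree (n-1,n-1) with compact support in the open set \<open>V\<close> are encoded by
  matrices: \<open>\<Theta>\<close> corresponds to \<open>F\<close> with \<open>\<i> dz\<^sub>j \<and> dzbar\<^sub>k \<and> \<Theta> = F\<^sub>j\<^sub>k d\<lambda>\<close>, where \<open>d\<lambda>\<close> is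
  Lebesgue measure. Since \<open>\<i> \<alpha> \<and> conj(\<alpha>) \<and> \<Theta> = (\<Sum>\<^sub>j\<^sub>k F\<^sub>j\<^sub>k \<alpha>\<^sub>j conj(\<alpha>\<^sub>k)) d\<lambda>\<close> for a (1,0)-form \<open>\<alpha>\<close>,
  \<open>\<Theta>\<close> is positive iff \<open>F\<close> is positive semidefinite everywhere.\<close>

definition positive_test_form ::
    "(complex^'n) set \<Rightarrow> (complex^'n \<Rightarrow> complex^'n^'n) \<Rightarrow> bool" where
  "positive_test_form V F \<longleftrightarrow> smooth_on UNIV F \<and>
     (\<exists>K. compact K \<and> K \<subseteq> V \<and> (\<forall>z. z \<notin> K \<longrightarrow> F z = 0)) \<and>
     (\<forall>z. pos_semidefinite (F z))"

text \<open>Positivity of the current \<open>\<omega> + \<i> \<partial>\<partial>bar u\<close>, read in the charts: its pairing with \<open>F\<close> is the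
  integral of \<open>\<Sum>\<^sub>j\<^sub>k g\<^sub>j\<^sub>k F\<^sub>j\<^sub>k + u \<Sum>\<^sub>j\<^sub>k \<partial>\<^sub>j\<partial>bar\<^sub>k F\<^sub>j\<^sub>k\<close>, which is real as \<open>g\<close> and \<open>F\<close> are Hermitian.
  The conversion of \<open>u\<close> to a real function matters only where \<open>u = -\<infinity>\<close>, a null set
  for integrable \<open>u\<close>.\<close>

definition current_nonneg ::
    "('a, 'n::finite) chart set \<Rightarrow> (('a, 'n) chart \<Rightarrow> complex^'n \<Rightarrow> complex^'n^'n) \<Rightarrow>
     ('a \<Rightarrow> ereal) \<Rightarrow> bool" where
  "current_nonneg atlas g u \<longleftrightarrow>
     (\<forall>c\<in>atlas. \<forall>F. positive_test_form (chart_image c) F \<longrightarrow>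
        0 \<le> (LINT z:chart_image c|lborel.
               Re (\<Sum>j\<in>UNIV. \<Sum>k\<in>UNIV. g c z $ j $ k * F z $ j $ k)
             + real_of_ereal (u (chart_inv c z))
               * Re (\<Sum>j\<in>UNIV. \<Sum>k\<in>UNIV. dz j (dzbar k (\<lambda>w. F w $ j $ k)) z)))"

text \<open>Integrability is stated through the extended-real \<open>\<bar>u\<bar>\<close>, so that \<open>u = -\<infinity>\<close> on a set of positive
  measure is excluded; measurability of \<open>u\<close> follows from upper semicontinuity.\<close>

definition PSH ::
    "('a::topological_space, 'n::finite) chart set \<Rightarrow>
     (('a, 'n) chart \<Rightarrow> complex^'n \<Rightarrow> complex^'n^'n) \<Rightarrow> ('a \<Rightarrow> ereal) set" where
  "PSH atlas g = {u. (\<forall>x. u x < \<infinity>) \<and>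
     (\<integral>\<^sup>+ x. e2ennreal \<bar>u x\<bar> \<partial>kaehler_volume atlas g) < \<infinity> \<and>
     upper_semicontinuous u \<and> current_nonneg atlas g u}"

definition smooth_function :: "('a, 'n::finite) chart set \<Rightarrow> ('a \<Rightarrow> real) \<Rightarrow> bool" where
  "smooth_function atlas f \<longleftrightarrow> (\<forall>c\<in>atlas. smooth_on (chart_image c) (f \<circ> chart_inv c))"

end

theory Submission
  imports Defs "HOL-Complex_Analysis.Cauchy_Integral_Formula"
begin

text \<open>In a chart, \<open>u\<close> minus a constant is a nonpositive function whose Levi form is bounded below by
  that of \<open>-\<omega>\<close> in the sense of distributions, and so almost are its mollifications. Mollifications in
  different charts are compared through the convexity of means in the logarithm of the radius: for
  small \<open>\<delta>\<close>, the function is at most \<open>1 - \<eta>\<close> times its mollification at \<open>z\<close> plus \<open>\<eta>\<close> on the whole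
  ball of radius \<open>C \<delta>\<close> around \<open>z\<close>, hence so are its mollifications in other charts near \<open>z\<close>.
  The mollifications \<open>u\<^sub>i\<close> are glued to \<open>\<epsilon> ln (exp (-N/\<epsilon>) + \<Sum>\<^sub>i \<xi>\<^sub>i\<^sup>2 exp (u\<^sub>i/\<epsilon>))\<close> with cutoffs \<open>\<xi>\<^sub>i\<close>, where the
  derivatives of the cutoffs contribute only \<open>O(\<epsilon>)\<close> to the Levi form because the comparison bounds
  the weights. Division by \<open>1 + O(\<epsilon>)\<close> yields a smooth \<open>\<omega>\<close>-plurisubharmonic function between \<open>u\<close> and
  any given continuous function that exceeds \<open>u\<close> by a positive constant.
  As \<open>u\<close> is upper semicontinuous, it is the infimum of countably many continuous functions; inserting
  smooth functions below the minimum of the previous one and the next of these gives the sequence.\<close>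

section \<open>Calculus of smooth functions\<close>

text \<open>Mollification depends on the coordinates, and u may be unbounded below and
  discontinuous, so the mollifications in two charts need not be uniformly close. The comparison
  between them loses a factor 1 - \<eta>, which for nonpositive values is an error proportional to
  their size. Truncation at a level -N makes this error smaller than \<epsilon>; that is the purpose
  of the summand exp (-N/\<epsilon>). It does no harm because the continuous majorant is bounded and
  N is chosen after it. Monotonicity cannot be obtained by shrinking the radius of mollification, as
  nothing orders the glued functions for different parameters. Therefore each function keeps a
  positive distance above u, and the next one is constructed below it; this distance pays for all
  errors of the construction.\<close>

abbreviation dird :: "('a::real_normed_vector \<Rightarrow> 'b::real_normed_vector) \<Rightarrow> 'a \<Rightarrow> 'a \<Rightarrow> 'b" where
  "dird f v x \<equiv> frechet_derivative f (at x) v"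

lemma has_derivative_cong_open:
  assumes "open S" "x \<in> S" "\<And>y. y \<in> S \<Longrightarrow> f y = g y"
  shows "(f has_derivative D) (at x) \<longleftrightarrow> (g has_derivative D) (at x)"
  using assms has_derivative_transform_within_open[of f D x UNIV S g]
    has_derivative_transform_within_open[of g D x UNIV S f] by auto

lemma frechet_derivative_cong_open:
  assumes "open S" "x \<in> S" "\<And>y. y \<in> S \<Longrightarrow> f y = g y"
  shows "frechet_derivative f (at x) = frechet_derivative g (at x)"
  unfolding frechet_derivative_def using has_derivative_cong_open[OF assms] by simp

lemma differentiable_cong_open:
  assumes "open S" "x \<in> S" "\<And>y. y \<in> S \<Longrightarrow> f y = g y"
  shows "f differentiable (at x) \<longleftrightarrow> g differentiable (at x)"
  unfolding differentiable_def using has_derivative_cong_open[OF assms] by simp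

lemma frechet_derivative_worksI:
  "f differentiable (at x) \<Longrightarrow> (f has_derivative frechet_derivative f (at x)) (at x)"
  using frechet_derivative_works by blast

lemma dird_eq: "(f has_derivative D) (at x) \<Longrightarrow> dird f v x = D v"
  by (metis frechet_derivative_at)

lemma Ck_on_cong:
  assumes "open S" "\<And>y. y \<in> S \<Longrightarrow> f y = g y"
  shows "Ck_on k S f \<longleftrightarrow> Ck_on k S g"
  using assms(2)
proof (induction k arbitrary: f g)
  case 0
  then show ?case by (auto intro!: continuous_on_cong)
next
  case (Suc k)
  have "f differentiable at x \<longleftrightarrow> g differentiable at x" if "x \<in> S" for x
    using differentiable_cong_open[OF assms(1) that Suc.prems] .
  moreover have "Ck_on k S (dird f v) \<longleftrightarrow> Ck_on k S (dird g v)" for v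
    by (rule Suc.IH) (simp add: frechet_derivative_cong_open[OF assms(1) _ Suc.prems])
  ultimately show ?case by auto
qed

lemma Ck_on_subset: "Ck_on k S f \<Longrightarrow> T \<subseteq> S \<Longrightarrow> Ck_on k T f"
  by (induction k arbitrary: f) (auto intro: continuous_on_subset)

lemma Ck_on_SucD: "Ck_on (Suc k) S f \<Longrightarrow> Ck_on k S f"
proof (induction k arbitrary: f)
  case 0
  then show ?case
    by (auto intro!: continuous_at_imp_continuous_on differentiable_imp_continuous_within)
qed auto

text \<open>Any family of derivatives may be used here instead of \<open>frechet_derivative\<close>;
  openness of S carries the class of its directional values over to \<open>dird f v\<close>.\<close>

lemma Ck_on_SucI:
  assumes "open S" "\<And>x. x \<in> S \<Longrightarrow> (f has_derivative f' x) (at x)" "\<And>v. Ck_on k S (\<lambda>x. f' x v)"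
  shows "Ck_on (Suc k) S f"
proof -
  have "Ck_on k S (dird f v)" for v
    using Ck_on_cong[OF assms(1), of "dird f v" "\<lambda>x. f' x v"] assms(3) dird_eq[OF assms(2)] by auto
  with assms(2) show ?thesis by (auto intro: differentiableI)
qed

lemma Ck_on_Suc_derivative:
  "Ck_on (Suc k) S f \<Longrightarrow> x \<in> S \<Longrightarrow> (f has_derivative frechet_derivative f (at x)) (at x)"
  by (simp add: frechet_derivative_worksI)

lemma Ck_on_Suc_dird: "Ck_on (Suc k) S f \<Longrightarrow> Ck_on k S (dird f v)"
  by simp

lemma Ck_on_const: "open S \<Longrightarrow> Ck_on k S (\<lambda>x. c)"
  by (induction k arbitrary: c)
     (auto intro!: Ck_on_SucI[where f' = "\<lambda>x v. 0"] simp del: Ck_on.simps(2))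

lemma Ck_on_bounded_linear: "open S \<Longrightarrow> bounded_linear L \<Longrightarrow> Ck_on k S L"
proof (induction k)
  case 0
  then show ?case using linear_continuous_on by auto
next
  case (Suc k)
  then show ?case
    by (intro Ck_on_SucI[where f' = "\<lambda>x. L"]) (auto intro: bounded_linear_imp_has_derivative Ck_on_const)
qed

lemma Ck_on_linear_compose:
  assumes "open S" "bounded_linear L" "Ck_on k S f"
  shows "Ck_on k S (\<lambda>x. L (f x))"
  using assms(3)
proof (induction k arbitrary: f)
  case 0
  then show ?case
    using continuous_on_compose2[OF linear_continuous_on[OF assms(2), of UNIV], of S f] by auto
next
  case (Suc k)
  show ?case
    by (rule Ck_on_SucI[OF assms(1), where f' = "\<lambda>x v. L (dird f v x)"])
       (use Suc in \<open>auto intro!: bounded_linear.has_derivative[OF assms(2)] Ck_on_Suc_derivative simp del: Ck_on.simps(2) dest: Ck_on_Suc_dird\<close>)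
qed

lemma Ck_on_add:
  assumes "open S" "Ck_on k S f" "Ck_on k S g"
  shows "Ck_on k S (\<lambda>x. f x + g x)"
  using assms(2,3)
proof (induction k arbitrary: f g)
  case 0
  then show ?case by (auto intro: continuous_on_add)
next
  case (Suc k)
  show ?case
    by (rule Ck_on_SucI[OF assms(1), where f' = "\<lambda>x v. dird f v x + dird g v x"])
       (use Suc in \<open>auto intro!: has_derivative_add Ck_on_Suc_derivative simp del: Ck_on.simps(2) dest: Ck_on_Suc_dird\<close>)
qed

lemma Ck_on_sum:
  assumes "open S" "\<And>i. i \<in> I \<Longrightarrow> Ck_on k S (f i)"
  shows "Ck_on k S (\<lambda>x. \<Sum>i\<in>I. f i x)"
  using assms(2) by (induction I rule: infinite_finite_induct) (auto intro: Ck_on_const Ck_on_add assms(1))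

lemma Ck_on_bilinear:
  assumes "open S" "bounded_bilinear B" "Ck_on k S f" "Ck_on k S g"
  shows "Ck_on k S (\<lambda>x. B (f x) (g x))"
  using assms(3,4)
proof (induction k arbitrary: f g)
  case 0
  then show ?case by (auto intro: bounded_bilinear.continuous_on[OF assms(2)])
next
  case (Suc k)
  have fg: "Ck_on k S f" "Ck_on k S g" using Suc.prems Ck_on_SucD by auto
  show ?case
  proof (rule Ck_on_SucI[OF assms(1), where f' = "\<lambda>x v. B (f x) (dird g v x) + B (dird f v x) (g x)"])
    show "((\<lambda>x. B (f x) (g x)) has_derivative (\<lambda>v. B (f x) (dird g v x) + B (dird f v x) (g x))) (at x)"
      if "x \<in> S" for x
      by (rule bounded_bilinear.FDERIV[OF assms(2)]) (use that Suc.prems in \<open>auto intro: frechet_derivative_worksI\<close>)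
    show "Ck_on k S (\<lambda>x. B (f x) (dird g v x) + B (dird f v x) (g x))" for v
      by (intro Ck_on_add assms Suc.IH fg) (use Suc.prems in auto)
  qed
qed

text \<open>The derivative of the composition is \<open>dird f (dird h v x) (h x)\<close>, whose
  direction moves with x, so the induction hypothesis does not fit it. Expanding that direction in a
  basis leaves a finite sum of products with fixed directions.\<close>

lemma Ck_on_compose:
  fixes f :: "'b::euclidean_space \<Rightarrow> 'c::real_normed_vector" and h :: "'a::real_normed_vector \<Rightarrow> 'b"
  assumes "open S" "open T" "h ` S \<subseteq> T" "Ck_on k S h" "Ck_on k T f"
  shows "Ck_on k S (\<lambda>x. f (h x))"
  using assms(4,5)
proof (induction k arbitrary: f)
  case 0
  then show ?case using assms(3) by (auto intro: continuous_on_compose2)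
next
  case (Suc k)
  have h: "Ck_on k S h" using Suc.prems Ck_on_SucD by auto
  have hx: "h x \<in> T" if "x \<in> S" for x using assms(3) that by auto
  show ?case
  proof (rule Ck_on_SucI[OF assms(1), where f' = "\<lambda>x v. \<Sum>b\<in>Basis. (dird h v x \<bullet> b) *\<^sub>R dird f b (h x)"])
    fix x assume x: "x \<in> S"
    have D: "((\<lambda>x. f (h x)) has_derivative (\<lambda>v. dird f (dird h v x) (h x))) (at x)"
      by (rule has_derivative_compose) (use x hx Suc.prems in \<open>auto intro: frechet_derivative_worksI\<close>)
    have lin: "linear (\<lambda>v. dird f v (h x))"
      using Ck_on_Suc_derivative[OF Suc.prems(2) hx[OF x]] has_derivative_linear by auto
    have "dird f (dird h v x) (h x) = (\<Sum>b\<in>Basis. (dird h v x \<bullet> b) *\<^sub>R dird f b (h x))" for v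
      by (subst euclidean_representation[symmetric, of "dird h v x"]) (simp add: linear_sum[OF lin] linear_scale[OF lin])
    then show "((\<lambda>x. f (h x)) has_derivative (\<lambda>v. \<Sum>b\<in>Basis. (dird h v x \<bullet> b) *\<^sub>R dird f b (h x))) (at x)"
      using D by simp
  next
    fix v
    show "Ck_on k S (\<lambda>x. \<Sum>b\<in>Basis. (dird h v x \<bullet> b) *\<^sub>R dird f b (h x))"
    proof (rule Ck_on_sum[OF assms(1)])
      fix b :: 'b
      show "Ck_on k S (\<lambda>x. (dird h v x \<bullet> b) *\<^sub>R dird f b (h x))"
      proof (rule Ck_on_bilinear[OF assms(1) bounded_bilinear_scaleR])
        show "Ck_on k S (\<lambda>x. dird h v x \<bullet> b)"
          by (rule Ck_on_linear_compose[OF assms(1) bounded_linear_inner_left]) (use Suc.prems in auto)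
        show "Ck_on k S (\<lambda>x. dird f b (h x))"
          by (rule Suc.IH[OF h]) (use Suc.prems in auto)
      qed
    qed
  qed
qed

lemma smooth_on_cong: "open S \<Longrightarrow> (\<And>y. y \<in> S \<Longrightarrow> f y = g y) \<Longrightarrow> smooth_on S f \<longleftrightarrow> smooth_on S g"
  unfolding smooth_on_def using Ck_on_cong by blast

lemma smooth_on_subset: "smooth_on S f \<Longrightarrow> T \<subseteq> S \<Longrightarrow> smooth_on T f"
  unfolding smooth_on_def using Ck_on_subset by blast

lemma smooth_on_const: "open S \<Longrightarrow> smooth_on S (\<lambda>x. c)"
  unfolding smooth_on_def using Ck_on_const by blast

lemma smooth_on_bounded_linear: "open S \<Longrightarrow> bounded_linear L \<Longrightarrow> smooth_on S L"
  unfolding smooth_on_def using Ck_on_bounded_linear by blast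

lemma smooth_on_linear_compose: "open S \<Longrightarrow> bounded_linear L \<Longrightarrow> smooth_on S f \<Longrightarrow> smooth_on S (\<lambda>x. L (f x))"
  unfolding smooth_on_def using Ck_on_linear_compose by blast

lemma smooth_on_add: "open S \<Longrightarrow> smooth_on S f \<Longrightarrow> smooth_on S g \<Longrightarrow> smooth_on S (\<lambda>x. f x + g x)"
  unfolding smooth_on_def using Ck_on_add by blast

lemma smooth_on_uminus: "open S \<Longrightarrow> smooth_on S f \<Longrightarrow> smooth_on S (\<lambda>x. - f x)"
  using smooth_on_linear_compose[OF _ bounded_linear_minus[OF bounded_linear_ident]] by blast

lemma smooth_on_diff: "open S \<Longrightarrow> smooth_on S f \<Longrightarrow> smooth_on S g \<Longrightarrow> smooth_on S (\<lambda>x. f x - g x)"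
  using smooth_on_add[of S f "\<lambda>x. - g x"] smooth_on_uminus[of S g] by simp

lemma smooth_on_sum: "open S \<Longrightarrow> (\<And>i. i \<in> I \<Longrightarrow> smooth_on S (f i)) \<Longrightarrow> smooth_on S (\<lambda>x. \<Sum>i\<in>I. f i x)"
  by (simp add: smooth_on_def Ck_on_sum)

lemma smooth_on_bilinear:
  "open S \<Longrightarrow> bounded_bilinear B \<Longrightarrow> smooth_on S f \<Longrightarrow> smooth_on S g \<Longrightarrow> smooth_on S (\<lambda>x. B (f x) (g x))"
  by (simp add: smooth_on_def Ck_on_bilinear)

lemmas smooth_on_scaleR = smooth_on_bilinear[OF _ bounded_bilinear_scaleR]
lemmas smooth_on_mult = smooth_on_bilinear[OF _ bounded_bilinear_mult]

lemma smooth_on_cmult: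
  fixes f :: "'a::real_normed_vector \<Rightarrow> 'b::real_normed_algebra"
  shows "open S \<Longrightarrow> smooth_on S f \<Longrightarrow> smooth_on S (\<lambda>x. c * f x)"
  by (rule smooth_on_mult) (auto intro: smooth_on_const)

lemma smooth_on_compose:
  fixes f :: "'b::euclidean_space \<Rightarrow> 'c::real_normed_vector" and h :: "'a::real_normed_vector \<Rightarrow> 'b"
  shows "open S \<Longrightarrow> open T \<Longrightarrow> h ` S \<subseteq> T \<Longrightarrow> smooth_on S h \<Longrightarrow> smooth_on T f \<Longrightarrow> smooth_on S (\<lambda>x. f (h x))"
  by (metis smooth_on_def Ck_on_compose)

lemma smooth_on_dird: "smooth_on S f \<Longrightarrow> smooth_on S (dird f v)"
  unfolding smooth_on_def using Ck_on_Suc_dird by blast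

lemma smooth_on_has_derivative:
  "smooth_on S f \<Longrightarrow> x \<in> S \<Longrightarrow> (f has_derivative frechet_derivative f (at x)) (at x)"
  unfolding smooth_on_def using Ck_on_Suc_derivative by blast

lemma smooth_on_continuous: "smooth_on S f \<Longrightarrow> continuous_on S f"
  unfolding smooth_on_def using Ck_on.simps(1) by blast

lemma Ck_on_local:
  assumes "\<And>x. x \<in> S \<Longrightarrow> \<exists>U. open U \<and> x \<in> U \<and> Ck_on k U f"
  shows "Ck_on k S f"
  using assms
proof (induction k arbitrary: f)
  case 0
  have "continuous (at x) f" if x: "x \<in> S" for x
  proof -
    obtain U where U: "open U" "x \<in> U" "Ck_on 0 U f" using 0[OF x] by auto
    then show ?thesis by (simp add: continuous_on_eq_continuous_at)
  qed
  then show ?case by (simp add: continuous_at_imp_continuous_on)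
next
  case (Suc k)
  have "f differentiable at x" if x: "x \<in> S" for x
  proof -
    obtain U where U: "open U" "x \<in> U" "Ck_on (Suc k) U f" using Suc.prems[OF x] by auto
    then show ?thesis by simp
  qed
  moreover have "Ck_on k S (dird f v)" for v
  proof (rule Suc.IH)
    fix x assume x: "x \<in> S"
    obtain U where U: "open U" "x \<in> U" "Ck_on (Suc k) U f" using Suc.prems[OF x] by auto
    then show "\<exists>U. open U \<and> x \<in> U \<and> Ck_on k U (dird f v)" by auto
  qed
  ultimately show ?case unfolding Ck_on.simps by simp
qed

lemma smooth_on_local:
  assumes "\<And>x. x \<in> S \<Longrightarrow> \<exists>U. open U \<and> x \<in> U \<and> smooth_on U f"
  shows "smooth_on S f"
  unfolding smooth_on_def
proof (intro allI Ck_on_local)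
  fix k x assume "x \<in> S"
  from assms[OF this] obtain U where "open U" "x \<in> U" "smooth_on U f" by auto
  then show "\<exists>U. open U \<and> x \<in> U \<and> Ck_on k U f" by (auto simp: smooth_on_def)
qed

section \<open>Smooth functions of one real variable and a smooth step\<close>

lemma Ck_on_Suc_realI:
  fixes f :: "real \<Rightarrow> real"
  assumes "open S" "\<And>x. x \<in> S \<Longrightarrow> (f has_real_derivative f' x) (at x)" "Ck_on k S f'"
  shows "Ck_on (Suc k) S f"
proof (rule Ck_on_SucI[OF assms(1), where f' = "\<lambda>x v. f' x * v"])
  show "Ck_on k S (\<lambda>x. f' x * v)" for v
    by (rule Ck_on_linear_compose[OF assms(1) bounded_linear_mult_left assms(3)])
qed (use assms(2) in \<open>auto simp: has_field_derivative_def\<close>)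

lemma smooth_on_exp: "smooth_on UNIV (exp :: real \<Rightarrow> real)"
proof -
  have "Ck_on k UNIV (exp :: real \<Rightarrow> real)" for k
    by (induction k) (auto intro!: Ck_on_Suc_realI continuous_intros DERIV_exp simp del: Ck_on.simps(2))
  then show ?thesis by (simp add: smooth_on_def)
qed

lemma smooth_on_inverse: "smooth_on {0<..} (inverse :: real \<Rightarrow> real)"
proof -
  have "Ck_on k {0<..} (inverse :: real \<Rightarrow> real)" for k
  proof (induction k)
    case (Suc k)
    have "Ck_on k {0<..} (\<lambda>x. - (inverse x * inverse x) :: real)"
      using Ck_on_linear_compose[OF _ bounded_linear_minus[OF bounded_linear_ident]
          Ck_on_bilinear[OF _ bounded_bilinear_mult Suc Suc]] by simp
    then show ?case
      by (rule Ck_on_Suc_realI[rotated 2]) (auto intro!: derivative_eq_intros simp: power2_eq_square)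
  qed (auto intro!: continuous_intros)
  then show ?thesis by (simp add: smooth_on_def)
qed

lemma smooth_on_ln: "smooth_on {0<..} (ln :: real \<Rightarrow> real)"
proof -
  have "Ck_on (Suc k) {0<..} (ln :: real \<Rightarrow> real)" for k
    by (rule Ck_on_Suc_realI[where f' = inverse])
       (use smooth_on_inverse in \<open>auto simp: smooth_on_def intro!: derivative_eq_intros simp: divide_inverse\<close>)
  then have "Ck_on k {0<..} (ln :: real \<Rightarrow> real)" for k using Ck_on_SucD by blast
  then show ?thesis by (simp add: smooth_on_def)
qed

text \<open>The functions exp (-1/x) / x^m, extended by 0, span a space closed under
  differentiation, so one induction on the order, with m arbitrary, shows that all of them are
  smooth.\<close>

definition flat :: "nat \<Rightarrow> real \<Rightarrow> real" where
  "flat m x = (if 0 < x then exp (- inverse x) * inverse x ^ m else 0)"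

lemma flat_nonneg: "0 \<le> flat m x" and flat_le_0: "x \<le> 0 \<Longrightarrow> flat m x = 0"
  by (auto simp: flat_def)

text \<open>One term of the exponential series at 1/x. The quadratic decay makes the difference
  quotient at 0 tend to 0 in \<open>flat_derivative\<close>.\<close>

lemma flat_bound: "flat m x \<le> fact (m + 2) * x\<^sup>2"
proof (cases "0 < x")
  case True
  define y where "y = inverse x"
  have y: "0 < y" using True by (simp add: y_def)
  have "y ^ (m + 2) /\<^sub>R fact (m + 2) \<le> exp y"
    unfolding exp_def by (rule order_trans[OF _ sum_le_suminf[OF summable_exp_generic, of "{m + 2}"]]) (use y in auto)
  then have "y ^ (m + 2) \<le> fact (m + 2) * exp y"
    by (simp add: divide_simps mult.commute del: fact_Suc)
  then have "exp (- y) * y ^ m * y\<^sup>2 \<le> fact (m + 2)"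
    by (simp add: exp_minus divide_simps power_add power2_eq_square mult_ac del: fact_Suc)
  then show ?thesis using True unfolding flat_def y_def
    by (simp add: field_simps del: fact_Suc)
qed (auto simp: flat_def)

lemma flat_derivative:
  "(flat m has_real_derivative (flat (m + 2) x - real m * flat (m + 1) x)) (at x)"
proof -
  consider "0 < x" | "x < 0" | "x = 0" by linarith
  then show ?thesis
  proof cases
    case 1
    have inv: "(inverse has_real_derivative - (inverse x)\<^sup>2) (at x)"
      using DERIV_inverse[of x] 1 by (simp add: power2_eq_square)
    have E: "((\<lambda>x. exp (- inverse x)) has_real_derivative exp (- inverse x) * (inverse x)\<^sup>2) (at x)"
      using DERIV_chain2[OF DERIV_exp DERIV_minus[OF inv]] by simp
    have "((\<lambda>x. inverse x ^ m) has_real_derivative real m * (- (inverse x)\<^sup>2 * inverse x ^ (m - 1))) (at x)"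
      using DERIV_power[OF inv, of m] by simp
    moreover have "real m * (- (inverse x)\<^sup>2 * inverse x ^ (m - 1)) = - real m * inverse x ^ (m + 1)"
      by (cases m) (auto simp: power2_eq_square algebra_simps)
    ultimately have P: "((\<lambda>x. inverse x ^ m) has_real_derivative - real m * inverse x ^ (m + 1)) (at x)" by metis
    have "((\<lambda>x. exp (- inverse x) * inverse x ^ m) has_real_derivative
        (flat (m + 2) x - real m * flat (m + 1) x)) (at x)"
      using DERIV_mult[OF E P] 1 by (simp add: flat_def power2_eq_square algebra_simps)
    then show ?thesis
      by (rule has_field_derivative_transform_within_open[where S = "{0<..}"]) (use 1 in \<open>auto simp: flat_def\<close>)
  next
    case 2
    have "((\<lambda>x. 0) has_real_derivative 0) (at x)" by simp
    then have "(flat m has_real_derivative 0) (at x)"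
      by (rule has_field_derivative_transform_within_open[where S = "{..<0}"]) (use 2 in \<open>auto simp: flat_def\<close>)
    then show ?thesis using 2 by (simp add: flat_def)
  next
    case 3
    have "((\<lambda>h. flat m h / h) \<longlongrightarrow> 0) (at 0)"
    proof (rule Lim_null_comparison[where g = "\<lambda>h. fact (m + 2) * \<bar>h\<bar>"])
      show "\<forall>\<^sub>F h in at 0. norm (flat m h / h) \<le> fact (m + 2) * \<bar>h\<bar>"
      proof (intro always_eventually allI)
        fix h :: real
        show "norm (flat m h / h) \<le> fact (m + 2) * \<bar>h\<bar>"
          using flat_bound[of m h] flat_nonneg[of m h]
          by (cases "h = 0") (simp_all add: divide_le_eq power2_eq_square abs_mult_self_eq mult.assoc del: fact_Suc)
      qed
      show "((\<lambda>h. fact (m + 2) * \<bar>h\<bar>) \<longlongrightarrow> (0::real)) (at 0)"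
        by (auto intro!: tendsto_eq_intros)
    qed
    then show ?thesis using 3 by (simp add: has_field_derivative_iff flat_def)
  qed
qed

lemma smooth_on_flat: "smooth_on UNIV (flat m)"
proof -
  have "Ck_on k UNIV (flat m)" for k
  proof (induction k arbitrary: m)
    case 0
    show ?case using flat_derivative DERIV_isCont
      by (metis Ck_on.simps(1) continuous_at_imp_continuous_on)
  next
    case (Suc k)
    have "Ck_on k UNIV (\<lambda>x. flat (m + 2) x + (- real m) * flat (m + 1) x)"
      by (intro Ck_on_add Ck_on_linear_compose[OF _ bounded_linear_mult_right] Suc) auto
    then show ?case
      by (intro Ck_on_Suc_realI[OF _ flat_derivative]) auto
  qed
  then show ?thesis by (simp add: smooth_on_def)
qed

text \<open>The number 1/16 is the square of 1/4: applied to a squared norm, the step is 1 up to a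
  quarter of the radius at which it reaches 0. Both the mollifier and the cutoffs in charts are
  built in this way.\<close>

definition step :: "real \<Rightarrow> real" where
  "step x = flat 0 (1 - x) / (flat 0 (1 - x) + flat 0 (x - 1/16))"

lemma flat_pos: "0 < x \<Longrightarrow> 0 < flat m x"
  by (simp add: flat_def)

lemma flat0_mono: "x \<le> y \<Longrightarrow> flat 0 x \<le> flat 0 y"
  by (auto simp: flat_def le_imp_inverse_le)

lemma step_denominator: "0 < flat 0 (1 - x) + flat 0 (x - 1/16)"
  using flat_pos[of "1 - x" 0] flat_pos[of "x - 1/16" 0] flat_nonneg[of 0 "1 - x"] flat_nonneg[of 0 "x - 1/16"]
  by (cases "x < 1") auto

lemma step_nonneg: "0 \<le> step x" and step_le_1: "step x \<le> 1"
  using step_denominator[of x] flat_nonneg[of 0 "1 - x"] flat_nonneg[of 0 "x - 1/16"]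
  by (auto simp: step_def)

lemma step_eq_1: "x \<le> 1/16 \<Longrightarrow> step x = 1"
  using step_denominator[of x] by (simp add: step_def flat_le_0)

lemma step_eq_0: "1 \<le> x \<Longrightarrow> step x = 0"
  by (simp add: step_def flat_le_0)

lemma step_antimono: assumes "x \<le> y" shows "step y \<le> step x"
proof -
  have "flat 0 (1 - y) * flat 0 (x - 1/16) \<le> flat 0 (1 - x) * flat 0 (y - 1/16)"
    by (intro mult_mono flat0_mono flat_nonneg) (use assms in auto)
  then show ?thesis using step_denominator[of x] step_denominator[of y]
    by (simp add: step_def divide_le_eq le_divide_eq algebra_simps)
qed

lemma smooth_on_ident: "open S \<Longrightarrow> smooth_on S (\<lambda>x. x)"
  by (rule smooth_on_bounded_linear[OF _ bounded_linear_ident])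

lemma smooth_on_step: "smooth_on UNIV step"
proof -
  have 1: "smooth_on UNIV (\<lambda>x. flat 0 (1 - x))"
    by (rule smooth_on_compose[OF _ open_UNIV _ _ smooth_on_flat])
       (auto intro!: smooth_on_diff smooth_on_const smooth_on_ident)
  have 2: "smooth_on UNIV (\<lambda>x. flat 0 (x - 1/16))"
    by (rule smooth_on_compose[OF _ open_UNIV _ _ smooth_on_flat])
       (auto intro!: smooth_on_diff smooth_on_const smooth_on_ident)
  have "smooth_on UNIV (\<lambda>x. inverse (flat 0 (1 - x) + flat 0 (x - 1/16)))"
  proof (rule smooth_on_compose[where T = "{0<..}" and f = inverse])
    show "(\<lambda>x. flat 0 (1 - x) + flat 0 (x - 1/16)) ` UNIV \<subseteq> {0<..}"
      unfolding image_subset_iff greaterThan_iff by (intro ballI step_denominator)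
    show "smooth_on UNIV (\<lambda>x. flat 0 (1 - x) + flat 0 (x - 1/16))"
      by (rule smooth_on_add[OF open_UNIV 1 2])
  qed (rule open_UNIV open_greaterThan smooth_on_inverse)+
  from smooth_on_mult[OF open_UNIV 1 this] show ?thesis
    unfolding step_def[abs_def] divide_inverse .
qed

section \<open>The Levi form\<close>

lemma has_derivative_dird_compose:
  assumes "(h has_derivative D) (at x within X)" "smooth_on T f" "h x \<in> T"
  shows "((\<lambda>x. f (h x)) has_derivative (\<lambda>w. dird f (D w) (h x))) (at x within X)"
  using has_derivative_compose[where g = f and f = h, OF assms(1) smooth_on_has_derivative[OF assms(2,3)]] .

lemma has_derivative_along:
  assumes "smooth_on S f" "z + t *\<^sub>R v \<in> S"
  shows "((\<lambda>t. f (z + t *\<^sub>R v)) has_vector_derivative dird f v (z + t *\<^sub>R v)) (at t)"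
proof -
  have "((\<lambda>t. f (z + t *\<^sub>R v)) has_derivative (\<lambda>s. dird f (s *\<^sub>R v) (z + t *\<^sub>R v))) (at t)"
    by (rule has_derivative_dird_compose[where h = "\<lambda>t. z + t *\<^sub>R v", OF _ assms]) (auto intro!: derivative_eq_intros)
  then show ?thesis
    using linear_scale[OF has_derivative_linear[OF smooth_on_has_derivative[OF assms]]]
    by (simp add: has_vector_derivative_def)
qed

lemma has_real_derivative_along:
  fixes f :: "'a::real_normed_vector \<Rightarrow> real"
  assumes "smooth_on S f" "z + t *\<^sub>R v \<in> S"
  shows "((\<lambda>t. f (z + t *\<^sub>R v)) has_real_derivative dird f v (z + t *\<^sub>R v)) (at t)"
  using has_derivative_along[OF assms] by (simp add: has_real_derivative_iff_has_vector_derivative)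

lemma dird_linear: "smooth_on S f \<Longrightarrow> x \<in> S \<Longrightarrow> linear (\<lambda>v. dird f v x)"
  using smooth_on_has_derivative has_derivative_linear by blast

lemma dird_Basis:
  fixes f :: "'a::euclidean_space \<Rightarrow> 'b::real_normed_vector"
  assumes "smooth_on S f" "x \<in> S"
  shows "dird f v x = (\<Sum>b\<in>Basis. (v \<bullet> b) *\<^sub>R dird f b x)"
proof -
  have "dird f v x = dird f (\<Sum>b\<in>Basis. (v \<bullet> b) *\<^sub>R b) x" by (simp add: euclidean_representation)
  also have "\<dots> = (\<Sum>b\<in>Basis. (v \<bullet> b) *\<^sub>R dird f b x)"
    using dird_linear[OF assms] by (simp add: linear_sum linear_scale)
  finally show ?thesis .
qed

lemma has_derivative_dird:
  assumes "smooth_on S f" "x \<in> S"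
  shows "(dird f v has_derivative (\<lambda>w. dird (dird f v) w x)) (at x)"
  by (rule smooth_on_has_derivative[OF smooth_on_dird[OF assms(1)] assms(2)])

text \<open>The expansion of the inner direction holds in a whole neighbourhood and can therefore be
  differentiated; so the second derivative is linear in the inner direction as well.\<close>

lemma dird_dird_Basis:
  fixes f :: "'a::euclidean_space \<Rightarrow> 'b::real_normed_vector"
  assumes "open S" "smooth_on S f" "x \<in> S"
  shows "dird (dird f v) w x = (\<Sum>b\<in>Basis. (v \<bullet> b) *\<^sub>R dird (dird f b) w x)"
proof -
  have "((\<lambda>x. \<Sum>b\<in>Basis. (v \<bullet> b) *\<^sub>R dird f b x) has_derivative
      (\<lambda>w. \<Sum>b\<in>Basis. (v \<bullet> b) *\<^sub>R dird (dird f b) w x)) (at x)"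
    by (intro has_derivative_sum has_derivative_scaleR_right has_derivative_dird[OF assms(2,3)])
  then have "(dird f v has_derivative (\<lambda>w. \<Sum>b\<in>Basis. (v \<bullet> b) *\<^sub>R dird (dird f b) w x)) (at x)"
    using has_derivative_cong_open[OF assms(1,3) dird_Basis[OF assms(2), where v = v]] by simp
  then show ?thesis by (rule dird_eq)
qed

text \<open>In coordinates the Levi form below is \<open>4 \<Sum>\<^sub>j\<^sub>k (\<partial>\<^sub>j \<partial>bar\<^sub>k f) v\<^sub>j conj(v\<^sub>k)\<close>.\<close>

definition levi :: "(complex^'n \<Rightarrow> real) \<Rightarrow> complex^'n \<Rightarrow> complex^'n \<Rightarrow> real" where
  "levi f z v = dird (dird f v) v z + dird (dird f (\<i> *s v)) (\<i> *s v) z"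

lemma levi_cong:
  assumes "open S" "z \<in> S" "\<And>y. y \<in> S \<Longrightarrow> f y = g y"
  shows "levi f z v = levi g z v"
proof -
  have "dird (dird f w) w z = dird (dird g w) w z" for w
    using frechet_derivative_cong_open[OF assms(1,2), of "dird f w" "dird g w"]
      frechet_derivative_cong_open[OF assms(1) _ assms(3)] by auto
  then show ?thesis by (simp add: levi_def)
qed

lemma dird_add:
  assumes "smooth_on S f" "smooth_on S g" "x \<in> S"
  shows "dird (\<lambda>x. f x + g x) v x = dird f v x + dird g v x"
  by (rule dird_eq) (intro has_derivative_add smooth_on_has_derivative[OF assms(1) assms(3)] smooth_on_has_derivative[OF assms(2) assms(3)])

lemma dird_cmult:
  fixes f :: "'a::real_normed_vector \<Rightarrow> real"
  assumes "smooth_on S f" "x \<in> S"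
  shows "dird (\<lambda>x. c * f x) v x = c * dird f v x"
  by (rule dird_eq) (intro has_derivative_mult_right smooth_on_has_derivative[OF assms])

lemma levi_add:
  assumes "open S" "smooth_on S f" "smooth_on S g" "z \<in> S"
  shows "levi (\<lambda>x. f x + g x) z v = levi f z v + levi g z v"
proof -
  have "dird (dird (\<lambda>x. f x + g x) w) w z = dird (dird f w) w z + dird (dird g w) w z" for w
    by (subst frechet_derivative_cong_open[OF assms(1,4) dird_add[OF assms(2,3)]])
       (auto intro!: dird_add[OF smooth_on_dird smooth_on_dird assms(4)] assms)
  then show ?thesis by (simp add: levi_def)
qed

lemma levi_cmult:
  assumes "open S" "smooth_on S f" "z \<in> S"
  shows "levi (\<lambda>x. c * f x) z v = c * levi f z v"
proof -
  have "dird (dird (\<lambda>x. c * f x) w) w z = c * dird (dird f w) w z" for w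
    by (subst frechet_derivative_cong_open[OF assms(1,3) dird_cmult[OF assms(2)]])
       (auto intro!: dird_cmult[OF smooth_on_dird assms(3)] assms)
  then show ?thesis by (simp add: levi_def algebra_simps)
qed

lemma levi_const: "levi (\<lambda>x. c) z v = 0"
  by (simp add: levi_def frechet_derivative_const)

lemma norm_vector_i: "norm (\<i> *s (v::complex^'n)) = norm v"
  by (simp add: norm_vec_def norm_mult vector_scalar_mult_def)

lemma smooth_on_norm_square:
  fixes p :: "'a::euclidean_space"
  shows "smooth_on UNIV (\<lambda>z. (norm (z - p))\<^sup>2)"
  unfolding power2_norm_eq_inner
  by (intro smooth_on_bilinear[OF _ bounded_bilinear_inner] smooth_on_diff smooth_on_ident smooth_on_const open_UNIV)

lemma levi_norm_square: "levi (\<lambda>z. (norm (z - p))\<^sup>2) z v = 4 * (norm v)\<^sup>2"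
proof -
  have 1: "((\<lambda>z. (norm (z - p))\<^sup>2) has_derivative (\<lambda>w. 2 * ((z - p) \<bullet> w))) (at z)" for z
    unfolding power2_norm_eq_inner by (auto intro!: derivative_eq_intros simp: inner_commute)
  have 2: "dird (\<lambda>z. (norm (z - p))\<^sup>2) w = (\<lambda>z. 2 * ((z - p) \<bullet> w))" for w
    by (rule ext, rule dird_eq[OF 1])
  have 3: "dird (\<lambda>z. 2 * ((z - p) \<bullet> w)) w z = 2 * (w \<bullet> w)" for w
    by (rule dird_eq) (auto intro!: derivative_eq_intros)
  show ?thesis unfolding levi_def 2 3
    by (simp add: norm_vector_i flip: power2_norm_eq_inner)
qed

section \<open>Bounds for derivatives and Levi forms on compact sets\<close>

lemma dird_bound:
  fixes f :: "'a::euclidean_space \<Rightarrow> real"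
  assumes "smooth_on S f" "compact K" "K \<subseteq> S"
  shows "\<exists>C\<ge>0. \<forall>z\<in>K. \<forall>v. \<bar>dird f v z\<bar> \<le> C * norm v"
proof -
  have "\<forall>b. \<exists>C. \<forall>z\<in>K. \<bar>dird f b z\<bar> \<le> C"
  proof
    fix b
    have "continuous_on K (dird f b)"
      using smooth_on_continuous[OF smooth_on_dird[OF assms(1)]] assms(3) continuous_on_subset by blast
    then have "bounded (dird f b ` K)" using assms(2) compact_continuous_image compact_imp_bounded by blast
    then show "\<exists>C. \<forall>z\<in>K. \<bar>dird f b z\<bar> \<le> C" by (auto simp: bounded_iff)
  qed
  then obtain C where C: "\<And>b z. z \<in> K \<Longrightarrow> \<bar>dird f b z\<bar> \<le> C b" by metis
  have "\<bar>dird f v z\<bar> \<le> (\<Sum>b\<in>Basis. \<bar>C b\<bar>) * norm v" if "z \<in> K" for z v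
  proof -
    have "dird f v z = (\<Sum>b\<in>Basis. (v \<bullet> b) * dird f b z)" using dird_Basis[OF assms(1), of z v] that assms(3) by auto
    also have "\<bar>\<dots>\<bar> \<le> (\<Sum>b\<in>Basis. \<bar>C b\<bar> * norm v)"
      unfolding abs_mult[symmetric]
    proof (rule order_trans[OF sum_abs sum_mono])
      fix b :: 'a assume "b \<in> Basis"
      then show "\<bar>(v \<bullet> b) * dird f b z\<bar> \<le> \<bar>C b\<bar> * norm v"
        unfolding abs_mult using Basis_le_norm[of b v] C[OF that, of b]
        by (subst mult.commute, intro mult_mono) auto
    qed
    finally show ?thesis by (simp add: sum_distrib_right)
  qed
  then show ?thesis by (intro exI[of _ "\<Sum>b\<in>Basis. \<bar>C b\<bar>"]) (auto intro: sum_nonneg)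
qed

lemma levi_bound:
  fixes f :: "complex^'n \<Rightarrow> real"
  assumes "open S" "smooth_on S f" "compact K" "K \<subseteq> S"
  shows "\<exists>C\<ge>0. \<forall>z\<in>K. \<forall>v. \<bar>levi f z v\<bar> \<le> C * (norm v)\<^sup>2"
proof -
  have "\<forall>b. \<exists>C\<ge>0. \<forall>z\<in>K. \<forall>v. \<bar>dird (dird f b) v z\<bar> \<le> C * norm v"
    using dird_bound[OF smooth_on_dird[OF assms(2)] assms(3,4)] by blast
  then obtain C where C0: "\<And>b. 0 \<le> C b" and C: "\<And>b z v. z \<in> K \<Longrightarrow> \<bar>dird (dird f b) v z\<bar> \<le> C b * norm v" by metis
  define D where "D = (\<Sum>b\<in>Basis. C b)"
  have *: "\<bar>dird (dird f v) v z\<bar> \<le> D * (norm v)\<^sup>2" if "z \<in> K" for z v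
  proof -
    have "dird (dird f v) v z = (\<Sum>b\<in>Basis. (v \<bullet> b) * dird (dird f b) v z)"
      using dird_dird_Basis[OF assms(1,2), of z v v] that assms(4) by auto
    also have "\<bar>\<dots>\<bar> \<le> (\<Sum>b\<in>Basis. norm v * (C b * norm v))"
    proof (rule order_trans[OF sum_abs sum_mono])
      fix b :: "complex^'n" assume "b \<in> Basis"
      then show "\<bar>(v \<bullet> b) * dird (dird f b) v z\<bar> \<le> norm v * (C b * norm v)"
        unfolding abs_mult using Basis_le_norm[of b v] C[OF that, of b v]
        by (intro mult_mono) auto
    qed
    finally show ?thesis by (simp add: D_def sum_distrib_right sum_distrib_left power2_eq_square mult_ac)
  qed
  have "\<bar>levi f z v\<bar> \<le> (2 * D) * (norm v)\<^sup>2" if "z \<in> K" for z v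
    using *[OF that, of v] *[OF that, of "\<i> *s v"] by (simp add: levi_def norm_vector_i)
  moreover have "0 \<le> 2 * D" using C0 by (simp add: D_def sum_nonneg)
  ultimately show ?thesis by blast
qed

subsection \<open>Invariance under holomorphic maps\<close>

lemma holomorphic_map_derivative:
  assumes "holomorphic_map_on S h" "z \<in> S"
  shows "(h has_derivative frechet_derivative h (at z)) (at z)" "dird h (c *s v) z = c *s dird h v z"
proof -
  obtain D where D: "(h has_derivative D) (at z)" "\<And>c v. D (c *s v) = c *s D v"
    using assms unfolding holomorphic_map_on_def by blast
  moreover have "D = frechet_derivative h (at z)" using frechet_derivative_at[OF D(1)] .
  ultimately show "(h has_derivative frechet_derivative h (at z)) (at z)" "dird h (c *s v) z = c *s dird h v z" by auto
qed

lemma bounded_linear_scalar: "bounded_linear (\<lambda>c. c *s (v::complex^'n))"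
  by (rule linear_conv_bounded_linear[THEN iffD1])
     (auto simp: linear_iff vec_eq_iff algebra_simps scaleR_conv_of_real[where 'a = complex])

lemma holomorphic_map_along:
  assumes "holomorphic_map_on S h" "z + c *s v \<in> S"
  shows "((\<lambda>c. h (z + c *s v) $ a) has_field_derivative dird h v (z + c *s v) $ a) (at c)"
proof -
  have "((\<lambda>c. h (z + c *s v)) has_derivative (\<lambda>d. dird h (d *s v) (z + c *s v))) (at c)"
    by (rule has_derivative_compose[where g = h and f = "\<lambda>c. z + c *s v", OF _ holomorphic_map_derivative(1)[OF assms]])
       (auto intro!: derivative_eq_intros bounded_linear.has_derivative[OF bounded_linear_scalar])
  from bounded_linear.has_derivative[OF bounded_linear_vec_nth[of a] this]
  show ?thesis
    by (rule has_derivative_imp_has_field_derivative) (simp add: holomorphic_map_derivative(2)[OF assms])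
qed

text \<open>On the complex line z + c v each component is holomorphic in c, and so is its derivative
  by Cauchy's theory. Hence the second derivative along \<i> v picks up the factor \<i> twice and
  cancels the one along v.\<close>

lemma holomorphic_map_second_derivative:
  fixes h :: "complex^'n \<Rightarrow> complex^'m"
  assumes "open S" "holomorphic_map_on S h" "smooth_on S h" "z \<in> S"
  shows "dird (dird h v) v z + dird (dird h (\<i> *s v)) (\<i> *s v) z = 0"
proof -
  have "(dird (dird h v) v z + dird (dird h (\<i> *s v)) (\<i> *s v) z) $ a = 0" for a
  proof -
    define \<Lambda> where "\<Lambda> = (\<lambda>c. z + c *s v) -` S"
    have "open \<Lambda>" unfolding \<Lambda>_def
      by (intro open_vimage assms(1) continuous_intros linear_continuous_on bounded_linear_scalar)
    have "0 \<in> \<Lambda>" using assms(4) by (simp add: \<Lambda>_def)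
    have \<phi>: "((\<lambda>c. h (z + c *s v) $ a) has_field_derivative dird h v (z + c *s v) $ a) (at c)" if "c \<in> \<Lambda>" for c
      using holomorphic_map_along[OF assms(2)] that by (simp add: \<Lambda>_def)
    then have "(\<lambda>c. h (z + c *s v) $ a) holomorphic_on \<Lambda>"
      using \<open>open \<Lambda>\<close> by (auto simp: holomorphic_on_open)
    then have "deriv (\<lambda>c. h (z + c *s v) $ a) holomorphic_on \<Lambda>"
      using \<open>open \<Lambda>\<close> by (rule holomorphic_deriv)
    moreover have "deriv (\<lambda>c. h (z + c *s v) $ a) c = dird h v (z + c *s v) $ a" if "c \<in> \<Lambda>" for c
      by (rule DERIV_imp_deriv[OF \<phi>[OF that]])
    ultimately have "(\<lambda>c. dird h v (z + c *s v) $ a) holomorphic_on \<Lambda>"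
      by (rule holomorphic_transform)
    then obtain d where "((\<lambda>c. dird h v (z + c *s v) $ a) has_field_derivative d) (at 0)"
      using \<open>0 \<in> \<Lambda>\<close> \<open>open \<Lambda>\<close> by (auto simp: holomorphic_on_open)
    then have d: "((\<lambda>c. dird h v (z + c *s v) $ a) has_derivative (\<lambda>c. d * c)) (at 0)"
      by (simp add: has_field_derivative_def)
    have "((\<lambda>c. dird h v (z + c *s v)) has_derivative (\<lambda>c. dird (dird h v) (c *s v) (z + 0 *s v))) (at 0)"
      by (rule has_derivative_dird_compose[where h = "\<lambda>c. z + c *s v", OF _ smooth_on_dird[OF assms(3)]])
         (use assms(4) in \<open>auto intro!: derivative_eq_intros bounded_linear.has_derivative[OF bounded_linear_scalar]\<close>)
    from bounded_linear.has_derivative[OF bounded_linear_vec_nth[of a] this]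
    have "(\<lambda>c. dird (dird h v) (c *s v) z $ a) = (\<lambda>c. d * c)"
      using has_derivative_unique[OF _ d] by simp
    from fun_cong[OF this] have e: "dird (dird h v) (c *s v) z $ a = d * c" for c .
    have "bounded_linear (\<lambda>x::complex^'m. \<i> *s x)"
      by (rule linear_conv_bounded_linear[THEN iffD1]) (auto simp: linear_iff vec_eq_iff algebra_simps)
    from bounded_linear.has_derivative[OF this has_derivative_dird[OF assms(3,4), of v]]
    have "((\<lambda>y. \<i> *s dird h v y) has_derivative (\<lambda>w. \<i> *s dird (dird h v) w z)) (at z)" .
    then have "(dird h (\<i> *s v) has_derivative (\<lambda>w. \<i> *s dird (dird h v) w z)) (at z)"
      using has_derivative_cong_open[OF assms(1,4) holomorphic_map_derivative(2)[OF assms(2), of _ \<i> v]] by simp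
    then have "dird (dird h (\<i> *s v)) (\<i> *s v) z = \<i> *s dird (dird h v) (\<i> *s v) z" by (rule dird_eq)
    then show ?thesis using e[of 1] e[of \<i>] by (simp add: mult.left_commute[of \<i>])
  qed
  then show ?thesis by (simp add: vec_eq_iff)
qed

lemma dird_compose:
  assumes "(h has_derivative D) (at x)" "smooth_on T f" "h x \<in> T"
  shows "dird (\<lambda>x. f (h x)) v x = dird f (D v) (h x)"
  by (rule dird_eq[OF has_derivative_dird_compose[OF assms]])

text \<open>In the second-order chain rule, the first derivative of f is applied to the sum of the
  second derivatives of h along v and \<i> v, which vanishes. In the remaining part, complex
  linearity turns the image of \<i> v into \<i> times the image of v.\<close>

lemma levi_compose:
  fixes h :: "complex^'n \<Rightarrow> complex^'m"
  assumes "open S" "open T" "h ` S \<subseteq> T" "holomorphic_map_on S h" "smooth_on S h" "smooth_on T f" "z \<in> S"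
  shows "levi (\<lambda>x. f (h x)) z v = levi f (h z) (dird h v z)"
proof -
  have hz: "h y \<in> T" if "y \<in> S" for y using assms(3) that by auto
  have 1: "dird (\<lambda>x. f (h x)) w y = (\<Sum>b\<in>Basis. (dird h w y \<bullet> b) * dird f b (h y))" if "y \<in> S" for w y
    using dird_compose[OF smooth_on_has_derivative[OF assms(5) that] assms(6) hz[OF that], of w]
      dird_Basis[OF assms(6) hz[OF that], of "dird h w y"] by simp
  have 2: "dird (dird (\<lambda>x. f (h x)) w) w z = dird f (dird (dird h w) w z) (h z) + dird (dird f (dird h w z)) (dird h w z) (h z)" for w
  proof -
    have "((\<lambda>y. \<Sum>b\<in>Basis. (dird h w y \<bullet> b) * dird f b (h y)) has_derivative
       (\<lambda>u. \<Sum>b\<in>Basis. (dird h w z \<bullet> b) * dird (dird f b) (dird h u z) (h z) + (dird (dird h w) u z \<bullet> b) * dird f b (h z))) (at z)"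
      by (intro has_derivative_sum has_derivative_mult has_derivative_inner_left
          has_derivative_dird[OF assms(5,7)]
          has_derivative_dird_compose[OF smooth_on_has_derivative[OF assms(5,7)] smooth_on_dird[OF assms(6)] hz[OF assms(7)]])
    then have "dird (dird (\<lambda>x. f (h x)) w) w z =
        (\<Sum>b\<in>Basis. (dird h w z \<bullet> b) * dird (dird f b) (dird h w z) (h z) + (dird (dird h w) w z \<bullet> b) * dird f b (h z))"
      using has_derivative_cong_open[OF assms(1,7) 1[where w = w]] by (intro dird_eq) simp
    then show ?thesis
      using dird_Basis[OF assms(6) hz[OF assms(7)], of "dird (dird h w) w z"]
        dird_dird_Basis[OF assms(2,6) hz[OF assms(7)], of "dird h w z" "dird h w z"]
      by (simp add: sum.distrib)
  qed
  have "dird f (dird (dird h v) v z) (h z) + dird f (dird (dird h (\<i> *s v)) (\<i> *s v) z) (h z) = 0"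
    using linear_add[OF dird_linear[OF assms(6) hz[OF assms(7)]], of "dird (dird h v) v z" "dird (dird h (\<i> *s v)) (\<i> *s v) z"]
      linear_0[OF dird_linear[OF assms(6) hz[OF assms(7)]]]
    by (simp add: holomorphic_map_second_derivative[OF assms(1,4,5,7)])
  then show ?thesis
    using holomorphic_map_derivative(2)[OF assms(4,7), of \<i> v] by (simp add: levi_def 2)
qed

subsection \<open>Gluing by a logarithm of a sum of exponentials\<close>

text \<open>The cutoffs enter squared so that each summand of S' contains a factor \<xi>: it is
  \<xi> a exp (u/\<epsilon>) with a = 2 \<xi>' + \<xi> u'/\<epsilon>. Cauchy-Schwarz, with weights
  \<xi>^2 exp (u/\<epsilon>) / S of sum at most 1, then absorbs (S'/S)^2 into the a^2 part of S''/S,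
  and no first derivative of u is left in the bound.\<close>

lemma log_sum_exp_second_derivative:
  fixes \<xi> u :: "'i \<Rightarrow> real \<Rightarrow> real"
  assumes "finite A" "0 < c" "0 < \<epsilon>" "0 < d"
    and \<xi>: "\<And>i t. i \<in> A \<Longrightarrow> \<bar>t\<bar> < d \<Longrightarrow> (\<xi> i has_real_derivative \<xi>d i t) (at t)"
    and u: "\<And>i t. i \<in> A \<Longrightarrow> \<bar>t\<bar> < d \<Longrightarrow> (u i has_real_derivative ud i t) (at t)"
    and \<xi>dd: "\<And>i. i \<in> A \<Longrightarrow> (\<xi>d i has_real_derivative \<xi>dd i) (at 0)"
    and udd: "\<And>i. i \<in> A \<Longrightarrow> (ud i has_real_derivative udd i) (at 0)"
    and L: "\<And>t. \<bar>t\<bar> < d \<Longrightarrow> ((\<lambda>t. \<epsilon> * ln (c + (\<Sum>i\<in>A. (\<xi> i t)\<^sup>2 * exp (u i t / \<epsilon>)))) has_real_derivative Ld t) (at t)"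
    and Ldd: "(Ld has_real_derivative Ldd) (at 0)"
  shows "Ldd \<ge> (\<Sum>i\<in>A. exp (u i 0 / \<epsilon>) / (c + (\<Sum>i\<in>A. (\<xi> i 0)\<^sup>2 * exp (u i 0 / \<epsilon>)))
            * ((\<xi> i 0)\<^sup>2 * udd i + \<epsilon> * (2 * \<xi> i 0 * \<xi>dd i - 2 * (\<xi>d i 0)\<^sup>2)))"
proof -
  define S where "S t = c + (\<Sum>i\<in>A. (\<xi> i t)\<^sup>2 * exp (u i t / \<epsilon>))" for t
  define S1 where "S1 t = (\<Sum>i\<in>A. (2 * \<xi> i t * \<xi>d i t + (\<xi> i t)\<^sup>2 * (ud i t / \<epsilon>)) * exp (u i t / \<epsilon>))" for t
  define w where "w i = exp (u i 0 / \<epsilon>) / S 0" for i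
  define q where "q i = ud i 0 / \<epsilon>" for i
  define a where "a i = 2 * \<xi>d i 0 + \<xi> i 0 * q i" for i
  \<comment> \<open>The part 2 \<xi>'^2 + 4 \<xi> \<xi>' q + \<xi>^2 q^2 of the second derivative is
    written as a^2 - 2 \<xi>'^2, ready for Cauchy-Schwarz.\<close>
  define S2 where "S2 = (\<Sum>i\<in>A. ((a i)\<^sup>2 - 2 * (\<xi>d i 0)\<^sup>2 + 2 * \<xi> i 0 * \<xi>dd i + (\<xi> i 0)\<^sup>2 * (udd i / \<epsilon>)) * exp (u i 0 / \<epsilon>))"
  have Spos: "0 < S t" for t unfolding S_def using assms(2) by (simp add: add_pos_nonneg sum_nonneg)
  have S1: "(S has_real_derivative S1 t) (at t)" if "\<bar>t\<bar> < d" for t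
    unfolding S_def[abs_def] S1_def using \<open>0 < \<epsilon>\<close>
    by (auto intro!: derivative_eq_intros \<xi>[OF _ that] u[OF _ that] sum.cong simp: field_simps)
  have Ld: "Ld t = \<epsilon> * (S1 t / S t)" if "\<bar>t\<bar> < d" for t
  proof -
    have "((\<lambda>t. \<epsilon> * ln (S t)) has_real_derivative \<epsilon> * (S1 t / S t)) (at t)"
      using Spos[of t] by (auto intro!: derivative_eq_intros S1[OF that] simp: field_simps)
    then show ?thesis using L[OF that] DERIV_unique unfolding S_def by blast
  qed
  have S1': "(S1 has_real_derivative S2) (at 0)"
  proof -
    have "((\<lambda>t. (2 * \<xi> i t * \<xi>d i t + (\<xi> i t)\<^sup>2 * (ud i t / \<epsilon>)) * exp (u i t / \<epsilon>)) has_real_derivative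
      ((a i)\<^sup>2 - 2 * (\<xi>d i 0)\<^sup>2 + 2 * \<xi> i 0 * \<xi>dd i + (\<xi> i 0)\<^sup>2 * (udd i / \<epsilon>)) * exp (u i 0 / \<epsilon>)) (at 0)" if "i \<in> A" for i
      using \<xi>[OF that, of 0] u[OF that, of 0] \<xi>dd[OF that] udd[OF that] \<open>0 < d\<close> \<open>0 < \<epsilon>\<close>
      by (auto intro!: derivative_eq_intros simp: a_def q_def field_simps power2_eq_square)
    then show ?thesis unfolding S1_def[abs_def] S2_def by (intro DERIV_sum) auto
  qed
  have "((\<lambda>t. \<epsilon> * (S1 t / S t)) has_real_derivative \<epsilon> * ((S2 * S 0 - S1 0 * S1 0) / (S 0 * S 0))) (at 0)"
    using Spos[of 0] \<open>0 < d\<close> by (intro DERIV_cmult DERIV_divide S1' S1) auto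
  then have "(Ld has_real_derivative \<epsilon> * ((S2 * S 0 - S1 0 * S1 0) / (S 0 * S 0))) (at 0)"
    by (rule has_field_derivative_transform_within_open[where S = "{-d<..<d}"]) (use \<open>0 < d\<close> Ld in auto)
  then have L2_eq: "Ldd = \<epsilon> * (S2 / S 0 - (S1 0 / S 0)\<^sup>2)"
    using DERIV_unique[OF Ldd] Spos[of 0] by (simp add: field_simps power2_eq_square)
  have w0: "0 \<le> w i" for i using Spos[of 0] by (simp add: w_def)
  have "(S1 0 / S 0)\<^sup>2 = (\<Sum>i\<in>A. (sqrt (w i) * \<xi> i 0) * (sqrt (w i) * a i))\<^sup>2"
  proof -
    have e: "(sqrt (w i) * \<xi> i 0) * (sqrt (w i) * a i) = w i * (\<xi> i 0 * a i)" for i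
      using real_sqrt_mult_self[of "w i"] w0[of i] by (simp add: mult_ac)
    have "S1 0 / S 0 = (\<Sum>i\<in>A. w i * (\<xi> i 0 * a i))"
      unfolding S1_def sum_divide_distrib w_def a_def q_def
      by (intro sum.cong refl) (simp add: power2_eq_square algebra_simps add_divide_distrib)
    then show ?thesis unfolding e by simp
  qed
  also have "\<dots> \<le> (\<Sum>i\<in>A. (sqrt (w i) * \<xi> i 0)\<^sup>2) * (\<Sum>i\<in>A. (sqrt (w i) * a i)\<^sup>2)"
    by (rule Cauchy_Schwarz_ineq_sum)
  also have "\<dots> \<le> 1 * (\<Sum>i\<in>A. (sqrt (w i) * a i)\<^sup>2)"
  proof (intro mult_right_mono sum_nonneg)
    have "(sqrt (w i) * \<xi> i 0)\<^sup>2 = (\<xi> i 0)\<^sup>2 * exp (u i 0 / \<epsilon>) / S 0" for i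
      using w0[of i] by (simp add: power_mult_distrib) (simp add: w_def)
    then have "(\<Sum>i\<in>A. (sqrt (w i) * \<xi> i 0)\<^sup>2) = (S 0 - c) / S 0"
      unfolding S_def[of 0] by (simp add: sum_divide_distrib)
    then show "(\<Sum>i\<in>A. (sqrt (w i) * \<xi> i 0)\<^sup>2) \<le> 1" using Spos[of 0] \<open>0 < c\<close> by simp
  qed simp
  also have "\<dots> = (\<Sum>i\<in>A. w i * (a i)\<^sup>2)" using w0 by (simp add: power_mult_distrib)
  finally have CS: "(S1 0 / S 0)\<^sup>2 \<le> (\<Sum>i\<in>A. w i * (a i)\<^sup>2)" .
  have "S2 / S 0 = (\<Sum>i\<in>A. w i * (a i)\<^sup>2) + (\<Sum>i\<in>A. w i * ((\<xi> i 0)\<^sup>2 * (udd i / \<epsilon>) + (2 * \<xi> i 0 * \<xi>dd i - 2 * (\<xi>d i 0)\<^sup>2)))"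
    unfolding S2_def sum_divide_distrib w_def sum.distrib[symmetric]
    by (intro sum.cong refl) (simp add: algebra_simps add_divide_distrib diff_divide_distrib)
  then have "\<epsilon> * (\<Sum>i\<in>A. w i * ((\<xi> i 0)\<^sup>2 * (udd i / \<epsilon>) + (2 * \<xi> i 0 * \<xi>dd i - 2 * (\<xi>d i 0)\<^sup>2))) \<le> Ldd"
    using CS L2_eq \<open>0 < \<epsilon>\<close> by (simp add: mult_left_mono)
  also have "\<epsilon> * (\<Sum>i\<in>A. w i * ((\<xi> i 0)\<^sup>2 * (udd i / \<epsilon>) + (2 * \<xi> i 0 * \<xi>dd i - 2 * (\<xi>d i 0)\<^sup>2)))
     = (\<Sum>i\<in>A. w i * ((\<xi> i 0)\<^sup>2 * udd i + \<epsilon> * (2 * \<xi> i 0 * \<xi>dd i - 2 * (\<xi>d i 0)\<^sup>2)))"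
    unfolding sum_distrib_left using \<open>0 < \<epsilon>\<close> by (intro sum.cong refl) (simp add: field_simps)
  finally show ?thesis unfolding w_def S_def .
qed

text \<open>The Levi form adds the second derivatives along the real lines in directions v and \<i>
  v, so the estimate in one variable is used twice.\<close>

lemma levi_log_sum_exp:
  fixes \<xi> u :: "'i \<Rightarrow> complex^'n \<Rightarrow> real"
  defines "W \<equiv> \<lambda>c \<epsilon> A z. c + (\<Sum>i\<in>A. (\<xi> i z)\<^sup>2 * exp (u i z / \<epsilon>))"
  assumes "finite A" "0 < c" "0 < \<epsilon>" "open X" "z \<in> X"
    and \<xi>: "\<And>i. i \<in> A \<Longrightarrow> smooth_on X (\<xi> i)" and u: "\<And>i. i \<in> A \<Longrightarrow> smooth_on X (u i)"
    and W: "smooth_on X (\<lambda>x. \<epsilon> * ln (W c \<epsilon> A x))"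
  shows "levi (\<lambda>x. \<epsilon> * ln (W c \<epsilon> A x)) z v \<ge> (\<Sum>i\<in>A. exp (u i z / \<epsilon>) / W c \<epsilon> A z *
      ((\<xi> i z)\<^sup>2 * levi (u i) z v + \<epsilon> * (2 * \<xi> i z * levi (\<xi> i) z v - 2 * ((dird (\<xi> i) v z)\<^sup>2 + (dird (\<xi> i) (\<i> *s v) z)\<^sup>2))))"
proof -
  have *: "dird (dird (\<lambda>x. \<epsilon> * ln (W c \<epsilon> A x)) v) v z \<ge> (\<Sum>i\<in>A. exp (u i z / \<epsilon>) / W c \<epsilon> A z *
      ((\<xi> i z)\<^sup>2 * dird (dird (u i) v) v z + \<epsilon> * (2 * \<xi> i z * dird (dird (\<xi> i) v) v z - 2 * (dird (\<xi> i) v z)\<^sup>2)))" for v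
  proof -
    have "open ((\<lambda>t. z + t *\<^sub>R v) -` X)" by (intro open_vimage \<open>open X\<close> continuous_intros)
    moreover have "0 \<in> (\<lambda>t. z + t *\<^sub>R v) -` X" using \<open>z \<in> X\<close> by simp
    ultimately obtain d where d: "0 < d" "ball 0 d \<subseteq> (\<lambda>t. z + t *\<^sub>R v) -` X"
      using open_contains_ball by blast
    then have dX: "z + t *\<^sub>R v \<in> X" if "\<bar>t\<bar> < d" for t using that by (auto simp: dist_real_def)
    have z0: "z + 0 *\<^sub>R v \<in> X" using \<open>z \<in> X\<close> by simp
    show ?thesis
      using log_sum_exp_second_derivative[where A = A and c = c and \<epsilon> = \<epsilon> and d = d
          and \<xi> = "\<lambda>i t. \<xi> i (z + t *\<^sub>R v)" and u = "\<lambda>i t. u i (z + t *\<^sub>R v)"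
          and \<xi>d = "\<lambda>i t. dird (\<xi> i) v (z + t *\<^sub>R v)" and ud = "\<lambda>i t. dird (u i) v (z + t *\<^sub>R v)"
          and \<xi>dd = "\<lambda>i. dird (dird (\<xi> i) v) v (z + 0 *\<^sub>R v)" and udd = "\<lambda>i. dird (dird (u i) v) v (z + 0 *\<^sub>R v)"
          and Ld = "\<lambda>t. dird (\<lambda>x. \<epsilon> * ln (W c \<epsilon> A x)) v (z + t *\<^sub>R v)"
          and Ldd = "dird (dird (\<lambda>x. \<epsilon> * ln (W c \<epsilon> A x)) v) v (z + 0 *\<^sub>R v)",
          OF \<open>finite A\<close> \<open>0 < c\<close> \<open>0 < \<epsilon>\<close> \<open>0 < d\<close>]
        has_real_derivative_along[OF \<xi> dX] has_real_derivative_along[OF u dX]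
        has_real_derivative_along[OF smooth_on_dird[OF \<xi>] z0] has_real_derivative_along[OF smooth_on_dird[OF u] z0]
        has_real_derivative_along[OF W dX]
        has_real_derivative_along[OF smooth_on_dird[OF W] z0]
      unfolding W_def by simp
  qed
  have "(\<Sum>i\<in>A. exp (u i z / \<epsilon>) / W c \<epsilon> A z *
      ((\<xi> i z)\<^sup>2 * levi (u i) z v + \<epsilon> * (2 * \<xi> i z * levi (\<xi> i) z v - 2 * ((dird (\<xi> i) v z)\<^sup>2 + (dird (\<xi> i) (\<i> *s v) z)\<^sup>2))))
    = (\<Sum>i\<in>A. exp (u i z / \<epsilon>) / W c \<epsilon> A z *
      ((\<xi> i z)\<^sup>2 * dird (dird (u i) v) v z + \<epsilon> * (2 * \<xi> i z * dird (dird (\<xi> i) v) v z - 2 * (dird (\<xi> i) v z)\<^sup>2)))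
    + (\<Sum>i\<in>A. exp (u i z / \<epsilon>) / W c \<epsilon> A z *
      ((\<xi> i z)\<^sup>2 * dird (dird (u i) (\<i> *s v)) (\<i> *s v) z + \<epsilon> * (2 * \<xi> i z * dird (dird (\<xi> i) (\<i> *s v)) (\<i> *s v) z - 2 * (dird (\<xi> i) (\<i> *s v) z)\<^sup>2)))"
    unfolding sum.distrib[symmetric] distrib_left[symmetric] levi_def
    by (intro sum.cong refl arg_cong2[where f = "(*)"]) (simp add: algebra_simps)
  with *[of v] *[of "\<i> *s v"] show ?thesis unfolding levi_def[of "\<lambda>x. \<epsilon> * ln (W c \<epsilon> A x)"] by linarith
qed

section \<open>Mollification\<close>

lemma lborel_nn_integral_affine:
  fixes f :: "'a::euclidean_space \<Rightarrow> ennreal"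
  assumes [measurable]: "f \<in> borel_measurable borel" and "c \<noteq> 0"
  shows "(\<integral>\<^sup>+x. f x \<partial>lborel) = ennreal (\<bar>c\<bar> ^ DIM('a)) * (\<integral>\<^sup>+x. f (t + c *\<^sub>R x) \<partial>lborel)"
  by (subst lborel_affine[OF \<open>c \<noteq> 0\<close>, of t])
     (simp add: nn_integral_density nn_integral_distr nn_integral_cmult ennreal_power)

lemma lborel_integral_affine:
  fixes f :: "'a::euclidean_space \<Rightarrow> real"
  assumes [measurable]: "f \<in> borel_measurable borel" and "c \<noteq> 0"
  shows "(\<integral>x. f x \<partial>lborel) = \<bar>c\<bar> ^ DIM('a) * (\<integral>x. f (t + c *\<^sub>R x) \<partial>lborel)"
  by (subst lborel_affine[OF \<open>c \<noteq> 0\<close>, of t])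
     (simp add: integral_density integral_distr ennreal_power)

lemma lborel_integral_reflect:
  fixes f :: "'a::euclidean_space \<Rightarrow> real"
  assumes "f \<in> borel_measurable borel"
  shows "(\<integral>x. f (z - x) \<partial>lborel) = (\<integral>x. f x \<partial>lborel)"
  using lborel_integral_affine[OF assms, of "-1" z] by simp

lemma integrable_mult_bounded:
  fixes U k :: "'a::euclidean_space \<Rightarrow> real"
  assumes "integrable lborel U" "k \<in> borel_measurable borel" "\<And>x. \<bar>k x\<bar> \<le> C"
  shows "integrable lborel (\<lambda>x. U x * k x)"
proof (rule Bochner_Integration.integrable_bound)
  show "integrable lborel (\<lambda>x. C * U x)" using assms(1) by simp
  show "(\<lambda>x. U x * k x) \<in> borel_measurable lborel"
    using assms(1,2) by simp
  have "\<bar>U x\<bar> * \<bar>k x\<bar> \<le> \<bar>C\<bar> * \<bar>U x\<bar>" for x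
    using mult_left_mono[OF assms(3)[of x], of "\<bar>U x\<bar>"] mult_right_mono[OF abs_ge_self[of C], of "\<bar>U x\<bar>"]
    by (simp add: mult.commute)
  then show "AE x in lborel. norm (U x * k x) \<le> norm (C * U x)"
    by (simp add: abs_mult)
qed

lemma borel_measurable_smooth:
  fixes K :: "'a::euclidean_space \<Rightarrow> 'b::euclidean_space"
  shows "smooth_on UNIV K \<Longrightarrow> K \<in> borel_measurable borel"
  using smooth_on_continuous borel_measurable_continuous_onI by blast

section \<open>Uniform bounds for smooth functions of compact support\<close>

lemma dird_outside:
  fixes K :: "'a::real_normed_vector \<Rightarrow> 'b::real_normed_vector"
  assumes "closed C" "\<And>x. x \<notin> C \<Longrightarrow> K x = 0" "x \<notin> C"
  shows "dird K v x = 0"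
proof -
  have "frechet_derivative K (at x) = frechet_derivative (\<lambda>x. 0) (at x)"
    by (rule frechet_derivative_cong_open[where S = "- C"]) (use assms in auto)
  then show ?thesis by (simp add: frechet_derivative_const)
qed

lemma dird_outside_cball:
  fixes K :: "'a::real_normed_vector \<Rightarrow> 'b::real_normed_vector"
  assumes "\<And>x. x \<notin> cball 0 R \<Longrightarrow> K x = 0" "x \<notin> cball 0 R"
  shows "dird K v x = 0"
  by (rule dird_outside[OF closed_cball assms])

lemma compact_support_bounded:
  fixes K :: "'a::euclidean_space \<Rightarrow> real"
  assumes "continuous_on UNIV K" "\<And>x. x \<notin> cball 0 R \<Longrightarrow> K x = 0"
  shows "\<exists>C\<ge>0. \<forall>x. \<bar>K x\<bar> \<le> C"
proof -
  have "bounded (K ` cball 0 R)"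
    by (intro compact_imp_bounded compact_continuous_image continuous_on_subset[OF assms(1)]) auto
  then obtain C where "\<forall>y\<in>K ` cball 0 R. norm y \<le> C" unfolding bounded_iff by blast
  then have C: "\<And>x. x \<in> cball 0 R \<Longrightarrow> \<bar>K x\<bar> \<le> C" by simp
  have "\<bar>K x\<bar> \<le> \<bar>C\<bar>" for x
    using C[of x] assms(2)[of x] by (cases "x \<in> cball 0 R") auto
  then show ?thesis by (intro exI[of _ "\<bar>C\<bar>"]) auto
qed

lemma compact_support_dird_bound:
  fixes K :: "'a::euclidean_space \<Rightarrow> real"
  assumes "smooth_on UNIV K" "\<And>x. x \<notin> cball 0 R \<Longrightarrow> K x = 0"
  shows "\<exists>C\<ge>0. \<forall>x v. \<bar>dird K v x\<bar> \<le> C * norm v"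
proof -
  obtain C where C: "0 \<le> C" "\<And>x v. x \<in> cball 0 R \<Longrightarrow> \<bar>dird K v x\<bar> \<le> C * norm v"
    using dird_bound[OF assms(1) compact_cball[of 0 R] subset_UNIV] by blast
  have "\<bar>dird K v x\<bar> \<le> C * norm v" for x v
    using C dird_outside_cball[of R K x v, OF assms(2)] by (cases "x \<in> cball 0 R") auto
  then show ?thesis using C(1) by auto
qed

lemma compact_support_lipschitz:
  fixes K :: "'a::euclidean_space \<Rightarrow> real"
  assumes "smooth_on UNIV K" "\<And>x. x \<notin> cball 0 R \<Longrightarrow> K x = 0"
  shows "\<exists>C\<ge>0. \<forall>x y. \<bar>K x - K y\<bar> \<le> C * norm (x - y)"
proof -
  obtain C where C: "0 \<le> C" "\<And>x v. \<bar>dird K v x\<bar> \<le> C * norm v"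
    using compact_support_dird_bound[OF assms] by blast
  have "norm (K x - K y) \<le> C * norm (x - y)" for x y
    by (rule differentiable_bound[where S = UNIV and f' = "\<lambda>x v. dird K v x"])
       (use C smooth_on_has_derivative[OF assms(1)] in \<open>auto intro!: onorm_bound\<close>)
  then show ?thesis using C(1) by auto
qed

text \<open>Uniformity in x is the point: it permits differentiation under the integral against a
  function that is merely integrable.\<close>

lemma compact_support_taylor:
  fixes K :: "'a::euclidean_space \<Rightarrow> real"
  assumes "smooth_on UNIV K" "\<And>x. x \<notin> cball 0 R \<Longrightarrow> K x = 0"
  shows "\<exists>C\<ge>0. \<forall>x h. \<bar>K (x + h) - K x - dird K h x\<bar> \<le> C * (norm h)\<^sup>2"
proof -
  have "\<exists>C\<ge>0. \<forall>x y. \<bar>dird K b x - dird K b y\<bar> \<le> C * norm (x - y)" for b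
    by (rule compact_support_lipschitz[OF smooth_on_dird[OF assms(1)] dird_outside_cball[OF assms(2)]])
  then obtain C where C: "\<And>b. 0 \<le> C b" "\<And>b x y. \<bar>dird K b x - dird K b y\<bar> \<le> C b * norm (x - y)" by metis
  define D where "D = (\<Sum>b\<in>Basis. C b)"
  have D0: "0 \<le> D" using C(1) by (simp add: D_def sum_nonneg)
  have D: "\<bar>dird K v x - dird K v y\<bar> \<le> D * norm (x - y) * norm v" for v x y
  proof -
    have "dird K v x - dird K v y = (\<Sum>b\<in>Basis. (v \<bullet> b) * (dird K b x - dird K b y))"
      using dird_Basis[OF assms(1), of x v] dird_Basis[OF assms(1), of y v]
      by (simp add: sum_subtractf right_diff_distrib)
    also have "\<bar>\<dots>\<bar> \<le> (\<Sum>b\<in>Basis. norm v * (C b * norm (x - y)))"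
    proof (rule order_trans[OF sum_abs sum_mono])
      fix b :: 'a assume "b \<in> Basis"
      then show "\<bar>(v \<bullet> b) * (dird K b x - dird K b y)\<bar> \<le> norm v * (C b * norm (x - y))"
        unfolding abs_mult using Basis_le_norm[of b v] C(2)[where b = b and x = x and y = y] by (intro mult_mono) auto
    qed
    finally show ?thesis by (simp add: D_def sum_distrib_right sum_distrib_left mult_ac)
  qed
  have "\<bar>K (x + h) - K x - dird K h x\<bar> \<le> D * (norm h)\<^sup>2" for x h
  proof -
    have "norm (K (x + h) - K x - dird K (x + h - x) x) \<le> norm (x + h - x) * (D * norm h)"
    proof (rule differentiable_bound_linearization[where S = "cball x (norm h)" and f' = "\<lambda>x v. dird K v x"])
      show "x + t *\<^sub>R (x + h - x) \<in> cball x (norm h)" if "t \<in> {0..1}" for t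
        using that by (auto simp: dist_norm mult_left_le_one_le)
      show "(K has_derivative (\<lambda>v. dird K v y)) (at y within cball x (norm h))" for y
        using smooth_on_has_derivative[OF assms(1)] has_derivative_at_withinI by blast
      show "onorm ((\<lambda>v. dird K v y) - (\<lambda>v. dird K v x)) \<le> D * norm h" if "y \<in> cball x (norm h)" for y
      proof (rule onorm_bound)
        show "norm (((\<lambda>v. dird K v y) - (\<lambda>v. dird K v x)) v) \<le> D * norm h * norm v" for v
          using D[where v = v and x = y and y = x] that D0 mult_right_mono[OF mult_left_mono[of "norm (y - x)" "norm h" D], of "norm v"]
          by (auto simp: dist_norm norm_minus_commute)
      qed (use D0 in auto)
    qed auto
    then show ?thesis by (simp add: power2_eq_square mult_ac)
  qed
  then show ?thesis using D0 by auto
qed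

section \<open>Convolution with a smooth kernel of compact support\<close>

definition conv :: "('a::euclidean_space \<Rightarrow> real) \<Rightarrow> ('a \<Rightarrow> real) \<Rightarrow> 'a \<Rightarrow> real" where
  "conv U K z = (\<integral>w. U w * K (z - w) \<partial>lborel)"

lemma conv_integrable:
  fixes U K :: "'a::euclidean_space \<Rightarrow> real"
  assumes "integrable lborel U" "continuous_on UNIV K" "\<And>x. x \<notin> cball 0 R \<Longrightarrow> K x = 0"
  shows "integrable lborel (\<lambda>w. U w * K (z - w))"
proof -
  obtain C where C: "\<And>x. \<bar>K x\<bar> \<le> C" using compact_support_bounded[OF assms(2,3)] by blast
  show ?thesis
    by (rule integrable_mult_bounded[OF assms(1) _ C])
       (intro borel_measurable_continuous_onI continuous_on_compose2[OF assms(2)] continuous_intros, auto)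
qed

text \<open>By the uniform Taylor bound of the kernel, the remainder is at most C |y - z|^2 times
  the L^1 norm of U.\<close>

lemma conv_derivative:
  assumes U: "integrable lborel U" and K: "smooth_on UNIV K" "\<And>x. x \<notin> cball 0 R \<Longrightarrow> K x = 0"
  shows "(conv U K has_derivative (\<lambda>v. conv U (dird K v) z)) (at z)"
proof -
  have iK: "integrable lborel (\<lambda>w. U w * K (z - w))" for z
    by (rule conv_integrable[OF U smooth_on_continuous[OF K(1)] K(2)])
  have iD: "integrable lborel (\<lambda>w. U w * dird K v (z - w))" for v z
    by (rule conv_integrable[OF U smooth_on_continuous[OF smooth_on_dird[OF K(1)]] dird_outside_cball[OF K(2)]])
  have lin: "linear (\<lambda>v. conv U (dird K v) z)"
  proof (rule linearI)
    fix v w show "conv U (dird K (v + w)) z = conv U (dird K v) z + conv U (dird K w) z"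
      using iD[where v = v and z = z] iD[where v = w and z = z] linear_add[OF dird_linear[OF K(1)]]
      by (simp add: conv_def distrib_left)
  next
    fix c v show "conv U (dird K (c *\<^sub>R v)) z = c *\<^sub>R conv U (dird K v) z"
      using linear_scale[OF dird_linear[OF K(1)]] by (simp add: conv_def mult.left_commute)
  qed
  obtain C where C: "0 \<le> C" "\<And>x h. \<bar>K (x + h) - K x - dird K h x\<bar> \<le> C * (norm h)\<^sup>2"
    using compact_support_taylor[OF K] by blast
  define M where "M = C * (\<integral>w. \<bar>U w\<bar> \<partial>lborel)"
  have "norm (conv U K y - conv U K z - conv U (dird K (y - z)) z) / norm (y - z) \<le> M * norm (y - z)" if "y \<noteq> z" for y
  proof -
    have "conv U K y - conv U K z - conv U (dird K (y - z)) z
        = (\<integral>w. U w * (K (y - w) - K (z - w) - dird K (y - z) (z - w)) \<partial>lborel)"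
      using iK[of y] iK[of z] iD[where v = "y - z" and z = z] by (simp add: conv_def right_diff_distrib)
    also have "norm \<dots> \<le> (\<integral>w. (C * (norm (y - z))\<^sup>2) * \<bar>U w\<bar> \<partial>lborel)"
    proof (rule Bochner_Integration.integral_norm_bound_integral)
      show "integrable lborel (\<lambda>w. U w * (K (y - w) - K (z - w) - dird K (y - z) (z - w)))"
        using iK[of y] iK[of z] iD[where v = "y - z" and z = z] by (simp add: right_diff_distrib)
      show "integrable lborel (\<lambda>w. (C * (norm (y - z))\<^sup>2) * \<bar>U w\<bar>)" using U by simp
      show "norm (U w * (K (y - w) - K (z - w) - dird K (y - z) (z - w))) \<le> (C * (norm (y - z))\<^sup>2) * \<bar>U w\<bar>" for w
        using mult_left_mono[OF C(2)[of "z - w" "y - z"], of "\<bar>U w\<bar>"] by (simp add: abs_mult mult_ac)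
    qed
    also have "\<dots> = M * norm (y - z) * norm (y - z)" by (simp add: M_def power2_eq_square)
    finally show ?thesis using that by (simp add: divide_le_eq)
  qed
  moreover have "((\<lambda>y. M * norm (y - z)) \<longlongrightarrow> 0) (at z)" by (auto intro!: tendsto_eq_intros)
  ultimately show ?thesis
    by (intro has_derivativeI_sandwich[where e = 1 and H = "\<lambda>y. M * norm (y - z)"])
       (use lin linear_conv_bounded_linear in auto)
qed

lemma conv_dird:
  assumes "integrable lborel U" "smooth_on UNIV K" "\<And>x. x \<notin> cball 0 R \<Longrightarrow> K x = 0"
  shows "dird (conv U K) v z = conv U (dird K v) z"
  by (rule dird_eq[OF conv_derivative[OF assms]])

lemma smooth_on_conv:
  assumes U: "integrable lborel U" and K: "smooth_on UNIV K" "\<And>x. x \<notin> cball 0 R \<Longrightarrow> K x = 0"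
  shows "smooth_on UNIV (conv U K)"
proof -
  have "Ck_on k UNIV (conv U K)" for k
    using K
  proof (induction k arbitrary: K)
    case 0
    show ?case
      using conv_derivative[OF U 0] has_derivative_continuous
      by (metis Ck_on.simps(1) continuous_at_imp_continuous_on)
  next
    case (Suc k)
    show ?case
      by (rule Ck_on_SucI[OF open_UNIV conv_derivative[OF U Suc.prems]])
         (auto intro!: Suc.IH smooth_on_dird Suc.prems(1) dird_outside_cball[OF Suc.prems(2)])
  qed
  then show ?thesis by (simp add: smooth_on_def)
qed

lemma levi_conv:
  fixes U K :: "complex^'n \<Rightarrow> real"
  assumes "integrable lborel U" "smooth_on UNIV K" "\<And>x. x \<notin> cball 0 R \<Longrightarrow> K x = 0"
  shows "levi (conv U K) z v = (\<integral>w. U w * levi K (z - w) v \<partial>lborel)"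
proof -
  have 1: "dird (dird (conv U K) v) v z = (\<integral>w. U w * dird (dird K v) v (z - w) \<partial>lborel)" for v
  proof -
    have "dird (conv U K) v = conv U (dird K v)" by (rule ext) (rule conv_dird[OF assms])
    from arg_cong[OF this, of "\<lambda>g. frechet_derivative g (at z) v"]
    have "dird (dird (conv U K) v) v z = conv U (dird (dird K v) v) z"
      using conv_dird[OF assms(1) smooth_on_dird[OF assms(2)] dird_outside_cball[OF assms(3)]] by simp
    then show ?thesis by (simp add: conv_def)
  qed
  have 2: "integrable lborel (\<lambda>w. U w * dird (dird K v) v (z - w))" for v
    by (intro conv_integrable[OF assms(1)] smooth_on_continuous smooth_on_dird assms(2)
        dird_outside_cball[OF dird_outside_cball[OF assms(3)]])
  show ?thesis unfolding levi_def 1 using 2[of v] 2[of "\<i> *s v"] by (simp add: distrib_left)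
qed

section \<open>The mollifier: a radially decreasing kernel with a plateau\<close>

definition bump :: "'a::euclidean_space \<Rightarrow> real" where
  "bump w = step ((norm w)\<^sup>2)"

lemma bump_nonneg: "0 \<le> bump w" and bump_le_1: "bump w \<le> 1"
  by (auto simp: bump_def step_nonneg step_le_1)

lemma bump_antimono: "norm x \<le> norm y \<Longrightarrow> bump y \<le> bump x"
  by (auto simp: bump_def intro!: step_antimono power_mono)

lemma bump_plateau: "norm x \<le> 1/4 \<Longrightarrow> bump x = 1"
  using power_mono[of "norm x" "1/4" 2] by (auto simp: bump_def power2_eq_square intro!: step_eq_1)

lemma bump_outside: "1 \<le> norm x \<Longrightarrow> bump x = 0"
  using power_mono[of 1 "norm x" 2] by (auto simp: bump_def intro!: step_eq_0)

lemma smooth_on_bump: "smooth_on UNIV (bump :: 'a::euclidean_space \<Rightarrow> real)"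
proof -
  have "smooth_on UNIV (\<lambda>w::'a. (norm w)\<^sup>2)" using smooth_on_norm_square[of 0] by simp
  from smooth_on_compose[OF open_UNIV open_UNIV _ this smooth_on_step] show ?thesis
    unfolding bump_def[abs_def] by simp
qed

lemma compact_support_integrable:
  fixes K :: "'a::euclidean_space \<Rightarrow> real"
  assumes "continuous_on UNIV K" "\<And>x. x \<notin> cball 0 R \<Longrightarrow> K x = 0"
  shows "integrable lborel K"
proof -
  have "integrable lborel (\<lambda>x. indicator (cball 0 R) x *\<^sub>R K x)"
    by (rule borel_integrable_compact[OF compact_cball continuous_on_subset[OF assms(1) subset_UNIV]])
  moreover have "(\<lambda>x. indicator (cball 0 R) x *\<^sub>R K x) = K"
    using assms(2) by (auto simp: indicator_def fun_eq_iff)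
  ultimately show ?thesis by simp
qed

lemma bump_integral_pos: "0 < (\<integral>w. bump w \<partial>lborel :: 'a::euclidean_space measure)"
proof -
  have i: "integrable lborel (bump :: 'a \<Rightarrow> real)"
    by (rule compact_support_integrable[OF smooth_on_continuous[OF smooth_on_bump], of 1]) (auto intro: bump_outside)
  have j: "integrable lborel (indicator (cball (0::'a) (1/4)) :: 'a \<Rightarrow> real)"
    by (rule integrable_real_indicator[OF _ emeasure_lborel_cball_finite]) simp
  have "0 < measure lborel (cball (0::'a) (1/4))" by (simp add: content_cball_pos)
  also have "\<dots> = (\<integral>w. indicator (cball (0::'a) (1/4)) w \<partial>lborel)" by simp
  also have "\<dots> \<le> (\<integral>w. bump w \<partial>lborel :: 'a measure)"
    by (rule integral_mono[OF j i]) (auto simp: indicator_def bump_plateau bump_nonneg)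
  finally show ?thesis .
qed

definition moll :: "real \<Rightarrow> 'a::euclidean_space \<Rightarrow> real" where
  "moll d w = bump ((1 / d) *\<^sub>R w) / (d ^ DIM('a) * (\<integral>w. bump w \<partial>lborel :: 'a measure))"

lemma moll_nonneg: "0 < d \<Longrightarrow> 0 \<le> moll d w"
  using bump_integral_pos by (auto simp: moll_def bump_nonneg less_imp_le)

lemma moll_outside: "0 < d \<Longrightarrow> d \<le> norm w \<Longrightarrow> moll d w = 0"
  by (simp add: moll_def bump_outside)

lemma moll_outside_cball: "0 < d \<Longrightarrow> w \<notin> cball 0 d \<Longrightarrow> moll d w = 0"
  by (simp add: moll_outside)

lemma moll_minus: "moll d (- w) = moll d w"
  by (simp add: moll_def bump_def)

lemma moll_commute: "moll d (x - y) = moll d (y - x)"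
  by (metis minus_diff_eq moll_minus)

lemma smooth_on_moll: "smooth_on UNIV (moll d :: 'a::euclidean_space \<Rightarrow> real)"
proof -
  have "smooth_on UNIV (\<lambda>w::'a. bump ((1 / d) *\<^sub>R w))"
    by (rule smooth_on_compose[OF open_UNIV open_UNIV _ smooth_on_bounded_linear[OF open_UNIV bounded_linear_scaleR_right] smooth_on_bump]) auto
  from smooth_on_cmult[OF open_UNIV this, of "1 / (d ^ DIM('a) * (\<integral>w. bump w \<partial>lborel :: 'a measure))"]
  show ?thesis unfolding moll_def[abs_def] by (simp add: field_simps)
qed

lemma continuous_on_moll: "continuous_on S (moll d)"
  using smooth_on_continuous[OF smooth_on_moll] continuous_on_subset by blast

lemma borel_measurable_moll [measurable]: "moll d \<in> borel_measurable borel"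
  by (intro borel_measurable_continuous_onI continuous_on_moll)

lemma moll_integrable: "0 < d \<Longrightarrow> integrable lborel (moll d)"
  by (rule compact_support_integrable[OF continuous_on_moll moll_outside_cball])

lemma moll_integral: assumes "0 < d" shows "(\<integral>w. moll d w \<partial>lborel :: 'a::euclidean_space measure) = 1"
proof -
  have [measurable]: "(bump :: 'a \<Rightarrow> real) \<in> borel_measurable borel" by (rule borel_measurable_smooth[OF smooth_on_bump])
  let ?I = "\<integral>w. bump w \<partial>lborel :: 'a measure" and ?J = "\<integral>w. bump ((1 / d) *\<^sub>R w) \<partial>lborel :: 'a measure"
  have "?I = (1 / d) ^ DIM('a) * ?J"
    using lborel_integral_affine[of "bump :: 'a \<Rightarrow> real" "1 / d" 0] assms by simp
  then have "?J = d ^ DIM('a) * ?I" using assms by (simp add: power_one_over)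
  moreover have "(\<integral>w. moll d w \<partial>lborel :: 'a measure) = ?J / (d ^ DIM('a) * ?I)" by (simp add: moll_def)
  ultimately show ?thesis using assms bump_integral_pos[where 'a = 'a] by simp
qed

lemma moll_reflect_integral: "0 < d \<Longrightarrow> (\<integral>w. moll d (z - w) \<partial>lborel) = 1"
  using lborel_integral_reflect[of "moll d" z] moll_integral by simp

lemma moll_scale:
  fixes f :: "'a::euclidean_space \<Rightarrow> real"
  assumes "0 < d" and [measurable]: "f \<in> borel_measurable borel"
  shows "(\<integral>x. f x * moll d (z - x) \<partial>lborel) = (\<integral>w. f (z + d *\<^sub>R w) * moll 1 w \<partial>lborel)"
proof -
  have "(\<integral>x. f x * moll d (z - x) \<partial>lborel) = d ^ DIM('a) * (\<integral>w. f (z + d *\<^sub>R w) * moll d (z - (z + d *\<^sub>R w)) \<partial>lborel)"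
    using lborel_integral_affine[of "\<lambda>x. f x * moll d (z - x)" d z] assms(1) by simp
  also have "\<dots> = (\<integral>w. f (z + d *\<^sub>R w) * moll 1 w \<partial>lborel)"
    unfolding integral_mult_right_zero[symmetric]
    by (intro Bochner_Integration.integral_cong refl) (use assms(1) in \<open>simp add: moll_def bump_def field_simps\<close>)
  finally show ?thesis .
qed

text \<open>Two mollifiers at comparable scales: this is where the plateau of \<^term>\<open>bump\<close> is needed.\<close>

lemma moll_domination:
  fixes x y z :: "'a::euclidean_space"
  assumes "0 < r" "4 * norm (y - z) \<le> R - r"
  shows "(r / R) ^ DIM('a) * moll r (x - z) \<le> moll R (x - y)"
proof -
  have R: "0 < R" "r \<le> R" using assms norm_ge_zero[of "y - z"] by linarith+
  have "norm (x - y) \<le> norm (x - z) + norm (y - z)" using norm_triangle_ineq4[of "x - z" "y - z"] by simp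
  also have "\<dots> \<le> norm (x - z) + (R - r) / 4" using assms(2) by simp
  finally have tri: "norm (x - y) \<le> norm (x - z) + (R - r) / 4" .
  have "bump ((1 / r) *\<^sub>R (x - z)) \<le> bump ((1 / R) *\<^sub>R (x - y))"
  \<comment> \<open>If x is in the plateau of the small kernel, it is also in that of the large one.
    Otherwise the rescaled distance does not increase on passing from z and r to y and R, and
    \<open>bump\<close> is radially decreasing.\<close>
  proof (cases "norm (x - z) \<le> r / 4")
    case True
    then have "norm (x - y) \<le> R / 4"
      using tri by (simp add: field_simps)
    then have "bump ((1 / R) *\<^sub>R (x - y)) = 1" using R(1) by (intro bump_plateau) simp
    then show ?thesis using bump_le_1 by auto
  next
    case False
    from mult_left_mono[OF tri, of r] have "r * norm (x - y) \<le> r * norm (x - z) + r / 4 * (R - r)"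
      using assms(1) by (simp add: algebra_simps)
    also have "\<dots> \<le> r * norm (x - z) + norm (x - z) * (R - r)"
      using False R by (intro add_left_mono mult_right_mono) auto
    also have "\<dots> = R * norm (x - z)" by (simp add: algebra_simps)
    finally have "norm ((1 / R) *\<^sub>R (x - y)) \<le> norm ((1 / r) *\<^sub>R (x - z))"
      unfolding norm_scaleR using assms(1) R(1) by (simp add: field_simps)
    then show ?thesis by (rule bump_antimono)
  qed
  moreover have "0 < (\<integral>w. bump w \<partial>lborel :: 'a measure)" by (rule bump_integral_pos)
  ultimately show ?thesis using assms(1) R(1)
    by (simp add: moll_def power_divide divide_simps)
qed

subsection \<open>Convergence in the mean\<close>

abbreviation mollify :: "('a::euclidean_space \<Rightarrow> real) \<Rightarrow> real \<Rightarrow> 'a \<Rightarrow> real" where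
  "mollify U d \<equiv> conv U (moll d)"

lemma smooth_on_mollify: "integrable lborel U \<Longrightarrow> 0 < d \<Longrightarrow> smooth_on UNIV (mollify U d)"
  by (rule smooth_on_conv[OF _ smooth_on_moll moll_outside_cball])

lemma mollify_integrable: "integrable lborel U \<Longrightarrow> 0 < d \<Longrightarrow> integrable lborel (\<lambda>w. U w * moll d (z - w))"
  by (rule conv_integrable[OF _ continuous_on_moll moll_outside_cball])

lemma mollify_add:
  assumes "integrable lborel U" "integrable lborel V" "0 < d"
  shows "mollify (\<lambda>x. U x + V x) d z = mollify U d z + mollify V d z"
  using mollify_integrable[OF assms(1,3)] mollify_integrable[OF assms(2,3)] by (simp add: conv_def distrib_right)

lemma mollify_le:
  assumes "integrable lborel U" "0 < d" "AE w in lborel. w \<in> ball z d \<longrightarrow> U w \<le> t"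
  shows "mollify U d z \<le> t"
proof -
  have "mollify U d z \<le> (\<integral>w. t * moll d (z - w) \<partial>lborel)"
    unfolding conv_def
  proof (rule integral_mono_AE[OF mollify_integrable[OF assms(1,2)]])
    show "integrable lborel (\<lambda>w. t * moll d (z - w))"
      using moll_reflect_integral[OF assms(2), of z] not_integrable_integral_eq by fastforce
    show "AE w in lborel. U w * moll d (z - w) \<le> t * moll d (z - w)"
      using assms(3)
    proof eventually_elim
      case (elim w)
      then show ?case using moll_nonneg[OF assms(2), of "z - w"] moll_outside[OF assms(2), of "z - w"]
        by (cases "w \<in> ball z d") (auto simp: dist_norm intro: mult_right_mono)
    qed
  qed
  then show ?thesis using moll_reflect_integral[OF assms(2), of z] by simp
qed

text \<open>Young's inequality for a kernel of mass 1. It reduces convergence in the mean to a dense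
  class of functions.\<close>

lemma mollify_norm_le:
  assumes "integrable lborel U" "0 < d"
  shows "(\<integral>\<^sup>+z. ennreal \<bar>mollify U d z\<bar> \<partial>lborel) \<le> (\<integral>\<^sup>+z. ennreal \<bar>U z\<bar> \<partial>(lborel :: 'a::euclidean_space measure))"
proof -
  have [measurable]: "U \<in> borel_measurable borel" using assms(1) by auto
  have "(\<integral>\<^sup>+z. ennreal \<bar>mollify U d z\<bar> \<partial>lborel) \<le> (\<integral>\<^sup>+z. \<integral>\<^sup>+w. ennreal \<bar>U w\<bar> * ennreal (moll d (z - w)) \<partial>lborel \<partial>lborel)"
  proof (rule nn_integral_mono)
    fix z
    have "ennreal \<bar>mollify U d z\<bar> \<le> (\<integral>\<^sup>+w. ennreal (norm (U w * moll d (z - w))) \<partial>lborel)"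
      unfolding conv_def real_norm_def[symmetric] by (rule integral_norm_bound_ennreal[OF mollify_integrable[OF assms]])
    also have "\<dots> = (\<integral>\<^sup>+w. ennreal \<bar>U w\<bar> * ennreal (moll d (z - w)) \<partial>lborel)"
      by (simp add: abs_mult ennreal_mult moll_nonneg[OF assms(2)])
    finally show "ennreal \<bar>mollify U d z\<bar> \<le> (\<integral>\<^sup>+w. ennreal \<bar>U w\<bar> * ennreal (moll d (z - w)) \<partial>lborel)" .
  qed
  also have "\<dots> = (\<integral>\<^sup>+w. \<integral>\<^sup>+z. ennreal \<bar>U w\<bar> * ennreal (moll d (z - w)) \<partial>lborel \<partial>lborel)"
    by (rule lborel_pair.Fubini'[symmetric]) measurable
  also have "\<dots> = (\<integral>\<^sup>+w. ennreal \<bar>U w\<bar> \<partial>lborel)"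
  proof (intro nn_integral_cong)
    fix w :: 'a
    have "(\<integral>\<^sup>+z. ennreal (moll d (z - w)) \<partial>lborel) = (\<integral>\<^sup>+z. ennreal (moll d z) \<partial>(lborel :: 'a measure))"
      using lborel_nn_integral_affine[of "\<lambda>z::'a. ennreal (moll d z)" 1 "- w"] by simp
    also have "\<dots> = 1"
      by (subst nn_integral_eq_integral[OF moll_integrable[OF assms(2)]])
         (simp_all add: moll_nonneg assms(2) moll_integral)
    finally show "(\<integral>\<^sup>+z. ennreal \<bar>U w\<bar> * ennreal (moll d (z - w)) \<partial>lborel) = ennreal \<bar>U w\<bar>"
      by (simp add: nn_integral_cmult)
  qed
  finally show ?thesis .
qed

text \<open>Inner regularity yields a closed set, which is then cut by a large ball; what lies
  outside the ball has small measure since A has finite measure.\<close>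

lemma lmeasurable_inner_compact:
  fixes A :: "'a::euclidean_space set"
  assumes A: "A \<in> lmeasurable" and "0 < \<eta>"
  obtains S where "compact S" "S \<subseteq> A" "A - S \<in> lmeasurable" "emeasure lebesgue (A - S) < ennreal \<eta>"
proof -
  have \<eta>2: "0 < \<eta> / 2" using assms by simp
  have A': "A \<in> sets lebesgue" "emeasure lebesgue A < \<infinity>" using A by (auto simp: fmeasurable_def)
  obtain S where S: "closed S" "S \<subseteq> A" "A - S \<in> lmeasurable" "emeasure lebesgue (A - S) < ennreal (\<eta> / 2)"
    using sets_lebesgue_inner_closed[OF A'(1) \<eta>2] .
  have Sl: "S \<in> sets lebesgue" using S(1) by (simp add: borel_closed)
  have cl: "cball (0::'a) r \<in> sets lebesgue" for r by simp
  have fin: "emeasure lebesgue (S - cball 0 r) < \<infinity>" for r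
    by (rule le_less_trans[OF emeasure_mono A'(2)]) (use S(2) A' in auto)
  have "(\<lambda>n. emeasure lebesgue (S - cball 0 (real n))) \<longlonglongrightarrow> emeasure lebesgue (\<Inter>n. S - cball 0 (real n))"
    by (rule Lim_emeasure_decseq) (use Sl fin in \<open>auto simp: decseq_def less_top[symmetric]\<close>)
  also have "(\<Inter>n. S - cball 0 (real n)) = {}"
  proof -
    have "\<exists>n. norm x \<le> real n" for x :: 'a by (rule real_arch_simple)
    then show ?thesis by auto
  qed
  finally have "(\<lambda>n. emeasure lebesgue (S - cball 0 (real n))) \<longlonglongrightarrow> 0" by simp
  then have "eventually (\<lambda>n. emeasure lebesgue (S - cball 0 (real n)) < ennreal (\<eta> / 2)) sequentially"
    using \<eta>2 by (intro order_tendstoD(2)) auto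
  then obtain n where n: "emeasure lebesgue (S - cball 0 (real n)) < ennreal (\<eta> / 2)"
    using eventually_happens sequentially_bot by blast
  have eq: "A - (S \<inter> cball 0 (real n)) = (A - S) \<union> (S - cball 0 (real n))" using S(2) by auto
  have "emeasure lebesgue (A - (S \<inter> cball 0 (real n))) \<le> emeasure lebesgue (A - S) + emeasure lebesgue (S - cball 0 (real n))"
    unfolding eq using S(3) Sl by (intro emeasure_subadditive) auto
  also have "\<dots> < ennreal (\<eta> / 2) + ennreal (\<eta> / 2)" by (rule add_strict_mono[OF S(4) n])
  also have "\<dots> = ennreal \<eta>" using assms(2) by (simp flip: ennreal_plus)
  finally have lt: "emeasure lebesgue (A - (S \<inter> cball 0 (real n))) < ennreal \<eta>" .
  show thesis
  proof (rule that[OF _ _ _ lt])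
    show "compact (S \<inter> cball 0 (real n))" using S(1) by (simp add: closed_Int_compact)
    show "A - S \<inter> cball 0 (real n) \<in> lmeasurable"
    proof (rule fmeasurableI)
      show "A - S \<inter> cball 0 (real n) \<in> sets lebesgue" by (rule sets.Diff[OF A'(1) sets.Int[OF Sl cl]])
      show "emeasure lebesgue (A - S \<inter> cball 0 (real n)) < \<infinity>" using less_trans[OF lt ennreal_less_top] by simp
    qed
  qed (use S(2) in auto)
qed

text \<open>Density of continuous functions of compact support in L^1. The essential case is an
  indicator, approximated by a Urysohn function between a compact and an open set of almost the same
  measure.\<close>

lemma integrable_approximate_continuous:
  fixes f :: "'a::euclidean_space \<Rightarrow> real"
  assumes "integrable lborel f" "0 < e"
  shows "\<exists>g R. continuous_on UNIV g \<and> (\<forall>x. x \<notin> cball 0 R \<longrightarrow> g x = 0) \<and> (\<integral>\<^sup>+x. ennreal \<bar>f x - g x\<bar> \<partial>lborel) < ennreal e"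
  using assms
proof (induction arbitrary: e rule: integrable_induct)
  case (base A c)
  \<comment> \<open>The error is at most |c| and lives on T - S, which has measure at most 2 \<eta>;
    the summand 1 keeps the estimate strict and the denominator positive.\<close>
  define \<eta> where "\<eta> = e / (2 * (\<bar>c\<bar> + 1))"
  have \<eta>: "0 < \<eta>" using base by (simp add: \<eta>_def)
  have A: "A \<in> sets lebesgue" "A \<in> lmeasurable" using base by (auto simp: fmeasurable_def)
  obtain T where T: "open T" "A \<subseteq> T" "T - A \<in> lmeasurable" "emeasure lebesgue (T - A) < ennreal \<eta>"
    using sets_lebesgue_outer_open[OF A(1) \<eta>] .
  obtain S where S: "compact S" "S \<subseteq> A" "A - S \<in> lmeasurable" "emeasure lebesgue (A - S) < ennreal \<eta>"
    using lmeasurable_inner_compact[OF A(2) \<eta>] .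
  obtain R where R: "S \<subseteq> ball 0 R" using bounded_subset_ballD[OF compact_imp_bounded[OF S(1)], of 0] by auto
  have disj: "S \<inter> (- (T \<inter> ball 0 R)) = {}" using S(2) T(2) R by auto
  have cl: "closed (- (T \<inter> ball 0 R))" using T(1) by (intro closed_Compl open_Int) auto
  obtain h :: "'a \<Rightarrow> real" where h: "continuous_on UNIV h" "\<And>x. h x \<in> closed_segment 1 0"
      "\<And>x. x \<in> S \<Longrightarrow> h x = 1" "\<And>x. x \<in> - (T \<inter> ball 0 R) \<Longrightarrow> h x = 0"
    using Urysohn[OF compact_imp_closed[OF S(1)] cl disj, of 1 0] by blast
  have h01: "0 \<le> h x" "h x \<le> 1" for x using h(2)[of x] by (auto simp: closed_segment_eq_real_ivl)
  have "(\<integral>\<^sup>+x. ennreal \<bar>indicator A x *\<^sub>R c - h x * c\<bar> \<partial>lborel) \<le> (\<integral>\<^sup>+x. ennreal \<bar>c\<bar> * indicator (T - S) x \<partial>lborel)"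
  proof (rule nn_integral_mono)
    fix x
    show "ennreal \<bar>indicator A x *\<^sub>R c - h x * c\<bar> \<le> ennreal \<bar>c\<bar> * indicator (T - S) x"
    proof (cases "x \<in> T - S")
      case True
      have "\<bar>indicator A x *\<^sub>R c - h x * c\<bar> = \<bar>indicator A x - h x\<bar> * \<bar>c\<bar>" by (simp add: abs_mult[symmetric] algebra_simps)
      also have "\<dots> \<le> 1 * \<bar>c\<bar>" using h01[of x] by (intro mult_right_mono) (auto simp: indicator_def)
      finally show ?thesis using True by simp
    next
      case False
      then have e: "indicator A x *\<^sub>R c = h x * c" using S(2) T(2) h(3)[of x] h(4)[of x] by (auto simp: indicator_def)
      show ?thesis unfolding e by simp
    qed
  qed
  also have "\<dots> = ennreal \<bar>c\<bar> * emeasure lborel (T - S)"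
    by (rule nn_integral_cmult_indicator) (use T(1) S(1) in \<open>auto simp: compact_imp_closed borel_open borel_closed\<close>)
  also have "\<dots> \<le> ennreal \<bar>c\<bar> * (ennreal \<eta> + ennreal \<eta>)"
  proof (rule mult_left_mono)
    have e: "(T - A) \<union> (A - S) = T - S" using S(2) T(2) by auto
    have "emeasure lborel (T - S) = emeasure lebesgue ((T - A) \<union> (A - S))"
      unfolding e using T(1) S(1) by (simp add: compact_imp_closed borel_open borel_closed)
    also have "\<dots> \<le> emeasure lebesgue (T - A) + emeasure lebesgue (A - S)"
      using T(3) S(3) by (intro emeasure_subadditive) auto
    also have "\<dots> \<le> ennreal \<eta> + ennreal \<eta>" using T(4) S(4) by (intro add_mono) auto
    finally show "emeasure lborel (T - S) \<le> ennreal \<eta> + ennreal \<eta>" .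
  qed simp
  also have "\<dots> = ennreal (\<bar>c\<bar> * (2 * \<eta>))"
    using \<eta> by (simp add: ennreal_mult flip: ennreal_plus)
  also have "\<dots> < ennreal e"
  proof (rule ennreal_lessI)
    have "\<bar>c\<bar> * (2 * \<eta>) = e * (\<bar>c\<bar> / (\<bar>c\<bar> + 1))" by (simp add: \<eta>_def field_simps)
    also have "\<dots> < e * 1" using base(3) by (intro mult_strict_left_mono) auto
    finally show "\<bar>c\<bar> * (2 * \<eta>) < e" by simp
  qed (use base in auto)
  finally have "(\<integral>\<^sup>+x. ennreal \<bar>indicator A x *\<^sub>R c - h x * c\<bar> \<partial>lborel) < ennreal e" .
  then show ?case
    by (intro exI[of _ "\<lambda>x. h x * c"] exI[of _ R]) (use h in \<open>auto intro!: continuous_intros\<close>)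
next
  case (add f g)
  have e2: "0 < e / 2" using add(5) by simp
  obtain f' Rf where f': "continuous_on UNIV f'" "\<And>x. x \<notin> cball 0 Rf \<Longrightarrow> f' x = 0" "(\<integral>\<^sup>+x. ennreal \<bar>f x - f' x\<bar> \<partial>lborel) < ennreal (e / 2)"
    using add(3)[OF e2] by blast
  obtain g' Rg where g': "continuous_on UNIV g'" "\<And>x. x \<notin> cball 0 Rg \<Longrightarrow> g' x = 0" "(\<integral>\<^sup>+x. ennreal \<bar>g x - g' x\<bar> \<partial>lborel) < ennreal (e / 2)"
    using add(4)[OF e2] by blast
  have [measurable]: "f \<in> borel_measurable borel" "g \<in> borel_measurable borel" "f' \<in> borel_measurable borel" "g' \<in> borel_measurable borel"
    using add(1,2) f'(1) g'(1) by (auto intro: borel_measurable_continuous_onI)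
  have "(\<integral>\<^sup>+x. ennreal \<bar>f x + g x - (f' x + g' x)\<bar> \<partial>lborel) \<le> (\<integral>\<^sup>+x. ennreal \<bar>f x - f' x\<bar> + ennreal \<bar>g x - g' x\<bar> \<partial>lborel)"
    by (intro nn_integral_mono) (simp flip: ennreal_plus)
  also have "\<dots> = (\<integral>\<^sup>+x. ennreal \<bar>f x - f' x\<bar> \<partial>lborel) + (\<integral>\<^sup>+x. ennreal \<bar>g x - g' x\<bar> \<partial>lborel)"
    by (rule nn_integral_add) measurable
  also have "\<dots> < ennreal (e / 2) + ennreal (e / 2)" by (rule add_strict_mono[OF f'(3) g'(3)])
  also have "\<dots> = ennreal e" using add(5) by (simp flip: ennreal_plus)
  finally show ?case
    using f'(2) g'(2) by (intro exI[of _ "\<lambda>x. f' x + g' x"] exI[of _ "max Rf Rg"])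
      (auto intro!: continuous_intros f'(1) g'(1))
next
  case (lim f s)
  have "(\<lambda>i. \<integral>\<^sup>+x. norm (f x - s i x) \<partial>lborel) \<longlonglongrightarrow> 0"
  proof (rule nn_integral_dominated_convergence_norm[where w = "\<lambda>x. 2 * \<bar>f x\<bar>"])
    show "(\<integral>\<^sup>+x. ennreal (2 * \<bar>f x\<bar>) \<partial>lborel) < \<infinity>"
      using integrable_iff_bounded[of lborel "\<lambda>x. 2 * f x"] lim(4) by (simp add: abs_mult)
  qed (use lim in auto)
  then have "eventually (\<lambda>i. (\<integral>\<^sup>+x. norm (f x - s i x) \<partial>lborel) < ennreal (e / 2)) sequentially"
    using lim(6) by (intro order_tendstoD(2)) auto
  then obtain i where i: "(\<integral>\<^sup>+x. norm (f x - s i x) \<partial>lborel) < ennreal (e / 2)"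
    using eventually_happens sequentially_bot by blast
  have e2: "0 < e / 2" using lim(6) by simp
  obtain g R where g: "continuous_on UNIV g" "\<And>x. x \<notin> cball 0 R \<Longrightarrow> g x = 0"
     "(\<integral>\<^sup>+x. ennreal \<bar>s i x - g x\<bar> \<partial>lborel) < ennreal (e / 2)" using lim(5)[OF e2, of i] by blast
  have [measurable]: "f \<in> borel_measurable borel" "s i \<in> borel_measurable borel" "g \<in> borel_measurable borel"
    using lim(1,4) g(1) by (auto intro: borel_measurable_continuous_onI)
  have "(\<integral>\<^sup>+x. ennreal \<bar>f x - g x\<bar> \<partial>lborel) \<le> (\<integral>\<^sup>+x. ennreal (norm (f x - s i x)) + ennreal \<bar>s i x - g x\<bar> \<partial>lborel)"
    by (intro nn_integral_mono) (simp flip: ennreal_plus)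
  also have "\<dots> = (\<integral>\<^sup>+x. ennreal (norm (f x - s i x)) \<partial>lborel) + (\<integral>\<^sup>+x. ennreal \<bar>s i x - g x\<bar> \<partial>lborel)"
    by (rule nn_integral_add) measurable
  also have "\<dots> < ennreal (e / 2) + ennreal (e / 2)" by (rule add_strict_mono[OF i g(3)])
  also have "\<dots> = ennreal e" using lim(6) by (simp flip: ennreal_plus)
  finally show ?case using g by blast
qed

text \<open>Two points at distance less than 1 either both lie in the ball of radius R + 1 or both
  lie outside the support, so uniform continuity on a compact ball is enough.\<close>

lemma continuous_compact_support_uniform:
  fixes g :: "'a::euclidean_space \<Rightarrow> real"
  assumes "continuous_on UNIV g" "\<And>x. x \<notin> cball 0 R \<Longrightarrow> g x = 0" "0 < e"
  shows "\<exists>d>0. \<forall>x y. dist x y < d \<longrightarrow> \<bar>g x - g y\<bar> < e"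
proof -
  have "uniformly_continuous_on (cball 0 (R + 1)) g"
    by (intro compact_uniformly_continuous continuous_on_subset[OF assms(1)]) auto
  then obtain d where d: "0 < d" "\<And>x y. x \<in> cball 0 (R + 1) \<Longrightarrow> y \<in> cball 0 (R + 1) \<Longrightarrow> dist y x < d \<Longrightarrow> dist (g y) (g x) < e"
    using assms(3) unfolding uniformly_continuous_on_def by meson
  have "\<bar>g x - g y\<bar> < e" if "dist x y < min d 1" for x y
  proof (cases "x \<in> cball 0 (R + 1) \<and> y \<in> cball 0 (R + 1)")
    case True
    then show ?thesis using d(2)[of y x] that by (simp add: dist_real_def)
  next
    case False
    have "\<bar>norm x - norm y\<bar> < 1" using that norm_triangle_ineq3[of x y] by (simp add: dist_norm)
    then have "x \<notin> cball 0 R" "y \<notin> cball 0 R" using False by auto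
    then show ?thesis using assms(2,3) by simp
  qed
  then show ?thesis using d(1) by (intro exI[of _ "min d 1"]) auto
qed

text \<open>Density argument: \<open>mollify_norm_le\<close> takes care of U - g, uniform continuity
  of g. Three errors of e/4 leave room for the strict inequality.\<close>

lemma mollify_tendsto:
  fixes U :: "'a::euclidean_space \<Rightarrow> real"
  assumes U: "integrable lborel U" and "0 < e"
  shows "\<exists>d0>0. \<forall>d. 0 < d \<longrightarrow> d < d0 \<longrightarrow> (\<integral>\<^sup>+z. ennreal \<bar>mollify U d z - U z\<bar> \<partial>lborel) < ennreal e"
proof -
  have e4: "0 < e / 4" using assms by simp
  obtain g R where g: "continuous_on UNIV g" "\<And>x. x \<notin> cball 0 R \<Longrightarrow> g x = 0"
    "(\<integral>\<^sup>+x. ennreal \<bar>U x - g x\<bar> \<partial>lborel) < ennreal (e / 4)"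
    using integrable_approximate_continuous[OF U e4] by blast
  have gi: "integrable lborel g" by (rule compact_support_integrable[OF g(1,2)])
  have [measurable]: "U \<in> borel_measurable borel" "g \<in> borel_measurable borel"
    using U g(1) by (auto intro: borel_measurable_continuous_onI)
  \<comment> \<open>For d < 1 both g and its mollification vanish outside this ball, so a pointwise
    error \<eta> integrates to at most \<eta> V.\<close>
  define V where "V = measure lborel (cball (0::'a) (R + 1))"
  define \<eta> where "\<eta> = e / 4 / (V + 1)"
  have V: "0 \<le> V" "0 < \<eta>" using assms by (auto simp: V_def \<eta>_def add_nonneg_pos)
  obtain d0 where d0: "0 < d0" "\<And>x y. dist x y < d0 \<Longrightarrow> \<bar>g x - g y\<bar> < \<eta>"
    using continuous_compact_support_uniform[OF g(1,2) V(2)] by blast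
  have "(\<integral>\<^sup>+z. ennreal \<bar>mollify U d z - U z\<bar> \<partial>lborel) < ennreal e" if d: "0 < d" "d < min d0 1" for d
  proof -
    have [measurable]: "mollify U d \<in> borel_measurable borel" "mollify g d \<in> borel_measurable borel" "mollify (\<lambda>x. U x - g x) d \<in> borel_measurable borel"
      using U gi d(1) by (auto intro!: borel_measurable_smooth smooth_on_mollify)
    have A: "(\<integral>\<^sup>+z. ennreal \<bar>mollify g d z - g z\<bar> \<partial>lborel) \<le> ennreal (e / 4)"
    proof -
      have "(\<integral>\<^sup>+z. ennreal \<bar>mollify g d z - g z\<bar> \<partial>lborel) \<le> (\<integral>\<^sup>+z. ennreal \<eta> * indicator (cball (0::'a) (R + 1)) z \<partial>lborel)"
      proof (rule nn_integral_mono)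
        fix z
        have near: "\<bar>g z - g w\<bar> < \<eta>" if "w \<in> ball z d" for w
          using d0(2)[of z w] that d(2) by auto
        have up: "mollify g d z \<le> g z + \<eta>"
        proof (rule mollify_le[OF gi d(1)], rule AE_I2, rule impI)
          show "g w \<le> g z + \<eta>" if "w \<in> ball z d" for w using near[OF that] by linarith
        qed
        have gi': "integrable lborel (\<lambda>x. - g x)" using gi by simp
        have "mollify (\<lambda>x. - g x) d z \<le> - g z + \<eta>"
        proof (rule mollify_le[OF gi' d(1)], rule AE_I2, rule impI)
          show "- g w \<le> - g z + \<eta>" if "w \<in> ball z d" for w using near[OF that] by linarith
        qed
        then have lo: "g z - \<eta> \<le> mollify g d z" by (simp add: conv_def)
        show "ennreal \<bar>mollify g d z - g z\<bar> \<le> ennreal \<eta> * indicator (cball 0 (R + 1)) z"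
        proof (cases "z \<in> cball 0 (R + 1)")
          case True
          then show ?thesis using up lo by (auto intro!: ennreal_leI)
        next
          case False
          have z0: "g w * moll d (z - w) = 0" for w
          proof (cases "w \<in> cball 0 R")
            case True
            then have "1 \<le> norm (z - w)" using False norm_triangle_sub[of z w] by auto
            then show ?thesis using d moll_outside[of d "z - w"] by simp
          next
            case False
            then show ?thesis using g(2) by simp
          qed
          have "mollify g d z = 0" unfolding conv_def z0 by simp
          moreover have "g z = 0" using False g(2) by simp
          ultimately show ?thesis by simp
        qed
      qed
      also have "\<dots> = ennreal \<eta> * emeasure lborel (cball (0::'a) (R + 1))"
        by (rule nn_integral_cmult_indicator) simp
      also have "\<dots> = ennreal (\<eta> * V)"
        using V(2) by (subst emeasure_eq_ennreal_measure) (use emeasure_lborel_cball_finite in \<open>auto simp: V_def ennreal_mult less_top\<close>)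
      also have "\<dots> \<le> ennreal (e / 4)"
      proof (rule ennreal_leI)
        have "\<eta> * V \<le> \<eta> * (V + 1)" using V by (intro mult_left_mono) auto
        also have "\<dots> = e / 4" using V(1) unfolding \<eta>_def by (intro nonzero_eq_divide_eq[THEN iffD1] refl) simp
        finally show "\<eta> * V \<le> e / 4" .
      qed
      finally show ?thesis .
    qed
    have B: "(\<integral>\<^sup>+z. ennreal \<bar>mollify (\<lambda>x. U x - g x) d z\<bar> \<partial>lborel) < ennreal (e / 4)"
      by (rule le_less_trans[OF mollify_norm_le g(3)]) (use U gi d(1) in auto)
    have eq: "mollify U d z = mollify (\<lambda>x. U x - g x) d z + mollify g d z" for z
      using mollify_add[of "\<lambda>x. U x - g x" g d z] U gi d(1) by simp
    have "(\<integral>\<^sup>+z. ennreal \<bar>mollify U d z - U z\<bar> \<partial>lborel)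
      \<le> (\<integral>\<^sup>+z. ennreal \<bar>mollify (\<lambda>x. U x - g x) d z\<bar> + (ennreal \<bar>mollify g d z - g z\<bar> + ennreal \<bar>U z - g z\<bar>) \<partial>lborel)"
      by (intro nn_integral_mono) (simp add: eq flip: ennreal_plus)
    also have "\<dots> = (\<integral>\<^sup>+z. ennreal \<bar>mollify (\<lambda>x. U x - g x) d z\<bar> \<partial>lborel)
       + ((\<integral>\<^sup>+z. ennreal \<bar>mollify g d z - g z\<bar> \<partial>lborel) + (\<integral>\<^sup>+z. ennreal \<bar>U z - g z\<bar> \<partial>lborel))"
      by (simp add: nn_integral_add)
    also have "\<dots> \<le> ennreal (e / 4) + (ennreal (e / 4) + ennreal (e / 4))"
      using A B g(3) by (intro add_mono) auto
    also have "\<dots> = ennreal (3 * (e / 4))" using e4 by (simp flip: ennreal_plus)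
    also have "\<dots> < ennreal e" using assms(2) by (intro ennreal_lessI) auto
    finally show ?thesis .
  qed
  then show ?thesis using d0(1) by (intro exI[of _ "min d0 1"]) auto
qed

section \<open>Complex space as a real coordinate space\<close>

text \<open>The library has the change of variables formula only for \<open>real^'m\<close> with a well-ordered
  index type; \<open>'n bit0\<close> is one with twice as many elements as \<open>'n\<close>.\<close>

definition real_basis :: "'n::finite bit0 \<Rightarrow> complex^'n" where
  "real_basis = (SOME b. bij_betw b UNIV Basis)"

lemma real_basis: "bij_betw (real_basis :: 'n::finite bit0 \<Rightarrow> complex^'n) UNIV Basis"
proof -
  have "\<exists>b. bij_betw b (UNIV :: 'n bit0 set) (Basis :: (complex^'n) set)"
    by (rule finite_same_card_bij) (auto simp: card_bit0)
  then show ?thesis unfolding real_basis_def by (rule someI_ex)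
qed

lemma real_basis_in: "real_basis i \<in> Basis"
  using bij_betwE[OF real_basis] by blast

lemma real_basis_inner: "real_basis i \<bullet> real_basis j = (if i = j then 1 else 0)"
  using inner_Basis[OF real_basis_in real_basis_in, of i j] bij_betw_imp_inj_on[OF real_basis]
  by (auto dest: injD)

lemma sum_real_basis: "(\<Sum>i\<in>UNIV. f (real_basis i)) = (\<Sum>b\<in>Basis. f b)"
  using sum.reindex_bij_betw[OF real_basis] .

lemma prod_real_basis: "(\<Prod>i\<in>UNIV. f (real_basis i)) = (\<Prod>b\<in>Basis. f b)"
  using prod.reindex_bij_betw[OF real_basis] .

definition to_real :: "complex^'n \<Rightarrow> real^('n::finite bit0)" where
  "to_real z = (\<chi> i. z \<bullet> real_basis i)"

definition of_real_vec :: "real^('n::finite bit0) \<Rightarrow> complex^'n" where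
  "of_real_vec x = (\<Sum>i\<in>UNIV. x $ i *\<^sub>R real_basis i)"

lemma of_real_vec_to_real [simp]: "of_real_vec (to_real z) = z"
  using sum_real_basis[of "\<lambda>b. (z \<bullet> b) *\<^sub>R b"]
  by (simp add: of_real_vec_def to_real_def euclidean_representation)

lemma to_real_of_real_vec [simp]: "to_real (of_real_vec x) = x"
  by (simp add: of_real_vec_def to_real_def inner_sum_left real_basis_inner vec_eq_iff if_distrib cong: if_cong)

lemma linear_to_real: "linear to_real"
  by (auto simp: linear_iff to_real_def vec_eq_iff inner_add_left)

lemma linear_of_real_vec: "linear of_real_vec"
  by (auto simp: linear_iff of_real_vec_def scaleR_add_left sum.distrib scaleR_right.sum)

lemma bounded_linear_to_real: "bounded_linear to_real"
  using linear_to_real linear_conv_bounded_linear by blast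

lemma bounded_linear_of_real_vec: "bounded_linear of_real_vec"
  using linear_of_real_vec linear_conv_bounded_linear by blast

lemma inner_to_real: "to_real z \<bullet> to_real w = z \<bullet> w"
proof -
  have "to_real z \<bullet> to_real w = (\<Sum>i\<in>UNIV. (z \<bullet> real_basis i) * (w \<bullet> real_basis i))"
    by (simp add: inner_vec_def to_real_def)
  also have "\<dots> = z \<bullet> w"
    using sum_real_basis[of "\<lambda>b. (z \<bullet> b) * (w \<bullet> b)"] euclidean_inner[of z w] by simp
  finally show ?thesis .
qed

lemma norm_to_real: "norm (to_real z) = norm z"
  by (simp add: norm_eq_sqrt_inner inner_to_real)

lemma measurable_to_real [measurable]: "to_real \<in> borel \<rightarrow>\<^sub>M borel"
  by (intro borel_measurable_continuous_onI linear_continuous_on bounded_linear_to_real)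

lemma measurable_of_real_vec [measurable]: "of_real_vec \<in> borel \<rightarrow>\<^sub>M borel"
  by (intro borel_measurable_continuous_onI linear_continuous_on bounded_linear_of_real_vec)

lemma box_real_cart: "(x::real^'m) \<in> box l u \<longleftrightarrow> (\<forall>i. l $ i < x $ i \<and> x $ i < u $ i)"
  by (auto simp: mem_box_cart)

lemma lborel_to_real: "distr lborel borel to_real = (lborel :: (real^('n::finite bit0)) measure)"
proof (rule lborel_eqI[symmetric])
  fix l u :: "real^('n bit0)"
  assume le: "\<And>b. b \<in> Basis \<Longrightarrow> l \<bullet> b \<le> u \<bullet> b"
  have le': "l $ i \<le> u $ i" for i using le[of "axis i 1"] by (auto simp: inner_axis axis_in_Basis_iff)
  have in_lu: "of_real_vec x \<bullet> real_basis i = x $ i" for x :: "real^('n bit0)" and i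
    using to_real_of_real_vec[of x] by (simp add: to_real_def vec_eq_iff)
  have B: "\<exists>i. b = real_basis i" if "b \<in> Basis" for b :: "complex^'n"
    using bij_betw_imp_surj_on[OF real_basis] that by (metis imageE)
  have vim: "to_real -` box l u = box (of_real_vec l) (of_real_vec u)"
  proof (rule set_eqI)
    fix z
    have "z \<in> box (of_real_vec l) (of_real_vec u) \<longleftrightarrow> (\<forall>i. of_real_vec l \<bullet> real_basis i < z \<bullet> real_basis i \<and> z \<bullet> real_basis i < of_real_vec u \<bullet> real_basis i)"
      unfolding mem_box using B real_basis_in by metis
    then show "z \<in> to_real -` box l u \<longleftrightarrow> z \<in> box (of_real_vec l) (of_real_vec u)"
      by (simp add: in_lu box_real_cart to_real_def)
  qed
  have le2: "of_real_vec l \<bullet> b \<le> of_real_vec u \<bullet> b" if "b \<in> Basis" for b :: "complex^'n"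
    using B[OF that] le' by (auto simp: in_lu)
  have "emeasure (distr lborel borel to_real) (box l u) = emeasure lborel (box (of_real_vec l) (of_real_vec u :: complex^'n))"
    by (subst emeasure_distr) (auto simp: vim)
  also have "\<dots> = ennreal (\<Prod>b\<in>Basis. (of_real_vec u - of_real_vec l) \<bullet> (b :: complex^'n))"
    using le2 by simp
  also have "(\<Prod>b\<in>Basis. (of_real_vec u - of_real_vec l) \<bullet> (b :: complex^'n)) = (\<Prod>i\<in>UNIV. u $ i - l $ i)"
    using prod_real_basis[of "\<lambda>b. (of_real_vec u - of_real_vec l) \<bullet> b"] by (simp add: inner_diff_left in_lu)
  also have "\<dots> = (\<Prod>b\<in>Basis. (u - l) \<bullet> b)"
  proof -
    have B: "(Basis :: (real^('n bit0)) set) = (\<lambda>i. axis i 1) ` UNIV" by (auto simp: Basis_vec_def)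
    have inj: "inj (\<lambda>i. axis i (1::real) :: real^('n bit0))" by (simp add: inj_def axis_eq_axis)
    have "(\<Prod>b\<in>Basis. (u - l) \<bullet> b) = (\<Prod>i\<in>UNIV. (u - l) \<bullet> axis i 1)"
      by (subst B, subst prod.reindex[OF inj]) simp
    then show ?thesis by (simp add: inner_axis)
  qed
  finally show "emeasure (distr lborel borel to_real) (box l u) = ennreal (\<Prod>b\<in>Basis. (u - l) \<bullet> b)" .
qed simp

lemma lborel_of_real_vec: "distr lborel borel of_real_vec = (lborel :: (complex^'n::finite) measure)"
proof -
  have "distr lborel borel of_real_vec = distr (distr lborel borel to_real) borel (of_real_vec :: _ \<Rightarrow> complex^'n)"
    by (simp add: lborel_to_real)
  also have "\<dots> = distr lborel borel (of_real_vec \<circ> to_real :: complex^'n \<Rightarrow> _)" by (simp add: distr_distr)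
  also have "\<dots> = distr lborel lborel (\<lambda>x. x)" by (rule distr_cong) auto
  also have "\<dots> = lborel" by (rule distr_id)
  finally show ?thesis .
qed

lemma emeasure_to_real_image:
  assumes "B \<in> sets borel"
  shows "to_real ` B \<in> sets borel" "emeasure lborel (to_real ` B) = emeasure lborel (B :: (complex^'n::finite) set)"
proof -
  have eq: "to_real ` B = of_real_vec -` B" by (auto intro: image_eqI[of _ _ "of_real_vec _"])
  show "to_real ` B \<in> sets borel" unfolding eq using measurable_sets_borel[OF measurable_of_real_vec assms] .
  have "emeasure lborel B = emeasure (distr lborel borel of_real_vec) B" by (simp add: lborel_of_real_vec)
  also have "\<dots> = emeasure lborel (of_real_vec -` B)" using assms by (subst emeasure_distr) auto
  finally show "emeasure lborel (to_real ` B) = emeasure lborel B" using eq by simp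
qed

subsection \<open>The real Jacobian of a complex linear map\<close>

definition real_jacobian :: "(complex^'n \<Rightarrow> complex^'n) \<Rightarrow> real" where
  "real_jacobian L = \<bar>det (matrix (to_real \<circ> L \<circ> of_real_vec))\<bar>"

lemma linear_real_conjugate: "linear L \<Longrightarrow> linear (to_real \<circ> L \<circ> of_real_vec)"
  by (intro linear_compose linear_to_real linear_of_real_vec)

lemma real_jacobian_compose:
  assumes "linear L" "linear M"
  shows "real_jacobian (L \<circ> M) = real_jacobian L * real_jacobian M"
proof -
  have "to_real \<circ> (L \<circ> M) \<circ> of_real_vec = (to_real \<circ> L \<circ> of_real_vec) \<circ> (to_real \<circ> M \<circ> of_real_vec)"
    by (auto simp: fun_eq_iff)
  then show ?thesis unfolding real_jacobian_def
    by (simp add: matrix_compose[OF linear_real_conjugate[OF assms(2)] linear_real_conjugate[OF assms(1)]] det_mul abs_mult)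
qed

lemma real_jacobian_isometry:
  assumes "linear L" "\<And>z. norm (L z) = norm z"
  shows "real_jacobian L = 1"
proof -
  have "orthogonal_transformation (to_real \<circ> L \<circ> of_real_vec)"
    unfolding orthogonal_transformation
  proof (intro conjI allI)
    show "linear (to_real \<circ> L \<circ> of_real_vec)" by (rule linear_real_conjugate[OF assms(1)])
    show "norm ((to_real \<circ> L \<circ> of_real_vec) v) = norm v" for v
      using norm_to_real[of "of_real_vec v"] by (simp add: norm_to_real assms(2))
  qed
  then show ?thesis unfolding real_jacobian_def
    using det_orthogonal_matrix orthogonal_transformation_matrix by fastforce
qed

text \<open>Lebesgue measure is determined by its values on boxes, and the real form of L, being
  orthogonal, preserves them.\<close>

lemma distr_isometry:
  fixes L :: "complex^'n \<Rightarrow> complex^'n"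
  assumes "linear L" "\<And>z. norm (L z) = norm z"
  shows "distr lborel borel L = lborel"
proof -
  let ?M = "to_real \<circ> L \<circ> of_real_vec"
  have M: "orthogonal_transformation ?M"
    unfolding orthogonal_transformation
  proof (intro conjI allI)
    show "linear ?M" by (rule linear_real_conjugate[OF assms(1)])
    show "norm (?M v) = norm v" for v
      using norm_to_real[of "of_real_vec v"] by (simp add: norm_to_real assms(2))
  qed
  have [measurable]: "L \<in> borel \<rightarrow>\<^sub>M borel"
    using assms(1) linear_conv_bounded_linear by (intro borel_measurable_continuous_onI linear_continuous_on) blast
  obtain N where N: "orthogonal_transformation N" "\<And>x. N (?M x) = x" "\<And>x. ?M (N x) = x"
    using orthogonal_transformation_inv[OF M] orthogonal_transformation_bij[OF M]
    by (metis bij_inv_eq_iff)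
  have Mb: "distr lborel borel ?M = (lborel :: (real^('n bit0)) measure)"
  proof (rule lborel_eqI[symmetric])
    fix l u :: "real^('n bit0)"
    assume le: "\<And>b. b \<in> Basis \<Longrightarrow> l \<bullet> b \<le> u \<bullet> b"
    have vim: "?M -` box l u = N ` box l u" by (auto simp: N image_iff) (metis N(2) comp_apply, metis N(3) comp_apply)
    have m: "?M -` box l u \<in> sets borel" using measurable_sets_borel[of ?M borel "box l u"] by simp
    have lm: "N ` box l u \<in> lmeasurable" "measure lebesgue (N ` box l u) = measure lebesgue (box l u)"
      using measure_orthogonal_image[OF N(1), of "box l u"] measurable_orthogonal_image[OF N(1), of "box l u"] by auto
    have "emeasure (distr lborel borel ?M) (box l u) = emeasure lborel (?M -` box l u)"
      by (subst emeasure_distr) auto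
    also have "\<dots> = emeasure lebesgue (N ` box l u)" using m by (simp add: vim)
    also have "\<dots> = ennreal (measure lebesgue (N ` box l u))"
      using lm(1) by (simp add: emeasure_eq_measure2)
    also have "\<dots> = emeasure lborel (box l u)" using lm(2) le by (simp add: measure_lborel_box_eq)
    also have "\<dots> = ennreal (\<Prod>b\<in>Basis. (u - l) \<bullet> b)" using le by simp
    finally show "emeasure (distr lborel borel ?M) (box l u) = ennreal (\<Prod>b\<in>Basis. (u - l) \<bullet> b)" .
  qed simp
  have "distr lborel borel L = distr (distr lborel borel of_real_vec) borel L" by (simp add: lborel_of_real_vec)
  also have "\<dots> = distr lborel borel (of_real_vec \<circ> ?M)" by (simp add: distr_distr comp_def)
  also have "\<dots> = distr (distr lborel borel ?M) borel of_real_vec" by (simp add: distr_distr comp_def)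
  also have "\<dots> = lborel" by (simp only: Mb lborel_of_real_vec)
  finally show ?thesis .
qed

lemma linear_scalar: "linear (\<lambda>z::complex^'n. c *s z)"
  by (auto simp: linear_iff vec_eq_iff algebra_simps)

lemma norm_vector_scalar_mult: "norm (c *s (v::complex^'n)) = cmod c * norm v"
  by (simp add: norm_vec_def norm_mult vector_scalar_mult_def L2_set_right_distrib)

lemma integral_rotate:
  fixes f :: "complex^'n \<Rightarrow> 'b::{banach,second_countable_topology}"
  assumes "cmod c = 1" and [measurable]: "f \<in> borel_measurable borel"
  shows "(\<integral>w. f (c *s w) \<partial>lborel) = (\<integral>w. f w \<partial>lborel)"
proof -
  have d: "distr lborel borel (\<lambda>z::complex^'n. c *s z) = lborel"
    by (rule distr_isometry) (auto simp: linear_scalar norm_vector_scalar_mult assms(1))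
  have [measurable]: "(\<lambda>z::complex^'n. c *s z) \<in> borel \<rightarrow>\<^sub>M borel"
    using linear_scalar linear_conv_bounded_linear by (intro borel_measurable_continuous_onI linear_continuous_on) blast
  have "(\<integral>w. f w \<partial>lborel) = (\<integral>w. f w \<partial>(distr lborel borel (\<lambda>z. c *s z)))" by (simp only: d)
  also have "\<dots> = (\<integral>w. f (c *s w) \<partial>lborel)" by (subst integral_distr) auto
  finally show ?thesis ..
qed

text \<open>The elementary matrices of Gauss-Jordan elimination. Depending on a, they are shears,
  dilations or rotations of one coordinate.\<close>

definition replace_column :: "'n \<Rightarrow> complex^'n \<Rightarrow> complex^'n^'n" where
  "replace_column k a = (\<chi> i j. if j = k then a $ i else mat 1 $ i $ j)"

lemma replace_column_mult: "(replace_column k a *v z) $ i = (if i = k then 0 else z $ i) + a $ i * z $ k"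
proof -
  have "(replace_column k a *v z) $ i = (\<Sum>j\<in>UNIV. (if j = k then a $ i else if i = j then 1 else 0) * z $ j)"
    by (simp add: replace_column_def matrix_vector_mult_def mat_def cong: if_cong)
  also have "\<dots> = a $ i * z $ k + (\<Sum>j\<in>UNIV - {k}. (if i = j then 1 else 0) * z $ j)"
    by (subst sum.remove[of _ k]) (auto intro!: sum.cong)
  also have "(\<Sum>j\<in>UNIV - {k}. (if i = j then 1 else 0) * z $ j) = (if i = k then 0 else z $ i)"
    by (simp add: if_distrib[of "\<lambda>x. x * _"] sum.delta' cong: if_cong)
  finally show ?thesis by simp
qed

lemma det_replace_column:
  fixes a :: "complex^'n"
  shows "det (replace_column k a) = a $ k"
  using cramer_lemma[where A = "mat 1 :: complex^'n^'n" and x = a and k = k]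
  by (simp add: replace_column_def matrix_vector_mul_lid cong: if_cong)

lemma linear_matrix_vector: "linear ((*v) (A :: complex^'n^'n))"
proof (rule linearI)
  show "A *v (x + y) = A *v x + A *v y" for x y by (rule matrix_vector_right_distrib)
  show "A *v (c *\<^sub>R x) = c *\<^sub>R (A *v x)" for c x
    by (simp add: vec_eq_iff matrix_vector_mult_def scaleR_right.sum)
qed

lemma real_jacobian_pos_invertible:
  fixes L M :: "complex^'n \<Rightarrow> complex^'n"
  assumes "linear L" "linear M" "L \<circ> M = id"
  shows "real_jacobian L * real_jacobian M = 1"
proof -
  have "real_jacobian (id :: complex^'n \<Rightarrow> _) = 1" by (rule real_jacobian_isometry) (auto simp: linear_id)
  then show ?thesis using real_jacobian_compose[OF assms(1,2)] assms(3) by simp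
qed

text \<open>In the real basis the map is diagonal, and exactly the two real directions of the
  complex coordinate k are scaled by r.\<close>

lemma real_jacobian_scale_coordinate:
  fixes k :: "'n::finite"
  assumes "0 < (r::real)"
  shows "real_jacobian ((*v) (replace_column k (axis k (of_real r)))) = r\<^sup>2"
proof -
  let ?L = "(*v) (replace_column k (axis k (of_real r)))"
  have Lb: "?L z $ i = (if i = k then of_real r * z $ i else z $ i)" for z i
    by (simp add: replace_column_mult axis_def)
  define c where "c b = (if b $ k = 0 then 1 else r)" for b :: "complex^'n"
  have L: "?L b = c b *\<^sub>R b" if bB: "b \<in> Basis" for b
  proof -
    obtain i e where b: "b = axis i e" "e \<in> Basis" using bB by (auto simp: Basis_vec_def)
    then have "e \<noteq> 0" using nonzero_Basis by blast
    then show ?thesis unfolding c_def b(1) vec_eq_iff Lb by (auto simp: axis_def scaleR_conv_of_real[where 'a = complex])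
  qed
  have M: "matrix (to_real \<circ> ?L \<circ> of_real_vec) $ i $ j = (if i = j then c (real_basis j) else 0)" for i j
  proof -
    have "of_real_vec (axis j 1) = real_basis j"
      by (simp add: of_real_vec_def axis_def if_distrib[of "\<lambda>x. x *\<^sub>R _"] cong: if_cong)
    then have "matrix (to_real \<circ> ?L \<circ> of_real_vec) $ i $ j = ?L (real_basis j) \<bullet> real_basis i"
      by (simp add: matrix_def to_real_def)
    then show ?thesis by (simp add: L[OF real_basis_in] real_basis_inner)
  qed
  have "det (matrix (to_real \<circ> ?L \<circ> of_real_vec)) = (\<Prod>i\<in>UNIV. c (real_basis i))"
    using M by (subst det_diagonal) auto
  also have "\<dots> = (\<Prod>b\<in>Basis. c b)" by (rule prod_real_basis)
  also have "\<dots> = (\<Prod>b\<in>{axis k 1, axis k \<i>}. r)"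
  proof (rule prod.mono_neutral_cong_right)
    show "{axis k 1, axis k \<i>} \<subseteq> (Basis :: (complex^'n) set)" by (auto simp: axis_in_Basis_iff Basis_complex_def)
    show "\<forall>b\<in>Basis - {axis k 1, axis k \<i>}. c b = 1"
    proof
      fix b :: "complex^'n" assume b: "b \<in> Basis - {axis k 1, axis k \<i>}"
      then obtain i e where ie: "b = axis i e" "e \<in> {1, \<i>}" by (auto simp: Basis_vec_def Basis_complex_def)
      then have "i \<noteq> k" using b by auto
      then show "c b = 1" using ie by (simp add: c_def axis_def)
    qed
    show "c b = r" if "b \<in> {axis k 1, axis k \<i>}" for b using that by (auto simp: c_def axis_def)
  qed auto
  also have "\<dots> = r\<^sup>2" by (simp add: axis_eq_axis power2_eq_square)
  finally show ?thesis by (simp add: real_jacobian_def)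
qed

text \<open>A shear is conjugate to its own square, so its Jacobian is 1.\<close>

lemma real_jacobian_shear:
  fixes a :: "complex^'n"
  assumes "a $ k = 1"
  shows "real_jacobian ((*v) (replace_column k a)) = 1"
proof -
  let ?S = "(*v) (replace_column k a)" and ?D = "(*v) (replace_column k (axis k (of_real 2)))"
    and ?D' = "(*v) (replace_column k (axis k (of_real (1/2))))"
  have l: "linear ?S" "linear ?D" "linear ?D'" by (rule linear_matrix_vector)+
  have "?S \<circ> ?S = ?D' \<circ> ?S \<circ> ?D"
    using assms by (auto simp: fun_eq_iff vec_eq_iff replace_column_mult axis_def algebra_simps)
  then have "real_jacobian ?S * real_jacobian ?S = real_jacobian ?D' * real_jacobian ?S * real_jacobian ?D"
    using real_jacobian_compose[OF l(1) l(1)] real_jacobian_compose[OF linear_compose[OF l(1) l(3)] l(2)]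
      real_jacobian_compose[OF l(3) l(1)] linear_compose[OF l(2)] by (simp add: comp_assoc)
  moreover have "real_jacobian ?D = 4" "real_jacobian ?D' = 1 / 4"
    using real_jacobian_scale_coordinate[of 2 k] real_jacobian_scale_coordinate[of "1/2" k] by (simp_all add: power2_eq_square)
  moreover have "real_jacobian ?S \<noteq> 0"
  proof -
    let ?T = "(*v) (replace_column k (\<chi> i. if i = k then 1 else - a $ i))"
    have "?S \<circ> ?T = id" using assms by (auto simp: fun_eq_iff vec_eq_iff replace_column_mult)
    from real_jacobian_pos_invertible[OF l(1) linear_matrix_vector this] show ?thesis by auto
  qed
  ultimately show ?thesis by simp
qed

text \<open>The map is a dilation of coordinate k by the modulus of \<open>a $ k\<close>, followed
  by a rotation by its phase and a shear; only the dilation changes volume.\<close>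

lemma real_jacobian_replace_column:
  fixes a :: "complex^'n"
  assumes "a $ k \<noteq> 0"
  shows "real_jacobian ((*v) (replace_column k a)) = (cmod (a $ k))\<^sup>2"
proof -
  define r where "r = cmod (a $ k)"
  define e where "e = a $ k / of_real r"
  have r: "0 < r" using assms by (simp add: r_def)
  have e: "cmod e = 1" "e * of_real r = a $ k" using r by (auto simp: e_def r_def norm_divide)
  let ?S = "(*v) (replace_column k (\<chi> i. if i = k then 1 else a $ i / a $ k))"
    and ?D = "(*v) (replace_column k (axis k (of_real r)))" and ?R = "(*v) (replace_column k (axis k e))"
  have "?S \<circ> (?R \<circ> ?D) = (*v) (replace_column k a)"
    using assms e(2) by (auto simp: fun_eq_iff vec_eq_iff replace_column_mult axis_def mult.assoc[symmetric])
  moreover have "real_jacobian (?S \<circ> (?R \<circ> ?D)) = real_jacobian ?S * (real_jacobian ?R * real_jacobian ?D)"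
    by (simp only: real_jacobian_compose[OF linear_matrix_vector linear_compose[OF linear_matrix_vector linear_matrix_vector]]
        real_jacobian_compose[OF linear_matrix_vector linear_matrix_vector])
  ultimately have "real_jacobian ((*v) (replace_column k a)) = real_jacobian ?S * (real_jacobian ?R * real_jacobian ?D)"
    by simp
  moreover have "real_jacobian ?S = 1" by (rule real_jacobian_shear) simp
  moreover have "real_jacobian ?R = 1"
  proof (rule real_jacobian_isometry[OF linear_matrix_vector])
    fix z :: "complex^'n"
    have "cmod ((?R z) $ i) = cmod (z $ i)" for i
      using e(1) by (simp add: replace_column_mult axis_def norm_mult)
    then show "norm (?R z) = norm z" by (simp add: norm_vec_def)
  qed
  moreover have "real_jacobian ?D = r\<^sup>2" by (rule real_jacobian_scale_coordinate[OF r])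
  ultimately show ?thesis by (simp add: r_def)
qed

text \<open>Gauss-Jordan elimination, by induction on the set K of columns that may differ from unit
  vectors. Both sides are multiplicative, and each step splits off matrices of the form
  \<open>replace_column\<close>.\<close>

lemma real_jacobian_invertible_matrix:
  fixes A :: "complex^'n^'n"
  assumes "det A \<noteq> 0"
  shows "real_jacobian ((*v) A) = (cmod (det A))\<^sup>2"
proof -
  have "finite K \<Longrightarrow> det A \<noteq> 0 \<Longrightarrow> (\<And>j. j \<notin> K \<Longrightarrow> column j A = axis j 1) \<Longrightarrow> real_jacobian ((*v) A) = (cmod (det A))\<^sup>2"
    for K and A :: "complex^'n^'n"
  proof (induction K arbitrary: A rule: finite_induct)
    case empty
    then have "A = mat 1" by (auto simp: vec_eq_iff column_def axis_def mat_def)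
    then show ?case using real_jacobian_isometry[of "\<lambda>x::complex^'n. x"] by (simp add: matrix_vector_mul_lid[abs_def] linear_id[unfolded id_def])
  next
    case (insert k K)
    have prod: "real_jacobian ((*v) (E ** B)) = (cmod (det (E ** B)))\<^sup>2"
      if "real_jacobian ((*v) E) = (cmod (det E))\<^sup>2" "real_jacobian ((*v) B) = (cmod (det B))\<^sup>2" for E B :: "complex^'n^'n"
      using real_jacobian_compose[OF linear_matrix_vector linear_matrix_vector, of E B] that
      by (simp add: matrix_vector_mult_matrix_matrix_mult_compose det_mul norm_mult power_mult_distrib)
    have col: "column j B = B *v axis j 1" for j and B :: "complex^'n^'n"
      by (simp add: matrix_vector_mul_component column_def vec_eq_iff matrix_vector_mult_def axis_def if_distrib[of "\<lambda>x. _ * x"] cong: if_cong)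
    have step: "real_jacobian ((*v) B) = (cmod (det B))\<^sup>2"
      if B: "B $ k $ k \<noteq> 0" "det B \<noteq> 0" "\<And>j. j \<notin> insert k K \<Longrightarrow> column j B = axis j 1" for B :: "complex^'n^'n"
    proof -
      define a where "a = column k B"
      have ak: "a $ k \<noteq> 0" using B(1) by (simp add: a_def column_def)
      \<comment> \<open>The inverse of \<open>replace_column k a\<close>; multiplication by it turns
        column k of B into a unit vector.\<close>
      define F where "F = replace_column k (\<chi> i. if i = k then 1 / a $ k else - a $ i / a $ k)"
      have EF: "replace_column k a ** (F ** B) = B"
      proof -
        have "replace_column k a *v (F *v z) = z" for z
          using ak by (auto simp: vec_eq_iff replace_column_mult F_def)
        then show ?thesis by (auto simp: matrix_eq matrix_vector_mul_assoc[symmetric])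
      qed
      have "real_jacobian ((*v) (F ** B)) = (cmod (det (F ** B)))\<^sup>2"
      proof (rule insert.IH)
        show "det (F ** B) \<noteq> 0" using B(2) ak by (simp add: det_mul F_def det_replace_column)
        fix j assume j: "j \<notin> K"
        show "column j (F ** B) = axis j 1"
        proof (cases "j = k")
          case True
          have "column k (F ** B) = F *v a" by (simp add: col a_def matrix_vector_mul_assoc)
          also have "\<dots> = axis k 1" using ak by (auto simp: vec_eq_iff replace_column_mult F_def axis_def)
          finally show ?thesis using True by simp
        next
          case False
          have "column j (F ** B) = F *v column j B" by (simp add: col matrix_vector_mul_assoc)
          also have "\<dots> = F *v axis j 1" using B(3) False j by simp
          also have "\<dots> = axis j 1" using False by (auto simp: vec_eq_iff replace_column_mult F_def axis_def)
          finally show ?thesis .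
        qed
      qed
      moreover have "real_jacobian ((*v) (replace_column k a)) = (cmod (det (replace_column k a)))\<^sup>2"
        using real_jacobian_replace_column[of a k, OF ak] by (simp add: det_replace_column)
      ultimately show ?thesis using prod[of "replace_column k a" "F ** B"] EF by simp
    qed
    show ?case
    proof (cases "A $ k $ k = 0")
      case False
      then show ?thesis using step insert.prems by blast
    next
      case True
      have "\<exists>l. l \<in> insert k K \<and> A $ l $ k \<noteq> 0"
      proof (rule ccontr)
        assume neg: "\<not> (\<exists>l. l \<in> insert k K \<and> A $ l $ k \<noteq> 0)"
        \<comment> \<open>If column k vanished in all rows of \<open>insert k K\<close>, it would be
          a combination of the unit columns, and this x would lie in the kernel.\<close>
        define x where "x = (\<chi> j. if j = k then 1 else - A $ j $ k)"
        have A_col: "A $ i $ j = axis j 1 $ i" if "j \<notin> insert k K" for i j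
          using insert.prems(2)[OF that] by (metis column_def vec_lambda_beta)
        have "(A *v x) $ i = 0" for i
        proof -
          have "(A *v x) $ i = A $ i $ k + (\<Sum>j\<in>UNIV - {k}. A $ i $ j * (- A $ j $ k))"
            unfolding matrix_vector_mult_def x_def by (subst sum.remove[of _ k]) (auto intro!: sum.cong)
          also have "(\<Sum>j\<in>UNIV - {k}. A $ i $ j * (- A $ j $ k)) = (\<Sum>j\<in>UNIV - {k}. if j = i then - A $ i $ k else 0)"
          proof (rule sum.cong[OF refl])
            fix j assume "j \<in> UNIV - {k}"
            show "A $ i $ j * (- A $ j $ k) = (if j = i then - A $ i $ k else 0)"
              using neg A_col[of j i] by (cases "j \<in> insert k K") (auto simp: axis_def)
          qed
          also have "\<dots> = (if i = k then 0 else - A $ i $ k)" by (simp add: sum.delta)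
          finally show ?thesis using True by auto
        qed
        then have "A *v x = 0" by (simp add: vec_eq_iff)
        moreover have "x \<noteq> 0" by (auto simp: x_def vec_eq_iff)
        moreover have "invertible A" using insert.prems(1) invertible_det_nz by blast
        ultimately show False by (metis invertible_def matrix_left_invertible_ker)
      qed
      then obtain l where l: "l \<in> insert k K" "A $ l $ k \<noteq> 0" by blast
      have lk: "l \<noteq> k" using l True by auto
      \<comment> \<open>E adds row l to row k, which makes the pivot nonzero, and E' undoes it. As l
        is in \<open>insert k K\<close>, the unit columns outside are unaffected.\<close>
      define E where "E = replace_column l (axis l 1 + axis k 1)"
      define E' where "E' = replace_column l (axis l 1 - axis k 1)"
      have EE: "E' ** (E ** A) = A"
      proof -
        have "E' *v (E *v z) = z" for z
          using lk by (auto simp: vec_eq_iff replace_column_mult E_def E'_def axis_def)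
        then show ?thesis by (auto simp: matrix_eq matrix_vector_mul_assoc[symmetric])
      qed
      have "real_jacobian ((*v) (E ** A)) = (cmod (det (E ** A)))\<^sup>2"
      proof (rule step)
        have "(E ** A) $ k $ k = column k (E ** A) $ k" by (simp add: column_def)
        also have "column k (E ** A) = E *v column k A" by (simp add: col matrix_vector_mul_assoc)
        also have "(E *v column k A) $ k = A $ l $ k"
          using lk True by (simp add: E_def replace_column_mult axis_def column_def)
        finally show "(E ** A) $ k $ k \<noteq> 0" using l(2) by simp
        show "det (E ** A) \<noteq> 0" using insert.prems(1) lk by (simp add: det_mul E_def det_replace_column axis_def)
        fix j assume j: "j \<notin> insert k K"
        then have "j \<noteq> l" using l(1) by auto
        have "column j (E ** A) = E *v column j A" by (simp add: col matrix_vector_mul_assoc)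
        also have "\<dots> = E *v axis j 1" using insert.prems(2)[OF j] by simp
        also have "\<dots> = axis j 1" using \<open>j \<noteq> l\<close> by (auto simp: vec_eq_iff replace_column_mult E_def axis_def)
        finally show "column j (E ** A) = axis j 1" .
      qed
      moreover have "real_jacobian ((*v) E') = (cmod (det E'))\<^sup>2"
        using real_jacobian_replace_column[of "axis l 1 - axis k 1" l] lk by (simp add: E'_def det_replace_column axis_def)
      ultimately show ?thesis using prod[of E' "E ** A"] EE by simp
    qed
  qed
  from this[of UNIV A] assms show ?thesis by simp
qed

section \<open>Means of functions with nonnegative Levi form\<close>

lemma lborel_integral_cbox:
  fixes F k :: "'a::euclidean_space \<Rightarrow> real"
  assumes "continuous_on UNIV F" "continuous_on UNIV k" "\<And>x. x \<notin> cball 0 R \<Longrightarrow> k x = 0" "cball 0 R \<subseteq> cbox a b"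
  shows "(\<integral>w. F w * k w \<partial>lborel) = integral (cbox a b) (\<lambda>w. F w * k w)"
proof -
  have "integrable lborel (\<lambda>w. F w * k w)"
    by (rule compact_support_integrable[where R = R]) (auto intro!: continuous_intros assms)
  then have "(\<integral>w. F w * k w \<partial>lborel) = integral UNIV (\<lambda>w. F w * k w)" by (simp add: integral_lborel)
  also have "\<dots> = integral (cbox a b) (\<lambda>w. F w * k w)"
  proof -
    have "k w = 0" if "w \<notin> cbox a b" for w using assms(3)[of w] assms(4) that by blast
    then have "(\<lambda>w. if w \<in> cbox a b then F w * k w else 0) = (\<lambda>w. F w * k w)" by (auto simp: fun_eq_iff)
    then show ?thesis using integral_restrict_UNIV[of "cbox a b" "\<lambda>w. F w * k w"] by simp
  qed
  finally show ?thesis .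
qed

text \<open>The compact support of k reduces the integral to a fixed box, where Leibniz' rule
  applies.\<close>

lemma integral_kernel_derivative:
  fixes f f' :: "real \<Rightarrow> 'a::euclidean_space \<Rightarrow> real"
  assumes der: "\<And>t w. ((\<lambda>t. f t w) has_real_derivative f' t w) (at t)"
    and cf: "\<And>t. continuous_on UNIV (f t)" and cf': "continuous_on UNIV (\<lambda>(t, w). f' t w)"
    and k: "continuous_on UNIV k" "\<And>x. x \<notin> cball 0 R \<Longrightarrow> k x = 0"
  shows "((\<lambda>t. \<integral>w. f t w * k w \<partial>lborel) has_real_derivative (\<integral>w. f' t w * k w \<partial>lborel)) (at t)"
proof -
  obtain a where a: "cball (0::'a) R \<subseteq> cbox (- a) a"
    using bounded_subset_cbox_symmetric[OF bounded_cball] by blast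
  have cf1: "continuous_on UNIV (f' t)" for t
    using continuous_on_compose2[OF cf', of UNIV "\<lambda>w. (t, w)"]
    by (simp add: continuous_on_Pair continuous_on_const continuous_on_id)
  have "((\<lambda>t. integral (cbox (- a) a) (\<lambda>w. f t w * k w)) has_real_derivative integral (cbox (- a) a) (\<lambda>w. f' t w * k w)) (at t within UNIV)"
  proof (rule leibniz_rule_field_derivative)
    show "((\<lambda>t. f t w * k w) has_real_derivative f' t w * k w) (at t within UNIV)" for t w
      by (rule DERIV_cmult_right[OF der])
    show "(\<lambda>w. f t w * k w) integrable_on cbox (- a) a" for t
      by (intro integrable_continuous continuous_intros continuous_on_subset[OF cf] continuous_on_subset[OF k(1)] subset_UNIV)
    show "continuous_on (UNIV \<times> cbox (- a) a) (\<lambda>(t, w). f' t w * k w)"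
      unfolding case_prod_beta
      by (intro continuous_intros continuous_on_compose2[OF k(1)] continuous_on_subset[OF cf'[unfolded case_prod_beta]] subset_UNIV)
  qed auto
  moreover have "(\<lambda>t. \<integral>w. f t w * k w \<partial>lborel) = (\<lambda>t. integral (cbox (- a) a) (\<lambda>w. f t w * k w))"
    by (rule ext, rule lborel_integral_cbox[OF cf k a])
  moreover have "(\<integral>w. f' t w * k w \<partial>lborel) = integral (cbox (- a) a) (\<lambda>w. f' t w * k w)"
    by (rule lborel_integral_cbox[OF cf1 k a])
  ultimately show ?thesis by simp
qed

lemma continuous_on_scalar [continuous_intros]:
  "continuous_on S c \<Longrightarrow> continuous_on S w \<Longrightarrow> continuous_on S (\<lambda>x. c x *s (w x :: complex^'n))"
  unfolding vector_scalar_mult_def by (intro continuous_intros)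

lemma scaleR_scalar: "r *\<^sub>R (w::complex^'n) = of_real r *s w"
  by (simp add: vec_eq_iff scaleR_conv_of_real[where 'a = complex])

text \<open>The curve exp (t a) c covers dilations (a = 1) and rotations (a = \<i>) at once. It is
  itself curved, whence the first-order term with factor a^2 in the second derivative.\<close>

lemma kernel_curve_derivatives:
  fixes \<psi> :: "complex^'n \<Rightarrow> real" and a c :: complex and z :: "complex^'n"
  defines "E \<equiv> \<lambda>t::real. exp (of_real t * a) * c"
  defines "F \<equiv> \<lambda>t. \<integral>w. \<psi> (z + E t *s w) * moll 1 w \<partial>lborel"
    and "F1 \<equiv> \<lambda>t. \<integral>w. dird \<psi> ((a * E t) *s w) (z + E t *s w) * moll 1 w \<partial>lborel"
    and "F2 \<equiv> \<lambda>t. \<integral>w. (dird (dird \<psi> ((a * E t) *s w)) ((a * E t) *s w) (z + E t *s w)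
       + dird \<psi> ((a * a * E t) *s w) (z + E t *s w)) * moll 1 w \<partial>lborel"
  assumes \<psi>: "smooth_on UNIV \<psi>"
  shows "(F has_real_derivative F1 t) (at t)" "(F1 has_real_derivative F2 t) (at t)"
proof -
  have E: "(E has_vector_derivative a * E t) (at t)" for t
    unfolding E_def
    by (rule has_vector_derivative_real_field[where f = "\<lambda>x. exp (x * a) * c"])
       (auto intro!: derivative_eq_intros simp: mult_ac)
  have cE: "continuous_on S E" for S
    unfolding E_def by (intro continuous_intros)
  have cE1: "continuous_on S (\<lambda>x. E (fst x))" for S :: "(real \<times> (complex^'n)) set"
    by (rule continuous_on_compose2[OF cE[of UNIV] continuous_on_fst[OF continuous_on_id]]) auto
  have cv: "continuous_on S (\<lambda>x. (b * E (fst x)) *s snd x)" for S :: "(real \<times> (complex^'n)) set" and b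
    by (intro continuous_on_scalar continuous_on_mult continuous_on_const cE1 continuous_on_snd continuous_on_id)
  have curve: "((\<lambda>t. (b * E t) *s w) has_derivative (\<lambda>s. s *\<^sub>R ((b * a * E t) *s w))) (at t)" for t w b
  proof -
    have "((\<lambda>t. b * E t) has_derivative (\<lambda>s. b * (s *\<^sub>R (a * E t)))) (at t)"
      by (rule has_derivative_mult_right[OF E[unfolded has_vector_derivative_def]])
    from bounded_linear.has_derivative[OF bounded_linear_scalar this]
    show ?thesis
      by (rule has_derivative_eq_rhs)
         (simp add: fun_eq_iff scaleR_scalar vector_smult_assoc scaleR_conv_of_real[where 'a = complex] mult_ac)
  qed
  have curve1: "((\<lambda>t. z + E t *s w) has_derivative (\<lambda>s. s *\<^sub>R ((a * E t) *s w))) (at t)" for t w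
    using has_derivative_add[OF has_derivative_const curve[of 1 w t], of z] by simp
  have along: "((\<lambda>t. f (z + E t *s w)) has_real_derivative dird f ((a * E t) *s w) (z + E t *s w)) (at t)"
    if "smooth_on UNIV f" for f :: "complex^'n \<Rightarrow> real" and t w
    unfolding has_field_derivative_def
    by (rule has_derivative_eq_rhs[OF has_derivative_dird_compose[OF curve1 that UNIV_I]])
       (simp add: fun_eq_iff linear_scale[OF dird_linear[OF that UNIV_I]])
  have cd: "continuous_on S (\<lambda>x. f (z + E (fst x) *s snd x))" if "smooth_on UNIV f" for f :: "complex^'n \<Rightarrow> real" and S
    by (rule continuous_on_compose2[OF smooth_on_continuous[OF that]])
       (auto intro!: continuous_on_add continuous_on_const continuous_on_scalar cE1 continuous_on_snd continuous_on_id)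
  have cd': "continuous_on S (\<lambda>w. f (z + E t *s w))" if "smooth_on UNIV f" for f :: "complex^'n \<Rightarrow> real" and S t
    by (rule continuous_on_compose2[OF smooth_on_continuous[OF that]]) (auto intro!: continuous_intros)
  have D1: "dird \<psi> (e *s w) x = (\<Sum>b\<in>Basis. ((e *s w) \<bullet> b) * dird \<psi> b x)" for e w x
    using dird_Basis[OF \<psi>, of x "e *s w"] by simp
  have D2: "dird (dird \<psi> (e *s w)) v x = (\<Sum>b\<in>Basis. ((e *s w) \<bullet> b) * dird (dird \<psi> b) v x)" for e w v x
    using dird_dird_Basis[OF open_UNIV \<psi>, of x "e *s w" v] by simp
  have D3: "dird (dird \<psi> b) (e *s w) x = (\<Sum>b'\<in>Basis. ((e *s w) \<bullet> b') * dird (dird \<psi> b) b' x)" for b e w x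
    using dird_Basis[OF smooth_on_dird[OF \<psi>], of x b "e *s w"] by simp
  show "(F has_real_derivative F1 t) (at t)"
    unfolding F_def F1_def
  proof (rule integral_kernel_derivative[where R = 1])
    show "((\<lambda>t. \<psi> (z + E t *s w)) has_real_derivative dird \<psi> ((a * E t) *s w) (z + E t *s w)) (at t)" for t w
      by (rule along[OF \<psi>])
    show "continuous_on UNIV (\<lambda>w. \<psi> (z + E t *s w))" for t by (rule cd'[OF \<psi>])
    show "continuous_on UNIV (\<lambda>(t, w). dird \<psi> ((a * E t) *s w) (z + E t *s w))"
      unfolding case_prod_beta D1
      by (intro continuous_on_sum continuous_on_mult continuous_on_inner continuous_on_const cv cd smooth_on_dird \<psi>)
  qed (auto simp: moll_outside continuous_on_moll)
  show "(F1 has_real_derivative F2 t) (at t)"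
    unfolding F1_def F2_def
  proof (rule integral_kernel_derivative[where R = 1])
    show "((\<lambda>t. dird \<psi> ((a * E t) *s w) (z + E t *s w)) has_real_derivative
        dird (dird \<psi> ((a * E t) *s w)) ((a * E t) *s w) (z + E t *s w) + dird \<psi> ((a * a * E t) *s w) (z + E t *s w)) (at t)" for t w
    proof -
      have c: "((\<lambda>t. ((a * E t) *s w) \<bullet> b) has_real_derivative ((a * a * E t) *s w) \<bullet> b) (at t)" for b
        unfolding has_field_derivative_def
        by (rule has_derivative_eq_rhs[OF has_derivative_inner_left[OF curve]]) (simp add: fun_eq_iff)
      have "((\<lambda>t. \<Sum>b\<in>Basis. (((a * E t) *s w) \<bullet> b) * dird \<psi> b (z + E t *s w)) has_real_derivative
         (\<Sum>b\<in>Basis. (((a * a * E t) *s w) \<bullet> b) * dird \<psi> b (z + E t *s w)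
           + dird (dird \<psi> b) ((a * E t) *s w) (z + E t *s w) * (((a * E t) *s w) \<bullet> b))) (at t)"
        by (intro DERIV_sum DERIV_mult c along[OF smooth_on_dird[OF \<psi>]])
      then show ?thesis
        unfolding D2 unfolding D1
        by (simp add: sum.distrib mult.commute add.commute)
    qed
    show "continuous_on UNIV (\<lambda>w. dird \<psi> ((a * E t) *s w) (z + E t *s w))" for t
      unfolding D1 by (intro continuous_intros cd'[OF smooth_on_dird[OF \<psi>]])
    show "continuous_on UNIV (\<lambda>(t, w). dird (dird \<psi> ((a * E t) *s w)) ((a * E t) *s w) (z + E t *s w) + dird \<psi> ((a * a * E t) *s w) (z + E t *s w))"
      unfolding case_prod_beta D2 unfolding D1 D3
      by (intro continuous_on_add continuous_on_sum continuous_on_mult continuous_on_inner continuous_on_const cv cd smooth_on_dird \<psi>)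
  qed (auto simp: moll_outside continuous_on_moll)
qed

text \<open>The second derivative in \<open>\<theta>\<close> of the mean over \<open>z + e\<^bsup>t + \<i> \<theta>\<^esup> w\<close> vanishes by rotation
  invariance; adding it to the second derivative in \<open>t\<close> produces the Levi form.\<close>

lemma mean_second_derivative:
  fixes \<psi> :: "complex^'n \<Rightarrow> real" and z :: "complex^'n"
  defines "G \<equiv> \<lambda>t. \<integral>w. \<psi> (z + exp t *\<^sub>R w) * moll 1 w \<partial>lborel"
  assumes \<psi>: "smooth_on UNIV \<psi>"
  obtains G1 G2 where "\<And>t. (G has_real_derivative G1 t) (at t)" "\<And>t. (G1 has_real_derivative G2 t) (at t)"
    "\<And>t. (\<And>x v. x \<in> cball z (exp t) \<Longrightarrow> 0 \<le> levi \<psi> x v) \<Longrightarrow> 0 \<le> G2 t"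
proof -
  define E where "E a c t = exp (of_real t * a) * c" for a c :: complex and t :: real
  define F where "F a c t = (\<integral>w. \<psi> (z + E a c t *s w) * moll 1 w \<partial>lborel)" for a c t
  define F1 where "F1 a c t = (\<integral>w. dird \<psi> ((a * E a c t) *s w) (z + E a c t *s w) * moll 1 w \<partial>lborel)" for a c t
  define K where "K a c t w = dird (dird \<psi> ((a * E a c t) *s w)) ((a * E a c t) *s w) (z + E a c t *s w)
       + dird \<psi> ((a * a * E a c t) *s w) (z + E a c t *s w)" for a c t w
  define F2 where "F2 a c t = (\<integral>w. K a c t w * moll 1 w \<partial>lborel)" for a c t
  have F: "(F a c has_real_derivative F1 a c t) (at t)" "(F1 a c has_real_derivative F2 a c t) (at t)" for a c t
    unfolding F_def[abs_def] F1_def[abs_def] F2_def K_def E_def by (rule kernel_curve_derivatives[OF \<psi>])+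
  have G: "G = F 1 1"
    by (simp add: G_def F_def E_def fun_eq_iff scaleR_scalar exp_of_real)
  have rot: "F2 \<i> c t = 0" for c t
  proof -
    have "F \<i> c t = F \<i> c 0" for t
    proof -
      have "F \<i> c t = (\<integral>w. (\<lambda>w. \<psi> (z + c *s w) * moll 1 w) (exp (of_real t * \<i>) *s w) \<partial>lborel)"
        by (simp add: F_def E_def vector_smult_assoc mult.commute moll_def bump_def norm_vector_scalar_mult)
      also have "\<dots> = (\<integral>w. \<psi> (z + c *s w) * moll 1 w \<partial>lborel)"
      proof (rule integral_rotate)
        have "continuous_on UNIV (\<lambda>w. \<psi> (z + c *s w) * moll 1 w)"
          by (intro continuous_intros continuous_on_moll continuous_on_compose2[OF smooth_on_continuous[OF \<psi>]] subset_UNIV)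
        then show "(\<lambda>w. \<psi> (z + c *s w) * moll 1 w) \<in> borel_measurable borel" by (rule borel_measurable_continuous_onI)
      qed simp
      also have "\<dots> = F \<i> c 0" by (simp add: F_def E_def)
      finally show ?thesis .
    qed
    then obtain k where k: "F \<i> c = (\<lambda>t. k)" by blast
    have "F1 \<i> c t = 0" for t using DERIV_unique[OF F(1)[of \<i> c t, unfolded k] DERIV_const] .
    then have k1: "F1 \<i> c = (\<lambda>t. 0)" by blast
    show ?thesis using DERIV_unique[OF F(2)[of \<i> c t, unfolded k1] DERIV_const] .
  qed
  have int: "integrable lborel (\<lambda>w. K a c t w * moll 1 w)" for a c t
  proof (rule compact_support_integrable[where R = 1])
    have cd: "continuous_on UNIV (\<lambda>w. f (z + e *s w))" if "smooth_on UNIV f" for f :: "complex^'n \<Rightarrow> real" and e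
      by (rule continuous_on_compose2[OF smooth_on_continuous[OF that]]) (auto intro!: continuous_intros)
    have D1: "dird \<psi> (e *s w) x = (\<Sum>b\<in>Basis. ((e *s w) \<bullet> b) * dird \<psi> b x)" for e w x
      using dird_Basis[OF \<psi>, of x "e *s w"] by simp
    have D2: "dird (dird \<psi> (e *s w)) v x = (\<Sum>b\<in>Basis. ((e *s w) \<bullet> b) * (\<Sum>b'\<in>Basis. (v \<bullet> b') * dird (dird \<psi> b) b' x))" for e w v x
      using dird_dird_Basis[OF open_UNIV \<psi>, of x "e *s w" v] dird_Basis[OF smooth_on_dird[OF \<psi>], of x _ v] by simp
    show "continuous_on UNIV (\<lambda>w. K a c t w * moll 1 w)"
      unfolding K_def D2 unfolding D1
      by (intro continuous_intros continuous_on_moll cd smooth_on_dird \<psi>)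
  qed (simp add: moll_outside)
  have pos: "0 \<le> F2 1 1 t" if "\<And>x v. x \<in> cball z (exp t) \<Longrightarrow> 0 \<le> levi \<psi> x v" for t
  proof -
    define e where "e = complex_of_real (exp t)"
    have e: "E 1 1 t = e" "E \<i> e 0 = e" by (simp_all add: E_def e_def exp_of_real)
    \<comment> \<open>The first-order terms carry the factors 1 and \<i> * \<i> = -1 and
      cancel.\<close>
    have "K 1 1 t w + K \<i> e 0 w = levi \<psi> (z + e *s w) (e *s w)" for w
    proof -
      have "(- e) *s w = - (e *s w)" by (simp add: vec_eq_iff)
      then have "dird \<psi> ((- e) *s w) (z + e *s w) = - dird \<psi> (e *s w) (z + e *s w)"
        using linear_neg[OF dird_linear[OF \<psi> UNIV_I]] by simp
      moreover have "(\<i> * e) *s w = \<i> *s (e *s w)" by (simp add: vector_smult_assoc)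
      ultimately show ?thesis by (simp add: K_def e levi_def)
    qed
    then have "F2 1 1 t + F2 \<i> e 0 = (\<integral>w. levi \<psi> (z + e *s w) (e *s w) * moll 1 w \<partial>lborel)"
      unfolding F2_def using int[of 1 1 t] int[of \<i> e 0]
      by (subst Bochner_Integration.integral_add[symmetric]) (auto simp: distrib_right[symmetric])
    also have "\<dots> \<ge> 0"
    proof (rule Bochner_Integration.integral_nonneg)
      fix w :: "complex^'n"
      show "0 \<le> levi \<psi> (z + e *s w) (e *s w) * moll 1 w"
      proof (cases "norm w \<le> 1")
        case True
        then have "z + e *s w \<in> cball z (exp t)"
          by (simp add: dist_norm e_def norm_vector_scalar_mult mult_left_le)
        then show ?thesis using that moll_nonneg[of 1 w] by simp
      next
        case False
        then show ?thesis by (simp add: moll_outside)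
      qed
    qed
    finally show ?thesis using rot[of e 0] by simp
  qed
  show thesis
    by (rule that[of "F1 1 1" "F2 1 1"]) (use F G pos in auto)
qed

section \<open>Means as functions of the radius\<close>

locale psh_mean =
  fixes \<psi> :: "complex^'n \<Rightarrow> real" and z :: "complex^'n" and r :: real
  assumes smooth: "smooth_on UNIV \<psi>" and r: "0 < r"
    and levi_nonneg: "\<And>x v. x \<in> ball z r \<Longrightarrow> 0 \<le> levi \<psi> x v"
begin

definition mean :: "real \<Rightarrow> real" where
  "mean \<rho> = (\<integral>w. \<psi> (z + \<rho> *\<^sub>R w) * moll 1 w \<partial>lborel)"

lemma convex_mean_exp: "convex_on {..<ln r} (\<lambda>t. mean (exp t))"
proof -
  obtain G1 G2 where G: "\<And>t. ((\<lambda>t. mean (exp t)) has_real_derivative G1 t) (at t)" "\<And>t. (G1 has_real_derivative G2 t) (at t)"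
    "\<And>t. (\<And>x v. x \<in> cball z (exp t) \<Longrightarrow> 0 \<le> levi \<psi> x v) \<Longrightarrow> 0 \<le> G2 t"
    unfolding mean_def using mean_second_derivative[OF smooth, of z] by blast
  show ?thesis
  proof (rule f''_ge0_imp_convex[OF _ G(1) G(2)])
    fix t assume "t \<in> {..<ln r}"
    then have "exp t < r" using r by (metis exp_less_cancel_iff exp_ln lessThan_iff)
    then show "0 \<le> G2 t" by (intro G(3) levi_nonneg) auto
  qed simp
qed

lemma mean_close:
  assumes "0 < e"
  shows "\<exists>d>0. \<forall>\<rho>. 0 < \<rho> \<longrightarrow> \<rho> < d \<longrightarrow> \<bar>mean \<rho> - \<psi> z\<bar> \<le> e"
proof -
  obtain d where d: "0 < d" "\<And>x. dist x z < d \<Longrightarrow> \<bar>\<psi> x - \<psi> z\<bar> < e"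
    using smooth_on_continuous[OF smooth] assms unfolding continuous_on_iff dist_real_def by (metis UNIV_I)
  have "\<bar>mean \<rho> - \<psi> z\<bar> \<le> e" if "0 < \<rho>" "\<rho> < d" for \<rho>
  proof -
    have c: "continuous_on UNIV (\<lambda>w. \<psi> (z + \<rho> *\<^sub>R w))"
      by (rule continuous_on_compose2[OF smooth_on_continuous[OF smooth]]) (auto intro!: continuous_intros)
    have i1: "integrable lborel (\<lambda>w. \<psi> (z + \<rho> *\<^sub>R w) * moll 1 w)"
      by (rule compact_support_integrable[where R = 1]) (auto intro!: continuous_intros c continuous_on_moll simp: moll_outside)
    have i2: "integrable lborel (\<lambda>w::complex^'n. k * moll 1 w)" for k by (simp add: moll_integrable)
    have "mean \<rho> - \<psi> z = (\<integral>w. (\<psi> (z + \<rho> *\<^sub>R w) - \<psi> z) * moll 1 w \<partial>lborel)"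
      using i1 i2 by (simp add: mean_def left_diff_distrib moll_integral)
    also have "\<bar>\<dots>\<bar> \<le> (\<integral>w. e * moll 1 w \<partial>(lborel :: (complex^'n) measure))"
      unfolding real_norm_def[symmetric]
    proof (rule Bochner_Integration.integral_norm_bound_integral)
      show "integrable lborel (\<lambda>w. (\<psi> (z + \<rho> *\<^sub>R w) - \<psi> z) * moll 1 w)" using i1 i2 by (simp add: left_diff_distrib)
      show "norm ((\<psi> (z + \<rho> *\<^sub>R w) - \<psi> z) * moll 1 w) \<le> e * moll 1 w" for w
      proof (cases "norm w < 1")
        case True
        then have le: "\<rho> * norm w \<le> \<rho> * 1" using that by (intro mult_left_mono) auto
        have "\<rho> * norm w < d" using that le by linarith
        then have "dist (z + \<rho> *\<^sub>R w) z < d" using that by (simp add: dist_norm)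
        then have "\<bar>\<psi> (z + \<rho> *\<^sub>R w) - \<psi> z\<bar> \<le> e" by (intro less_imp_le d(2))
        then show ?thesis using moll_nonneg[of 1 w] by (simp add: abs_mult mult_right_mono)
      qed (simp add: moll_outside)
    qed (rule i2)
    also have "\<dots> = e" by (simp add: moll_integral)
    finally show ?thesis .
  qed
  then show ?thesis using d(1) by blast
qed

text \<open>A convex function of the logarithm of the radius that stays bounded above towards
  -\<infinity> cannot decrease; it is bounded there because the means tend to the value at the
  centre.\<close>

lemma mean_mono:
  assumes "0 < \<rho>" "\<rho> \<le> \<sigma>" "\<sigma> < r"
  shows "mean \<rho> \<le> mean \<sigma>"
proof (rule ccontr)
  define G where "G t = mean (exp t)" for t
  define t1 t2 where "t1 = ln \<rho>" and "t2 = ln \<sigma>"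
  assume "\<not> mean \<rho> \<le> mean \<sigma>"
  then have neg: "G t2 < G t1" and ne: "\<rho> < \<sigma>" using assms by (auto simp: G_def t1_def t2_def less_le)
  have t12: "t1 < t2" "t2 < ln r" using ne assms by (auto simp: t1_def t2_def)
  obtain d where d: "0 < d" "\<And>\<rho>. 0 < \<rho> \<Longrightarrow> \<rho> < d \<Longrightarrow> \<bar>mean \<rho> - \<psi> z\<bar> \<le> 1" using mean_close[of 1] by auto
  define \<beta> where "\<beta> = (G t1 - G t2) / (t2 - t1)"
  have \<beta>: "0 < \<beta>" using neg t12 by (simp add: \<beta>_def)
  \<comment> \<open>So far to the left that convexity and the slope -\<beta> between t1 and t2 would
    force the mean up to \<psi> z + 2, whereas \<open>mean_close\<close> keeps it below \<psi> z +
    1.\<close>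
  define s where "s = min (min (t1 - 1) (ln d - 1)) (t2 - (\<psi> z + 2 - G t2) / \<beta>)"
  have s: "s < t1" "s < ln d" "s \<le> t2 - (\<psi> z + 2 - G t2) / \<beta>" by (auto simp: s_def)
  define k where "k = (t2 - t1) / (t2 - s)"
  have k: "0 < k" "k < 1" using s(1) t12 by (auto simp: k_def)
  have "k * s + (1 - k) * t2 = t2 - k * (t2 - s)" by (simp add: algebra_simps)
  also have "\<dots> = t1" using s(1) t12 by (simp add: k_def)
  finally have "G t1 \<le> k * G s + (1 - k) * G t2"
    using convex_onD[OF convex_mean_exp, of "1 - k" s t2] k s(1) t12 by (simp add: G_def)
  then have "G t1 - G t2 \<le> k * (G s - G t2)" by (simp add: algebra_simps)
  then have "(G t1 - G t2) / k \<le> G s - G t2" using k by (simp add: divide_le_eq mult.commute)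
  moreover have "(G t1 - G t2) / k = \<beta> * (t2 - s)" using t12 by (simp add: k_def \<beta>_def)
  ultimately have "\<beta> * (t2 - s) \<le> G s - G t2" by simp
  moreover have "\<psi> z + 2 - G t2 \<le> \<beta> * (t2 - s)"
  proof -
    have "(\<psi> z + 2 - G t2) / \<beta> \<le> t2 - s" using s(3) by linarith
    then show ?thesis using \<beta> by (simp add: pos_divide_le_eq mult.commute)
  qed
  moreover have "G s \<le> \<psi> z + 1"
  proof -
    have "exp s < d" using s(2) d(1) by (metis exp_less_cancel_iff exp_ln)
    then show ?thesis using d(2)[of "exp s"] by (simp add: G_def)
  qed
  ultimately show False by linarith
qed

lemma le_mean:
  assumes "0 < \<rho>" "\<rho> < r"
  shows "\<psi> z \<le> mean \<rho>"
proof (rule field_le_epsilon)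
  fix e :: real assume "0 < e"
  then obtain d where d: "0 < d" "\<And>\<rho>. 0 < \<rho> \<Longrightarrow> \<rho> < d \<Longrightarrow> \<bar>mean \<rho> - \<psi> z\<bar> \<le> e" using mean_close by blast
  define s where "s = min (d / 2) \<rho>"
  have "\<bar>mean s - \<psi> z\<bar> \<le> e" using d(1) assms by (intro d(2)) (auto simp: s_def)
  then have "\<psi> z \<le> mean s + e" by linarith
  also have "mean s \<le> mean \<rho>" using assms d(1) by (intro mean_mono) (auto simp: s_def)
  finally show "\<psi> z \<le> mean \<rho> + e" by simp
qed

text \<open>The three circles inequality; k is the relative position of ln \<sigma> between ln
  \<rho> and ln \<tau>.\<close>

lemma mean_log_convex:
  assumes "0 < \<rho>" "\<rho> \<le> \<sigma>" "\<sigma> < \<tau>" "\<tau> < r"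
  defines "k \<equiv> ln (\<sigma> / \<rho>) / ln (\<tau> / \<rho>)"
  shows "mean \<sigma> \<le> (1 - k) * mean \<rho> + k * mean \<tau>"
proof -
  have p: "0 < \<sigma>" "0 < \<tau>" "0 < ln (\<tau> / \<rho>)" "0 \<le> ln (\<sigma> / \<rho>)" "ln (\<sigma> / \<rho>) \<le> ln (\<tau> / \<rho>)"
    using assms by (auto simp: divide_simps)
  have k: "0 \<le> k" "k \<le> 1" using p by (auto simp: k_def)
  have "(1 - k) * ln \<rho> + k * ln \<tau> = ln \<rho> + k * (ln \<tau> - ln \<rho>)" by (simp add: algebra_simps)
  also have "\<dots> = ln \<rho> + k * ln (\<tau> / \<rho>)" using assms p by (simp add: ln_div)
  also have "\<dots> = ln \<rho> + ln (\<sigma> / \<rho>)" using p(3) by (simp add: k_def)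
  also have "\<dots> = ln \<sigma>" using assms p by (simp add: ln_div)
  finally have e: "(1 - k) * ln \<rho> + k * ln \<tau> = ln \<sigma>" .
  have "ln \<rho> < ln r" "ln \<tau> < ln r" using assms p r by auto
  then show ?thesis
    using convex_onD[OF convex_mean_exp k, of "ln \<rho>" "ln \<tau>"] e assms(1) p by simp
qed

end

section \<open>Quasi-plurisubharmonic functions and their mollifications\<close>

text \<open>The distributional form of \<open>levi U z v \<ge> - 4 * H z v\<close> on \<Omega>, for
  each constant v. Scalar test functions are what mollification provides.\<close>

definition quasi_psh ::
    "(complex^'n) set \<Rightarrow> (complex^'n \<Rightarrow> complex^'n \<Rightarrow> real) \<Rightarrow> (complex^'n \<Rightarrow> real) \<Rightarrow> bool" where
  "quasi_psh \<Omega> H U \<longleftrightarrow> (\<forall>v \<phi>. smooth_on UNIV \<phi> \<and> (\<forall>z. 0 \<le> \<phi> z) \<and>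
     (\<exists>K. compact K \<and> K \<subseteq> \<Omega> \<and> (\<forall>z. z \<notin> K \<longrightarrow> \<phi> z = 0)) \<longrightarrow>
     0 \<le> (\<integral>z. 4 * (\<phi> z * H z v) + U z * levi \<phi> z v \<partial>lborel))"

lemma continuous_on_levi: "smooth_on S f \<Longrightarrow> continuous_on S (\<lambda>z. levi f z v)"
  unfolding levi_def by (intro continuous_on_add smooth_on_continuous smooth_on_dird)

lemma smooth_on_reflect:
  fixes K :: "'a::euclidean_space \<Rightarrow> real"
  assumes "smooth_on UNIV K"
  shows "smooth_on UNIV (\<lambda>w. K (z - w))"
  by (rule smooth_on_compose[OF open_UNIV open_UNIV _ smooth_on_diff[OF open_UNIV smooth_on_const smooth_on_ident] assms]) auto

lemma levi_reflect:
  fixes K :: "complex^'n \<Rightarrow> real"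
  assumes "smooth_on UNIV K"
  shows "levi (\<lambda>w. K (z - w)) w v = levi K (z - w) v"
proof -
  have D: "dird (\<lambda>w. f (z - w)) v w = - dird f v (z - w)" if "smooth_on UNIV f" for f :: "complex^'n \<Rightarrow> real" and v w
  proof -
    have "((\<lambda>w. z - w) has_derivative (\<lambda>v. - v)) (at w)" by (auto intro!: derivative_eq_intros)
    from dird_compose[OF this that UNIV_I] show ?thesis
      using linear_neg[OF dird_linear[OF that UNIV_I]] by simp
  qed
  have "dird (dird (\<lambda>w. K (z - w)) v) v w = dird (dird K v) v (z - w)" for v
  proof -
    have "dird (\<lambda>w. K (z - w)) v = (\<lambda>w. - dird K v (z - w))" using D[OF assms] by auto
    then have "dird (dird (\<lambda>w. K (z - w)) v) v w = dird (\<lambda>w. - dird K v (z - w)) v w"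
      by (rule arg_cong[where f = "\<lambda>g. frechet_derivative g (at w) v"])
    also have "\<dots> = - dird (\<lambda>w. dird K v (z - w)) v w"
      by (rule dird_eq) (intro has_derivative_minus smooth_on_has_derivative[OF smooth_on_reflect[OF smooth_on_dird[OF assms]] UNIV_I])
    also have "\<dots> = dird (dird K v) v (z - w)" using D[OF smooth_on_dird[OF assms]] by simp
    finally show ?thesis .
  qed
  then show ?thesis by (simp add: levi_def)
qed

lemma levi_outside:
  assumes "\<And>x. x \<notin> cball 0 R \<Longrightarrow> K x = 0" "x \<notin> cball 0 R"
  shows "levi K x v = 0"
proof -
  have "dird (dird K w) w x = 0" for w by (rule dird_outside_cball[OF dird_outside_cball[OF assms(1)] assms(2)])
  then show ?thesis by (simp add: levi_def)
qed

text \<open>The reflected and translated kernel is itself an admissible test function, and the Levi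
  form of a convolution falls on the kernel.\<close>

lemma levi_mollify:
  assumes U: "integrable lborel U" "quasi_psh \<Omega> H U" and d: "0 < d" "cball z d \<subseteq> \<Omega>"
    and H: "continuous_on \<Omega> (\<lambda>w. H w v)" "\<And>w. w \<in> cball z d \<Longrightarrow> H w v \<le> M"
  shows "- 4 * M \<le> levi (mollify U d) z v"
proof -
  define \<phi> where "\<phi> w = moll d (z - w)" for w
  have sm: "smooth_on UNIV \<phi>" unfolding \<phi>_def[abs_def] by (rule smooth_on_reflect[OF smooth_on_moll])
  have c0: "0 \<le> \<phi> w" for w using moll_nonneg[OF d(1)] by (simp add: \<phi>_def)
  have off: "\<phi> w = 0" if "w \<notin> cball z d" for w using that d(1) by (simp add: \<phi>_def moll_outside dist_norm)
  have lv: "levi \<phi> w v = levi (moll d) (z - w) v" for w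
    unfolding \<phi>_def[abs_def] by (rule levi_reflect[OF smooth_on_moll])
  have i1: "integrable lborel (\<lambda>w. \<phi> w * H w v)"
  proof -
    have "integrable lborel (\<lambda>w. indicator (cball z d) w *\<^sub>R (\<phi> w * H w v))"
      by (intro borel_integrable_compact compact_cball continuous_on_mult continuous_on_subset[OF H(1) d(2)]
          continuous_on_subset[OF smooth_on_continuous[OF sm] subset_UNIV])
    also have "(\<lambda>w. indicator (cball z d) w *\<^sub>R (\<phi> w * H w v)) = (\<lambda>w. \<phi> w * H w v)"
      using off by (auto simp: fun_eq_iff indicator_def)
    finally show ?thesis .
  qed
  have i2: "integrable lborel (\<lambda>w. U w * levi \<phi> w v)"
    unfolding lv by (rule conv_integrable[OF U(1) continuous_on_levi[OF smooth_on_moll] levi_outside[OF moll_outside_cball[OF d(1)]]])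
  have "\<exists>K. compact K \<and> K \<subseteq> \<Omega> \<and> (\<forall>w. w \<notin> K \<longrightarrow> \<phi> w = 0)"
    using d(2) off by (intro exI[of _ "cball z d"]) auto
  then have "0 \<le> (\<integral>w. 4 * (\<phi> w * H w v) + U w * levi \<phi> w v \<partial>lborel)"
    using sm c0 by (intro U(2)[unfolded quasi_psh_def, THEN spec, THEN spec, THEN mp]) auto
  also have "\<dots> = 4 * (\<integral>w. \<phi> w * H w v \<partial>lborel) + levi (mollify U d) z v"
  proof -
    have "levi (mollify U d) z v = (\<integral>w. U w * levi \<phi> w v \<partial>lborel)"
      unfolding lv by (rule levi_conv[OF U(1) smooth_on_moll moll_outside_cball[OF d(1)]])
    then show ?thesis using i1 i2 by simp
  qed
  also have "(\<integral>w. \<phi> w * H w v \<partial>lborel) \<le> (\<integral>w. M * moll d (z - w) \<partial>lborel)"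
  proof (rule integral_mono[OF i1])
    show "integrable lborel (\<lambda>w. M * moll d (z - w))"
      using moll_reflect_integral[OF d(1), of z] not_integrable_integral_eq by fastforce
    show "\<phi> w * H w v \<le> M * moll d (z - w)" for w
    proof (cases "w \<in> cball z d")
      case True
      then show ?thesis using mult_left_mono[OF H(2)[OF True] c0[of w]] by (simp add: \<phi>_def mult.commute)
    qed (use off[of w] in \<open>auto simp: \<phi>_def\<close>)
  qed
  also have "\<dots> = M" using moll_reflect_integral[OF d(1), of z] by simp
  finally show ?thesis by simp
qed

section \<open>Pointwise upper bounds by mollifications at nearby points\<close>

lemma kernel_integrable:
  fixes \<psi> :: "'a::euclidean_space \<Rightarrow> real"
  assumes "continuous_on UNIV \<psi>" "0 < d"
  shows "integrable lborel (\<lambda>x. \<psi> x * moll d (z - x))"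
proof (rule compact_support_integrable[where R = "norm z + d"])
  show "continuous_on UNIV (\<lambda>x. \<psi> x * moll d (z - x))"
    by (intro continuous_on_mult assms(1) continuous_on_compose2[OF continuous_on_moll[of UNIV]] continuous_on_diff
        continuous_on_const continuous_on_id subset_UNIV)
  fix x :: 'a assume "x \<notin> cball 0 (norm z + d)"
  then have "d \<le> norm (z - x)" using norm_triangle_ineq2[of x z] by (simp add: norm_minus_commute)
  then show "\<psi> x * moll d (z - x) = 0" using assms(2) by (simp add: moll_outside)
qed

lemma kernel_le:
  fixes \<psi> :: "'a::euclidean_space \<Rightarrow> real"
  assumes "continuous_on UNIV \<psi>" "0 < d" "\<And>x. x \<in> ball z d \<Longrightarrow> \<psi> x \<le> t"
  shows "(\<integral>x. \<psi> x * moll d (z - x) \<partial>lborel) \<le> t"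
proof -
  have "(\<integral>x. \<psi> x * moll d (z - x) \<partial>lborel) \<le> (\<integral>x. t * moll d (z - x) \<partial>lborel)"
  proof (rule integral_mono[OF kernel_integrable[OF assms(1,2)] kernel_integrable[OF continuous_on_const assms(2)]])
    show "\<psi> x * moll d (z - x) \<le> t * moll d (z - x)" for x
      using assms(3)[of x] moll_nonneg[OF assms(2), of "z - x"] moll_outside[OF assms(2), of "z - x"]
      by (cases "x \<in> ball z d") (auto simp: dist_norm intro: mult_right_mono)
  qed
  then show ?thesis using moll_reflect_integral[OF assms(2), of z] by simp
qed

lemma (in psh_mean) mean_kernel: "0 < \<rho> \<Longrightarrow> mean \<rho> = (\<integral>x. \<psi> x * moll \<rho> (z - x) \<partial>lborel)"
  unfolding mean_def by (subst moll_scale) (auto intro: borel_measurable_smooth smooth)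

text \<open>The values near \<open>z\<close> are bounded by the mean over a much larger ball around them (with radius
  \<open>R d\<close>); for \<open>\<psi> \<le> 0\<close> this is almost bounded by the mean over a ball around \<open>z\<close>, and by
  convexity in the logarithm of the radius this can be replaced by the mean over radius \<open>d\<close>.\<close>

lemma psh_upper_bound:
  fixes \<psi> :: "complex^'n \<Rightarrow> real"
  assumes \<psi>: "smooth_on UNIV \<psi>" "\<And>x v. x \<in> ball z (2 * r) \<Longrightarrow> 0 \<le> levi \<psi> x v" "\<And>x. x \<in> ball z (2 * r) \<Longrightarrow> \<psi> x \<le> 0"
    and par: "0 < d" "0 < C" "1 + 4 * C \<le> R" "2 * R * d < r" "0 < r" and y: "norm (y - z) < C * d"
  shows "\<psi> y \<le> ((R - 4 * C) / R) ^ DIM(complex^'n) * ((1 - ln (R - 4 * C) / ln (r / 2 / d)) * (\<integral>x. \<psi> x * moll d (z - x) \<partial>lborel))"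
proof -
  define R' where "R' = R - 4 * C"
  have R: "0 < R" "1 \<le> R'" "R' \<le> R" using par by (auto simp: R'_def)
  have "R' * d \<le> R * d" "C * d \<le> R * d" using R par by (auto intro!: mult_right_mono)
  moreover have "0 < R * d" "0 < R' * d" using R par by auto
  ultimately have Rd: "0 < R * d" "0 < R' * d" "R' * d < r / 2" "R * d < r / 2" "C * d \<le> R * d"
    using par by linarith+
  have c\<psi>: "continuous_on UNIV \<psi>" by (rule smooth_on_continuous[OF \<psi>(1)])
  have by': "ball y r \<subseteq> ball z (2 * r)"
  proof
    fix x assume "x \<in> ball y r"
    then show "x \<in> ball z (2 * r)"
      using y Rd dist_triangle_less_add[of z y "r/2" x r] by (auto simp: dist_norm norm_minus_commute)
  qed
  have bz: "ball z r \<subseteq> ball z (2 * r)" using par by auto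
  interpret Y: psh_mean \<psi> y r using \<psi>(1,2) by' par by unfold_locales auto
  interpret Z: psh_mean \<psi> z r using \<psi>(1,2) bz par by unfold_locales auto
  let ?m = "\<lambda>\<rho> z. \<integral>x. \<psi> x * moll \<rho> (z - x) \<partial>lborel"
  have "\<psi> y \<le> Y.mean (R * d)" by (rule Y.le_mean) (use Rd par in auto)
  also have "\<dots> = ?m (R * d) y" by (rule Y.mean_kernel[OF Rd(1)])
  \<comment> \<open>For \<psi> \<le> 0 a larger kernel gives a smaller mean, so the domination of
    kernels is reversed. The choice R - R' = 4 C is what \<open>moll_domination\<close> demands for
    points at distance less than C d.\<close>
  also have "\<dots> \<le> (\<integral>x. (R' / R) ^ DIM(complex^'n) * (\<psi> x * moll (R' * d) (z - x)) \<partial>lborel)"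
  proof (rule integral_mono[OF kernel_integrable[OF c\<psi> Rd(1)]])
    show "integrable lborel (\<lambda>x. (R' / R) ^ DIM(complex^'n) * (\<psi> x * moll (R' * d) (z - x)))"
      by (intro integrable_mult_right kernel_integrable[OF c\<psi> Rd(2)])
    fix x
    have dom: "(R' / R) ^ DIM(complex^'n) * moll (R' * d) (z - x) \<le> moll (R * d) (y - x)"
    proof -
      have "4 * norm (y - z) \<le> R * d - R' * d" using y by (simp add: R'_def algebra_simps)
      from moll_domination[OF Rd(2) this, of x] show ?thesis
        using par(1) by (simp add: moll_commute[of _ x])
    qed
    show "\<psi> x * moll (R * d) (y - x) \<le> (R' / R) ^ DIM(complex^'n) * (\<psi> x * moll (R' * d) (z - x))"
    proof (cases "x \<in> ball z (2 * r)")
      case True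
      from mult_left_mono_neg[OF dom \<psi>(3)[OF True]] show ?thesis by (simp add: mult_ac)
    next
      case False
      then have z: "2 * r \<le> norm (z - x)" by (simp add: dist_norm)
      have "norm (z - x) \<le> norm (z - y) + norm (y - x)" using norm_triangle_ineq[of "z - y" "y - x"] by simp
      then have "R * d \<le> norm (y - x)" "R' * d \<le> norm (z - x)" using z y Rd by (auto simp: norm_minus_commute)
      then show ?thesis using Rd by (simp add: moll_outside)
    qed
  qed
  also have "\<dots> = (R' / R) ^ DIM(complex^'n) * Z.mean (R' * d)" by (simp add: Z.mean_kernel[OF Rd(2)])
  also have "\<dots> \<le> (R' / R) ^ DIM(complex^'n) * ((1 - ln R' / ln (r / 2 / d)) * ?m d z)"
  proof (rule mult_left_mono)
    \<comment> \<open>Convexity between the radii d and r/2. The outer mean is nonpositive and is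
      dropped; the coefficient of the inner one tends to 1 as d tends to 0.\<close>
    have "Z.mean (R' * d) \<le> (1 - ln (R' * d / d) / ln (r / 2 / d)) * Z.mean d + ln (R' * d / d) / ln (r / 2 / d) * Z.mean (r / 2)"
      using R Rd par by (intro Z.mean_log_convex) auto
    moreover have "Z.mean (r / 2) \<le> 0"
      using par by (subst Z.mean_kernel) (auto intro!: kernel_le[OF c\<psi>] \<psi>(3))
    moreover have "0 \<le> ln (R' * d / d) / ln (r / 2 / d)"
    proof -
      have "d \<le> R' * d" using R(2) par(1) by simp
      then have "2 * d \<le> r" using Rd(3) by linarith
      then have "1 \<le> r / 2 / d" using par(1) by (simp add: le_divide_eq)
      then show ?thesis using R(2) par(1) by simp
    qed
    ultimately have "Z.mean (R' * d) \<le> (1 - ln (R' * d / d) / ln (r / 2 / d)) * Z.mean d"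
      using mult_nonneg_nonpos by (smt (verit))
    then show "Z.mean (R' * d) \<le> (1 - ln R' / ln (r / 2 / d)) * ?m d z"
      using par(1) by (simp add: Z.mean_kernel[OF par(1)])
  qed (use R in auto)
  finally show ?thesis by (simp add: R'_def)
qed

text \<open>To apply \<open>psh_upper_bound\<close>, A q is added: its Levi form 4 A |v|^2 outweighs
  the lower bound -4 H, and q is nonpositive on the ball of radius 4 r. Smoothness is achieved by
  mollifying U at a further scale s. The limit in s is taken in L^1, whence a conclusion almost
  everywhere.\<close>

lemma quasi_psh_upper_bound_raw:
  fixes U :: "complex^'n \<Rightarrow> real"
  defines "q \<equiv> \<lambda>x p r. (norm (x - p))\<^sup>2 - 16 * r\<^sup>2"
  assumes r: "0 < r" and U: "integrable lborel U" "\<And>x. U x \<le> 0" "quasi_psh (ball p (4 * r)) H U"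
    and H: "\<And>v. continuous_on (ball p (4 * r)) (\<lambda>z. H z v)" "\<And>z v. z \<in> ball p (4 * r) \<Longrightarrow> H z v \<le> A * (norm v)\<^sup>2" "0 \<le> A"
    and par: "0 < d" "0 < C" "1 + 4 * C \<le> R" "8 * R * d < r" and z: "z \<in> cball p (2 * r)"
  defines "\<theta> \<equiv> ((R - 4 * C) / R) ^ DIM(complex^'n) * (1 - ln (R - 4 * C) / ln (r / 4 / d))"
  shows "AE y in lborel. y \<in> ball z (C * d) \<longrightarrow>
    U y + A * q y p r \<le> \<theta> * (mollify U d z + A * (\<integral>x. q x p r * moll d (z - x) \<partial>lborel))"
proof -
  define N where "N = mollify U d z + A * (\<integral>x. q x p r * moll d (z - x) \<partial>lborel)"
  define \<psi> where "\<psi> s x = mollify U s x + A * q x p r" for s x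
  define NN where "NN s = (\<integral>x. \<psi> s x * moll d (z - x) \<partial>lborel)" for s
  have sq: "smooth_on UNIV (\<lambda>x. A * q x p r)" unfolding q_def
    by (intro smooth_on_cmult smooth_on_diff smooth_on_norm_square smooth_on_const open_UNIV)
  have cq: "continuous_on UNIV (\<lambda>x. q x p r)" unfolding q_def by (intro continuous_intros)
  have lq: "levi (\<lambda>x. A * q x p r) x v = 4 * A * (norm v)\<^sup>2" for x v
  proof -
    have "levi (\<lambda>x. q x p r) x v = levi (\<lambda>x. (norm (x - p))\<^sup>2) x v + levi (\<lambda>x. - 16 * r\<^sup>2) x v"
      using levi_add[OF open_UNIV smooth_on_norm_square[of p] smooth_on_const[OF open_UNIV, of "- 16 * r\<^sup>2"], of x v] by (simp add: q_def)
    then have "levi (\<lambda>x. q x p r) x v = 4 * (norm v)\<^sup>2" by (simp add: levi_norm_square levi_const)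
    moreover have "smooth_on UNIV (\<lambda>x. q x p r)" unfolding q_def
      by (intro smooth_on_diff smooth_on_norm_square smooth_on_const open_UNIV)
    ultimately show ?thesis using levi_cmult[OF open_UNIV, of "\<lambda>x. q x p r" x A v] by simp
  qed
  \<comment> \<open>The radii fit: the ball of radius r around z lies in that of radius 3 r around
    p, and mollification at scale s < r looks no farther than 4 r.\<close>
  have \<psi>s: "\<psi> s y \<le> \<theta> * NN s" if s: "0 < s" "s < r" and y: "y \<in> ball z (C * d)" for s y
  proof -
    have sm: "smooth_on UNIV (\<psi> s)" unfolding \<psi>_def[abs_def]
      by (intro smooth_on_add smooth_on_mollify U s open_UNIV sq)
    have inball: "x \<in> ball p (3 * r)" if "x \<in> ball z r" for x
      using that z dist_triangle[of p x z] by auto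
    have "\<psi> s y \<le> ((R - 4 * C) / R) ^ DIM(complex^'n) * ((1 - ln (R - 4 * C) / ln (r / 2 / 2 / d)) * (\<integral>x. \<psi> s x * moll d (z - x) \<partial>lborel))"
    proof (rule psh_upper_bound[OF sm])
      fix x v assume "x \<in> ball z (2 * (r / 2))"
      then have x: "x \<in> ball p (3 * r)" using inball by simp
      have sub: "cball x s \<subseteq> ball p (4 * r)"
      proof
        fix w assume "w \<in> cball x s"
        then show "w \<in> ball p (4 * r)" using x s dist_triangle[of p w x] by auto
      qed
      have "- 4 * (A * (norm v)\<^sup>2) \<le> levi (mollify U s) x v"
        by (rule levi_mollify[OF U(1,3) s(1) sub H(1)]) (use H(2) sub in auto)
      then show "0 \<le> levi (\<psi> s) x v"
        unfolding \<psi>_def[abs_def] using levi_add[OF open_UNIV smooth_on_mollify[OF U(1) s(1)] sq, of x v] by (simp add: lq)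
      have "norm (x - p) \<le> 4 * r" using x r by (simp add: dist_norm norm_minus_commute)
      then have "(norm (x - p))\<^sup>2 \<le> (4 * r)\<^sup>2" by (intro power_mono) auto
      then have "q x p r \<le> 0" by (simp add: q_def power2_eq_square)
      moreover have "mollify U s x \<le> 0" by (rule mollify_le[OF U(1) s(1)]) (use U(2) in auto)
      ultimately show "\<psi> s x \<le> 0" using H(3) by (simp add: \<psi>_def mult_nonneg_nonpos add_nonpos_nonpos)
    next
      show "norm (y - z) < C * d" using y by (simp add: dist_norm norm_minus_commute)
    qed (use par r in auto)
    then show ?thesis by (simp add: \<theta>_def NN_def mult.assoc)
  qed
  obtain Mx where Mx: "0 \<le> Mx" "\<And>x::complex^'n. \<bar>moll d x\<bar> \<le> Mx"
    using compact_support_bounded[OF continuous_on_moll moll_outside_cball[OF par(1)]] by blast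
  have [measurable]: "U \<in> borel_measurable borel" using U(1) by auto
  have Ns: "\<bar>NN s - N\<bar> \<le> Mx * e" if s: "0 < s" and e: "0 < e" "(\<integral>\<^sup>+x. ennreal \<bar>mollify U s x - U x\<bar> \<partial>lborel) < ennreal e" for s e
  proof -
    have [measurable]: "mollify U s \<in> borel_measurable borel" by (rule borel_measurable_smooth[OF smooth_on_mollify[OF U(1) s]])
    have i0: "integrable lborel (\<lambda>x. mollify U s x - U x)"
      using less_trans[OF e(2) ennreal_less_top] by (intro integrableI_bounded) auto
    have im: "integrable lborel (\<lambda>x. mollify U s x * moll d (z - x))"
      by (rule kernel_integrable[OF smooth_on_continuous[OF smooth_on_mollify[OF U(1) s]] par(1)])
    have iU: "integrable lborel (\<lambda>x. U x * moll d (z - x))" by (rule mollify_integrable[OF U(1) par(1)])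
    have iq: "integrable lborel (\<lambda>x. q x p r * moll d (z - x))" by (rule kernel_integrable[OF cq par(1)])
    have "NN s - N = (\<integral>x. (mollify U s x - U x) * moll d (z - x) \<partial>lborel)"
      using im iU iq by (simp add: NN_def N_def \<psi>_def conv_def[of U "moll d" z] distrib_right left_diff_distrib mult.assoc)
    also have "\<bar>\<dots>\<bar> \<le> (\<integral>x. Mx * \<bar>mollify U s x - U x\<bar> \<partial>lborel)"
      unfolding real_norm_def[symmetric]
    proof (rule Bochner_Integration.integral_norm_bound_integral)
      show "integrable lborel (\<lambda>x. (mollify U s x - U x) * moll d (z - x))"
        using im iU by (simp add: left_diff_distrib)
      show "integrable lborel (\<lambda>x. Mx * norm (mollify U s x - U x))" using i0 by simp
      show "norm ((mollify U s x - U x) * moll d (z - x)) \<le> Mx * norm (mollify U s x - U x)" for x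
        using mult_right_mono[OF Mx(2)[of "z - x"], of "\<bar>mollify U s x - U x\<bar>"] by (simp add: abs_mult mult.commute)
    qed
    also have "\<dots> = Mx * (\<integral>x. \<bar>mollify U s x - U x\<bar> \<partial>lborel)" by simp
    also have "\<dots> \<le> Mx * e"
    proof (rule mult_left_mono[OF _ Mx(1)])
      have "ennreal (\<integral>x. \<bar>mollify U s x - U x\<bar> \<partial>lborel) = (\<integral>\<^sup>+x. ennreal \<bar>mollify U s x - U x\<bar> \<partial>lborel)"
        using i0 by (intro nn_integral_eq_integral[symmetric]) auto
      then have "ennreal (\<integral>x. \<bar>mollify U s x - U x\<bar> \<partial>lborel) < ennreal e" using e(2) by simp
      then show "(\<integral>x. \<bar>mollify U s x - U x\<bar> \<partial>lborel) \<le> e" using e(1) by (simp add: ennreal_less_iff)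
    qed
    finally show ?thesis .
  qed
  define V where "V = measure lborel (ball z (C * d))"
  have V: "emeasure lborel (ball z (C * d)) = ennreal V" "0 \<le> V"
    unfolding V_def using emeasure_lborel_ball_finite[of z "C * d"] by (auto simp: emeasure_eq_ennreal_measure less_top)
  have [measurable]: "ball z (C * d) \<in> sets borel" by simp
  define f where "f y = U y + A * q y p r - \<theta> * N" for y
  have [measurable]: "f \<in> borel_measurable borel"
    unfolding f_def q_def by measurable
  \<comment> \<open>The aim is f \<le> 0 almost everywhere on the ball. As \<open>ennreal\<close>
    cuts off negative values, it suffices that this integral vanishes.\<close>
  have "(\<integral>\<^sup>+y. ennreal (f y) * indicator (ball z (C * d)) y \<partial>lborel) \<le> 0"
  proof (rule ennreal_le_epsilon)
    fix e0 :: real assume e0: "0 < e0"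
    define e where "e = e0 / (1 + \<bar>\<theta>\<bar> * Mx * V)"
    have den: "0 < 1 + \<bar>\<theta>\<bar> * Mx * V" using Mx V by (simp add: add_pos_nonneg)
    have e: "0 < e" using e0 den by (simp add: e_def)
    obtain s0 where s0: "0 < s0" "\<And>s. 0 < s \<Longrightarrow> s < s0 \<Longrightarrow> (\<integral>\<^sup>+x. ennreal \<bar>mollify U s x - U x\<bar> \<partial>lborel) < ennreal e"
      using mollify_tendsto[OF U(1) e] by blast
    define s where "s = min s0 r / 2"
    have s: "0 < s" "s < s0" "s < r" using s0(1) r by (auto simp: s_def)
    have [measurable]: "mollify U s \<in> borel_measurable borel" by (rule borel_measurable_smooth[OF smooth_on_mollify[OF U(1) s(1)]])
    have pw: "ennreal (f y) * indicator (ball z (C * d)) y \<le> ennreal \<bar>mollify U s y - U y\<bar> + ennreal (\<bar>\<theta>\<bar> * (Mx * e)) * indicator (ball z (C * d)) y" for y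
    proof (cases "y \<in> ball z (C * d)")
      case True
      \<comment> \<open>The first summand is small in L^1, the second nonpositive by
        \<open>\<psi>s\<close>, the third uniformly small by \<open>Ns\<close>.\<close>
      have "f y = (U y - mollify U s y) + (\<psi> s y - \<theta> * NN s) + \<theta> * (NN s - N)" by (simp add: f_def \<psi>_def algebra_simps)
      also have "\<dots> \<le> \<bar>mollify U s y - U y\<bar> + 0 + \<bar>\<theta>\<bar> * (Mx * e)"
      proof (intro add_mono)
        show "\<psi> s y - \<theta> * NN s \<le> 0" using \<psi>s[OF s(1,3) True] by simp
        have "\<theta> * (NN s - N) \<le> \<bar>\<theta>\<bar> * \<bar>NN s - N\<bar>" by (simp flip: abs_mult)
        also have "\<dots> \<le> \<bar>\<theta>\<bar> * (Mx * e)" using Ns[OF s(1) e s0(2)[OF s(1,2)]] by (intro mult_left_mono) auto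
        finally show "\<theta> * (NN s - N) \<le> \<bar>\<theta>\<bar> * (Mx * e)" .
      qed auto
      finally have "ennreal (f y) \<le> ennreal (\<bar>mollify U s y - U y\<bar> + \<bar>\<theta>\<bar> * (Mx * e))" by (intro ennreal_leI) simp
      then show ?thesis using True Mx e by (simp add: ennreal_plus)
    qed simp
    have "(\<integral>\<^sup>+y. ennreal (f y) * indicator (ball z (C * d)) y \<partial>lborel)
      \<le> (\<integral>\<^sup>+y. ennreal \<bar>mollify U s y - U y\<bar> + ennreal (\<bar>\<theta>\<bar> * (Mx * e)) * indicator (ball z (C * d)) y \<partial>lborel)"
      by (rule nn_integral_mono) (rule pw)
    also have "\<dots> = (\<integral>\<^sup>+y. ennreal \<bar>mollify U s y - U y\<bar> \<partial>lborel) + ennreal (\<bar>\<theta>\<bar> * (Mx * e)) * ennreal V"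
    proof (subst nn_integral_add)
      show "(\<lambda>y. ennreal (\<bar>\<theta>\<bar> * (Mx * e)) * indicator (ball z (C * d)) y) \<in> borel_measurable lborel" by measurable
    qed (auto simp: nn_integral_cmult_indicator V)
    also have "\<dots> \<le> ennreal e + ennreal (\<bar>\<theta>\<bar> * (Mx * e) * V)"
      using s0(2)[OF s(1,2)] Mx V e by (intro add_mono) (auto simp: ennreal_mult)
    also have "\<dots> = ennreal (e * (1 + \<bar>\<theta>\<bar> * Mx * V))"
      using Mx V e by (simp add: algebra_simps flip: ennreal_plus)
    also have "e * (1 + \<bar>\<theta>\<bar> * Mx * V) = e0" using den by (simp add: e_def)
    finally show "(\<integral>\<^sup>+y. ennreal (f y) * indicator (ball z (C * d)) y \<partial>lborel) \<le> 0 + ennreal e0" by simp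
  qed
  then have "(\<integral>\<^sup>+y. ennreal (f y) * indicator (ball z (C * d)) y \<partial>lborel) = 0" by simp
  then have "AE y in lborel. ennreal (f y) * indicator (ball z (C * d)) y = 0"
    by (subst (asm) nn_integral_0_iff_AE) auto
  then show ?thesis
  proof eventually_elim
    case (elim y)
    then have "y \<in> ball z (C * d) \<longrightarrow> f y \<le> 0" by (auto simp: ennreal_eq_0_iff)
    then show ?case by (simp add: f_def N_def)
  qed
qed

text \<open>Two parameters are fixed in succession: R so large that the power of R'/R is close to 1,
  then d so small that ln R' / ln (r/4/d) is close to 0. The loss caused by A q goes into the
  additive \<eta>.\<close>

lemma quasi_psh_upper_bound:
  fixes U :: "complex^'n \<Rightarrow> real"
  assumes r: "0 < r" and U: "integrable lborel U" "\<And>x. U x \<le> 0" "quasi_psh (ball p (4 * r)) H U"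
    and H: "\<And>v. continuous_on (ball p (4 * r)) (\<lambda>z. H z v)" "\<And>z v. z \<in> ball p (4 * r) \<Longrightarrow> H z v \<le> A * (norm v)\<^sup>2" "0 \<le> A"
    and C: "1 \<le> C" and \<eta>: "0 < \<eta>" "\<eta> < 1"
  shows "\<exists>d0>0. \<forall>d z. 0 < d \<longrightarrow> d < d0 \<longrightarrow> z \<in> cball p (2 * r) \<longrightarrow>
    (AE y in lborel. y \<in> ball z (C * d) \<longrightarrow> U y \<le> (1 - \<eta>) * mollify U d z + \<eta>)"
proof -
  define D where "D = real DIM(complex^'n)"
  \<comment> \<open>An upper bound for 1 - \<theta>. Since the mean of q is at least -16 r^2, the
    deviation of \<theta> from 1 costs at most 16 A r^2 \<eta>0 \<le> \<eta>/2; the other half of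
    \<eta> is for the oscillation of A q.\<close>
  define \<eta>0 where "\<eta>0 = min \<eta> (\<eta> / (2 * (A * 16 * r\<^sup>2 + 1)))"
  have A1: "0 < A * 16 * r\<^sup>2 + 1" "0 < A * 16 * r * C + 1" using H(3) r C by (auto intro!: add_nonneg_pos)
  have \<eta>0: "0 < \<eta>0" "\<eta>0 \<le> \<eta>" "\<eta>0 < 1" using \<eta> A1 by (auto simp: \<eta>0_def)
  have A\<eta>: "A * 16 * r\<^sup>2 * \<eta>0 \<le> \<eta> / 2"
  proof -
    have "A * 16 * r\<^sup>2 * \<eta>0 \<le> (A * 16 * r\<^sup>2 + 1) * (\<eta> / (2 * (A * 16 * r\<^sup>2 + 1)))"
      using H(3) \<eta>0 by (intro mult_mono) (auto simp: \<eta>0_def)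
    also have "\<dots> = \<eta> / 2" using A1 by (simp add: field_simps)
    finally show ?thesis .
  qed
  \<comment> \<open>The last summand makes Bernoulli's inequality give (1 - 4 C/R)^D \<ge> 1 -
    \<eta>0/2.\<close>
  define R where "R = 4 * C + 1 + 8 * C * D / \<eta>0"
  define R' where "R' = R - 4 * C"
  have D0: "0 \<le> D" by (simp add: D_def)
  have "0 \<le> 8 * C * D / \<eta>0" using C D0 \<eta>0 by simp
  then have R: "1 + 4 * C \<le> R" "0 < R" "1 \<le> R'" "8 * C * D / \<eta>0 \<le> R"
    using C unfolding R'_def R_def by linarith+
  have pow: "1 - \<eta>0 / 2 \<le> (R' / R) ^ DIM(complex^'n)" "(R' / R) ^ DIM(complex^'n) \<le> 1"
  proof -
    have eq: "R' / R = 1 + (- (4 * C / R))" using R by (simp add: R'_def diff_divide_distrib)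
    have "8 * C * D \<le> R * \<eta>0" using R(4) \<eta>0 by (simp add: pos_divide_le_eq)
    then have "D * (4 * C / R) \<le> \<eta>0 / 2" using R by (simp add: divide_le_eq field_simps)
    moreover have "1 + real DIM(complex^'n) * (- (4 * C / R)) \<le> (1 + (- (4 * C / R))) ^ DIM(complex^'n)"
      by (rule Bernoulli_inequality) (use R C in \<open>auto simp: divide_le_eq\<close>)
    ultimately show "1 - \<eta>0 / 2 \<le> (R' / R) ^ DIM(complex^'n)" unfolding eq D_def by simp
    show "(R' / R) ^ DIM(complex^'n) \<le> 1" using R C by (intro power_le_one) (auto simp: R'_def)
  qed
  \<comment> \<open>The three bounds ensure, in this order, 8 R d < r, then \<kappa> \<le>
    \<eta>0/2, then an oscillation of A q of at most \<eta>/2.\<close>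
  define d0 where "d0 = min (r / (8 * R)) (min (r / 4 * exp (- (2 * ln R' / \<eta>0))) (\<eta> / (2 * (A * 16 * r * C + 1))))"
  have d0: "0 < d0" using r R \<eta> A1 by (simp add: d0_def)
  have "AE y in lborel. y \<in> ball z (C * d) \<longrightarrow> U y \<le> (1 - \<eta>) * mollify U d z + \<eta>"
    if d: "0 < d" "d < d0" and z: "z \<in> cball p (2 * r)" for d z
  proof -
    have d1: "8 * R * d < r" using d(2) R by (simp add: d0_def less_divide_eq mult.commute)
    have d2: "d \<le> r / 4 * exp (- (2 * ln R' / \<eta>0))" using d(2) by (simp add: d0_def)
    have d3: "A * 16 * r * C * d \<le> \<eta> / 2"
    proof -
      have "A * 16 * r * C * d \<le> (A * 16 * r * C + 1) * (\<eta> / (2 * (A * 16 * r * C + 1)))"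
        using H(3) r C d by (intro mult_mono) (auto simp: d0_def)
      also have "\<dots> = \<eta> / 2" using A1 by (simp add: field_simps)
      finally show ?thesis .
    qed
    define \<kappa> where "\<kappa> = ln R' / ln (r / 4 / d)"
    have dr: "d < r / 4"
    proof -
      have "8 * 5 * d \<le> 8 * R * d" using R C d by (intro mult_right_mono) auto
      then show ?thesis using d1 d by linarith
    qed
    have lnpos: "0 < ln (r / 4 / d)" using dr d by (simp add: less_divide_eq)
    have \<kappa>: "0 \<le> \<kappa>" "\<kappa> \<le> \<eta>0 / 2"
    proof -
      show "0 \<le> \<kappa>" using lnpos R by (simp add: \<kappa>_def)
      have "exp (2 * ln R' / \<eta>0) * d \<le> exp (2 * ln R' / \<eta>0) * (r / 4 * exp (- (2 * ln R' / \<eta>0)))"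
        using d2 by (intro mult_left_mono) auto
      also have "\<dots> = r / 4" by (simp add: exp_minus)
      finally have "exp (2 * ln R' / \<eta>0) \<le> r / 4 / d" using d by (simp add: le_divide_eq)
      then have "2 * ln R' / \<eta>0 \<le> ln (r / 4 / d)" using d r by (subst ln_ge_iff) auto
      then show "\<kappa> \<le> \<eta>0 / 2" using lnpos \<eta>0 by (simp add: \<kappa>_def divide_le_eq field_simps)
    qed
    define \<theta> where "\<theta> = (R' / R) ^ DIM(complex^'n) * (1 - \<kappa>)"
    have \<theta>: "1 - \<eta>0 \<le> \<theta>" "\<theta> \<le> 1" "0 \<le> \<theta>"
    proof -
      have "(1 - \<eta>0 / 2) * (1 - \<eta>0 / 2) \<le> \<theta>"
        unfolding \<theta>_def using pow \<kappa> \<eta>0 by (intro mult_mono) auto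
      moreover have "1 - \<eta>0 \<le> (1 - \<eta>0 / 2) * (1 - \<eta>0 / 2)" by (simp add: algebra_simps)
      ultimately show "1 - \<eta>0 \<le> \<theta>" by linarith
      then show "0 \<le> \<theta>" using \<eta>0 by linarith
      have "\<theta> \<le> 1 * 1" unfolding \<theta>_def using pow \<kappa> \<eta>0 by (intro mult_mono) auto
      then show "\<theta> \<le> 1" by simp
    qed
    define q where "q x = (norm (x - p))\<^sup>2 - 16 * r\<^sup>2" for x
    define Q where "Q = (\<integral>x. q x * moll d (z - x) \<partial>lborel)"
    have cq: "continuous_on UNIV q" unfolding q_def[abs_def] by (intro continuous_intros)
    have mU: "mollify U d z \<le> 0" by (rule mollify_le[OF U(1) d(1)]) (use U(2) in auto)
    have Q1: "- (16 * r\<^sup>2) \<le> Q"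
    proof -
      have "(\<integral>x. - q x * moll d (z - x) \<partial>lborel) \<le> 16 * r\<^sup>2"
        by (rule kernel_le[OF continuous_on_minus[OF cq] d(1)]) (simp add: q_def)
      then show ?thesis by (simp add: Q_def)
    qed
    \<comment> \<open>On the ball of radius 4 r around p, q is Lipschitz with constant 8 r, and x
      and y both lie within C d of z.\<close>
    have Q2: "Q \<le> q y + 16 * r * C * d" if y: "y \<in> ball z (C * d)" for y
      unfolding Q_def
    proof (rule kernel_le[OF cq d(1)])
      fix x assume x: "x \<in> ball z d"
      have Cd: "C * d \<le> R * d" using R d C by (intro mult_right_mono) auto
      have "d \<le> C * d" using C d by simp
      have pz: "norm (z - p) \<le> 2 * r" using z by (simp add: dist_norm norm_minus_commute)
      have nx: "norm (x - p) \<le> 4 * r"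
        using norm_triangle_ineq[of "x - z" "z - p"] x pz dr r by (simp add: dist_norm norm_minus_commute)
      have ny: "norm (y - p) \<le> 4 * r"
        using norm_triangle_ineq[of "y - z" "z - p"] y pz Cd d1 r by (simp add: dist_norm norm_minus_commute)
      have xy: "norm (x - p) - norm (y - p) \<le> 2 * C * d"
        using norm_triangle_sub[of "x - p" "y - p"] norm_triangle_ineq4[of "x - z" "y - z"] x y \<open>d \<le> C * d\<close>
        by (simp add: dist_norm norm_minus_commute)
      have "q x - q y = (norm (x - p) - norm (y - p)) * (norm (x - p) + norm (y - p))"
        by (simp add: q_def power2_eq_square algebra_simps)
      also have "\<dots> \<le> (2 * C * d) * (norm (x - p) + norm (y - p))" by (intro mult_right_mono xy) auto
      also have "\<dots> \<le> (2 * C * d) * (8 * r)" using nx ny C d by (intro mult_left_mono) auto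
      finally show "q x \<le> q y + 16 * r * C * d" by (simp add: algebra_simps)
    qed
    have "AE y in lborel. y \<in> ball z (C * d) \<longrightarrow> U y + A * q y \<le> \<theta> * (mollify U d z + A * Q)"
      using quasi_psh_upper_bound_raw[OF r U H d(1) _ R(1) d1 z] C unfolding q_def Q_def \<theta>_def \<kappa>_def R'_def by simp
    then show ?thesis
    proof eventually_elim
      case (elim y)
      show ?case
      proof
        assume y: "y \<in> ball z (C * d)"
        have "U y \<le> \<theta> * mollify U d z + A * (\<theta> * Q - q y)" using elim y by (simp add: algebra_simps)
        also have "\<theta> * Q - q y \<le> 16 * r * C * d + \<eta>0 * (16 * r\<^sup>2)"
        proof -
          have "\<theta> * Q = Q - (1 - \<theta>) * Q" by (simp add: algebra_simps)
          also have "- ((1 - \<theta>) * Q) \<le> (1 - \<theta>) * (16 * r\<^sup>2)"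
            using mult_left_mono[OF Q1, of "1 - \<theta>"] \<theta> by simp
          then have "Q - (1 - \<theta>) * Q \<le> Q + (1 - \<theta>) * (16 * r\<^sup>2)" by linarith
          also have "(1 - \<theta>) * (16 * r\<^sup>2) \<le> \<eta>0 * (16 * r\<^sup>2)" using \<theta> by (intro mult_right_mono) auto
          finally show ?thesis using Q2[OF y] by linarith
        qed
        then have "A * (\<theta> * Q - q y) \<le> A * (16 * r * C * d + \<eta>0 * (16 * r\<^sup>2))" using H(3) by (intro mult_left_mono)
        moreover have "A * (16 * r * C * d + \<eta>0 * (16 * r\<^sup>2)) \<le> \<eta>" using d3 A\<eta> by (simp add: algebra_simps)
        moreover have "\<theta> * mollify U d z \<le> (1 - \<eta>) * mollify U d z"
          using \<theta>(1) \<eta>0(2) mU by (intro mult_right_mono_neg) auto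
        ultimately show "U y \<le> (1 - \<eta>) * mollify U d z + \<eta>"
          using \<open>U y \<le> \<theta> * mollify U d z + A * (\<theta> * Q - q y)\<close> by linarith
      qed
    qed
  qed
  then show ?thesis using d0 by blast
qed

section \<open>Holomorphic maps are smooth\<close>

lemma circle_mean_value:
  assumes "continuous_on (cball 0 1) f" "f holomorphic_on ball 0 1"
  shows "((\<lambda>t. f (exp (2 * of_real pi * \<i> * of_real t))) has_integral f 0) {0..1}"
proof -
  have "((\<lambda>u. f u / (u - 0)) has_contour_integral (2 * of_real pi * \<i> * f 0)) (circlepath 0 1)"
    by (rule Cauchy_integral_circlepath) (use assms in auto)
  then have "((\<lambda>x. f (circlepath 0 1 x) / (circlepath 0 1 x - 0) * vector_derivative (circlepath 0 1) (at x)) has_integral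
      (2 * of_real pi * \<i> * f 0)) {0..1}"
    by (simp add: has_contour_integral)
  moreover have "f (circlepath 0 1 x) / (circlepath 0 1 x - 0) * vector_derivative (circlepath 0 1) (at x)
      = (2 * of_real pi * \<i>) * f (exp (2 * of_real pi * \<i> * of_real x))" for x
    unfolding vector_derivative_circlepath by (simp add: circlepath)
  ultimately have "((\<lambda>x. (2 * of_real pi * \<i>) * f (exp (2 * of_real pi * \<i> * of_real x))) has_integral (2 * of_real pi * \<i> * f 0)) {0..1}"
    by (simp only:)
  from has_integral_mult_right[OF this, of "1 / (2 * of_real pi * \<i>)"] show ?thesis by simp
qed

text \<open>The kernel is radial, so rotating the argument of F does not change the integral, and
  one may average over all rotations; after exchanging the integrals, the mean value property
  applies on each circle.\<close>

lemma rotation_mean_value: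
  fixes F :: "complex^'n \<Rightarrow> real"
  assumes F: "continuous_on UNIV F" and "0 < d"
    and mv: "\<And>w. norm w \<le> d \<Longrightarrow> ((\<lambda>t. F (z + exp (2 * of_real pi * \<i> * of_real t) *s w)) has_integral F z) {0..1}"
  shows "(\<integral>w. F (z + w) * moll d w \<partial>lborel) = F z"
proof -
  define e where "e t = exp (2 * of_real pi * \<i> * of_real t)" for t :: real
  have ce: "continuous_on S e" for S unfolding e_def by (intro continuous_intros)
  obtain a where a: "cball (0::complex^'n) d \<subseteq> cbox (- a) a"
    using bounded_subset_cbox_symmetric[OF bounded_cball] by blast
  have cF: "continuous_on UNIV (\<lambda>w. F (z + c *s w))" for c
    by (rule continuous_on_compose2[OF F]) (auto intro!: continuous_intros)
  have conv: "(\<integral>w. F (z + c *s w) * moll d w \<partial>lborel) = integral (cbox (- a) a) (\<lambda>w. F (z + c *s w) * moll d w)" for c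
    by (rule lborel_integral_cbox[OF cF continuous_on_moll moll_outside_cball[OF \<open>0 < d\<close>] a])
  define I where "I = (\<integral>w. F (z + 1 *s w) * moll d w \<partial>lborel)"
  have rot: "integral (cbox (- a) a) (\<lambda>w. F (z + e t *s w) * moll d w) = I" for t
  proof -
    have "cmod (e t) = 1" by (simp add: e_def)
    have "integral (cbox (- a) a) (\<lambda>w. F (z + e t *s w) * moll d w) = (\<integral>w. (\<lambda>w. F (z + 1 *s w) * moll d w) (e t *s w) \<partial>lborel)"
    proof -
      have "moll d (e t *s w) = moll d w" for w :: "complex^'n"
        using \<open>cmod (e t) = 1\<close> by (simp add: moll_def bump_def norm_vector_scalar_mult)
      then show ?thesis by (simp only: vector_smult_lid conv)
    qed
    also have "\<dots> = I" unfolding I_def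
    proof (rule integral_rotate[OF \<open>cmod (e t) = 1\<close>])
      show "(\<lambda>w. F (z + 1 *s w) * moll d w) \<in> borel_measurable borel"
        by (intro borel_measurable_continuous_onI continuous_on_mult cF continuous_on_moll)
    qed
    finally show ?thesis .
  qed
  have cont: "continuous_on (cbox (0, - a) (1, a)) (\<lambda>(t, w). F (z + e t *s w) * moll d w)"
    unfolding case_prod_beta
    by (intro continuous_on_mult continuous_on_compose2[OF F] continuous_on_compose2[OF continuous_on_moll[of UNIV]]
        continuous_on_add continuous_on_const continuous_on_scalar continuous_on_compose2[OF ce[of UNIV]] continuous_on_fst continuous_on_snd
        continuous_on_id subset_UNIV)
  have "I = integral (cbox 0 1) (\<lambda>t::real. integral (cbox (- a) a) (\<lambda>w. F (z + e t *s w) * moll d w))"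
    by (simp add: rot)
  also have "\<dots> = integral (cbox (- a) a) (\<lambda>w. integral (cbox 0 1) (\<lambda>t. F (z + e t *s w) * moll d w))"
    by (rule integral_swap_continuous[OF cont])
  also have "\<dots> = integral (cbox (- a) a) (\<lambda>w. F z * moll d w)"
  proof (rule Henstock_Kurzweil_Integration.integral_cong)
    fix w
    show "integral (cbox 0 1) (\<lambda>t. F (z + e t *s w) * moll d w) = F z * moll d w"
    proof (cases "norm w \<le> d")
      case True
      from integral_unique[OF mv[OF True]] show ?thesis by (simp add: e_def)
    next
      case False
      then show ?thesis using \<open>0 < d\<close> by (simp add: moll_outside)
    qed
  qed
  also have "\<dots> = (\<integral>w. F z * moll d w \<partial>(lborel :: (complex^'n) measure))"
    by (rule sym, rule lborel_integral_cbox[OF continuous_on_const continuous_on_moll moll_outside_cball[OF \<open>0 < d\<close>] a])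
  also have "\<dots> = F z" using moll_integral[OF \<open>0 < d\<close>, where 'a = "complex^'n"] by simp
  finally show ?thesis by (simp add: I_def)
qed

lemma holomorphic_map_mean_value:
  fixes h :: "complex^'n \<Rightarrow> complex^'m"
  assumes "open S" "holomorphic_map_on S h" "cball z d \<subseteq> S" "norm w \<le> d"
  shows "((\<lambda>t. h (z + exp (2 * of_real pi * \<i> * of_real t) *s w) \<bullet> b) has_integral (h z \<bullet> b)) {0..1}"
proof -
  have sub: "z + c *s w \<in> S" if "cmod c \<le> 1" for c
  proof -
    have "norm (c *s w) \<le> 1 * d" unfolding norm_vector_scalar_mult using that assms(4) by (intro mult_mono) auto
    then show ?thesis using assms(3) by (auto simp: dist_norm)
  qed
  have "((\<lambda>t. h (z + exp (2 * of_real pi * \<i> * of_real t) *s w) $ a) has_integral (h z $ a)) {0..1}" for a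
  proof -
    have D: "((\<lambda>c. h (z + c *s w) $ a) has_field_derivative dird h w (z + c *s w) $ a) (at c)" if "cmod c \<le> 1" for c
      by (rule holomorphic_map_along[OF assms(2) sub[OF that]])
    have "continuous_on (cball 0 1) (\<lambda>c. h (z + c *s w) $ a)"
      by (intro continuous_at_imp_continuous_on ballI DERIV_isCont[OF D]) simp
    moreover have "(\<lambda>c. h (z + c *s w) $ a) holomorphic_on ball 0 1"
      unfolding holomorphic_on_open[OF open_ball] using D by (metis less_imp_le mem_ball_0)
    ultimately show ?thesis using circle_mean_value[of "\<lambda>c. h (z + c *s w) $ a"] by simp
  qed
  then have "((\<lambda>t. \<Sum>a\<in>UNIV. h (z + exp (2 * of_real pi * \<i> * of_real t) *s w) $ a \<bullet> b $ a) has_integral (\<Sum>a\<in>UNIV. h z $ a \<bullet> b $ a)) {0..1}"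
    by (intro has_integral_sum) (auto intro: has_integral_linear[OF _ bounded_linear_inner_left, unfolded o_def])
  then show ?thesis by (simp add: inner_vec_def)
qed

lemma smooth_on_components:
  fixes h :: "'a::real_normed_vector \<Rightarrow> 'b::euclidean_space"
  assumes "open S" "\<And>b. b \<in> Basis \<Longrightarrow> smooth_on S (\<lambda>z. h z \<bullet> b)"
  shows "smooth_on S h"
proof -
  have "smooth_on S (\<lambda>z. \<Sum>b\<in>Basis. (h z \<bullet> b) *\<^sub>R b)"
    by (intro smooth_on_sum smooth_on_scaleR smooth_on_const assms)
  then show ?thesis by (simp add: euclidean_representation)
qed

lemma holomorphic_map_continuous: "holomorphic_map_on S h \<Longrightarrow> continuous_on S h"
  by (meson continuous_at_imp_continuous_on has_derivative_continuous holomorphic_map_derivative(1))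

text \<open>\<open>holomorphic_map_on\<close> asks for complex differentiability at each point. The
  mean value property on circles shows that each real component coincides locally with its own
  mollification, which is smooth.\<close>

lemma holomorphic_map_smooth:
  fixes h :: "complex^'n \<Rightarrow> complex^'m"
  assumes "open S" "holomorphic_map_on S h"
  shows "smooth_on S h"
proof (rule smooth_on_components[OF assms(1)])
  fix b :: "complex^'m"
  show "smooth_on S (\<lambda>z. h z \<bullet> b)"
  proof (rule smooth_on_local)
    fix z0 assume "z0 \<in> S"
    then obtain r where r: "0 < r" "cball z0 r \<subseteq> S" using assms(1) open_contains_cball by blast
    define d where "d = r / 2"
    have d: "0 < d" "d + d = r" using r by (auto simp: d_def)
    have "continuous_on (cball z0 r) (\<lambda>z. h z \<bullet> b)"
      using holomorphic_map_continuous[OF assms(2)] r(2) by (intro continuous_intros) (rule continuous_on_subset)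
    \<comment> \<open>A global continuous extension, because \<open>rotation_mean_value\<close>
      integrates over the whole space.\<close>
    then obtain F :: "complex^'n \<Rightarrow> real" where F: "continuous_on UNIV F" "\<And>z. z \<in> cball z0 r \<Longrightarrow> F z = h z \<bullet> b"
      using Tietze_unbounded[of "cball z0 r" "\<lambda>z. h z \<bullet> b" UNIV] by auto
    define U where "U x = indicator (cball z0 r) x *\<^sub>R F x" for x
    have U: "integrable lborel U" unfolding U_def[abs_def]
      by (rule borel_integrable_compact[OF compact_cball continuous_on_subset[OF F(1) subset_UNIV]])
    have eq: "h z \<bullet> b = mollify U d z" if z: "z \<in> ball z0 d" for z
    proof -
      have sub: "cball z d \<subseteq> cball z0 r"
      proof
        fix x assume "x \<in> cball z d"
        then show "x \<in> cball z0 r" using z d dist_triangle[of z0 x z] by auto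
      qed
      have zr: "z \<in> cball z0 r" using z d by auto
      have "(\<integral>w. F (z + w) * moll d w \<partial>lborel) = F z"
      proof (rule rotation_mean_value[OF F(1) d(1)])
        fix w :: "complex^'n" assume w: "norm w \<le> d"
        have "z + exp (2 * of_real pi * \<i> * of_real t) *s w \<in> cball z0 r" for t :: real
          using sub w by (intro subsetD[OF sub]) (simp add: dist_norm norm_vector_scalar_mult)
        then show "((\<lambda>t. F (z + exp (2 * of_real pi * \<i> * of_real t) *s w)) has_integral F z) {0..1}"
          using holomorphic_map_mean_value[OF assms order_trans[OF sub r(2)] w, of b] F(2) zr by simp
      qed
      also have "(\<integral>w. F (z + w) * moll d w \<partial>lborel) = (\<integral>x. F x * moll d (x - z) \<partial>lborel)"
      proof -
        have "(\<lambda>x. F x * moll d (x - z)) \<in> borel_measurable borel"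
          by (intro borel_measurable_continuous_onI continuous_on_mult F continuous_on_compose2[OF continuous_on_moll[of UNIV]]) (auto intro!: continuous_intros)
        from lborel_integral_affine[OF this, of 1 z] show ?thesis by simp
      qed
      also have "\<dots> = mollify U d z"
        unfolding conv_def
      proof (intro Bochner_Integration.integral_cong refl)
        fix x
        show "F x * moll d (x - z) = U x * moll d (z - x)"
        proof (cases "x \<in> cball z d")
          case True
          then show ?thesis using sub by (auto simp: U_def indicator_def moll_commute)
        next
          case False
          then show ?thesis using d(1) by (simp add: moll_outside dist_norm norm_minus_commute)
        qed
      qed
      finally show ?thesis using F(2)[OF zr] by simp
    qed
    have "smooth_on (ball z0 d) (\<lambda>z. h z \<bullet> b)"
      using smooth_on_cong[OF open_ball, of z0 d "\<lambda>z. h z \<bullet> b" "mollify U d"] eq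
        smooth_on_subset[OF smooth_on_mollify[OF U d(1)] subset_UNIV] by simp
    then show "\<exists>W. open W \<and> z0 \<in> W \<and> smooth_on W (\<lambda>z. h z \<bullet> b)"
      using d(1) by (intro exI[of _ "ball z0 d"]) auto
  qed
qed

section \<open>Integration by parts\<close>

text \<open>The integral of h (w + t v) over w does not depend on t; its derivative at t = 0 is the
  integral in question. The factor k is 1 where h (w + t v) can be nonzero for |t| < 1 and supplies
  the compact support for differentiation under the integral.\<close>

lemma integral_dird_zero:
  fixes h :: "'a::euclidean_space \<Rightarrow> real"
  assumes h: "smooth_on UNIV h" "\<And>x. x \<notin> cball 0 R \<Longrightarrow> h x = 0"
  shows "(\<integral>x. dird h v x \<partial>lborel) = 0"
proof -
  \<comment> \<open>The factor 4 appears because \<open>bump\<close> is 1 up to a quarter of its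
    radius.\<close>
  define \<rho> where "\<rho> = 4 * (\<bar>R\<bar> + norm v + 1)"
  have \<rho>: "0 < \<rho>" using norm_ge_zero[of v] by (simp add: \<rho>_def add_nonneg_pos)
  define k where "k x = bump ((1 / \<rho>) *\<^sub>R x)" for x :: 'a
  have ck: "continuous_on UNIV k" unfolding k_def
    by (rule continuous_on_compose2[OF smooth_on_continuous[OF smooth_on_bump]]) (auto intro!: continuous_intros)
  have k0: "k x = 0" if "x \<notin> cball 0 \<rho>" for x
    using that \<rho> by (auto simp: k_def intro!: bump_outside)
  have k1: "k x = 1" if "norm x \<le> \<bar>R\<bar> + norm v + 1" for x
    unfolding k_def using that \<rho> by (intro bump_plateau) (simp add: \<rho>_def field_simps)
  have cd: "continuous_on UNIV (\<lambda>(t, w). dird h v (w + t *\<^sub>R v))"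
    unfolding case_prod_beta
    by (rule continuous_on_compose2[OF smooth_on_continuous[OF smooth_on_dird[OF h(1)]]]) (auto intro!: continuous_intros)
  have "((\<lambda>t. \<integral>w. h (w + t *\<^sub>R v) * k w \<partial>lborel) has_real_derivative (\<integral>w. dird h v (w + 0 *\<^sub>R v) * k w \<partial>lborel)) (at 0)"
  proof (rule integral_kernel_derivative[OF _ _ cd ck k0])
    show "((\<lambda>t. h (w + t *\<^sub>R v)) has_real_derivative dird h v (w + t *\<^sub>R v)) (at t)" for t w
      by (rule has_real_derivative_along[OF h(1)]) simp
    show "continuous_on UNIV (\<lambda>w. h (w + t *\<^sub>R v))" for t
      by (rule continuous_on_compose2[OF smooth_on_continuous[OF h(1)]]) (auto intro!: continuous_intros)
  qed
  moreover have "(\<integral>w. h (w + t *\<^sub>R v) * k w \<partial>lborel) = (\<integral>w. h w \<partial>lborel)" if "\<bar>t\<bar> < 1" for t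
  proof -
    have e: "h (w + t *\<^sub>R v) * k w = h (w + t *\<^sub>R v)" for w
    proof (cases "norm (w + t *\<^sub>R v) \<le> R")
      case True
      have "norm w \<le> norm (w + t *\<^sub>R v) + norm (t *\<^sub>R v)" using norm_triangle_ineq4[of "w + t *\<^sub>R v" "t *\<^sub>R v"] by simp
      also have "norm (t *\<^sub>R v) \<le> 1 * norm v" unfolding norm_scaleR using that by (intro mult_right_mono) auto
      finally have "norm w \<le> \<bar>R\<bar> + norm v + 1" using True by linarith
      then show ?thesis using k1 by simp
    qed (use h(2) in auto)
    have "(\<integral>w. h (w + t *\<^sub>R v) * k w \<partial>lborel) = (\<integral>w. h (t *\<^sub>R v + 1 *\<^sub>R w) \<partial>lborel)"
      unfolding e by (simp add: add.commute)
    also have "\<dots> = (\<integral>w. h w \<partial>lborel)"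
      using lborel_integral_affine[OF borel_measurable_smooth[OF h(1)], of 1 "t *\<^sub>R v"] by simp
    finally show ?thesis .
  qed
  then have "((\<lambda>t. \<integral>w. h (w + t *\<^sub>R v) * k w \<partial>lborel) has_real_derivative 0) (at 0)"
    by (intro has_field_derivative_transform_within_open[OF DERIV_const, of "ball 0 1"]) auto
  ultimately have "(\<integral>w. dird h v (w + 0 *\<^sub>R v) * k w \<partial>lborel) = 0" by (rule DERIV_unique)
  moreover have e: "dird h v w * k w = dird h v w" for w
  proof (cases "w \<in> cball 0 R")
    case True
    then have "norm w \<le> R" by simp
    then have "norm w \<le> \<bar>R\<bar> + norm v + 1" using norm_ge_zero[of v] by linarith
    then show ?thesis using k1[of w] by simp
  next
    case False
    have "dird h v w = 0" by (rule dird_outside_cball[OF _ False]) (rule h(2))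
    then show ?thesis by simp
  qed
  ultimately show ?thesis unfolding scaleR_zero_left add_0_right e by blast
qed

text \<open>Meant for f smooth on V and G vanishing outside a compact subset of V: extension by 0
  then keeps the product smooth, whatever f is outside V.\<close>

definition ext_mult :: "'a set \<Rightarrow> ('a \<Rightarrow> real) \<Rightarrow> ('a \<Rightarrow> real) \<Rightarrow> 'a \<Rightarrow> real" where
  "ext_mult V f G x = (if x \<in> V then f x * G x else 0)"

locale test_pair =
  fixes V K :: "'a::euclidean_space set"
  assumes V: "open V" and K: "compact K" "K \<subseteq> V"
begin

lemma smooth_on_ext_mult:
  assumes "smooth_on V f" "smooth_on UNIV G" "\<And>x. x \<notin> K \<Longrightarrow> G x = 0"
  shows "smooth_on UNIV (ext_mult V f G)"
proof (rule smooth_on_local)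
  fix x
  show "\<exists>U. open U \<and> x \<in> U \<and> smooth_on U (ext_mult V f G)"
  proof (cases "x \<in> V")
    case True
    have "smooth_on V (\<lambda>x. f x * G x)"
      by (intro smooth_on_mult V assms(1) smooth_on_subset[OF assms(2)] subset_UNIV)
    then have "smooth_on V (ext_mult V f G)"
      using smooth_on_cong[OF V, of "ext_mult V f G" "\<lambda>x. f x * G x"] by (simp add: ext_mult_def)
    then show ?thesis using True V by blast
  next
    case False
    have oK: "open (- K)" using K(1) compact_imp_closed by auto
    have "smooth_on (- K) (ext_mult V f G)"
      using smooth_on_cong[OF oK, of "ext_mult V f G" "\<lambda>x. 0"] smooth_on_const[OF oK, of "0::real"] assms(3) by (auto simp: ext_mult_def)
    then show ?thesis using False K(2) oK by blast
  qed
qed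

lemma support_cball: obtains R where "\<And>x. x \<notin> cball 0 R \<Longrightarrow> x \<notin> K"
proof -
  obtain R where "K \<subseteq> ball 0 R" using bounded_subset_ballD[OF compact_imp_bounded[OF K(1)], of 0] by blast
  then show thesis by (intro that[of R]) auto
qed

lemma dird_support: "(\<And>x. x \<notin> K \<Longrightarrow> G x = 0) \<Longrightarrow> x \<notin> K \<Longrightarrow> dird G v x = 0"
  by (rule dird_outside[OF compact_imp_closed[OF K(1)]])

lemma integrable_ext_mult:
  assumes "continuous_on V f" "continuous_on UNIV G" "\<And>x. x \<notin> K \<Longrightarrow> G x = 0"
  shows "integrable lborel (ext_mult V f G)"
proof -
  have "integrable lborel (\<lambda>x. indicator K x *\<^sub>R (f x * G x))"
    by (intro borel_integrable_compact K continuous_on_mult continuous_on_subset[OF assms(1)] continuous_on_subset[OF assms(2)] subset_UNIV)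
  also have "(\<lambda>x. indicator K x *\<^sub>R (f x * G x)) = ext_mult V f G"
    using assms(3) K(2) by (auto simp: fun_eq_iff ext_mult_def indicator_def)
  finally show ?thesis .
qed

lemma integration_by_parts:
  assumes f: "smooth_on V f" and G: "smooth_on UNIV G" "\<And>x. x \<notin> K \<Longrightarrow> G x = 0"
  shows "(\<integral>x. ext_mult V f (dird G v) x \<partial>lborel) = - (\<integral>x. ext_mult V (dird f v) G x \<partial>lborel)"
proof -
  have sp: "smooth_on UNIV (ext_mult V f G)" by (rule smooth_on_ext_mult[OF f G])
  have eq: "dird (ext_mult V f G) v x = ext_mult V f (dird G v) x + ext_mult V (dird f v) G x" for x
  proof (cases "x \<in> V")
    case True
    have "((\<lambda>x. f x * G x) has_derivative (\<lambda>w. f x * dird G w x + dird f w x * G x)) (at x)"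
      by (intro has_derivative_mult smooth_on_has_derivative[OF f True] smooth_on_has_derivative[OF G(1) UNIV_I])
    then have "(ext_mult V f G has_derivative (\<lambda>w. f x * dird G w x + dird f w x * G x)) (at x)"
      using has_derivative_cong_open[OF V True, of "ext_mult V f G" "\<lambda>x. f x * G x"] by (simp add: ext_mult_def)
    then show ?thesis using True dird_eq by (simp add: ext_mult_def)
  next
    case False
    then have "x \<notin> K" using K(2) by auto
    have "dird (ext_mult V f G) v x = 0"
    proof (rule dird_support)
      show "ext_mult V f G y = 0" if "y \<notin> K" for y using G(2)[OF that] by (simp add: ext_mult_def)
    qed fact
    then show ?thesis using False by (simp add: ext_mult_def)
  qed
  obtain R where R: "\<And>x. x \<notin> cball 0 R \<Longrightarrow> x \<notin> K" by (rule support_cball) blast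
  have "(\<integral>x. dird (ext_mult V f G) v x \<partial>lborel) = 0"
  proof (rule integral_dird_zero[OF sp])
    show "ext_mult V f G x = 0" if "x \<notin> cball 0 R" for x using G(2)[OF R[OF that]] by (simp add: ext_mult_def)
  qed
  moreover have "integrable lborel (ext_mult V f (dird G v))" "integrable lborel (ext_mult V (dird f v) G)"
    by (intro integrable_ext_mult smooth_on_continuous smooth_on_dird f G dird_support[OF G(2)]; assumption)+
  ultimately show ?thesis by (simp add: eq)
qed

lemma integration_by_parts_twice:
  assumes f: "smooth_on V f" and G: "smooth_on UNIV G" "\<And>x. x \<notin> K \<Longrightarrow> G x = 0"
  shows "(\<integral>x. ext_mult V f (dird (dird G b) a) x \<partial>lborel) = (\<integral>x. ext_mult V (dird (dird f a) b) G x \<partial>lborel)"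
  using integration_by_parts[OF f smooth_on_dird[OF G(1)] dird_support[OF G(2)], of b a]
    integration_by_parts[OF smooth_on_dird[OF f] G, of a b] by simp

end

section \<open>Positive semidefinite matrices\<close>

lemma hermitian_form_axis:
  fixes F :: "complex^'n^'n" and v :: "complex^'n"
  shows
  "hermitian_form F (v + axis i s) = hermitian_form F v + s * cnj s * F $ i $ i
     + cnj s * (\<Sum>j\<in>UNIV. F $ j $ i * v $ j) + s * (\<Sum>k\<in>UNIV. F $ i $ k * cnj (v $ k))"
proof -
  have a: "axis i s $ j = (if j = i then s else 0)" for j :: 'n by (simp add: axis_def)
  have e: "F $ j $ k * (v + axis i s) $ j * cnj ((v + axis i s) $ k) =
     F $ j $ k * v $ j * cnj (v $ k) + F $ j $ k * v $ j * cnj (axis i s $ k)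
     + (F $ j $ k * axis i s $ j * cnj (v $ k) + F $ j $ k * axis i s $ j * cnj (axis i s $ k))" for j k
    by (simp only: vector_add_component complex_cnj_add distrib_left distrib_right add_ac)
  have "hermitian_form F (v + axis i s) =
     (\<Sum>j\<in>UNIV. \<Sum>k\<in>UNIV. F $ j $ k * v $ j * cnj (v $ k)) + (\<Sum>j\<in>UNIV. \<Sum>k\<in>UNIV. F $ j $ k * v $ j * cnj (axis i s $ k))
     + ((\<Sum>j\<in>UNIV. \<Sum>k\<in>UNIV. F $ j $ k * axis i s $ j * cnj (v $ k)) + (\<Sum>j\<in>UNIV. \<Sum>k\<in>UNIV. F $ j $ k * axis i s $ j * cnj (axis i s $ k)))"
    unfolding hermitian_form_def e by (simp only: sum.distrib)
  moreover have "(\<Sum>j\<in>UNIV. \<Sum>k\<in>UNIV. F $ j $ k * v $ j * cnj (axis i s $ k)) = cnj s * (\<Sum>j\<in>UNIV. F $ j $ i * v $ j)"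
    by (simp add: a if_distrib[of cnj] if_distrib[of "\<lambda>x. _ * x"] sum_distrib_left mult_ac cong: if_cong)
  moreover have "(\<Sum>j\<in>UNIV. \<Sum>k\<in>UNIV. F $ j $ k * axis i s $ j * cnj (v $ k)) = s * (\<Sum>k\<in>UNIV. F $ i $ k * cnj (v $ k))"
    by (subst sum.swap) (simp add: a if_distrib[of "\<lambda>x. _ * x"] if_distrib[of "\<lambda>x. x * _"] sum_distrib_left mult_ac cong: if_cong)
  moreover have "(\<Sum>j\<in>UNIV. \<Sum>k\<in>UNIV. F $ j $ k * axis i s $ j * cnj (axis i s $ k)) = s * cnj s * F $ i $ i"
  proof -
    have "(\<Sum>k\<in>UNIV. F $ j $ k * axis i s $ j * cnj (axis i s $ k)) = F $ j $ i * axis i s $ j * cnj s" for j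
      by (simp add: a if_distrib[of cnj] if_distrib[of "\<lambda>x. _ * x"] cong: if_cong)
    then show ?thesis
      by (simp add: a if_distrib[of "\<lambda>x. _ * x"] if_distrib[of "\<lambda>x. x * _"] mult_ac cong: if_cong)
  qed
  ultimately show ?thesis by (simp add: hermitian_form_def)
qed

lemma pos_semidefinite_diagonal:
  fixes F :: "complex^'n^'n"
  assumes "pos_semidefinite F"
  shows "F $ i $ i = of_real (Re (F $ i $ i))" "0 \<le> Re (F $ i $ i)"
proof -
  have "F $ i $ i = cnj (F $ i $ i)" using assms unfolding pos_semidefinite_def hermitian_def by blast
  then show "F $ i $ i = of_real (Re (F $ i $ i))" by (metis Reals_cnj_iff of_real_Re)
  have "hermitian_form F (0 + axis i 1) = F $ i $ i" by (subst hermitian_form_axis) (simp add: hermitian_form_def)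
  then show "0 \<le> Re (F $ i $ i)" using assms by (metis pos_semidefinite_def)
qed

text \<open>If the diagonal entry is 0, the form at e_j + s e_i has no quadratic term in s. Along s
  = -t cnj c it decreases linearly in t without bound, unless c = 0.\<close>

lemma pos_semidefinite_zero_diagonal:
  fixes F :: "complex^'n^'n"
  assumes F: "pos_semidefinite F" and "F $ i $ i = 0"
  shows "F $ i $ j = 0"
proof (cases "j = i")
  case False
  define c where "c = F $ i $ j"
  have cj: "F $ j $ i = cnj c" using F unfolding pos_semidefinite_def hermitian_def c_def by blast
  have "0 \<le> Re (F $ j $ j) - 2 * t * (cmod c)\<^sup>2" for t :: real
  proof -
    define s where "s = - of_real t * cnj c"
    have v: "hermitian_form F (0 + axis j 1) = F $ j $ j" by (subst hermitian_form_axis) (simp add: hermitian_form_def)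
    have "hermitian_form F (axis j 1 + axis i s) = F $ j $ j + cnj s * F $ j $ i + s * F $ i $ j"
      using v assms(2) False
      by (subst hermitian_form_axis) (simp add: axis_def if_distrib[of cnj] if_distrib[of "\<lambda>x. _ * x"] cong: if_cong)
    also have "\<dots> = F $ j $ j - of_real (2 * t) * (c * cnj c)" by (simp add: s_def cj c_def[symmetric] algebra_simps)
    also have "\<dots> = F $ j $ j - of_real (2 * t * (cmod c)\<^sup>2)" by (simp add: mult.assoc complex_norm_square flip: of_real_power)
    finally have "Re (hermitian_form F (axis j 1 + axis i s)) = Re (F $ j $ j) - 2 * t * (cmod c)\<^sup>2" by simp
    then show ?thesis using F by (metis pos_semidefinite_def)
  qed
  \<comment> \<open>For c nonzero, the nonnegative expression would be -1 at this t.\<close>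
  from this[of "(Re (F $ j $ j) + 1) / (2 * (cmod c)\<^sup>2)"] have "c = 0" by (cases "c = 0") auto
  then show ?thesis by (simp add: c_def)
qed (use assms in simp)

text \<open>Gaussian elimination writes a positive semidefinite matrix as a sum of matrices
  \<open>u\<^sub>j conj(u\<^sub>k)\<close>, for which the pairing is a value of the form of \<open>B\<close>.\<close>

lemma pos_semidefinite_pairing:
  fixes B F :: "complex^'n^'n"
  assumes B: "\<And>v. 0 \<le> Re (hermitian_form B v)" and "pos_semidefinite F"
  shows "0 \<le> Re (\<Sum>j\<in>UNIV. \<Sum>k\<in>UNIV. B $ j $ k * F $ j $ k)"
proof -
  have "finite K \<Longrightarrow> pos_semidefinite F \<Longrightarrow> (\<And>j k. j \<notin> K \<Longrightarrow> F $ j $ k = 0) \<Longrightarrow>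
     0 \<le> Re (\<Sum>j\<in>UNIV. \<Sum>k\<in>UNIV. B $ j $ k * F $ j $ k)" for K and F :: "complex^'n^'n"
  proof (induction K arbitrary: F rule: finite_induct)
    case empty
    then show ?case by simp
  next
    case (insert i K)
    have herm: "F $ k $ j = cnj (F $ j $ k)" for j k using insert.prems(1) unfolding pos_semidefinite_def hermitian_def by blast
    show ?case
    proof (cases "F $ i $ i = 0")
      case True
      show ?thesis
      proof (rule insert.IH[OF insert.prems(1)])
        fix j k assume j: "j \<notin> K"
        show "F $ j $ k = 0"
        proof (cases "j = i")
          case i: True
          show ?thesis using pos_semidefinite_zero_diagonal[OF insert.prems(1) True, of k] i by simp
        next
          case False
          then show ?thesis using insert.prems(2)[of j k] j by simp
        qed
      qed
    next
      case False
      define a where "a = Re (F $ i $ i)"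
      have Fii: "F $ i $ i = of_real a" and a: "0 < a"
        using pos_semidefinite_diagonal[OF insert.prems(1), of i] False by (auto simp: a_def less_le)
      define u where "u = (\<chi> j. F $ j $ i)"
      define F' where "F' = (\<chi> j k. F $ j $ k - u $ j * cnj (u $ k) / of_real a)"
      \<comment> \<open>Completing the square: subtracting the rank-one part is the same as
        evaluating F after the shift of coordinate i that minimises the form.\<close>
      have form: "hermitian_form F' v = hermitian_form F (v + axis i (- (\<Sum>j\<in>UNIV. u $ j * v $ j) / of_real a))" for v
      proof -
        define L where "L = (\<Sum>j\<in>UNIV. u $ j * v $ j)"
        have L': "(\<Sum>k\<in>UNIV. F $ i $ k * cnj (v $ k)) = cnj L"
          unfolding L_def cnj_sum by (rule sum.cong) (simp_all add: u_def herm[of i])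
        have "hermitian_form F' v = hermitian_form F v - (\<Sum>j\<in>UNIV. \<Sum>k\<in>UNIV. (u $ j * v $ j) * (cnj (u $ k) * cnj (v $ k))) / of_real a"
          by (simp add: hermitian_form_def F'_def left_diff_distrib right_diff_distrib sum_subtractf sum_divide_distrib mult_ac)
        also have "(\<Sum>j\<in>UNIV. \<Sum>k\<in>UNIV. (u $ j * v $ j) * (cnj (u $ k) * cnj (v $ k))) = L * cnj L"
          by (simp add: L_def sum_product cnj_sum)
        finally have 1: "hermitian_form F' v = hermitian_form F v - L * cnj L / of_real a" .
        have "hermitian_form F (v + axis i (- L / of_real a)) = hermitian_form F v - L * cnj L / of_real a"
          using a L' by (subst hermitian_form_axis) (simp add: Fii L_def u_def field_simps)
        then show ?thesis using 1 by (simp add: L_def)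
      qed
      have psd: "pos_semidefinite F'"
        unfolding pos_semidefinite_def hermitian_def
      proof (intro conjI allI)
        show "F' $ k $ j = cnj (F' $ j $ k)" for j k by (simp add: F'_def herm[of k j] mult.commute)
        show "0 \<le> Re (hermitian_form F' v)" for v
          unfolding form using insert.prems(1) by (simp add: pos_semidefinite_def)
      qed
      have "0 \<le> Re (\<Sum>j\<in>UNIV. \<Sum>k\<in>UNIV. B $ j $ k * F' $ j $ k)"
      proof (rule insert.IH[OF psd])
        fix j k assume j: "j \<notin> K"
        show "F' $ j $ k = 0"
        proof (cases "j = i")
          case True
          then show ?thesis using a by (simp add: F'_def u_def Fii herm[of k i])
        next
          case False
          then show ?thesis using insert.prems(2)[of j] j by (simp add: F'_def u_def)
        qed
      qed
      moreover have "(\<Sum>j\<in>UNIV. \<Sum>k\<in>UNIV. B $ j $ k * F $ j $ k) = (\<Sum>j\<in>UNIV. \<Sum>k\<in>UNIV. B $ j $ k * F' $ j $ k) + hermitian_form B u / of_real a"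
        by (simp add: hermitian_form_def F'_def sum_divide_distrib right_diff_distrib sum_subtractf mult_ac)
      ultimately show ?thesis using B[of u] a by simp
    qed
  qed
  from this[of UNIV F] assms(2) show ?thesis by simp
qed

section \<open>Currents in a chart\<close>

lemma dird_linear_compose:
  assumes "bounded_linear L" "smooth_on S G" "z \<in> S"
  shows "dird (\<lambda>w. L (G w)) b z = L (dird G b z)"
  by (rule dird_eq[OF bounded_linear.has_derivative[OF assms(1) smooth_on_has_derivative[OF assms(2,3)]]])

lemma dird_dird_linear_compose:
  assumes "bounded_linear L" "open S" "smooth_on S G" "z \<in> S"
  shows "dird (dird (\<lambda>w. L (G w)) b) a z = L (dird (dird G b) a z)"
proof -
  have "dird (dird (\<lambda>w. L (G w)) b) a z = dird (\<lambda>w. L (dird G b w)) a z"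
    by (rule fun_cong[OF frechet_derivative_cong_open[OF assms(2,4)]]) (rule dird_linear_compose[OF assms(1,3)])
  also have "\<dots> = L (dird (dird G b) a z)"
    by (rule dird_linear_compose[OF assms(1) smooth_on_dird[OF assms(3)] assms(4)])
  finally show ?thesis .
qed

lemma Re_dz_dzbar:
  fixes G :: "complex^'n \<Rightarrow> complex"
  assumes S: "open S" and G: "smooth_on S G" and z: "z \<in> S"
  shows "Re (dz j (dzbar k G) z) =
    (Re (dird (dird G (axis k 1)) (axis j 1) z) + Re (dird (dird G (axis k \<i>)) (axis j \<i>) z)
     - (Im (dird (dird G (axis k \<i>)) (axis j 1) z) - Im (dird (dird G (axis k 1)) (axis j \<i>) z))) / 4"
proof -
  have e: "dzbar k G = (\<lambda>w. (dird G (axis k 1) w + \<i> * dird G (axis k \<i>) w) / 2)"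
    by (simp add: dzbar_def fun_eq_iff)
  have "(dzbar k G has_derivative (\<lambda>a. (dird (dird G (axis k 1)) a z + \<i> * dird (dird G (axis k \<i>)) a z) / 2)) (at z)"
    unfolding e divide_inverse
    by (intro has_derivative_mult_left has_derivative_add has_derivative_mult_right has_derivative_dird[OF G z])
  note d = dird_eq[OF this]
  show ?thesis by (simp add: dz_def d add_divide_distrib diff_divide_distrib)
qed

text \<open>The mixed Wirtinger derivatives of f, with index j for z and k for its conjugate, in
  terms of real derivatives. Direction j is differentiated first, because two integrations by parts
  of \<open>dz j (dzbar k F)\<close> leave the derivatives on f in this order.\<close>

definition ddbar :: "(complex^'n \<Rightarrow> real) \<Rightarrow> complex^'n \<Rightarrow> complex^'n^'n" where
  "ddbar f z = (\<chi> j k. Complex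
     ((dird (dird f (axis j 1)) (axis k 1) z + dird (dird f (axis j \<i>)) (axis k \<i>) z) / 4)
     ((dird (dird f (axis j 1)) (axis k \<i>) z - dird (dird f (axis j \<i>)) (axis k 1) z) / 4))"

text \<open>Adding the value at \<i> v leaves only the part of M that depends on the products v_j
  conj(v_k). This links \<open>levi\<close> to Wirtinger derivatives, for smooth functions as well
  as for test functions.\<close>

lemma bilinear_wirtinger:
  fixes M :: "complex^'n \<Rightarrow> complex^'n \<Rightarrow> real"
  assumes M: "bilinear M"
  shows "M v v + M (\<i> *s v) (\<i> *s v) = (\<Sum>j\<in>UNIV. \<Sum>k\<in>UNIV.
      (M (axis j 1) (axis k 1) + M (axis j \<i>) (axis k \<i>)) * Re (v $ j * cnj (v $ k))
      - (M (axis j 1) (axis k \<i>) - M (axis j \<i>) (axis k 1)) * Im (v $ j * cnj (v $ k)))"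
proof -
  have exp: "w = (\<Sum>j\<in>UNIV. Re (w $ j) *\<^sub>R axis j 1 + Im (w $ j) *\<^sub>R axis j \<i>)" for w :: "complex^'n"
  proof -
    have "(\<Sum>j\<in>UNIV. Re (w $ j) *\<^sub>R axis j 1 + Im (w $ j) *\<^sub>R axis j \<i>) $ i =
        (\<Sum>j\<in>UNIV. if j = i then w $ i else 0)" for i
      unfolding sum_component
      by (rule sum.cong) (auto simp: axis_def complex_eq_iff)
    then show ?thesis by (simp add: vec_eq_iff)
  qed
  have eq: "M w w = (\<Sum>j\<in>UNIV. \<Sum>k\<in>UNIV. Re (w $ j) * Re (w $ k) * M (axis j 1) (axis k 1)
      + Re (w $ j) * Im (w $ k) * M (axis j 1) (axis k \<i>) + Im (w $ j) * Re (w $ k) * M (axis j \<i>) (axis k 1)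
      + Im (w $ j) * Im (w $ k) * M (axis j \<i>) (axis k \<i>))" for w
  proof -
    define A where "A = (\<lambda>j. Re (w $ j) *\<^sub>R axis j 1 + Im (w $ j) *\<^sub>R axis j \<i>)"
    have "M w w = M (\<Sum>j\<in>UNIV. A j) (\<Sum>j\<in>UNIV. A j)" using exp[of w] by (simp add: A_def)
    also have "\<dots> = (\<Sum>j\<in>UNIV. \<Sum>k\<in>UNIV. M (A j) (A k))"
      by (simp add: bilinear_sum[OF M] sum.cartesian_product)
    finally have MA: "M w w = (\<Sum>j\<in>UNIV. \<Sum>k\<in>UNIV. M (A j) (A k))" .
    have "M (A j) (A k) = Re (w $ j) * Re (w $ k) * M (axis j 1) (axis k 1)
      + Re (w $ j) * Im (w $ k) * M (axis j 1) (axis k \<i>) + Im (w $ j) * Re (w $ k) * M (axis j \<i>) (axis k 1)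
      + Im (w $ j) * Im (w $ k) * M (axis j \<i>) (axis k \<i>)" for j k
      by (simp add: A_def bilinear_ladd[OF M] bilinear_radd[OF M] bilinear_lmul[OF M] bilinear_rmul[OF M] algebra_simps)
    then show ?thesis unfolding MA by (intro sum.cong refl)
  qed
  have c: "Re (v $ j * cnj (v $ k)) = Re (v $ j) * Re (v $ k) + Im (v $ j) * Im (v $ k)"
    "Im (v $ j * cnj (v $ k)) = Im (v $ j) * Re (v $ k) - Re (v $ j) * Im (v $ k)"
    "Re ((\<i> *s v) $ j) = - Im (v $ j)" "Im ((\<i> *s v) $ j) = Re (v $ j)" for j k
    by simp_all
  have "a * b * p + a * y * q + x * b * r + x * y * s + (- x * - y * p + - x * b * q + a * - y * r + a * b * s)
      = (p + s) * (a * b + x * y) - (q - r) * (x * b - a * y)" for a b x y p q r s :: real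
    by (simp add: algebra_simps)
  note pt = this
  show ?thesis
    unfolding eq[of v] eq[of "\<i> *s v"] sum.distrib[symmetric] c pt ..
qed

lemma bilinear_dird_dird:
  fixes f :: "'a::euclidean_space \<Rightarrow> real"
  assumes "open S" "smooth_on S f" "z \<in> S"
  shows "bilinear (\<lambda>v w. dird (dird f v) w z)"
  unfolding bilinear_def
proof (intro conjI allI)
  show "linear (\<lambda>w. dird (dird f v) w z)" for v
    by (rule dird_linear[OF smooth_on_dird[OF assms(2)] assms(3)])
  fix w
  define c where "c = (\<lambda>b. dird (dird f b) w z)"
  have e: "c = (\<lambda>v. \<Sum>b\<in>Basis. (v \<bullet> b) *\<^sub>R c b)"
    unfolding c_def by (rule ext) (rule dird_dird_Basis[OF assms])
  have "linear c"
    by (subst e) (simp add: linear_iff inner_add_left sum.distrib sum_distrib_left algebra_simps)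
  then show "linear (\<lambda>v. dird (dird f v) w z)" unfolding c_def .
qed

lemma bilinear_swap: "bilinear h \<Longrightarrow> bilinear (\<lambda>v w. h w v)"
  by (simp add: bilinear_def)

lemma hermitian_form_ddbar:
  assumes "open S" "smooth_on S f" "z \<in> S"
  shows "Re (hermitian_form (ddbar f z) v) = levi f z v / 4"
  unfolding levi_def bilinear_wirtinger[OF bilinear_dird_dird[OF assms]]
  unfolding hermitian_form_def Re_sum sum_divide_distrib
  by (intro sum.cong refl) (simp add: ddbar_def mult.assoc field_simps)

text \<open>The real and imaginary parts of F are real test functions, and the real integration by
  parts applies to each of the four second derivatives.\<close>

lemma dz_dzbar_integration_by_parts:
  fixes F :: "complex^'n \<Rightarrow> complex"
  assumes "test_pair V K" and f: "smooth_on V f" and F: "smooth_on UNIV F" "\<And>x. x \<notin> K \<Longrightarrow> F x = 0"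
  shows "integrable lborel (ext_mult V f (\<lambda>z. Re (dz j (dzbar k F) z)))"
    "integrable lborel (ext_mult V (\<lambda>z. 1) (\<lambda>z. Re (ddbar f z $ j $ k * F z)))"
    "(\<integral>z. ext_mult V f (\<lambda>z. Re (dz j (dzbar k F) z)) z \<partial>lborel) =
     (\<integral>z. ext_mult V (\<lambda>z. 1) (\<lambda>z. Re (ddbar f z $ j $ k * F z)) z \<partial>lborel)"
proof -
  interpret test_pair V K by fact
  define P where "P = (\<lambda>z. Re (F z))"
  define Q where "Q = (\<lambda>z. Im (F z))"
  have P: "smooth_on UNIV P" "\<And>x. x \<notin> K \<Longrightarrow> P x = 0"
    unfolding P_def using F smooth_on_linear_compose[OF open_UNIV bounded_linear_Re F(1)] by auto
  have Q: "smooth_on UNIV Q" "\<And>x. x \<notin> K \<Longrightarrow> Q x = 0"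
    unfolding Q_def using F smooth_on_linear_compose[OF open_UNIV bounded_linear_Im F(1)] by auto
  have ReD: "Re (dird (dird F b) a z) = dird (dird P b) a z" for a b z
    unfolding P_def by (rule dird_dird_linear_compose[OF bounded_linear_Re open_UNIV F(1) UNIV_I, symmetric])
  have ImD: "Im (dird (dird F b) a z) = dird (dird Q b) a z" for a b z
    unfolding Q_def by (rule dird_dird_linear_compose[OF bounded_linear_Im open_UNIV F(1) UNIV_I, symmetric])
  define L where "L = (\<lambda>G a b. ext_mult V f (dird (dird G b) a))"
  define R where "R = (\<lambda>G a b. ext_mult V (dird (dird f a) b) G)"
  have iL: "integrable lborel (L G a b)" and iR: "integrable lborel (R G a b)"
    and LR: "(\<integral>z. L G a b z \<partial>lborel) = (\<integral>z. R G a b z \<partial>lborel)"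
    if G: "smooth_on UNIV G" "\<And>x. x \<notin> K \<Longrightarrow> G x = 0" for G a b
  proof -
    show "integrable lborel (L G a b)" unfolding L_def
    proof (rule integrable_ext_mult)
      show "dird (dird G b) a x = 0" if "x \<notin> K" for x
        by (rule dird_support[OF dird_support[OF G(2)] that])
    qed (intro smooth_on_continuous smooth_on_dird f G)+
    show "integrable lborel (R G a b)" unfolding R_def
      by (rule integrable_ext_mult) (intro smooth_on_continuous smooth_on_dird f G | simp add: G)+
    show "(\<integral>z. L G a b z \<partial>lborel) = (\<integral>z. R G a b z \<partial>lborel)"
      unfolding L_def R_def by (rule integration_by_parts_twice[OF f G])
  qed
  have el: "ext_mult V f (\<lambda>z. Re (dz j (dzbar k F) z)) =
      (\<lambda>z. (L P (axis j 1) (axis k 1) z + L P (axis j \<i>) (axis k \<i>) z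
         - (L Q (axis j 1) (axis k \<i>) z - L Q (axis j \<i>) (axis k 1) z)) / 4)"
    by (auto simp: fun_eq_iff ext_mult_def L_def Re_dz_dzbar[OF open_UNIV F(1) UNIV_I] ReD ImD field_simps)
  have er: "ext_mult V (\<lambda>z. 1) (\<lambda>z. Re (ddbar f z $ j $ k * F z)) =
      (\<lambda>z. (R P (axis j 1) (axis k 1) z + R P (axis j \<i>) (axis k \<i>) z
         - (R Q (axis j 1) (axis k \<i>) z - R Q (axis j \<i>) (axis k 1) z)) / 4)"
    by (auto simp: fun_eq_iff ext_mult_def R_def P_def Q_def ddbar_def field_simps)
  note i = iL[OF P] iL[OF Q] iR[OF P] iR[OF Q]
  show "integrable lborel (ext_mult V f (\<lambda>z. Re (dz j (dzbar k F) z)))"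
    unfolding el by (intro integrable_divide Bochner_Integration.integrable_add Bochner_Integration.integrable_diff i)
  show "integrable lborel (ext_mult V (\<lambda>z. 1) (\<lambda>z. Re (ddbar f z $ j $ k * F z)))"
    unfolding er by (intro integrable_divide Bochner_Integration.integrable_add Bochner_Integration.integrable_diff i)
  show "(\<integral>z. ext_mult V f (\<lambda>z. Re (dz j (dzbar k F) z)) z \<partial>lborel) =
     (\<integral>z. ext_mult V (\<lambda>z. 1) (\<lambda>z. Re (ddbar f z $ j $ k * F z)) z \<partial>lborel)"
    unfolding el er by (simp add: i LR[OF P] LR[OF Q])
qed

text \<open>Once both derivatives have been moved to f, the integrand is the pairing of
  \<open>G z + ddbar f z\<close> with the positive semidefinite matrix \<open>F z\<close>, hence
  pointwise nonnegative.\<close>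

lemma smooth_current_nonneg:
  fixes F :: "complex^'n \<Rightarrow> complex^'n^'n"
  assumes V: "open V" and f: "smooth_on V f" and G: "continuous_on V G" and F: "positive_test_form V F"
    and pos: "\<And>z v. z \<in> V \<Longrightarrow> - 4 * Re (hermitian_form (G z) v) \<le> levi f z v"
  shows "0 \<le> (LINT z:V|lborel. Re (\<Sum>j\<in>UNIV. \<Sum>k\<in>UNIV. G z $ j $ k * F z $ j $ k)
             + f z * Re (\<Sum>j\<in>UNIV. \<Sum>k\<in>UNIV. dz j (dzbar k (\<lambda>w. F w $ j $ k)) z))"
proof -
  obtain K where K': "compact K" "K \<subseteq> V" "\<And>z. z \<notin> K \<Longrightarrow> F z = 0"
    and sF: "smooth_on UNIV F" and psd: "\<And>z. pos_semidefinite (F z)"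
    using F unfolding positive_test_form_def by blast
  interpret test_pair V K by unfold_locales (fact V K')+
  have sFc: "smooth_on UNIV (\<lambda>w. F w $ j $ k)" for j k
    by (rule smooth_on_linear_compose[OF open_UNIV _ sF, of "\<lambda>A. A $ j $ k"])
       (intro bounded_linear_compose[OF bounded_linear_vec_nth] bounded_linear_vec_nth)
  have F0: "F x $ j $ k = 0" if "x \<notin> K" for x j k using K'(3)[OF that] by simp
  note ibp = dz_dzbar_integration_by_parts[OF test_pair_axioms f sFc F0]
  define g where "g = (\<lambda>z. Re (\<Sum>j\<in>UNIV. \<Sum>k\<in>UNIV. G z $ j $ k * F z $ j $ k))"
  have ig: "integrable lborel (\<lambda>z. indicator V z * g z)"
  proof -
    have "continuous_on K g" unfolding g_def
      by (intro continuous_intros continuous_on_subset[OF G K(2)] continuous_on_subset[OF smooth_on_continuous[OF sF]] subset_UNIV)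
    then have "integrable lborel (\<lambda>z. indicator K z *\<^sub>R g z)" by (rule borel_integrable_compact[OF K(1)])
    also have "(\<lambda>z. indicator K z *\<^sub>R g z) = (\<lambda>z. indicator V z * g z)"
      using K'(2,3) by (auto simp: fun_eq_iff indicator_def g_def)
    finally show ?thesis .
  qed
  have "(LINT z:V|lborel. Re (\<Sum>j\<in>UNIV. \<Sum>k\<in>UNIV. G z $ j $ k * F z $ j $ k)
             + f z * Re (\<Sum>j\<in>UNIV. \<Sum>k\<in>UNIV. dz j (dzbar k (\<lambda>w. F w $ j $ k)) z))
     = (\<integral>z. indicator V z * g z + (\<Sum>j\<in>UNIV. \<Sum>k\<in>UNIV. ext_mult V f (\<lambda>z. Re (dz j (dzbar k (\<lambda>w. F w $ j $ k)) z)) z) \<partial>lborel)"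
    unfolding set_lebesgue_integral_def
    by (rule Bochner_Integration.integral_cong) (auto simp: g_def ext_mult_def indicator_def sum_distrib_left)
  also have "\<dots> = (\<integral>z. indicator V z * g z \<partial>lborel)
      + (\<Sum>j\<in>UNIV. \<Sum>k\<in>UNIV. \<integral>z. ext_mult V f (\<lambda>z. Re (dz j (dzbar k (\<lambda>w. F w $ j $ k)) z)) z \<partial>lborel)"
    using ig ibp(1) by simp
  also have "\<dots> = (\<integral>z. indicator V z * g z \<partial>lborel)
      + (\<Sum>j\<in>UNIV. \<Sum>k\<in>UNIV. \<integral>z. ext_mult V (\<lambda>z. 1) (\<lambda>z. Re (ddbar f z $ j $ k * F z $ j $ k)) z \<partial>lborel)"
    by (intro arg_cong2[where f = "(+)"] refl sum.cong ibp(3))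
  also have "\<dots> = (\<integral>z. indicator V z * g z
      + (\<Sum>j\<in>UNIV. \<Sum>k\<in>UNIV. ext_mult V (\<lambda>z. 1) (\<lambda>z. Re (ddbar f z $ j $ k * F z $ j $ k)) z) \<partial>lborel)"
    using ig ibp(2) by simp
  also have "0 \<le> \<dots>"
  proof (rule Bochner_Integration.integral_nonneg)
    fix z
    show "0 \<le> indicator V z * g z + (\<Sum>j\<in>UNIV. \<Sum>k\<in>UNIV. ext_mult V (\<lambda>z. 1) (\<lambda>z. Re (ddbar f z $ j $ k * F z $ j $ k)) z)"
    proof (cases "z \<in> V")
      case True
      have "0 \<le> Re (\<Sum>j\<in>UNIV. \<Sum>k\<in>UNIV. (G z + ddbar f z) $ j $ k * F z $ j $ k)"
      proof (rule pos_semidefinite_pairing[OF _ psd])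
        fix v
        have "hermitian_form (G z + ddbar f z) v = hermitian_form (G z) v + hermitian_form (ddbar f z) v"
          by (simp add: hermitian_form_def distrib_right sum.distrib)
        then show "0 \<le> Re (hermitian_form (G z + ddbar f z) v)"
          using pos[OF True, of v] hermitian_form_ddbar[OF V f True, of v] by simp
      qed
      then show ?thesis using True by (simp add: g_def ext_mult_def distrib_right sum.distrib)
    qed (simp add: ext_mult_def)
  qed
  finally show ?thesis .
qed

lemma rank_one_pos_semidefinite:
  fixes v :: "complex^'n"
  assumes "0 \<le> (t::real)"
  shows "pos_semidefinite (t *\<^sub>R (\<chi> j k. v $ j * cnj (v $ k)))"
  unfolding pos_semidefinite_def hermitian_def
proof (intro conjI allI)
  fix w :: "complex^'n"
  have "hermitian_form (t *\<^sub>R (\<chi> j k. v $ j * cnj (v $ k))) w = t *\<^sub>R ((\<Sum>j\<in>UNIV. v $ j * w $ j) * cnj (\<Sum>j\<in>UNIV. v $ j * w $ j))"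
    by (simp add: hermitian_form_def cnj_sum sum_product scaleR_sum_right mult_ac)
  also have "\<dots> = of_real (t * (cmod (\<Sum>j\<in>UNIV. v $ j * w $ j))\<^sup>2)"
    by (simp only: complex_norm_square scaleR_conv_of_real of_real_mult)
  finally show "0 \<le> Re (hermitian_form (t *\<^sub>R (\<chi> j k. v $ j * cnj (v $ k))) w)" using assms by simp
qed (simp add: mult.commute)

lemma levi_integral_zero:
  fixes f :: "complex^'n \<Rightarrow> real"
  assumes "smooth_on UNIV f" "\<And>x. x \<notin> cball 0 R \<Longrightarrow> f x = 0"
  shows "(\<integral>x. levi f x v \<partial>lborel) = 0" "integrable lborel (\<lambda>x. levi f x v)"
proof -
  have z: "dird f w x = 0" if "x \<notin> cball 0 R" for x w by (rule dird_outside_cball[OF assms(2) that])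
  have zz: "dird (dird f w) w x = 0" if "x \<notin> cball 0 R" for x w by (rule dird_outside_cball[OF z that])
  have i: "integrable lborel (\<lambda>x. dird (dird f w) w x)" for w
    by (rule compact_support_integrable[OF smooth_on_continuous zz]) (intro smooth_on_dird assms(1))+
  have "(\<integral>x. dird (dird f w) w x \<partial>lborel) = 0" for w
    by (rule integral_dird_zero[OF smooth_on_dird[OF assms(1)] z])
  then show "(\<integral>x. levi f x v \<partial>lborel) = 0" "integrable lborel (\<lambda>x. levi f x v)"
    unfolding levi_def using i by simp_all
qed

text \<open>Rank-one test forms \<phi> v_j conj(v_k) turn the pairing into one with the Levi form of
  \<phi>. The constant B drops out because that Levi form has integral 0.\<close>

lemma quasi_psh_of_current:
  fixes U :: "complex^'n \<Rightarrow> real"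
  assumes V: "open V" and \<Omega>: "\<Omega> \<subseteq> V" and G: "continuous_on V G"
    and U: "integrable lborel U" "\<And>z. z \<in> \<Omega> \<Longrightarrow> U z = u z - B"
    and cur: "\<And>F. positive_test_form V F \<Longrightarrow> 0 \<le> (LINT z:V|lborel. Re (\<Sum>j\<in>UNIV. \<Sum>k\<in>UNIV. G z $ j $ k * F z $ j $ k)
             + u z * Re (\<Sum>j\<in>UNIV. \<Sum>k\<in>UNIV. dz j (dzbar k (\<lambda>w. F w $ j $ k)) z))"
  shows "quasi_psh \<Omega> (\<lambda>z v. Re (hermitian_form (G z) v)) U"
  unfolding quasi_psh_def
proof (intro allI impI, elim conjE exE)
  fix v :: "complex^'n" and \<phi> :: "complex^'n \<Rightarrow> real" and K
  assume \<phi>: "smooth_on UNIV \<phi>" "\<forall>z. 0 \<le> \<phi> z" and K': "compact K" "K \<subseteq> \<Omega>" "\<forall>z. z \<notin> K \<longrightarrow> \<phi> z = 0"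
  have KV: "K \<subseteq> V" using K'(2) \<Omega> by blast
  interpret test_pair V K by unfold_locales (fact V K' KV)+
  have \<phi>0: "\<phi> x = 0" if "x \<notin> K" for x using K'(3) that by blast
  have l0: "levi \<phi> x v = 0" if "x \<notin> K" for x
    using dird_support[OF dird_support[OF \<phi>0] that] by (simp add: levi_def)
  obtain R where R: "\<And>x. x \<notin> cball 0 R \<Longrightarrow> x \<notin> K" by (rule support_cball) blast
  note li = levi_integral_zero[OF \<phi>(1) \<phi>0[OF R], of R]
  define C where "C = (\<chi> j k. v $ j * cnj (v $ k))"
  define F where "F = (\<lambda>w. \<phi> w *\<^sub>R C)"
  have "positive_test_form V F"
    unfolding positive_test_form_def F_def
    using smooth_on_linear_compose[OF open_UNIV bounded_linear_scaleR_left \<phi>(1)] K' KV \<phi>(2) rank_one_pos_semidefinite[of _ v]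
    by (auto simp: C_def intro!: exI[of _ K])
  from cur[OF this] have c: "0 \<le> (LINT z:V|lborel. Re (\<Sum>j\<in>UNIV. \<Sum>k\<in>UNIV. G z $ j $ k * F z $ j $ k)
             + u z * Re (\<Sum>j\<in>UNIV. \<Sum>k\<in>UNIV. dz j (dzbar k (\<lambda>w. F w $ j $ k)) z))" .
  have h: "Re (\<Sum>j\<in>UNIV. \<Sum>k\<in>UNIV. G z $ j $ k * F z $ j $ k) = \<phi> z * Re (hermitian_form (G z) v)" for z
    by (simp add: F_def C_def hermitian_form_def sum_distrib_left mult_ac)
  have l: "Re (\<Sum>j\<in>UNIV. \<Sum>k\<in>UNIV. dz j (dzbar k (\<lambda>w. F w $ j $ k)) z) = levi \<phi> z v / 4" for z
  proof -
    have d: "dird (dird (\<lambda>w. F w $ j $ k) b) a z = dird (dird \<phi> b) a z *\<^sub>R (v $ j * cnj (v $ k))" for j k a b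
      using dird_dird_linear_compose[OF bounded_linear_scaleR_left open_UNIV \<phi>(1) UNIV_I, of "v $ j * cnj (v $ k)" b z a]
      by (simp add: F_def C_def)
    have s: "smooth_on UNIV (\<lambda>w. F w $ j $ k)" for j k
      using smooth_on_linear_compose[OF open_UNIV bounded_linear_scaleR_left \<phi>(1), of "v $ j * cnj (v $ k)"] by (simp add: F_def C_def)
    have "levi \<phi> z v = (\<Sum>j\<in>UNIV. \<Sum>k\<in>UNIV.
      (dird (dird \<phi> (axis k 1)) (axis j 1) z + dird (dird \<phi> (axis k \<i>)) (axis j \<i>) z) * Re (v $ j * cnj (v $ k))
      - (dird (dird \<phi> (axis k \<i>)) (axis j 1) z - dird (dird \<phi> (axis k 1)) (axis j \<i>) z) * Im (v $ j * cnj (v $ k)))"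
      unfolding levi_def by (rule bilinear_wirtinger[OF bilinear_swap[OF bilinear_dird_dird[OF open_UNIV \<phi>(1) UNIV_I]]])
    also have "\<dots> = 4 * (\<Sum>j\<in>UNIV. \<Sum>k\<in>UNIV. Re (dz j (dzbar k (\<lambda>w. F w $ j $ k)) z))"
      unfolding sum_distrib_left
      by (intro sum.cong refl) (simp add: Re_dz_dzbar[OF open_UNIV s UNIV_I] d algebra_simps)
    finally show ?thesis by simp
  qed
  define a where "a = (\<lambda>z. indicator V z *\<^sub>R (\<phi> z * Re (hermitian_form (G z) v) + u z * (levi \<phi> z v / 4)))"
  have a: "0 \<le> (\<integral>z. a z \<partial>lborel)" using c unfolding set_lebesgue_integral_def h l a_def .
  have e: "4 * (\<phi> z * Re (hermitian_form (G z) v)) + U z * levi \<phi> z v = 4 * a z - B * levi \<phi> z v" for z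
  proof (cases "z \<in> K")
    case True
    then have "z \<in> V" "u z = U z + B" using K'(2) KV U(2)[of z] by auto
    then show ?thesis by (simp add: a_def algebra_simps)
  qed (simp add: a_def l0 \<phi>0)
  have "integrable lborel (\<lambda>z. 4 * (\<phi> z * Re (hermitian_form (G z) v)) + U z * levi \<phi> z v)"
  proof (rule Bochner_Integration.integrable_add)
    have ch: "continuous_on V (\<lambda>z. Re (hermitian_form (G z) v))"
      unfolding hermitian_form_def by (intro continuous_intros G)
    have "integrable lborel (ext_mult V (\<lambda>z. Re (hermitian_form (G z) v)) \<phi>)"
      by (rule integrable_ext_mult[OF ch smooth_on_continuous[OF \<phi>(1)] \<phi>0])
    also have "ext_mult V (\<lambda>z. Re (hermitian_form (G z) v)) \<phi> = (\<lambda>z. \<phi> z * Re (hermitian_form (G z) v))"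
      using \<phi>0 KV by (auto simp: ext_mult_def fun_eq_iff)
    finally show "integrable lborel (\<lambda>z. 4 * (\<phi> z * Re (hermitian_form (G z) v)))" by simp
    obtain D where D: "\<And>x. \<bar>levi \<phi> x v\<bar> \<le> D"
      using compact_support_bounded[OF continuous_on_levi[OF \<phi>(1)] l0[OF R], of R] by auto
    show "integrable lborel (\<lambda>z. U z * levi \<phi> z v)"
      using integrable_mult_bounded[OF U(1) _ , of "\<lambda>x. levi \<phi> x v" D] D borel_measurable_continuous_onI[OF continuous_on_levi[OF \<phi>(1)]]
      by (simp add: mult.commute)
  qed
  \<comment> \<open>Integrability of a is recovered from that of U; it is needed to split the
    integral below.\<close>
  then have "integrable lborel (\<lambda>z. (4 * a z - B * levi \<phi> z v) + B * levi \<phi> z v)"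
    unfolding e using li(2) by (intro Bochner_Integration.integrable_add) simp_all
  then have "integrable lborel a" by simp
  then have "(\<integral>z. 4 * (\<phi> z * Re (hermitian_form (G z) v)) + U z * levi \<phi> z v \<partial>lborel) = 4 * (\<integral>z. a z \<partial>lborel)"
    unfolding e using li by simp
  then show "0 \<le> (\<integral>z. 4 * (\<phi> z * Re (hermitian_form (G z) v)) + U z * levi \<phi> z v \<partial>lborel)" using a by simp
qed

section \<open>Complex Jacobian matrices\<close>

definition complex_jacobian :: "(complex^'n \<Rightarrow> complex^'m) \<Rightarrow> complex^'n \<Rightarrow> complex^'n^'m" where
  "complex_jacobian T z = (\<chi> a j. dird T (axis j 1) z $ a)"

lemma complex_jacobian_mult:
  assumes "holomorphic_map_on S T" "z \<in> S"
  shows "complex_jacobian T z *v v = dird T v z"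
proof -
  note h = holomorphic_map_derivative[OF assms]
  have lin: "linear (\<lambda>v. dird T v z)" using h(1) has_derivative_linear by blast
  have "v = (\<Sum>j\<in>UNIV. v $ j *s axis j 1)" by (simp add: vec_eq_iff axis_def if_distrib cong: if_cong)
  from arg_cong[OF this, of "\<lambda>v. dird T v z"]
  have "dird T v z = (\<Sum>j\<in>UNIV. v $ j *s dird T (axis j 1) z)"
    by (simp only: linear_sum[OF lin, of "\<lambda>j. v $ j *s axis j 1" UNIV] h(2))
  then show ?thesis by (simp add: vec_eq_iff matrix_vector_mult_def complex_jacobian_def mult.commute)
qed

lemma dz_component:
  assumes "holomorphic_map_on S T" "z \<in> S"
  shows "dz j (\<lambda>w. T w $ a) z = complex_jacobian T z $ a $ j"
proof -
  note h = holomorphic_map_derivative[OF assms]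
  have d: "dird (\<lambda>w. T w $ a) v z = dird T v z $ a" for v
    by (rule dird_eq[OF bounded_linear.has_derivative[OF bounded_linear_vec_nth h(1)]])
  have "axis j \<i> = \<i> *s axis j 1" by (simp add: vec_eq_iff axis_def)
  then have "dird T (axis j \<i>) z = \<i> *s dird T (axis j 1) z" by (simp add: h(2))
  then show ?thesis by (simp add: dz_def d complex_jacobian_def field_simps)
qed

section \<open>Change of variables\<close>

lemma set_nn_integral_eq_iff_has_integral:
  fixes h :: "'a::euclidean_space \<Rightarrow> real"
  assumes "(\<lambda>x. h x * indicator A x) \<in> borel_measurable borel" "\<And>x. x \<in> A \<Longrightarrow> 0 \<le> h x" "0 \<le> b"
  shows "(\<integral>\<^sup>+x\<in>A. ennreal (h x) \<partial>lborel) = ennreal b \<longleftrightarrow> (h has_integral b) A"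
proof
  assume "(\<integral>\<^sup>+x\<in>A. ennreal (h x) \<partial>lborel) = ennreal b"
  moreover have "(\<integral>\<^sup>+x\<in>A. ennreal (h x) \<partial>lborel) = (\<integral>\<^sup>+x. ennreal (h x * indicator A x) \<partial>lborel)"
    by (rule nn_integral_cong) (simp add: indicator_def)
  ultimately have "((\<lambda>x. h x * indicator A x) has_integral b) UNIV"
    using assms by (intro nn_integral_has_integral) (auto simp: indicator_def)
  also have "(\<lambda>x. h x * indicator A x) = (\<lambda>x. if x \<in> A then h x else 0)" by (auto simp: fun_eq_iff)
  finally show "(h has_integral b) A" by (simp only: has_integral_restrict_UNIV)
next
  assume "(h has_integral b) A"
  from nn_integral_has_integral_lebesgue'[OF assms(2) this]
  show "(\<integral>\<^sup>+x\<in>A. ennreal (h x) \<partial>lborel) = ennreal b" by simp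
qed

text \<open>The change of variables theorem concerns finite integrals. Since for every finite b one
  side equals b iff the other does, the sides are also infinite together.\<close>

lemma nn_integral_image:
  fixes t :: "real^'m::{finite,wellorder} \<Rightarrow> real^'m::_" and f :: "real^'m::_ \<Rightarrow> real"
  assumes S: "S \<in> sets borel" and der: "\<And>x. x \<in> S \<Longrightarrow> (t has_derivative t' x) (at x within S)" and inj: "inj_on t S"
    and f: "\<And>x. 0 \<le> f x" "(\<lambda>y. f y * indicator (t ` S) y) \<in> borel_measurable borel"
    and m: "(\<lambda>x. \<bar>det (matrix (t' x))\<bar> * f (t x) * indicator S x) \<in> borel_measurable borel"
  shows "(\<integral>\<^sup>+x\<in>S. ennreal (\<bar>det (matrix (t' x))\<bar> * f (t x)) \<partial>lborel) = (\<integral>\<^sup>+y\<in>t ` S. ennreal (f y) \<partial>lborel)"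
proof -
  have S': "S \<in> sets lebesgue" using S by simp
  \<comment> \<open>The theorem speaks of vector-valued integrands, so f is read as a function into
    real^1.\<close>
  have hi: "((\<lambda>x. \<bar>det (matrix (t' x))\<bar> * f (t x)) has_integral b) S \<longleftrightarrow> (f has_integral b) (t ` S)" for b
    using has_absolute_integral_change_of_variables[OF S' der inj, of "\<lambda>x. vec (f x) :: real^1" "vec b"] f(1)
    unfolding absolutely_integrable_on_1_iff integral_on_1_eq has_integral_iff
    by (simp add: absolutely_integrable_on_iff_nonneg)
  let ?L = "\<integral>\<^sup>+x\<in>S. ennreal (\<bar>det (matrix (t' x))\<bar> * f (t x)) \<partial>lborel" and ?R = "\<integral>\<^sup>+y\<in>t ` S. ennreal (f y) \<partial>lborel"
  have iff: "(\<integral>\<^sup>+x\<in>S. ennreal (\<bar>det (matrix (t' x))\<bar> * f (t x)) \<partial>lborel) = ennreal b \<longleftrightarrow> (\<integral>\<^sup>+y\<in>t ` S. ennreal (f y) \<partial>lborel) = ennreal b"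
    if "0 \<le> b" for b
  proof -
    have "?L = ennreal b \<longleftrightarrow> ((\<lambda>x. \<bar>det (matrix (t' x))\<bar> * f (t x)) has_integral b) S"
      by (rule set_nn_integral_eq_iff_has_integral[OF m _ that]) (intro mult_nonneg_nonneg abs_ge_zero f(1))
    also note hi
    also have "(f has_integral b) (t ` S) \<longleftrightarrow> ?R = ennreal b"
      by (rule set_nn_integral_eq_iff_has_integral[OF f(2) f(1) that, symmetric])
    finally show ?thesis .
  qed
  show "?L = ?R"
  proof (cases ?R rule: ennreal_cases)
    case (real r)
    then show ?thesis using iff[of r] by (simp only:)
  next
    case top
    show ?thesis
    proof (cases ?L rule: ennreal_cases)
      case (real r)
      then show ?thesis using iff[of r] by (simp only:)
    next
      case top': top
      show ?thesis using top top' by (simp only:)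
    qed
  qed
qed

text \<open>The real Jacobian of a holomorphic map is the squared modulus of the complex one;
  \<open>to_real\<close> carries the statement to real coordinates and back.\<close>

lemma nn_integral_holomorphic_image:
  fixes T :: "complex^'n \<Rightarrow> complex^'n" and f :: "complex^'n \<Rightarrow> real"
  assumes S: "open S" "holomorphic_map_on S T" "inj_on T S" "\<And>z. z \<in> S \<Longrightarrow> det (complex_jacobian T z) \<noteq> 0"
    and B: "B \<subseteq> S" "B \<in> sets borel" "T ` B \<in> sets borel"
    and f: "\<And>x. 0 \<le> f x" "f \<in> borel_measurable borel"
  shows "(\<integral>\<^sup>+z\<in>B. ennreal ((cmod (det (complex_jacobian T z)))\<^sup>2 * f (T z)) \<partial>lborel) = (\<integral>\<^sup>+y\<in>T ` B. ennreal (f y) \<partial>lborel)"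
proof -
  define t where "t = to_real \<circ> T \<circ> of_real_vec"
  define D where "D = (\<lambda>x. to_real \<circ> (\<lambda>v. dird T v (of_real_vec x)) \<circ> of_real_vec)"
  define A where "A = to_real ` B"
  have A: "A \<in> sets borel" unfolding A_def by (rule emeasure_to_real_image(1)[OF B(2)])
  have AB: "x \<in> A \<longleftrightarrow> of_real_vec x \<in> B" for x
    unfolding A_def by (metis image_iff of_real_vec_to_real to_real_of_real_vec)
  have tA: "t ` A = to_real ` T ` B" by (auto simp: t_def A_def image_image)
  have TB: "y \<in> t ` A \<longleftrightarrow> of_real_vec y \<in> T ` B" for y
    unfolding tA by (metis (no_types, opaque_lifting) image_iff of_real_vec_to_real to_real_of_real_vec)
  have der: "(t has_derivative D x) (at x within A)" if "x \<in> A" for x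
  proof -
    have "of_real_vec x \<in> S" using that AB B(1) by blast
    from holomorphic_map_derivative(1)[OF S(2) this]
    have "(T has_derivative (\<lambda>v. dird T v (of_real_vec x))) (at (of_real_vec x))" .
    then have "(t has_derivative D x) (at x)"
      unfolding t_def D_def comp_def
      using has_derivative_compose[OF bounded_linear_imp_has_derivative[OF bounded_linear_of_real_vec], of T _ x]
      by (intro bounded_linear.has_derivative[OF bounded_linear_to_real]) auto
    then show ?thesis by (rule has_derivative_at_withinI)
  qed
  have inj: "inj_on t A"
  proof (rule inj_onI)
    fix x y assume "x \<in> A" "y \<in> A" "t x = t y"
    then have "T (of_real_vec x) = T (of_real_vec y)" unfolding t_def by (metis comp_apply of_real_vec_to_real)
    then have "of_real_vec x = (of_real_vec y :: complex^'n)" using S(3) B(1) AB \<open>x \<in> A\<close> \<open>y \<in> A\<close> by (meson inj_on_def subsetD)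
    then show "x = y" by (metis to_real_of_real_vec)
  qed
  have J: "\<bar>det (matrix (D x))\<bar> = (cmod (det (complex_jacobian T (of_real_vec x))))\<^sup>2" if "x \<in> A" for x
  proof -
    have s: "of_real_vec x \<in> S" using that AB B(1) by blast
    have "(\<lambda>v. dird T v (of_real_vec x)) = (*v) (complex_jacobian T (of_real_vec x))"
      using complex_jacobian_mult[OF S(2) s] by (simp add: fun_eq_iff)
    then show ?thesis
      using real_jacobian_invertible_matrix[OF S(4)[OF s]] by (simp add: real_jacobian_def D_def)
  qed
  define h where "h = (\<lambda>z. (cmod (det (complex_jacobian T z)))\<^sup>2 * f (T z) * indicator B z)"
  have cj: "continuous_on S (\<lambda>z. det (complex_jacobian T z))"
    unfolding det_def complex_jacobian_def
    by (simp, intro continuous_intros smooth_on_continuous[OF smooth_on_dird[OF holomorphic_map_smooth[OF S(1,2)]]])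
  have cT: "continuous_on S T" by (rule holomorphic_map_continuous[OF S(2)])
  have "(\<lambda>z. indicator S z *\<^sub>R ((cmod (det (complex_jacobian T z)))\<^sup>2 :: real)) \<in> borel_measurable borel"
    by (rule borel_measurable_continuous_on_indicator) (use S(1) in \<open>auto intro!: continuous_intros cj\<close>)
  moreover have "(\<lambda>z. indicator S z *\<^sub>R T z) \<in> borel_measurable borel"
    by (rule borel_measurable_continuous_on_indicator) (use S(1) cT in auto)
  ultimately have "(\<lambda>z. (indicator S z *\<^sub>R ((cmod (det (complex_jacobian T z)))\<^sup>2 :: real)) * f (indicator S z *\<^sub>R T z) * indicator B z) \<in> borel_measurable borel"
    using f(2) B(2) by measurable
  also have "(\<lambda>z. (indicator S z *\<^sub>R ((cmod (det (complex_jacobian T z)))\<^sup>2 :: real)) * f (indicator S z *\<^sub>R T z) * indicator B z) = h"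
    using B(1) by (auto simp: h_def fun_eq_iff indicator_def)
  finally have h: "h \<in> borel_measurable borel" .
  have ind: "indicator A x = (indicator B (of_real_vec x) :: 'b::zero_neq_one)"
    "indicator (t ` A) x = (indicator (T ` B) (of_real_vec x) :: 'b::zero_neq_one)" for x
    by (simp_all add: indicator_def AB TB)
  have hA: "\<bar>det (matrix (D x))\<bar> * f (of_real_vec (t x)) * indicator A x = h (of_real_vec x)" for x
    using J[of x] by (cases "x \<in> A") (simp_all add: h_def ind[symmetric] t_def)
  have "(\<integral>\<^sup>+z\<in>B. ennreal ((cmod (det (complex_jacobian T z)))\<^sup>2 * f (T z)) \<partial>lborel) = (\<integral>\<^sup>+z. ennreal (h z) \<partial>lborel)"
    by (rule nn_integral_cong) (simp add: h_def indicator_def)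
  also have "\<dots> = (\<integral>\<^sup>+x. ennreal (h (of_real_vec x)) \<partial>lborel)"
    unfolding lborel_of_real_vec[symmetric] by (rule nn_integral_distr) (use h in measurable)
  also have "\<dots> = (\<integral>\<^sup>+x\<in>A. ennreal (\<bar>det (matrix (D x))\<bar> * f (of_real_vec (t x))) \<partial>lborel)"
    by (rule nn_integral_cong) (simp add: hA[symmetric] indicator_def)
  also have "\<dots> = (\<integral>\<^sup>+y\<in>t ` A. ennreal (f (of_real_vec y)) \<partial>lborel)"
  proof (rule nn_integral_image[OF A der inj])
    show "(\<lambda>y. f (of_real_vec y) * indicator (t ` A) y) \<in> borel_measurable borel"
      unfolding ind using f(2) B(3) by measurable
    show "(\<lambda>x. \<bar>det (matrix (D x))\<bar> * f (of_real_vec (t x)) * indicator A x) \<in> borel_measurable borel"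
      unfolding hA using h by measurable
  qed (use f(1) in auto)
  also have "\<dots> = (\<integral>\<^sup>+x. ennreal (f (of_real_vec x)) * indicator (T ` B) (of_real_vec x) \<partial>lborel)"
    unfolding ind ..
  also have "\<dots> = (\<integral>\<^sup>+y\<in>T ` B. ennreal (f y) \<partial>lborel)"
    unfolding lborel_of_real_vec[symmetric] by (rule nn_integral_distr[symmetric]) (use f(2) B(3) in measurable)
  finally show ?thesis .
qed

section \<open>Determinants of positive definite matrices\<close>

lemma det_cnj: "det (\<chi> i j. cnj (A $ i $ j)) = cnj (det A)"
  for A :: "complex^'n^'n"
  by (simp add: det_def)

lemma hermitian_det_real:
  assumes "hermitian H"
  shows "det H = of_real (Re (det H))"
proof -
  have "cnj (H $ i $ j) = H $ j $ i" for i j using assms unfolding hermitian_def by metis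
  then have "(\<chi> i j. cnj (H $ i $ j)) = transpose H" by (simp add: vec_eq_iff transpose_def)
  then have "cnj (det H) = det H" by (metis det_cnj det_transpose)
  then show ?thesis by (metis Reals_cnj_iff of_real_Re)
qed

lemma pos_definite_det_nonzero:
  fixes H :: "complex^'n^'n"
  assumes "pos_definite H"
  shows "det H \<noteq> 0"
proof -
  have "w = 0" if w: "H *v w = 0" for w
  proof -
    \<comment> \<open>The form conjugates its second argument, so the kernel vector enters
      conjugated.\<close>
    define v where "v = (\<chi> k. cnj (w $ k))"
    have "hermitian_form H v = (\<Sum>j\<in>UNIV. v $ j * (H *v w) $ j)"
      by (simp add: hermitian_form_def v_def matrix_vector_mult_def sum_distrib_left mult_ac)
    then have "Re (hermitian_form H v) = 0" using w by simp
    then have "v = 0" using assms unfolding pos_definite_def by (metis less_irrefl)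
    then show "w = 0" by (simp add: v_def vec_eq_iff)
  qed
  then show ?thesis by (metis matrix_left_invertible_ker invertible_det_nz invertible_left_inverse)
qed

lemma hermitian_form_mat_1: "Re (hermitian_form (mat 1 :: complex^'n^'n) v) = (norm v)\<^sup>2"
proof -
  have "hermitian_form (mat 1) v = (\<Sum>j\<in>UNIV. v $ j * cnj (v $ j))"
    by (simp add: hermitian_form_def mat_def if_distrib[of "\<lambda>x. x * _"] cong: if_cong)
  then show ?thesis
    by (simp add: complex_mult_cnj norm_vec_def L2_set_def sum_nonneg cmod_power2)
qed

text \<open>On the segment from the identity to H all matrices are positive definite; their
  determinants are real and never 0, so they keep the sign they have at the identity.\<close>

lemma pos_definite_det:
  fixes H :: "complex^'n^'n"
  assumes H: "pos_definite H"
  shows "0 < Re (det H)"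
proof (rule ccontr)
  assume neg: "\<not> 0 < Re (det H)"
  define P where "P = (\<lambda>t::real. (1 - t) *\<^sub>R mat 1 + t *\<^sub>R H)"
  have pd: "pos_definite (P t)" if t: "t \<in> {0..1}" for t
    unfolding pos_definite_def
  proof (intro conjI allI impI)
    have "hermitian H" using H unfolding pos_definite_def by blast
    then have h: "H $ k $ j = cnj (H $ j $ k)" for j k unfolding hermitian_def by blast
    have "P t $ k $ j = cnj (P t $ j $ k)" for j k using h[of k j] by (simp add: mat_def P_def)
    then show "hermitian (P t)" unfolding hermitian_def by blast
    fix v :: "complex^'n" assume v: "v \<noteq> 0"
    have "hermitian_form (P t) v = (1 - t) *\<^sub>R hermitian_form (mat 1) v + t *\<^sub>R hermitian_form H v"
      by (simp add: hermitian_form_def P_def distrib_right sum.distrib scaleR_sum_right)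
    then have e: "Re (hermitian_form (P t) v) = (1 - t) * (norm v)\<^sup>2 + t * Re (hermitian_form H v)"
      by (simp add: hermitian_form_mat_1)
    have "0 < Re (hermitian_form H v)" using H v unfolding pos_definite_def by blast
    moreover have "0 < (norm v)\<^sup>2" using v by simp
    ultimately show "0 < Re (hermitian_form (P t) v)" unfolding e using t
      by (cases "t = 0") (auto intro: add_nonneg_pos mult_nonneg_nonneg)
  qed
  have "continuous_on {0..1} (\<lambda>t. Re (det (P t)))"
    unfolding det_def P_def by (intro continuous_intros)
  moreover have "Re (det (P 1)) \<le> 0" "0 \<le> Re (det (P 0))" using neg by (simp_all add: P_def)
  ultimately obtain t where t: "0 \<le> t" "t \<le> 1" "Re (det (P t)) = 0"
    using IVT2'[of "\<lambda>t. Re (det (P t))" 1 0 0] by auto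
  then have "pos_definite (P t)" using pd by simp
  then have "det (P t) = 0" using hermitian_det_real[of "P t"] t(3) by (simp add: pos_definite_def)
  then show False using pos_definite_det_nonzero[OF \<open>pos_definite (P t)\<close>] by simp
qed

section \<open>The volume of a compact Kaehler manifold\<close>

context complex_manifold
begin

lemma chart_inv_in: "c \<in> atlas \<Longrightarrow> z \<in> chart_image c \<Longrightarrow> chart_inv c z \<in> fst c"
  and chart_chart_inv: "c \<in> atlas \<Longrightarrow> z \<in> chart_image c \<Longrightarrow> snd c (chart_inv c z) = z"
  and chart_inv_chart: "c \<in> atlas \<Longrightarrow> x \<in> fst c \<Longrightarrow> chart_inv c (snd c x) = x"
  and continuous_chart: "c \<in> atlas \<Longrightarrow> continuous_on (fst c) (snd c)"
  and continuous_chart_inv: "c \<in> atlas \<Longrightarrow> continuous_on (chart_image c) (chart_inv c)"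
  using chart_homeomorphism[of c] by (auto simp: homeomorphism_def)

lemma chart_in_image: "x \<in> fst c \<Longrightarrow> snd c x \<in> chart_image c"
  by (simp add: chart_image_def)

lemma obtain_chart: obtains c where "c \<in> atlas" "x \<in> fst c"
  using charts_cover by blast

lemma chart_image_eq:
  assumes "c \<in> atlas" "B \<subseteq> fst c"
  shows "snd c ` B = chart_image c \<inter> chart_inv c -` B"
  using assms(2) chart_inv_chart[OF assms(1)] chart_chart_inv[OF assms(1)] chart_in_image[of _ c]
  by (auto simp: subset_iff image_iff) (metis vimageI2)

lemma open_chart_image: "c \<in> atlas \<Longrightarrow> open B \<Longrightarrow> B \<subseteq> fst c \<Longrightarrow> open (snd c ` B)"
  unfolding chart_image_eq by (rule continuous_open_preimage[OF continuous_chart_inv open_image])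

text \<open>With a constant value outside the chart image the map is Borel measurable on the whole
  space, as needed for push-forwards.\<close>

definition chart_inv_ext :: "('a, 'n) chart \<Rightarrow> complex^'n \<Rightarrow> 'a" where
  "chart_inv_ext c z = (if z \<in> chart_image c then chart_inv c z else undefined)"

lemma measurable_chart_inv_ext: "c \<in> atlas \<Longrightarrow> chart_inv_ext c \<in> borel \<rightarrow>\<^sub>M borel"
  unfolding chart_inv_ext_def
  by (rule borel_measurable_continuous_on_if) (auto intro!: open_image continuous_chart_inv borel_open)

lemma borel_chart_image: "c \<in> atlas \<Longrightarrow> B \<in> sets borel \<Longrightarrow> B \<subseteq> fst c \<Longrightarrow> snd c ` B \<in> sets borel"
proof -
  assume c: "c \<in> atlas" and B: "B \<in> sets borel" "B \<subseteq> fst c"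
  have "snd c ` B = chart_image c \<inter> (chart_inv_ext c -` B \<inter> space borel)"
    unfolding chart_image_eq[OF c B(2)] by (auto simp: chart_inv_ext_def)
  then show ?thesis
    using measurable_sets[OF measurable_chart_inv_ext[OF c] B(1)] borel_open[OF open_image[OF c]] by simp
qed

lemma transition_chart: "c \<in> atlas \<Longrightarrow> x \<in> fst c \<Longrightarrow> transition c d (snd c x) = snd d x"
  by (simp add: transition_def chart_inv_chart)

lemma open_overlap: "c \<in> atlas \<Longrightarrow> d \<in> atlas \<Longrightarrow> open (snd c ` (fst c \<inter> fst d))"
  by (intro open_chart_image open_Int open_domain) auto

lemma smooth_transition: "c \<in> atlas \<Longrightarrow> d \<in> atlas \<Longrightarrow> smooth_on (snd c ` (fst c \<inter> fst d)) (transition c d)"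
  by (intro holomorphic_map_smooth open_overlap holomorphic_transition)

lemma inj_transition: "c \<in> atlas \<Longrightarrow> d \<in> atlas \<Longrightarrow> inj_on (transition c d) (snd c ` (fst c \<inter> fst d))"
  by (rule inj_onI) (auto simp: transition_chart, metis chart_inv_chart)

end

context compact_kaehler_manifold
begin

section \<open>Transformation of the metric between charts\<close>

lemma coefficient_matrix_transform:
  assumes "c \<in> atlas" "d \<in> atlas" "z \<in> snd c ` (fst c \<inter> fst d)"
  defines "J \<equiv> complex_jacobian (transition c d) z"
  shows "g c z = transpose J ** g d (transition c d z) ** (\<chi> i j. cnj (J $ i $ j))"
proof -
  have dz: "dz j (\<lambda>w. transition c d w $ a) z = J $ a $ j" for a j
    unfolding J_def by (rule dz_component[OF holomorphic_transition[OF assms(1,2)] assms(3)])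
  have "g c z $ j $ k = (transpose J ** g d (transition c d z) ** (\<chi> i j. cnj (J $ i $ j))) $ j $ k" for j k
    unfolding coefficient_transform[OF assms(1-3)] dz
    by (subst sum.swap) (simp add: matrix_matrix_mult_def transpose_def sum_distrib_right sum_distrib_left mult_ac)
  then show ?thesis by (simp add: vec_eq_iff)
qed

lemma det_coefficient_transform:
  assumes "c \<in> atlas" "d \<in> atlas" "z \<in> snd c ` (fst c \<inter> fst d)"
  shows "Re (det (g c z)) = (cmod (det (complex_jacobian (transition c d) z)))\<^sup>2 * Re (det (g d (transition c d z)))"
proof -
  define j where "j = det (complex_jacobian (transition c d) z)"
  have "det (g c z) = j * det (g d (transition c d z)) * cnj j"
    unfolding coefficient_matrix_transform[OF assms] det_mul det_transpose det_cnj j_def ..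
  also have "\<dots> = of_real ((cmod j)\<^sup>2) * det (g d (transition c d z))"
    unfolding complex_norm_square by (simp add: mult_ac)
  finally show ?thesis by (simp add: j_def)
qed

lemma coefficient_form_transform:
  assumes "c \<in> atlas" "d \<in> atlas" "z \<in> snd c ` (fst c \<inter> fst d)"
  shows "hermitian_form (g c z) v = hermitian_form (g d (transition c d z)) (dird (transition c d) v z)"
proof -
  define J where "J = complex_jacobian (transition c d) z"
  have Jv: "dird (transition c d) v z $ a = (\<Sum>j\<in>UNIV. J $ a $ j * v $ j)" for a
    using complex_jacobian_mult[OF holomorphic_transition[OF assms(1,2)] assms(3), of v]
    by (simp add: J_def matrix_vector_mult_def vec_eq_iff)
  define G where "G = g d (transition c d z)"
  have "hermitian_form (g c z) v = (\<Sum>j\<in>UNIV. \<Sum>k\<in>UNIV. \<Sum>a\<in>UNIV. \<Sum>b\<in>UNIV. G $ a $ b * (J $ a $ j * v $ j) * cnj (J $ b $ k * v $ k))"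
    unfolding hermitian_form_def coefficient_transform[OF assms] dz_component[OF holomorphic_transition[OF assms(1,2)] assms(3)] J_def[symmetric] G_def[symmetric]
    by (simp add: sum_distrib_left mult_ac)
  also have "\<dots> = (\<Sum>j\<in>UNIV. \<Sum>a\<in>UNIV. \<Sum>k\<in>UNIV. \<Sum>b\<in>UNIV. G $ a $ b * (J $ a $ j * v $ j) * cnj (J $ b $ k * v $ k))"
    by (intro sum.cong refl sum.swap)
  also have "\<dots> = (\<Sum>a\<in>UNIV. \<Sum>j\<in>UNIV. \<Sum>k\<in>UNIV. \<Sum>b\<in>UNIV. G $ a $ b * (J $ a $ j * v $ j) * cnj (J $ b $ k * v $ k))"
    by (rule sum.swap)
  also have "\<dots> = (\<Sum>a\<in>UNIV. \<Sum>j\<in>UNIV. \<Sum>b\<in>UNIV. \<Sum>k\<in>UNIV. G $ a $ b * (J $ a $ j * v $ j) * cnj (J $ b $ k * v $ k))"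
    by (intro sum.cong refl sum.swap)
  also have "\<dots> = (\<Sum>a\<in>UNIV. \<Sum>b\<in>UNIV. \<Sum>j\<in>UNIV. \<Sum>k\<in>UNIV. G $ a $ b * (J $ a $ j * v $ j) * cnj (J $ b $ k * v $ k))"
    by (intro sum.cong refl sum.swap)
  also have "\<dots> = (\<Sum>a\<in>UNIV. \<Sum>b\<in>UNIV. G $ a $ b * (\<Sum>j\<in>UNIV. J $ a $ j * v $ j) * cnj (\<Sum>k\<in>UNIV. J $ b $ k * v $ k))"
    by (simp add: sum_distrib_left sum_distrib_right cnj_sum mult_ac)
  also have "\<dots> = hermitian_form G (dird (transition c d) v z)" by (simp add: hermitian_form_def Jv)
  finally show ?thesis unfolding G_def .
qed

section \<open>The volume read in a single chart\<close>

definition chart_density :: "('a, 'n) chart \<Rightarrow> complex^'n \<Rightarrow> real" where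
  "chart_density c z = (if z \<in> chart_image c then 2 ^ CARD('n) * Re (det (g c z)) else 0)"

lemma chart_density_pos: "c \<in> atlas \<Longrightarrow> z \<in> chart_image c \<Longrightarrow> 0 < chart_density c z"
  using pos_definite_det[OF coefficients_pos_definite] by (simp add: chart_density_def)

lemma chart_density_nonneg: "c \<in> atlas \<Longrightarrow> 0 \<le> chart_density c z"
  using chart_density_pos[of c z] by (cases "z \<in> chart_image c") (auto simp: chart_density_def)

lemma continuous_coefficients: "c \<in> atlas \<Longrightarrow> continuous_on (chart_image c) (g c)"
  by (rule smooth_on_continuous[OF smooth_coefficients])

lemma continuous_chart_density:
  assumes "c \<in> atlas"
  shows "continuous_on (chart_image c) (chart_density c)"
proof -
  have "continuous_on (chart_image c) (\<lambda>z. 2 ^ CARD('n) * Re (det (g c z)))"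
    unfolding det_def by (intro continuous_intros continuous_coefficients[OF assms])
  then show ?thesis by (rule continuous_on_eq) (simp add: chart_density_def)
qed

lemma measurable_chart_density:
  assumes "c \<in> atlas"
  shows "chart_density c \<in> borel_measurable borel"
proof -
  have "(\<lambda>z. indicator (chart_image c) z *\<^sub>R chart_density c z) \<in> borel_measurable borel"
    by (rule borel_measurable_continuous_on_indicator) (auto intro: borel_open open_image assms continuous_chart_density)
  also have "(\<lambda>z. indicator (chart_image c) z *\<^sub>R chart_density c z) = chart_density c"
    by (auto simp: chart_density_def indicator_def)
  finally show ?thesis .
qed

definition chart_measure :: "('a, 'n) chart \<Rightarrow> 'a measure" where
  "chart_measure c = distr (density lborel (\<lambda>z. ennreal (chart_density c z))) borel (chart_inv_ext c)"

lemma emeasure_chart_measure: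
  assumes c: "c \<in> atlas" and B: "B \<in> sets borel" "B \<subseteq> fst c"
  shows "emeasure (chart_measure c) B = (\<integral>\<^sup>+z\<in>snd c ` B. ennreal (2 ^ CARD('n) * Re (det (g c z))) \<partial>lborel)"
proof -
  have m: "chart_inv_ext c \<in> borel \<rightarrow>\<^sub>M borel" by (rule measurable_chart_inv_ext[OF c])
  have "emeasure (chart_measure c) B = emeasure (density lborel (\<lambda>z. ennreal (chart_density c z))) (chart_inv_ext c -` B)"
    unfolding chart_measure_def using m B(1) by (subst emeasure_distr) auto
  also have "\<dots> = (\<integral>\<^sup>+z\<in>chart_inv_ext c -` B. ennreal (chart_density c z) \<partial>lborel)"
    using measurable_sets[OF m B(1)] measurable_chart_density[OF c] by (subst emeasure_density) auto
  also have "\<dots> = (\<integral>\<^sup>+z\<in>snd c ` B. ennreal (2 ^ CARD('n) * Re (det (g c z))) \<partial>lborel)"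
    by (rule nn_integral_cong) (auto simp: chart_density_def chart_image_eq[OF c B(2)] chart_inv_ext_def indicator_def)
  finally show ?thesis .
qed

lemma det_transition_nonzero:
  assumes "c \<in> atlas" "d \<in> atlas" "z \<in> snd c ` (fst c \<inter> fst d)"
  shows "det (complex_jacobian (transition c d) z) \<noteq> 0"
proof
  assume "det (complex_jacobian (transition c d) z) = 0"
  then have "Re (det (g c z)) = 0" using det_coefficient_transform[OF assms] by simp
  moreover have "z \<in> chart_image c" using assms(3) by (auto simp: chart_image_def)
  ultimately show False using pos_definite_det[OF coefficients_pos_definite[OF assms(1)]] by fastforce
qed

text \<open>The factor by which det g changes, the squared modulus of the complex Jacobian, is
  precisely the real Jacobian of the transition map.\<close>

lemma chart_measure_eq:
  assumes c: "c \<in> atlas" and d: "d \<in> atlas" and B: "B \<in> sets borel" "B \<subseteq> fst c" "B \<subseteq> fst d"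
  shows "emeasure (chart_measure c) B = emeasure (chart_measure d) B"
proof -
  let ?T = "transition c d"
  have im: "?T ` snd c ` B = snd d ` B"
    unfolding image_image by (rule image_cong[OF refl]) (use B(2) in \<open>auto intro!: transition_chart[OF c]\<close>)
  have sub: "snd c ` B \<subseteq> snd c ` (fst c \<inter> fst d)" using B by auto
  have "emeasure (chart_measure c) B = (\<integral>\<^sup>+z\<in>snd c ` B. ennreal ((cmod (det (complex_jacobian ?T z)))\<^sup>2 * chart_density d (?T z)) \<partial>lborel)"
    unfolding emeasure_chart_measure[OF c B(1,2)]
  proof (rule nn_integral_cong)
    fix z
    show "ennreal (2 ^ CARD('n) * Re (det (g c z))) * indicator (snd c ` B) z =
      ennreal ((cmod (det (complex_jacobian ?T z)))\<^sup>2 * chart_density d (?T z)) * indicator (snd c ` B) z"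
    proof (cases "z \<in> snd c ` B")
      case True
      then have "?T z \<in> chart_image d" using im B(3) by (force simp: chart_image_def)
      then show ?thesis using det_coefficient_transform[OF c d, of z] True sub
        by (auto simp: chart_density_def mult_ac subset_iff)
    qed simp
  qed
  also have "\<dots> = (\<integral>\<^sup>+z\<in>?T ` snd c ` B. ennreal (chart_density d z) \<partial>lborel)"
  proof (rule nn_integral_holomorphic_image[OF open_overlap[OF c d] holomorphic_transition[OF c d] inj_transition[OF c d]])
    show "det (complex_jacobian ?T z) \<noteq> 0" if "z \<in> snd c ` (fst c \<inter> fst d)" for z
      by (rule det_transition_nonzero[OF c d that])
    show "?T ` snd c ` B \<in> sets borel" unfolding im by (rule borel_chart_image[OF d B(1,3)])
  qed (use sub borel_chart_image[OF c B(1,2)] chart_density_nonneg[OF d] measurable_chart_density[OF d] in auto)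
  also have "\<dots> = emeasure (chart_measure d) B"
    unfolding emeasure_chart_measure[OF d B(1,3)] im
    by (rule nn_integral_cong) (use B(3) in \<open>auto simp: chart_density_def indicator_def chart_image_def\<close>)
  finally show ?thesis .
qed

section \<open>Existence and uniqueness of the volume\<close>

lemma finite_chart_cover: obtains A where "finite A" "A \<subseteq> atlas" "(\<Union>c\<in>A. fst c) = UNIV"
  using compactE_image[OF compact_space, of atlas fst] open_domain charts_cover
  by (metis subset_UNIV top.extremum_unique)

lemma disjoint_chart_cover:
  obtains A :: "('a, 'n) chart set" and P where "finite A" "A \<subseteq> atlas" "(\<Union>c\<in>A. P c) = UNIV" "disjoint_family_on P A"
    "\<And>c. c \<in> A \<Longrightarrow> P c \<in> sets borel" "\<And>c. c \<in> A \<Longrightarrow> P c \<subseteq> fst c"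
proof -
  obtain A where A: "finite A" "A \<subseteq> atlas" "(\<Union>c\<in>A. fst c) = UNIV" by (rule finite_chart_cover)
  obtain n :: "('a, 'n) chart \<Rightarrow> nat" where n: "inj_on n A" using finite_imp_inj_to_nat_seg[OF A(1)] by blast
  \<comment> \<open>Each point is assigned to the first chart, in the order given by n, that
    contains it.\<close>
  define P where "P = (\<lambda>c. fst c - (\<Union>d\<in>{d\<in>A. n d < n c}. fst d))"
  have "x \<in> (\<Union>c\<in>A. P c)" for x
  proof -
    define c where "c = arg_min n (\<lambda>c. c \<in> A \<and> x \<in> fst c)"
    obtain c0 where "c0 \<in> A \<and> x \<in> fst c0" using A(3) by blast
    then have c: "c \<in> A \<and> x \<in> fst c" unfolding c_def by (rule arg_min_natI)
    have "n c \<le> n d" if "d \<in> A \<and> x \<in> fst d" for d unfolding c_def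
      by (rule arg_min_nat_le[where P = "\<lambda>c. c \<in> A \<and> x \<in> fst c"]) (rule that)
    then have "x \<in> P c" using c by (auto simp: P_def not_less)
    then show ?thesis using c by blast
  qed
  moreover have "disjoint_family_on P A"
    unfolding disjoint_family_on_def
  proof (intro ballI impI)
    fix c d assume "c \<in> A" "d \<in> A" "c \<noteq> d"
    then have "n c < n d \<or> n d < n c" using n by (metis inj_onD linorder_neqE_nat)
    then show "P c \<inter> P d = {}" using \<open>c \<in> A\<close> \<open>d \<in> A\<close> by (auto simp: P_def)
  qed
  moreover have "P c \<in> sets borel" if "c \<in> A" for c
    unfolding P_def using that A(2) by (intro sets.Diff borel_open open_UN ballI open_domain) auto
  ultimately show thesis using A by (intro that[of A P]) (auto simp: P_def)
qed

text \<open>The property inside the description in \<open>kaehler_volume\<close>; nothing can be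
  concluded about the latter before exactly one measure is known to have it.\<close>

definition is_volume :: "'a measure \<Rightarrow> bool" where
  "is_volume \<mu> \<longleftrightarrow> sets \<mu> = sets borel \<and>
     (\<forall>c\<in>atlas. \<forall>B\<in>sets borel. B \<subseteq> fst c \<longrightarrow> emeasure \<mu> B = emeasure (chart_measure c) B)"

lemma is_volume_unique:
  assumes "is_volume \<mu>" "is_volume \<nu>"
  shows "\<mu> = \<nu>"
proof (rule measure_eqI)
  show s: "sets \<mu> = sets \<nu>" using assms by (simp add: is_volume_def)
  fix B assume "B \<in> sets \<mu>"
  then have B: "B \<in> sets borel" using assms by (simp add: is_volume_def)
  obtain A :: "('a, 'n) chart set" and P where A: "finite A" "A \<subseteq> atlas" "(\<Union>c\<in>A. P c) = UNIV" "disjoint_family_on P A"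
    "\<And>c. c \<in> A \<Longrightarrow> P c \<in> sets borel" "\<And>c. c \<in> A \<Longrightarrow> P c \<subseteq> fst c"
    by (rule disjoint_chart_cover) blast
  have "emeasure \<rho> B = (\<Sum>c\<in>A. emeasure (chart_measure c) (P c \<inter> B))" if \<rho>: "is_volume \<rho>" for \<rho>
  proof -
    have dj: "disjoint_family_on (\<lambda>c. P c \<inter> B) A" using A(4) unfolding disjoint_family_on_def by blast
    have im: "(\<lambda>c. P c \<inter> B) ` A \<subseteq> sets \<rho>"
      using \<rho> unfolding is_volume_def by (intro image_subsetI) (simp add: A(5) B sets.Int)
    have "B = (\<Union>c\<in>A. P c \<inter> B)" using A(3) by blast
    then have "emeasure \<rho> B = emeasure \<rho> (\<Union>c\<in>A. P c \<inter> B)" by simp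
    also have "\<dots> = (\<Sum>c\<in>A. emeasure \<rho> (P c \<inter> B))"
      by (rule sum_emeasure[OF im dj A(1), symmetric])
    also have "\<dots> = (\<Sum>c\<in>A. emeasure (chart_measure c) (P c \<inter> B))"
    proof (rule sum.cong[OF refl])
      fix c assume "c \<in> A"
      then have "c \<in> atlas" "P c \<inter> B \<in> sets borel" "P c \<inter> B \<subseteq> fst c"
        using A(2,5) A(6)[of c] B by (blast, simp add: sets.Int, blast)
      then show "emeasure \<rho> (P c \<inter> B) = emeasure (chart_measure c) (P c \<inter> B)" using \<rho> unfolding is_volume_def by blast
    qed
    finally show ?thesis .
  qed
  then show "emeasure \<mu> B = emeasure \<nu> B" using assms by simp
qed

lemma sets_chart_measure [simp]: "sets (chart_measure c) = sets borel"
  by (simp add: chart_measure_def)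

text \<open>The chart measures are added up over a finite Borel partition subordinate to the charts.
  \<open>chart_measure_eq\<close> shows that the sum also has the prescribed form in all other
  charts.\<close>

lemma is_volume_exists: "\<exists>\<mu>. is_volume \<mu>"
proof -
  obtain A :: "('a, 'n) chart set" and P where A: "finite A" "A \<subseteq> atlas" "(\<Union>c\<in>A. P c) = UNIV" "disjoint_family_on P A"
    "\<And>c. c \<in> A \<Longrightarrow> P c \<in> sets borel" "\<And>c. c \<in> A \<Longrightarrow> P c \<subseteq> fst c"
    by (rule disjoint_chart_cover) blast
  define m where "m = (\<lambda>B. \<Sum>c\<in>A. emeasure (chart_measure c) (P c \<inter> B))"
  define \<mu> where "\<mu> = measure_of UNIV (sets borel) m"
  have sa: "sigma_algebra UNIV (sets (borel :: 'a measure))"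
    using sets.sigma_algebra_axioms[of "borel :: 'a measure"] by simp
  have s: "sets \<mu> = sets borel" unfolding \<mu>_def using sigma_algebra.sets_measure_of_eq[OF sa] by simp
  have em: "emeasure \<mu> B = m B" if B: "B \<in> sets borel" for B
  proof (rule emeasure_measure_of_sigma[OF sa, of m B, folded \<mu>_def])
    show "positive (sets borel) m" by (simp add: positive_def m_def)
    show "countably_additive (sets borel) m"
    proof (rule countably_additiveI)
      fix F :: "nat \<Rightarrow> 'a set" assume F: "range F \<subseteq> sets borel" "disjoint_family F"
      have "(\<Sum>i. m (F i)) = (\<Sum>c\<in>A. \<Sum>i. emeasure (chart_measure c) (P c \<inter> F i))"
        unfolding m_def by (rule suminf_sum) simp
      also have "\<dots> = (\<Sum>c\<in>A. emeasure (chart_measure c) (\<Union>i. P c \<inter> F i))"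
        by (intro sum.cong refl suminf_emeasure) (use F A in \<open>auto simp: disjoint_family_on_def\<close>)
      finally show "(\<Sum>i. m (F i)) = m (\<Union>i. F i)" by (simp add: m_def)
    qed
  qed (use B in auto)
  have "emeasure \<mu> B = emeasure (chart_measure d) B" if d: "d \<in> atlas" and B: "B \<in> sets borel" "B \<subseteq> fst d" for d B
  proof -
    have "emeasure \<mu> B = (\<Sum>c\<in>A. emeasure (chart_measure d) (P c \<inter> B))"
      unfolding em[OF B(1)] m_def
    proof (intro sum.cong refl)
      fix c assume "c \<in> A"
      then have "c \<in> atlas" "P c \<inter> B \<in> sets borel" "P c \<inter> B \<subseteq> fst c" "P c \<inter> B \<subseteq> fst d"
        using A(2,5) A(6)[of c] B by (blast, simp add: sets.Int, blast, blast)
      then show "emeasure (chart_measure c) (P c \<inter> B) = emeasure (chart_measure d) (P c \<inter> B)" using d by (intro chart_measure_eq)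
    qed
    also have "\<dots> = emeasure (chart_measure d) (\<Union>c\<in>A. P c \<inter> B)"
    proof (rule sum_emeasure)
      show "disjoint_family_on (\<lambda>c. P c \<inter> B) A" using A(4) unfolding disjoint_family_on_def by blast
      show "(\<lambda>c. P c \<inter> B) ` A \<subseteq> sets (chart_measure d)" by (intro image_subsetI) (simp add: A(5) B sets.Int)
    qed (rule A(1))
    also have "(\<Union>c\<in>A. P c \<inter> B) = B" using A(3) by blast
    finally show ?thesis .
  qed
  then show ?thesis using s by (auto simp: is_volume_def)
qed

abbreviation vol :: "'a measure" where "vol \<equiv> kaehler_volume atlas g"

lemma is_volume_kaehler_volume: "is_volume vol"
proof -
  have e: "kaehler_volume atlas g = (THE \<mu>. is_volume \<mu>)"
    unfolding kaehler_volume_def is_volume_def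
    by (rule arg_cong[where f = The]) (auto simp: fun_eq_iff emeasure_chart_measure)
  show ?thesis unfolding e using is_volume_exists is_volume_unique by (metis theI)
qed

lemma sets_vol [simp]: "sets vol = sets borel" and space_vol [simp]: "space vol = UNIV"
  using is_volume_kaehler_volume sets_eq_imp_space_eq[of vol borel] by (auto simp: is_volume_def)

lemma emeasure_vol: "c \<in> atlas \<Longrightarrow> B \<in> sets borel \<Longrightarrow> B \<subseteq> fst c \<Longrightarrow> emeasure vol B = emeasure (chart_measure c) B"
  using is_volume_kaehler_volume unfolding is_volume_def by blast

end

section \<open>Omega-plurisubharmonic functions in charts\<close>

context compact_kaehler_manifold
begin

text \<open>The density is positive, so null sets of the manifold and of its charts correspond. In
  this way statements almost everywhere pass from one chart to another.\<close>

lemma vol_null_chart: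
  assumes c: "c \<in> atlas" and B: "B \<in> sets borel" "B \<subseteq> fst c"
  shows "emeasure vol B = 0 \<longleftrightarrow> emeasure lborel (snd c ` B) = 0"
proof -
  have m: "snd c ` B \<in> sets borel" by (rule borel_chart_image[OF c B])
  have "emeasure vol B = (\<integral>\<^sup>+z. ennreal (chart_density c z) * indicator (snd c ` B) z \<partial>lborel)"
    unfolding emeasure_vol[OF c B] emeasure_chart_measure[OF c B]
    by (rule nn_integral_cong) (use B(2) in \<open>auto simp: chart_density_def indicator_def chart_image_def\<close>)
  also have "\<dots> = 0 \<longleftrightarrow> (AE z in lborel. ennreal (chart_density c z) * indicator (snd c ` B) z = 0)"
    by (rule nn_integral_0_iff_AE) (use measurable_chart_density[OF c] m in measurable)
  also have "\<dots> \<longleftrightarrow> (AE z in lborel. z \<notin> snd c ` B)"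
  proof (rule AE_cong)
    fix z
    have "0 < chart_density c z" if "z \<in> snd c ` B"
      by (rule chart_density_pos[OF c]) (use that B(2) in \<open>auto simp: chart_image_def\<close>)
    then show "(ennreal (chart_density c z) * indicator (snd c ` B) z = 0) = (z \<notin> snd c ` B)"
      by (auto simp: indicator_def ennreal_eq_0_iff not_le)
  qed
  also have "\<dots> \<longleftrightarrow> emeasure lborel (snd c ` B) = 0"
    using AE_iff_null[of lborel "\<lambda>z. z \<notin> snd c ` B"] m by (simp add: null_sets_def)
  finally show ?thesis .
qed

lemma AE_vol_chart:
  assumes c: "c \<in> atlas" and P: "{x. P x} \<in> sets borel"
  shows "(AE x in vol. x \<in> fst c \<longrightarrow> P x) \<longleftrightarrow> (AE z in lborel. z \<in> chart_image c \<longrightarrow> P (chart_inv c z))"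
proof -
  define N where "N = fst c - {x. P x}"
  have N: "N \<in> sets borel" "N \<subseteq> fst c" unfolding N_def using P borel_open[OF open_domain[OF c]] by auto
  have im: "snd c ` N \<in> sets borel" by (rule borel_chart_image[OF c N])
  have e: "snd c ` N = {z. \<not> (z \<in> chart_image c \<longrightarrow> P (chart_inv c z))}"
    unfolding chart_image_eq[OF c N(2)] using chart_inv_in[OF c] by (auto simp: N_def)
  have e': "N = {x. \<not> (x \<in> fst c \<longrightarrow> P x)}" by (auto simp: N_def)
  have "(AE x in vol. x \<in> fst c \<longrightarrow> P x) \<longleftrightarrow> emeasure vol N = 0"
    using AE_iff_measurable[of N vol "\<lambda>x. x \<in> fst c \<longrightarrow> P x"] N(1) e' by simp
  also have "\<dots> \<longleftrightarrow> emeasure lborel (snd c ` N) = 0" by (rule vol_null_chart[OF c N])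
  also have "\<dots> \<longleftrightarrow> (AE z in lborel. z \<in> chart_image c \<longrightarrow> P (chart_inv c z))"
    using AE_iff_measurable[of "snd c ` N" lborel "\<lambda>z. z \<in> chart_image c \<longrightarrow> P (chart_inv c z)"] im e by simp
  finally show ?thesis .
qed

lemma nn_integral_vol_chart:
  assumes c: "c \<in> atlas" and h: "h \<in> borel_measurable borel"
  shows "(\<integral>\<^sup>+x\<in>fst c. h x \<partial>vol) = (\<integral>\<^sup>+z\<in>chart_image c. ennreal (chart_density c z) * h (chart_inv c z) \<partial>lborel)"
proof -
  have oc: "fst c \<in> sets borel" by (rule borel_open[OF open_domain[OF c]])
  have mv: "indicator (fst c) \<in> borel_measurable vol" "h \<in> borel_measurable vol"
    "indicator (fst c) \<in> borel_measurable (chart_measure c)" "h \<in> borel_measurable (chart_measure c)"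
    using oc h by (simp_all add: measurable_cong_sets[OF sets_vol refl] measurable_cong_sets[OF sets_chart_measure refl])
  have eq: "density vol (indicator (fst c)) = density (chart_measure c) (indicator (fst c))"
  proof (rule measure_eqI)
    fix A assume "A \<in> sets (density vol (indicator (fst c)))"
    then have A: "A \<in> sets borel" by simp
    have "emeasure (density vol (indicator (fst c))) A = emeasure vol (fst c \<inter> A)"
      using A oc mv by (subst emeasure_density) (auto simp: indicator_inter_arith[symmetric])
    also have "\<dots> = emeasure (chart_measure c) (fst c \<inter> A)" by (rule emeasure_vol[OF c]) (use A oc in auto)
    also have "\<dots> = emeasure (density (chart_measure c) (indicator (fst c))) A"
      using A oc mv by (subst emeasure_density) (auto simp: indicator_inter_arith[symmetric])
    finally show "emeasure (density vol (indicator (fst c))) A = emeasure (density (chart_measure c) (indicator (fst c))) A" .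
  qed simp
  have m: "chart_inv_ext c \<in> borel \<rightarrow>\<^sub>M borel" by (rule measurable_chart_inv_ext[OF c])
  have hm: "(\<lambda>x. indicator (fst c) x * h x) \<in> borel_measurable borel" using h oc by measurable
  have "(\<integral>\<^sup>+x\<in>fst c. h x \<partial>vol) = (\<integral>\<^sup>+x. h x \<partial>density vol (indicator (fst c)))"
    using mv by (subst nn_integral_density) (auto simp: mult.commute)
  also have "\<dots> = (\<integral>\<^sup>+x. indicator (fst c) x * h x \<partial>chart_measure c)"
    unfolding eq using mv by (subst nn_integral_density) auto
  also have "\<dots> = (\<integral>\<^sup>+z. indicator (fst c) (chart_inv_ext c z) * h (chart_inv_ext c z) \<partial>density lborel (\<lambda>z. ennreal (chart_density c z)))"
    unfolding chart_measure_def using m hm by (subst nn_integral_distr) auto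
  also have "\<dots> = (\<integral>\<^sup>+z. ennreal (chart_density c z) * (indicator (fst c) (chart_inv_ext c z) * h (chart_inv_ext c z)) \<partial>lborel)"
    using measurable_chart_density[OF c] measurable_compose[OF m hm] by (subst nn_integral_density) auto
  also have "\<dots> = (\<integral>\<^sup>+z\<in>chart_image c. ennreal (chart_density c z) * h (chart_inv c z) \<partial>lborel)"
    by (rule nn_integral_cong)
       (use chart_inv_in[OF c] in \<open>auto simp: chart_density_def chart_inv_ext_def indicator_def\<close>)
  finally show ?thesis .
qed

lemma chart_cball:
  assumes "c \<in> atlas" "x \<in> fst c"
  obtains r where "0 < r" "cball (snd c x) r \<subseteq> chart_image c"
  using open_contains_cball[of "chart_image c"] open_image[OF assms(1)] chart_in_image[OF assms(2)] that by blast

definition chart_ball :: "('a, 'n) chart \<Rightarrow> complex^'n \<Rightarrow> real \<Rightarrow> 'a set" where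
  "chart_ball c p r = {x \<in> fst c. snd c x \<in> ball p r}"

lemma open_chart_ball: "c \<in> atlas \<Longrightarrow> open (chart_ball c p r)"
proof -
  assume c: "c \<in> atlas"
  have "chart_ball c p r = fst c \<inter> snd c -` ball p r" by (auto simp: chart_ball_def)
  then show ?thesis using continuous_open_preimage[OF continuous_chart[OF c] open_domain[OF c] open_ball] by simp
qed

text \<open>Finitely many coordinate balls whose closed balls lie in the chart image cover the
  manifold, and the density is bounded on each. Finite volume makes continuous functions integrable,
  as membership in \<open>PSH\<close> demands.\<close>

lemma vol_finite: "emeasure vol UNIV < \<infinity>"
proof -
  define \<B> where "\<B> = {chart_ball c p r | c p r. c \<in> atlas \<and> cball p r \<subseteq> chart_image c}"
  have fin: "emeasure vol B < \<infinity>" "open B" if BB: "B \<in> \<B>" for B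
  proof -
    obtain c p r where c: "c \<in> atlas" and r: "cball p r \<subseteq> chart_image c" and B: "B = chart_ball c p r"
      using BB unfolding \<B>_def by blast
    show o: "open B" unfolding B by (rule open_chart_ball[OF c])
    have "bounded (chart_density c ` cball p r)"
      by (intro compact_imp_bounded compact_continuous_image continuous_on_subset[OF continuous_chart_density[OF c] r] compact_cball)
    then obtain M where M: "\<And>z. z \<in> cball p r \<Longrightarrow> norm (chart_density c z) \<le> M" unfolding bounded_iff by blast
    have B': "B \<in> sets borel" "B \<subseteq> fst c" using o B by (auto simp: chart_ball_def)
    have "emeasure vol B \<le> (\<integral>\<^sup>+z. ennreal M * indicator (cball p r) z \<partial>lborel)"
      unfolding emeasure_vol[OF c B'] emeasure_chart_measure[OF c B']
    proof (rule nn_integral_mono)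
      fix z
      show "ennreal (2 ^ CARD('n) * Re (det (g c z))) * indicator (snd c ` B) z \<le> ennreal M * indicator (cball p r) z"
      proof (cases "z \<in> snd c ` B")
        case True
        then have "z \<in> ball p r" "z \<in> chart_image c" using B by (auto simp: chart_ball_def chart_image_def)
        then show ?thesis using M[of z] True by (auto simp: chart_density_def intro!: ennreal_leI)
      qed simp
    qed
    also have "\<dots> = ennreal M * emeasure lborel (cball p r)" by (rule nn_integral_cmult_indicator) simp
    also have "\<dots> < \<infinity>" using emeasure_lborel_cball_finite[of p r] by (simp add: ennreal_mult_less_top)
    finally show "emeasure vol B < \<infinity>" .
  qed
  have cov: "UNIV \<subseteq> \<Union>\<B>"
  proof
    fix x :: 'a
    obtain c where c: "c \<in> atlas" "x \<in> fst c" by (rule obtain_chart)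
    obtain r where r: "0 < r" "cball (snd c x) r \<subseteq> chart_image c" by (rule chart_cball[OF c])
    have "x \<in> chart_ball c (snd c x) r" using c r(1) by (simp add: chart_ball_def)
    moreover have "chart_ball c (snd c x) r \<in> \<B>" unfolding \<B>_def using c(1) r(2) by blast
    ultimately show "x \<in> \<Union>\<B>" by (rule UnionI[rotated])
  qed
  have ob: "\<forall>B\<in>\<B>. open B" using fin(2) by blast
  obtain \<C> where C: "\<C> \<subseteq> \<B>" "finite \<C>" "UNIV \<subseteq> \<Union>\<C>"
    using compactE[OF compact_space cov] fin(2) by metis
  have "emeasure vol (\<Union>\<C>) \<le> (\<Sum>B\<in>\<C>. emeasure vol B)"
  proof -
    have "\<C> \<subseteq> sets borel" using C(1) ob borel_open by blast
    then show ?thesis using emeasure_subadditive_finite[OF C(2), of "\<lambda>B. B" vol] by simp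
  qed
  also have "\<dots> < \<infinity>" using C(1,2) fin(1) by (auto simp: less_top[symmetric])
  finally show ?thesis using C(3) by (simp add: top.extremum_unique)
qed

lemma upper_semicontinuous_measurable:
  assumes "upper_semicontinuous (f :: 'a \<Rightarrow> ereal)"
  shows "f \<in> borel_measurable borel"
proof (rule borel_measurableI_less)
  fix y
  have "open {x. f x < y}" using assms unfolding upper_semicontinuous_def by blast
  then show "{x \<in> space borel. f x < y} \<in> sets borel" by simp
qed

lemma PSH_bounded_above:
  assumes "u \<in> PSH atlas g"
  obtains B where "0 \<le> B" "\<And>x. u x \<le> ereal B"
proof -
  have usc: "\<And>a. open {x. u x < a}" and fin: "\<And>x. u x < \<infinity>"
    using assms unfolding PSH_def upper_semicontinuous_def by auto
  have "UNIV \<subseteq> (\<Union>n::nat. {x. u x < ereal (real n)})"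
  proof
    fix x :: 'a
    show "x \<in> (\<Union>n::nat. {x. u x < ereal (real n)})"
      using fin[of x] by (cases "u x") (auto intro: reals_Archimedean2)
  qed
  then obtain C where C: "finite C" "UNIV \<subseteq> (\<Union>n\<in>C. {x. u x < ereal (real n)})"
    using compactE_image[OF compact_space, of UNIV "\<lambda>n. {x. u x < ereal (real n)}"] usc by metis
  have "u x \<le> ereal (real (Max (insert 0 C)))" for x
  proof -
    obtain n where n: "n \<in> C" "u x < ereal (real n)" using C(2) by blast
    then have "n \<le> Max (insert 0 C)" using C(1) by simp
    then have "ereal (real n) \<le> ereal (real (Max (insert 0 C)))" by simp
    then show ?thesis using n(2) by (meson less_imp_le order_trans)
  qed
  then show thesis by (intro that[of "real (Max (insert 0 C))"]) auto
qed

lemma PSH_AE_finite: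
  assumes "u \<in> PSH atlas g"
  shows "AE x in vol. u x \<noteq> -\<infinity>"
proof -
  have "(\<integral>\<^sup>+x. e2ennreal \<bar>u x\<bar> \<partial>vol) \<noteq> \<infinity>" and m: "u \<in> borel_measurable borel"
    using assms upper_semicontinuous_measurable unfolding PSH_def by auto
  moreover have "(\<lambda>x. e2ennreal \<bar>u x\<bar>) \<in> borel_measurable vol"
    using m by (simp add: measurable_cong_sets[OF sets_vol refl])
  ultimately have "AE x in vol. e2ennreal \<bar>u x\<bar> \<noteq> \<infinity>" by (intro nn_integral_PInf_AE)
  then show ?thesis by (rule AE_mp) (auto simp: e2ennreal_infty)
qed

text \<open>Cut off outside a compact set to be integrable on the whole space. Where u is
  -\<infinity> the conversion gives 0, so the value on K is -B, which for B \<ge> 0 is still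
  nonpositive.\<close>

definition chart_function :: "('a \<Rightarrow> ereal) \<Rightarrow> real \<Rightarrow> ('a, 'n) chart \<Rightarrow> (complex^'n) set \<Rightarrow> complex^'n \<Rightarrow> real" where
  "chart_function u B c K z = indicator K z * (real_of_ereal (u (chart_inv c z)) - B)"

lemma measurable_chart_function:
  assumes u: "u \<in> borel_measurable borel" and c: "c \<in> atlas" and K: "compact K" "K \<subseteq> chart_image c"
  shows "chart_function u B c K \<in> borel_measurable borel"
proof -
  have "(\<lambda>z. u (chart_inv_ext c z)) \<in> borel_measurable borel"
    by (rule measurable_compose[OF measurable_chart_inv_ext[OF c] u])
  then have "(\<lambda>z. indicator K z * (real_of_ereal (u (chart_inv_ext c z)) - B)) \<in> borel_measurable borel"
    using borel_compact[OF K(1)] by measurable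
  also have "(\<lambda>z. indicator K z * (real_of_ereal (u (chart_inv_ext c z)) - B)) = chart_function u B c K"
    using K(2) by (auto simp: fun_eq_iff chart_function_def chart_inv_ext_def indicator_def)
  finally show ?thesis .
qed

lemma integrable_chart_function:
  assumes u: "u \<in> PSH atlas g" and c: "c \<in> atlas" and K: "compact K" "K \<subseteq> chart_image c"
  shows "integrable lborel (chart_function u B c K)"
proof (cases "K = {}")
  case False
  have um: "u \<in> borel_measurable borel" and fin: "(\<integral>\<^sup>+x. e2ennreal \<bar>u x\<bar> \<partial>vol) < \<infinity>"
    using u upper_semicontinuous_measurable unfolding PSH_def by auto
  have m: "chart_function u B' c K \<in> borel_measurable borel" for B' by (rule measurable_chart_function[OF um c K])
  \<comment> \<open>The positive minimum of the density on K bounds Lebesgue integrals over K by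
    integrals against the volume.\<close>
  obtain z0 where z0: "z0 \<in> K" "\<And>z. z \<in> K \<Longrightarrow> chart_density c z0 \<le> chart_density c z"
    using continuous_attains_inf[OF K(1) False continuous_on_subset[OF continuous_chart_density[OF c] K(2)]] by blast
  define \<delta> where "\<delta> = chart_density c z0"
  have \<delta>: "0 < \<delta>" unfolding \<delta>_def using chart_density_pos[OF c] z0(1) K(2) by blast
  have em: "(\<lambda>x. e2ennreal \<bar>u x\<bar>) \<in> borel_measurable borel" using um by measurable
  have "ennreal \<delta> * (\<integral>\<^sup>+z. ennreal (norm (chart_function u 0 c K z)) \<partial>lborel)
      = (\<integral>\<^sup>+z. ennreal \<delta> * ennreal (norm (chart_function u 0 c K z)) \<partial>lborel)"
    using m by (intro nn_integral_cmult[symmetric]) auto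
  also have "\<dots> \<le> (\<integral>\<^sup>+z\<in>chart_image c. ennreal (chart_density c z) * e2ennreal \<bar>u (chart_inv c z)\<bar> \<partial>lborel)"
  proof (rule nn_integral_mono)
    fix z
    show "ennreal \<delta> * ennreal (norm (chart_function u 0 c K z))
      \<le> ennreal (chart_density c z) * e2ennreal \<bar>u (chart_inv c z)\<bar> * indicator (chart_image c) z"
    proof (cases "z \<in> K")
      case True
      have "ennreal \<bar>real_of_ereal a\<bar> \<le> e2ennreal \<bar>a\<bar>" for a
        by (cases a) (auto simp: e2ennreal_ereal e2ennreal_infty)
      moreover have "ennreal \<delta> \<le> ennreal (chart_density c z)" using z0(2)[OF True] by (simp add: \<delta>_def ennreal_leI)
      moreover have "z \<in> chart_image c" using True K(2) by blast
      ultimately show ?thesis using True by (simp add: chart_function_def mult_mono)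
    qed (simp add: chart_function_def)
  qed
  also have "\<dots> = (\<integral>\<^sup>+x\<in>fst c. e2ennreal \<bar>u x\<bar> \<partial>vol)" by (rule nn_integral_vol_chart[OF c em, symmetric])
  also have "\<dots> \<le> (\<integral>\<^sup>+x. e2ennreal \<bar>u x\<bar> \<partial>vol)" by (rule nn_integral_mono) (simp add: indicator_def)
  also have "\<dots> < \<infinity>" by (rule fin)
  finally have "(\<integral>\<^sup>+z. ennreal (norm (chart_function u 0 c K z)) \<partial>lborel) < \<infinity>"
    using \<delta> by (auto simp: ennreal_mult_less_top ennreal_mult_eq_top_iff less_top)
  then have i: "integrable lborel (chart_function u 0 c K)" by (intro integrableI_bounded) (use m in auto)
  have "integrable lborel (\<lambda>z. chart_function u 0 c K z - B * indicator K z)"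
    using emeasure_compact_finite[OF K(1)] borel_compact[OF K(1)] i by (intro Bochner_Integration.integrable_diff) auto
  also have "(\<lambda>z. chart_function u 0 c K z - B * indicator K z) = chart_function u B c K"
    by (auto simp: fun_eq_iff chart_function_def algebra_simps)
  finally show ?thesis .
qed (simp add: chart_function_def[abs_def])

lemma chart_function_nonpos:
  assumes "0 \<le> B" "\<And>x. u x \<le> ereal B"
  shows "chart_function u B c K z \<le> 0"
proof -
  have "real_of_ereal (u (chart_inv c z)) \<le> B"
    using assms(2)[of "chart_inv c z"] assms(1) by (cases "u (chart_inv c z)") auto
  then show ?thesis by (simp add: chart_function_def indicator_def)
qed

lemma quasi_psh_chart_function:
  assumes u: "u \<in> PSH atlas g" and c: "c \<in> atlas" and K: "compact K" "K \<subseteq> chart_image c" and \<Omega>: "\<Omega> \<subseteq> K"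
  shows "quasi_psh \<Omega> (\<lambda>z v. Re (hermitian_form (g c z) v)) (chart_function u B c K)"
proof (rule quasi_psh_of_current[OF open_image[OF c] _ continuous_coefficients[OF c] integrable_chart_function[OF u c K]])
  show "\<Omega> \<subseteq> chart_image c" using \<Omega> K(2) by blast
  show "chart_function u B c K z = real_of_ereal (u (chart_inv c z)) - B" if "z \<in> \<Omega>" for z
    using that \<Omega> by (auto simp: chart_function_def indicator_def)
  show "0 \<le> (LINT z:chart_image c|lborel. Re (\<Sum>j\<in>UNIV. \<Sum>k\<in>UNIV. g c z $ j $ k * F z $ j $ k)
             + real_of_ereal (u (chart_inv c z)) * Re (\<Sum>j\<in>UNIV. \<Sum>k\<in>UNIV. dz j (dzbar k (\<lambda>w. F w $ j $ k)) z))"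
    if "positive_test_form (chart_image c) F" for F
    using u c that unfolding PSH_def current_nonneg_def by blast
qed

text \<open>The pointwise form of positivity of \<omega> + \<i> \<partial>\<partial>bar w; the 4 is
  the ratio between \<open>levi\<close> and the Wirtinger derivatives.\<close>

definition smooth_psh :: "('a \<Rightarrow> real) \<Rightarrow> bool" where
  "smooth_psh w \<longleftrightarrow> smooth_function atlas w \<and>
     (\<forall>c\<in>atlas. \<forall>z\<in>chart_image c. \<forall>v. - 4 * Re (hermitian_form (g c z) v) \<le> levi (w \<circ> chart_inv c) z v)"

lemma smooth_function_continuous:
  assumes "smooth_function atlas w"
  shows "continuous_on UNIV w"
proof -
  have "continuous_on (fst c) w" if c: "c \<in> atlas" for c
  proof -
    have "continuous_on (chart_image c) (w \<circ> chart_inv c)"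
      using assms c unfolding smooth_function_def by (blast intro: smooth_on_continuous)
    then have "continuous_on (fst c) (\<lambda>x. (w \<circ> chart_inv c) (snd c x))"
      by (rule continuous_on_compose2[OF _ continuous_chart[OF c]]) (auto simp: chart_image_def)
    then show ?thesis
      by (rule continuous_on_eq) (simp add: chart_inv_chart[OF c])
  qed
  then have "continuous_on (\<Union>c\<in>atlas. fst c) w"
    using open_domain by (intro continuous_on_open_UN) auto
  then show ?thesis unfolding charts_cover .
qed

lemma smooth_psh_PSH:
  assumes w: "smooth_psh w"
  shows "(\<lambda>x. ereal (w x)) \<in> PSH atlas g"
proof -
  have sm: "smooth_function atlas w" using w unfolding smooth_psh_def by blast
  have cont: "continuous_on UNIV w" by (rule smooth_function_continuous[OF sm])
  have "bounded (w ` UNIV)" by (intro compact_imp_bounded compact_continuous_image cont compact_space)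
  then obtain M where M: "\<And>x. \<bar>w x\<bar> \<le> M" unfolding bounded_iff by auto
  have "(\<integral>\<^sup>+x. e2ennreal \<bar>ereal (w x)\<bar> \<partial>vol) \<le> (\<integral>\<^sup>+x. ennreal M \<partial>vol)"
    by (intro nn_integral_mono) (simp add: e2ennreal_ereal M ennreal_leI)
  also have "\<dots> < \<infinity>" using vol_finite by (simp add: ennreal_mult_less_top)
  finally have fin: "(\<integral>\<^sup>+x. e2ennreal \<bar>ereal (w x)\<bar> \<partial>vol) < \<infinity>" .
  have usc: "upper_semicontinuous (\<lambda>x. ereal (w x))"
    unfolding upper_semicontinuous_def
    by (intro allI open_Collect_less continuous_on_const continuous_on_ereal cont)
  have cur: "current_nonneg atlas g (\<lambda>x. ereal (w x))"
    unfolding current_nonneg_def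
  proof (intro ballI allI impI)
    fix c F assume c: "c \<in> atlas" and F: "positive_test_form (chart_image c) F"
    have "smooth_on (chart_image c) (w \<circ> chart_inv c)" using sm c unfolding smooth_function_def by blast
    from smooth_current_nonneg[OF open_image[OF c] this continuous_coefficients[OF c] F] w c
    show "0 \<le> (LINT z:chart_image c|lborel. Re (\<Sum>j\<in>UNIV. \<Sum>k\<in>UNIV. g c z $ j $ k * F z $ j $ k)
             + real_of_ereal (ereal (w (chart_inv c z))) * Re (\<Sum>j\<in>UNIV. \<Sum>k\<in>UNIV. dz j (dzbar k (\<lambda>w. F w $ j $ k)) z))"
      unfolding smooth_psh_def comp_def real_of_ereal.simps by blast
  qed
  show ?thesis using fin usc cur by (simp add: PSH_def)
qed

lemma smooth_psh_add_const:
  assumes "smooth_psh w"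
  shows "smooth_psh (\<lambda>x. w x + B)"
proof -
  have e: "(\<lambda>x. w x + B) \<circ> chart_inv c = (\<lambda>z. (w \<circ> chart_inv c) z + B)" for c by auto
  have "smooth_on (chart_image c) ((\<lambda>x. w x + B) \<circ> chart_inv c) \<and>
     (\<forall>z\<in>chart_image c. \<forall>v. levi ((\<lambda>x. w x + B) \<circ> chart_inv c) z v = levi (w \<circ> chart_inv c) z v)" if c: "c \<in> atlas" for c
  proof -
    have s: "smooth_on (chart_image c) (w \<circ> chart_inv c)"
      using assms c unfolding smooth_psh_def smooth_function_def by blast
    note k = smooth_on_const[OF open_image[OF c], of B]
    show ?thesis unfolding e
      using smooth_on_add[OF open_image[OF c] s k] levi_add[OF open_image[OF c] s k] by (simp add: levi_const)
  qed
  then show ?thesis using assms unfolding smooth_psh_def smooth_function_def by auto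
qed

end

section \<open>Uniform estimates on compact sets\<close>

lemma compact_neighbourhood:
  fixes K :: "'a::euclidean_space set"
  assumes "compact K" "open V" "K \<subseteq> V"
  obtains d L where "0 < d" "compact L" "L \<subseteq> V" "\<And>z w. z \<in> K \<Longrightarrow> dist w z < d \<Longrightarrow> w \<in> L" "L = (\<Union>z\<in>K. cball z d)"
proof -
  obtain d where d: "0 < d" "(\<Union>z\<in>K. cball z d) \<subseteq> V" by (rule compact_subset_open_imp_cball_epsilon_subset[OF assms])
  show thesis
    by (rule that[OF d(1) compact_minkowski_sum_cball[OF assms(1)] d(2)]) (force simp: dist_commute)+
qed

lemma continuous_near_compact:
  fixes K :: "'a::euclidean_space set" and f :: "'a \<Rightarrow> 'b::metric_space"
  assumes "compact K" "open V" "K \<subseteq> V" "continuous_on V f" "0 < e"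
  obtains d where "0 < d" "\<And>z w. z \<in> K \<Longrightarrow> dist w z < d \<Longrightarrow> w \<in> V \<and> dist (f w) (f z) < e"
proof -
  obtain d L where d: "0 < d" "compact L" "L \<subseteq> V" "\<And>z w. z \<in> K \<Longrightarrow> dist w z < d \<Longrightarrow> w \<in> L" "L = (\<Union>z\<in>K. cball z d)"
    by (rule compact_neighbourhood[OF assms(1-3)]) blast
  have "uniformly_continuous_on L f"
    by (rule compact_uniformly_continuous[OF continuous_on_subset[OF assms(4) d(3)] d(2)])
  then obtain d' where d': "0 < d'" "\<And>x x'. x \<in> L \<Longrightarrow> x' \<in> L \<Longrightarrow> dist x' x < d' \<Longrightarrow> dist (f x') (f x) < e"
    using assms(5) unfolding uniformly_continuous_on_def by metis
  show thesis
  proof (rule that[of "min d d'"])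
    fix z w assume z: "z \<in> K" "dist w z < min d d'"
    then have "w \<in> L" "z \<in> L" using d(4)[of z w] d(4)[of z z] d(1) by auto
    then show "w \<in> V \<and> dist (f w) (f z) < e" using d(3) d'(2)[of z w] z(2) by auto
  qed (use d(1) d'(1) in auto)
qed

lemma dird_norm_bound:
  fixes f :: "'a::euclidean_space \<Rightarrow> 'b::euclidean_space"
  assumes "open S" "smooth_on S f" "compact K" "K \<subseteq> S"
  obtains C where "0 \<le> C" "\<And>z v. z \<in> K \<Longrightarrow> norm (dird f v z) \<le> C * norm v"
proof -
  have "\<exists>C\<ge>0. \<forall>z\<in>K. \<forall>v. \<bar>dird (\<lambda>x. f x \<bullet> b) v z\<bar> \<le> C * norm v" for b
    by (rule dird_bound[OF smooth_on_linear_compose[OF assms(1) bounded_linear_inner_left assms(2)] assms(3,4)])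
  then obtain C where C: "\<And>b. 0 \<le> C b" "\<And>b z v. z \<in> K \<Longrightarrow> \<bar>dird (\<lambda>x. f x \<bullet> b) v z\<bar> \<le> C b * norm v"
    by metis
  show thesis
  proof (rule that[of "\<Sum>b\<in>Basis. C b"])
    fix z v assume z: "z \<in> K"
    have e: "dird f v z \<bullet> b = dird (\<lambda>x. f x \<bullet> b) v z" for b
      using dird_linear_compose[OF bounded_linear_inner_left assms(2), of z b v] z assms(4) by auto
    have "norm (dird f v z) \<le> (\<Sum>b\<in>Basis. \<bar>dird f v z \<bullet> b\<bar>)" by (rule norm_le_l1)
    also have "\<dots> \<le> (\<Sum>b\<in>Basis. C b * norm v)" unfolding e by (intro sum_mono C(2) z)
    finally show "norm (dird f v z) \<le> (\<Sum>b\<in>Basis. C b) * norm v" by (simp add: sum_distrib_right)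
  qed (simp add: sum_nonneg C(1))
qed

lemma smooth_on_lipschitz_near_compact:
  fixes f :: "'a::euclidean_space \<Rightarrow> 'b::euclidean_space"
  assumes "open S" "smooth_on S f" "compact K" "K \<subseteq> S"
  obtains C d where "1 \<le> C" "0 < d" "\<And>z w. z \<in> K \<Longrightarrow> dist w z < d \<Longrightarrow> w \<in> S \<and> dist (f w) (f z) \<le> C * dist w z"
proof -
  obtain d L where d: "0 < d" "compact L" "L \<subseteq> S" "\<And>z w. z \<in> K \<Longrightarrow> dist w z < d \<Longrightarrow> w \<in> L" "L = (\<Union>z\<in>K. cball z d)"
    by (rule compact_neighbourhood[OF assms(3,1,4)]) blast
  obtain C where C: "0 \<le> C" "\<And>z v. z \<in> L \<Longrightarrow> norm (dird f v z) \<le> C * norm v"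
    by (rule dird_norm_bound[OF assms(1,2) d(2,3)]) blast
  show thesis
  proof (rule that[of "max 1 C" d])
    fix z w assume z: "z \<in> K" "dist w z < d"
    have sub: "ball z d \<subseteq> L" using d(4)[OF z(1)] by (auto simp: dist_commute)
    have "norm (f w - f z) \<le> max 1 C * norm (w - z)"
    proof (rule differentiable_bound[of "ball z d"])
      fix x assume x: "x \<in> ball z d"
      then have "x \<in> S" using sub d(3) by blast
      then show "(f has_derivative (\<lambda>v. dird f v x)) (at x within ball z d)"
        by (rule has_derivative_at_withinI[OF smooth_on_has_derivative[OF assms(2)]])
      have "norm (dird f v x) \<le> max 1 C * norm v" for v
        using C(2)[of x v] x sub mult_right_mono[of C "max 1 C" "norm v"] by force
      then show "onorm (\<lambda>v. dird f v x) \<le> max 1 C" by (rule onorm_le)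
    qed (use z d(1) in \<open>auto simp: dist_commute\<close>)
    then show "w \<in> S \<and> dist (f w) (f z) \<le> max 1 C * dist w z" using d(3,4) z by (auto simp: dist_norm)
  qed (use d(1) in auto)
qed

lemma hermitian_form_bound:
  fixes H :: "complex^'n^'n"
  shows "\<bar>Re (hermitian_form H v)\<bar> \<le> (real CARD('n))\<^sup>2 * norm H * (norm v)\<^sup>2"
proof -
  have t: "cmod (H $ j $ k * v $ j * cnj (v $ k)) \<le> norm H * (norm v)\<^sup>2" for j k
  proof -
    have h: "cmod (H $ j $ k) \<le> norm H"
      using Finite_Cartesian_Product.norm_nth_le[of H j] Finite_Cartesian_Product.norm_nth_le[of "H $ j" k] by linarith
    have "cmod (H $ j $ k * v $ j * cnj (v $ k)) = cmod (H $ j $ k) * (cmod (v $ j) * cmod (v $ k))"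
      by (simp add: norm_mult mult.assoc)
    also have "\<dots> \<le> norm H * (norm v * norm v)"
      by (intro mult_mono mult_nonneg_nonneg norm_ge_zero Finite_Cartesian_Product.norm_nth_le h)
    finally show ?thesis by (simp add: power2_eq_square)
  qed
  have "\<bar>Re (hermitian_form H v)\<bar> \<le> cmod (hermitian_form H v)" by (rule abs_Re_le_cmod)
  also have "\<dots> \<le> (\<Sum>j\<in>UNIV. \<Sum>k\<in>UNIV. cmod (H $ j $ k * v $ j * cnj (v $ k)))"
    unfolding hermitian_form_def by (intro sum_norm_le norm_sum)
  also have "\<dots> \<le> (\<Sum>(j::'n)\<in>UNIV. \<Sum>(k::'n)\<in>UNIV. norm H * (norm v)\<^sup>2)" by (intro sum_mono t)
  finally show ?thesis by (simp add: power2_eq_square mult_ac)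
qed

lemma hermitian_form_diff: "hermitian_form (G - H) v = hermitian_form G v - hermitian_form H v"
  by (simp add: hermitian_form_def left_diff_distrib sum_subtractf)

lemma hermitian_form_scaleR: "hermitian_form H (t *\<^sub>R v) = of_real (t\<^sup>2) * hermitian_form H v"
  by (simp add: hermitian_form_def sum_distrib_left power2_eq_square mult_ac scaleR_conv_of_real[where 'a = complex])

text \<open>The minimum over K times the unit sphere, extended by homogeneity.\<close>

lemma pos_definite_uniform:
  fixes G :: "complex^'n \<Rightarrow> complex^'n^'n"
  assumes K: "compact K" and G: "continuous_on K G" "\<And>z. z \<in> K \<Longrightarrow> pos_definite (G z)"
  obtains l where "0 < l" "\<And>z v. z \<in> K \<Longrightarrow> l * (norm v)\<^sup>2 \<le> Re (hermitian_form (G z) v)"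
proof (cases "K = {}")
  case False
  define F where "F = (\<lambda>x. Re (hermitian_form (G (fst x)) (snd x)))"
  have cF: "continuous_on (K \<times> sphere 0 1) F"
    unfolding F_def hermitian_form_def
    by (intro continuous_intros continuous_on_compose2[OF G(1)]) auto
  have cS: "compact (K \<times> sphere (0::complex^'n) 1)" by (intro compact_Times K compact_sphere)
  have ne: "K \<times> sphere (0::complex^'n) 1 \<noteq> {}" using False by simp
  obtain x where x: "x \<in> K \<times> sphere 0 1" "\<And>y. y \<in> K \<times> sphere 0 1 \<Longrightarrow> F x \<le> F y"
    using continuous_attains_inf[OF cS ne cF] by blast
  have "fst x \<in> K" "snd x \<noteq> 0" using x(1) by auto
  then have "0 < F x" unfolding F_def using G(2) unfolding pos_definite_def by blast
  moreover have "F x * (norm v)\<^sup>2 \<le> Re (hermitian_form (G z) v)" if z: "z \<in> K" for z v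
  proof (cases "v = 0")
    case False
    have "F x \<le> F (z, (1 / norm v) *\<^sub>R v)" by (rule x(2)) (use z False in simp)
    also have "\<dots> = (1 / norm v)\<^sup>2 * Re (hermitian_form (G z) v)" by (simp add: F_def hermitian_form_scaleR flip: of_real_power)
    finally show ?thesis using False by (simp add: field_simps power2_eq_square)
  qed (simp add: hermitian_form_def)
  ultimately show thesis by (rule that)
qed (use that[of 1] in simp)

text \<open>The uniform lower bound l converts an additive error of the coefficients into a relative
  error of the form.\<close>

lemma hermitian_form_near_compact:
  fixes G :: "complex^'n \<Rightarrow> complex^'n^'n"
  assumes K: "compact K" "open V" "K \<subseteq> V" and G: "continuous_on V G" "\<And>z. z \<in> K \<Longrightarrow> pos_definite (G z)" and "0 < e"
  obtains d where "0 < d" "\<And>z w v. z \<in> K \<Longrightarrow> dist w z < d \<Longrightarrow> w \<in> V \<and> Re (hermitian_form (G w) v) \<le> (1 + e) * Re (hermitian_form (G z) v)"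
proof -
  obtain l where l: "0 < l" "\<And>z v. z \<in> K \<Longrightarrow> l * (norm v)\<^sup>2 \<le> Re (hermitian_form (G z) v)"
    by (rule pos_definite_uniform[OF K(1) continuous_on_subset[OF G(1) K(3)] G(2)]) blast+
  define n where "n = (real CARD('n))\<^sup>2"
  have n: "0 < n" by (simp add: n_def)
  obtain d where d: "0 < d" "\<And>z w. z \<in> K \<Longrightarrow> dist w z < d \<Longrightarrow> w \<in> V \<and> dist (G w) (G z) < e * l / n"
    by (rule continuous_near_compact[OF K G(1), of "e * l / n"]) (use \<open>0 < e\<close> l(1) n in auto)
  show thesis
  proof (rule that[OF d(1)])
    fix z w v assume z: "z \<in> K" "dist w z < d"
    have dd: "w \<in> V" "norm (G w - G z) \<le> e * l / n" using d(2)[OF z] by (auto simp: dist_norm)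
    have "Re (hermitian_form (G w) v) - Re (hermitian_form (G z) v) \<le> \<bar>Re (hermitian_form (G w - G z) v)\<bar>"
      unfolding hermitian_form_diff by simp
    also have "\<dots> \<le> n * norm (G w - G z) * (norm v)\<^sup>2" unfolding n_def by (rule hermitian_form_bound)
    also have "\<dots> \<le> n * (e * l / n) * (norm v)\<^sup>2" using dd(2) n by (intro mult_right_mono mult_left_mono) auto
    also have "\<dots> = e * (l * (norm v)\<^sup>2)" using n by simp
    also have "\<dots> \<le> e * Re (hermitian_form (G z) v)" using l(2)[OF z(1), of v] \<open>0 < e\<close> by simp
    finally show "w \<in> V \<and> Re (hermitian_form (G w) v) \<le> (1 + e) * Re (hermitian_form (G z) v)"
      using dd(1) by (simp add: algebra_simps)
  qed
qed

text \<open>The null set depends on z, so only the countably many z of a dense set are used. If the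
  claim failed at y, the points z near y with t z < U y would form a nonempty open set and contain
  one of them.\<close>

lemma AE_open_dense:
  fixes U t :: "'a::euclidean_space \<Rightarrow> real"
  assumes ae: "\<And>z. z \<in> \<Omega> \<Longrightarrow> AE y in lborel. y \<in> ball z d \<longrightarrow> U y \<le> t z" and "open \<Omega>" "0 < d" and t: "continuous_on UNIV t"
  shows "AE y in lborel. y \<in> \<Omega> \<longrightarrow> U y \<le> t y"
proof -
  obtain D :: "'a set" where D: "countable D" "\<And>X. open X \<Longrightarrow> X \<noteq> {} \<Longrightarrow> \<exists>d\<in>D. d \<in> X"
    by (rule countable_dense_setE) blast
  have "AE y in lborel. \<forall>z\<in>D \<inter> \<Omega>. y \<in> ball z d \<longrightarrow> U y \<le> t z"
    using D(1) ae by (subst AE_ball_countable) auto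
  then show ?thesis
  proof (rule AE_mp, intro AE_I2 impI)
    fix y assume y: "\<forall>z\<in>D \<inter> \<Omega>. y \<in> ball z d \<longrightarrow> U y \<le> t z" "y \<in> \<Omega>"
    show "U y \<le> t y"
    proof (rule ccontr)
      assume "\<not> U y \<le> t y"
      then have "y \<in> ball y d \<inter> \<Omega> \<inter> {z. t z < U y}" using y(2) \<open>0 < d\<close> by auto
      moreover have "open (ball y d \<inter> \<Omega> \<inter> {z. t z < U y})"
        by (intro open_Int open_ball \<open>open \<Omega>\<close> open_Collect_less t continuous_on_const)
      ultimately obtain z where "z \<in> D" "z \<in> ball y d \<inter> \<Omega> \<inter> {z. t z < U y}" using D(2) by blast
      then show False using y(1) by (force simp: dist_commute)
    qed
  qed
qed

section \<open>Gluing\<close>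

text \<open>Three radii around each centre: within r/2 the cutoff is 1, and these balls cover;
  beyond 2 r it vanishes; the ball of radius 4 r is the room for mollification and for
  \<open>quasi_psh_upper_bound\<close>.\<close>

locale chart_cover = compact_kaehler_manifold atlas g
  for atlas :: "('a::{t2_space, second_countable_topology}, 'n::finite) chart set" and g +
  fixes X :: "'a set" and c :: "'a \<Rightarrow> ('a, 'n) chart" and r :: "'a \<Rightarrow> real"
  assumes finite_X: "finite X" and c: "i \<in> X \<Longrightarrow> c i \<in> atlas" and r: "i \<in> X \<Longrightarrow> 0 < r i"
    and cball: "i \<in> X \<Longrightarrow> cball (snd (c i) i) (4 * r i) \<subseteq> chart_image (c i)"
    and cover: "(\<Union>i\<in>X. chart_ball (c i) (snd (c i) i) (r i / 2)) = UNIV"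

lemma (in compact_kaehler_manifold) chart_cover_exists: "\<exists>X c r. chart_cover atlas g X c r"
proof -
  have "\<exists>d s. d \<in> atlas \<and> x \<in> fst d \<and> 0 < s \<and> cball (snd d x) (4 * s) \<subseteq> chart_image d" for x
  proof -
    obtain d where d: "d \<in> atlas" "x \<in> fst d" by (rule obtain_chart)
    obtain s where s: "0 < s" "cball (snd d x) s \<subseteq> chart_image d" by (rule chart_cball[OF d])
    then show ?thesis using d by (intro exI[of _ d] exI[of _ "s / 4"]) simp
  qed
  then obtain c r where cr: "\<And>x. c x \<in> atlas" "\<And>x. x \<in> fst (c x)" "\<And>x. (0::real) < r x"
    "\<And>x. cball (snd (c x) x) (4 * r x) \<subseteq> chart_image (c x)" by metis
  have "x \<in> chart_ball (c x) (snd (c x) x) (r x / 2)" for x using cr(2,3)[of x] by (simp add: chart_ball_def)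
  then have "UNIV \<subseteq> (\<Union>x\<in>UNIV. chart_ball (c x) (snd (c x) x) (r x / 2))" by blast
  then obtain X where X: "finite X" "UNIV \<subseteq> (\<Union>x\<in>X. chart_ball (c x) (snd (c x) x) (r x / 2))"
    by (rule compactE_image[OF compact_space open_chart_ball[OF cr(1)]]) blast
  then have "chart_cover atlas g X c r" using cr by unfold_locales auto
  then show ?thesis by blast
qed

context chart_cover
begin

abbreviation p :: "'a \<Rightarrow> complex^'n" where "p i \<equiv> snd (c i) i"
abbreviation disc :: "'a \<Rightarrow> (complex^'n) set" where "disc i \<equiv> cball (p i) (2 * r i)"

lemma disc_subset: "i \<in> X \<Longrightarrow> disc i \<subseteq> chart_image (c i)"
  using cball[of i] r[of i] subset_cball[of "2 * r i" "4 * r i" "p i"] by auto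

definition cutoff :: "'a \<Rightarrow> complex^'n \<Rightarrow> real" where
  "cutoff i z = step ((norm (z - p i))\<^sup>2 / (4 * (r i)\<^sup>2))"

lemma smooth_cutoff: "smooth_on UNIV (cutoff i)"
proof -
  have "smooth_on UNIV (\<lambda>z. (1 / (4 * (r i)\<^sup>2)) * (norm (z - p i))\<^sup>2)"
    by (rule smooth_on_cmult[OF open_UNIV smooth_on_norm_square])
  from smooth_on_compose[OF open_UNIV open_UNIV _ this smooth_on_step] show ?thesis
    by (simp add: cutoff_def[abs_def])
qed

lemma cutoff_eq_1: "i \<in> X \<Longrightarrow> z \<in> ball (p i) (r i / 2) \<Longrightarrow> cutoff i z = 1"
proof -
  assume "i \<in> X" "z \<in> ball (p i) (r i / 2)"
  then have "0 < r i" "norm (z - p i) \<le> r i / 2" using r by (auto simp: dist_norm norm_minus_commute)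
  then have "(norm (z - p i))\<^sup>2 \<le> (r i / 2)\<^sup>2" by (intro power_mono) auto
  then show ?thesis using \<open>0 < r i\<close> unfolding cutoff_def by (intro step_eq_1) (simp add: field_simps power2_eq_square)
qed

lemma cutoff_eq_0: "i \<in> X \<Longrightarrow> z \<notin> disc i \<Longrightarrow> cutoff i z = 0"
proof -
  assume "i \<in> X" "z \<notin> disc i"
  then have "0 < r i" "2 * r i \<le> norm (z - p i)" using r by (auto simp: dist_norm norm_minus_commute)
  then have "(2 * r i)\<^sup>2 \<le> (norm (z - p i))\<^sup>2" by (intro power_mono) auto
  then show ?thesis using \<open>0 < r i\<close> unfolding cutoff_def by (intro step_eq_0) (simp add: field_simps power2_eq_square)
qed

text \<open>The expression multiplied by \<epsilon> in \<open>levi_log_sum_exp\<close>: the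
  contribution of the derivatives of the cutoff.\<close>

definition cutoff_error :: "'a \<Rightarrow> complex^'n \<Rightarrow> complex^'n \<Rightarrow> real" where
  "cutoff_error i z v = 2 * cutoff i z * levi (cutoff i) z v
     - 2 * ((dird (cutoff i) v z)\<^sup>2 + (dird (cutoff i) (\<i> *s v) z)\<^sup>2)"

lemma cutoff_error_outside: "i \<in> X \<Longrightarrow> z \<notin> disc i \<Longrightarrow> cutoff_error i z v = 0"
proof -
  assume i: "i \<in> X" and z: "z \<notin> disc i"
  have "dird (cutoff i) w z = 0" for w by (rule dird_outside[OF closed_cball cutoff_eq_0[OF i] z])
  then show ?thesis using cutoff_eq_0[OF i z] by (simp add: cutoff_error_def)
qed

text \<open>Both sides are quadratic in v, and the metric is uniformly positive on the disc. The
  constants depend only on the cover, neither on \<epsilon> nor on the functions to be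
  glued.\<close>

lemma cutoff_error_bound:
  "\<exists>C. \<forall>i\<in>X. 0 \<le> C i \<and> (\<forall>z\<in>disc i. \<forall>v. - 4 * C i * Re (hermitian_form (g (c i) z) v) \<le> cutoff_error i z v)"
proof -
  have "\<exists>C\<ge>0. \<forall>z\<in>disc i. \<forall>v. - 4 * C * Re (hermitian_form (g (c i) z) v) \<le> cutoff_error i z v" if i: "i \<in> X" for i
  proof -
    obtain A where A: "0 \<le> A" "\<And>z v. z \<in> disc i \<Longrightarrow> \<bar>levi (cutoff i) z v\<bar> \<le> A * (norm v)\<^sup>2"
      using levi_bound[OF open_UNIV smooth_cutoff compact_cball subset_UNIV, of "p i" "2 * r i" i] by blast
    obtain D where D: "0 \<le> D" "\<And>z v. z \<in> disc i \<Longrightarrow> \<bar>dird (cutoff i) v z\<bar> \<le> D * norm v"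
      using dird_bound[OF smooth_cutoff compact_cball subset_UNIV, of "p i" "2 * r i" i] by blast
    obtain l where l: "0 < l" "\<And>z v. z \<in> disc i \<Longrightarrow> l * (norm v)\<^sup>2 \<le> Re (hermitian_form (g (c i) z) v)"
    proof (rule pos_definite_uniform[OF compact_cball])
      show "continuous_on (disc i) (g (c i))"
        by (rule continuous_on_subset[OF continuous_coefficients[OF c[OF i]] disc_subset[OF i]])
      show "pos_definite (g (c i) z)" if "z \<in> disc i" for z
        using coefficients_pos_definite[OF c[OF i]] disc_subset[OF i] that by blast
    qed blast
    define M where "M = 2 * A + 4 * D\<^sup>2"
    have M: "0 \<le> M" using A(1) by (simp add: M_def)
    have "- 4 * (M / (4 * l)) * Re (hermitian_form (g (c i) z) v) \<le> cutoff_error i z v" if z: "z \<in> disc i" for z v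
    proof -
      have 1: "\<bar>cutoff i z * levi (cutoff i) z v\<bar> \<le> A * (norm v)\<^sup>2"
      proof -
        have "\<bar>cutoff i z\<bar> \<le> 1" using step_nonneg step_le_1 by (simp add: cutoff_def)
        then have "\<bar>cutoff i z * levi (cutoff i) z v\<bar> \<le> 1 * (A * (norm v)\<^sup>2)"
          unfolding abs_mult using A z by (intro mult_mono) auto
        then show ?thesis by simp
      qed
      have 2: "(dird (cutoff i) w z)\<^sup>2 \<le> D\<^sup>2 * (norm w)\<^sup>2" for w
        using power_mono[OF D(2)[OF z, of w] abs_ge_zero, of 2] by (simp add: power_mult_distrib)
      have "- (M * (norm v)\<^sup>2) \<le> cutoff_error i z v"
        using 1 2[of v] 2[of "\<i> *s v"] unfolding cutoff_error_def M_def norm_vector_i abs_le_iff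
        by (simp add: algebra_simps)
      moreover have "M * (norm v)\<^sup>2 \<le> M / l * Re (hermitian_form (g (c i) z) v)"
        using mult_left_mono[OF l(2)[OF z, of v] divide_nonneg_pos[OF M l(1)]] l(1) by simp
      ultimately show ?thesis by simp
    qed
    then show ?thesis using M l(1) by (intro exI[of _ "M / (4 * l)"]) auto
  qed
  then show ?thesis by metis
qed

definition partial_cutoff :: "'a \<Rightarrow> 'a \<Rightarrow> real" where
  "partial_cutoff i x = (if x \<in> fst (c i) then cutoff i (snd (c i) x) else 0)"

text \<open>The first summand controls the weights of the sum where all \<open>f i\<close> are below \<open>- N\<close>.\<close>

definition weight_sum :: "real \<Rightarrow> real \<Rightarrow> ('a \<Rightarrow> complex^'n \<Rightarrow> real) \<Rightarrow> 'a \<Rightarrow> real" where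
  "weight_sum N \<epsilon> f x = exp (- N / \<epsilon>) + (\<Sum>i\<in>X. (partial_cutoff i x)\<^sup>2 * exp (f i (snd (c i) x) / \<epsilon>))"

definition glue :: "real \<Rightarrow> real \<Rightarrow> ('a \<Rightarrow> complex^'n \<Rightarrow> real) \<Rightarrow> 'a \<Rightarrow> real" where
  "glue N \<epsilon> f x = \<epsilon> * ln (weight_sum N \<epsilon> f x)"

lemma weight_sum_pos: "0 < weight_sum N \<epsilon> f x"
  unfolding weight_sum_def by (intro add_pos_nonneg sum_nonneg) auto

text \<open>The support of a cutoff is compact inside its chart, hence closed in the manifold. So a
  neighbourhood of the given point avoids the supports belonging to charts that do not contain it,
  and there the sum is an expression in smooth transition maps.\<close>

lemma glue_local:
  assumes d: "d \<in> atlas" and z0: "z0 \<in> chart_image d"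
  defines "A \<equiv> {i \<in> X. chart_inv d z0 \<in> fst (c i)}"
  obtains Y where "open Y" "z0 \<in> Y" "Y \<subseteq> chart_image d"
    "\<And>i. i \<in> A \<Longrightarrow> Y \<subseteq> snd d ` (fst d \<inter> fst (c i))"
    "\<And>z N \<epsilon> f. z \<in> Y \<Longrightarrow> weight_sum N \<epsilon> f (chart_inv d z)
       = exp (- N / \<epsilon>) + (\<Sum>i\<in>A. (cutoff i (transition d (c i) z))\<^sup>2 * exp (f i (transition d (c i) z) / \<epsilon>))"
proof -
  define K where "K = (\<lambda>i. chart_inv (c i) ` disc i)"
  have cK: "closed (K i)" if i: "i \<in> X" for i
    unfolding K_def
    by (intro compact_imp_closed compact_continuous_image compact_cball
        continuous_on_subset[OF continuous_chart_inv[OF c[OF i]] disc_subset[OF i]])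
  have Ks: "K i \<subseteq> fst (c i)" if i: "i \<in> X" for i
    using chart_inv_in[OF c[OF i]] disc_subset[OF i] unfolding K_def by blast
  define Q where "Q = (\<Inter>i\<in>A. fst (c i)) \<inter> (\<Inter>i\<in>X - A. - K i)"
  define Y where "Y = chart_image d \<inter> chart_inv d -` Q"
  have fA: "finite A" unfolding A_def using finite_X by simp
  have "open Q" unfolding Q_def
    by (intro open_Int open_INT fA finite_Diff finite_X ballI) (auto simp: A_def intro!: open_domain c cK open_Compl)
  then have oY: "open Y" unfolding Y_def by (intro continuous_open_preimage continuous_chart_inv open_image d)
  have "chart_inv d z0 \<in> Q" unfolding Q_def using Ks by (auto simp: A_def)
  then have zY: "z0 \<in> Y" using z0 by (simp add: Y_def)
  have ov: "Y \<subseteq> snd d ` (fst d \<inter> fst (c i))" if "i \<in> A" for i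
  proof
    fix z assume "z \<in> Y"
    then have "z \<in> chart_image d" "chart_inv d z \<in> fst (c i)" using that by (auto simp: Y_def Q_def)
    then show "z \<in> snd d ` (fst d \<inter> fst (c i))"
      by (intro image_eqI[of _ _ "chart_inv d z"]) (auto simp: chart_chart_inv[OF d] chart_inv_in[OF d])
  qed
  have w: "weight_sum N \<epsilon> f (chart_inv d z)
       = exp (- N / \<epsilon>) + (\<Sum>i\<in>A. (cutoff i (transition d (c i) z))\<^sup>2 * exp (f i (transition d (c i) z) / \<epsilon>))"
    if z: "z \<in> Y" for z N \<epsilon> f
  proof -
    have 0: "partial_cutoff i (chart_inv d z) = 0" if i: "i \<in> X - A" for i
    proof (cases "chart_inv d z \<in> fst (c i)")
      case True
      have "chart_inv d z \<notin> K i" using z i unfolding Y_def Q_def by blast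
      then have "snd (c i) (chart_inv d z) \<notin> disc i"
        unfolding K_def using chart_inv_chart[OF c True] i by (metis DiffD1 imageI)
      then show ?thesis using i by (simp add: partial_cutoff_def cutoff_eq_0)
    qed (simp add: partial_cutoff_def)
    have 1: "partial_cutoff i (chart_inv d z) = cutoff i (transition d (c i) z)" if "i \<in> A" for i
      using z that by (auto simp: Y_def Q_def partial_cutoff_def transition_def)
    have "weight_sum N \<epsilon> f (chart_inv d z)
       = exp (- N / \<epsilon>) + (\<Sum>i\<in>A. (partial_cutoff i (chart_inv d z))\<^sup>2 * exp (f i (snd (c i) (chart_inv d z)) / \<epsilon>))"
      unfolding weight_sum_def by (intro arg_cong2[where f = "(+)"] refl sum.mono_neutral_right finite_X) (auto simp: A_def 0)
    then show ?thesis by (simp add: 1 transition_def)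
  qed
  show thesis by (rule that[OF oY zY _ ov w]) (auto simp: Y_def)
qed

text \<open>The derivatives of the cutoffs enter with the factor \<open>\<epsilon>\<close> times a weight \<open>exp (f i / \<epsilon>) / weight_sum\<close>;
  assumption \<open>weight\<close> bounds these weights on the supports of the cutoffs.\<close>

lemma glue_smooth_psh:
  assumes f: "\<And>i. i \<in> X \<Longrightarrow> smooth_on UNIV (f i)" and \<epsilon>: "0 < \<epsilon>"
    and levi_f: "\<And>i z v. i \<in> X \<Longrightarrow> z \<in> disc i \<Longrightarrow> - 4 * (1 + \<epsilon>) * Re (hermitian_form (g (c i) z) v) \<le> levi (f i) z v"
    and weight: "\<And>i x. i \<in> X \<Longrightarrow> x \<in> fst (c i) \<Longrightarrow> snd (c i) x \<in> disc i \<Longrightarrow> exp (f i (snd (c i) x) / \<epsilon>) \<le> exp 1 * weight_sum N \<epsilon> f x"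
    and C: "\<And>i. i \<in> X \<Longrightarrow> 0 \<le> C i" "\<And>i z v. i \<in> X \<Longrightarrow> z \<in> disc i \<Longrightarrow> - 4 * C i * Re (hermitian_form (g (c i) z) v) \<le> cutoff_error i z v"
    and d: "d \<in> atlas"
  shows "smooth_on (chart_image d) (glue N \<epsilon> f \<circ> chart_inv d)"
    "z0 \<in> chart_image d \<Longrightarrow> - 4 * (1 + \<epsilon> + \<epsilon> * (exp 1 * (\<Sum>i\<in>X. C i))) * Re (hermitian_form (g d z0) v) \<le> levi (glue N \<epsilon> f \<circ> chart_inv d) z0 v"
proof -
  have loc: "(\<exists>Y. open Y \<and> z0 \<in> Y \<and> smooth_on Y (glue N \<epsilon> f \<circ> chart_inv d)) \<and>
     - 4 * (1 + \<epsilon> + \<epsilon> * (exp 1 * (\<Sum>i\<in>X. C i))) * Re (hermitian_form (g d z0) v) \<le> levi (glue N \<epsilon> f \<circ> chart_inv d) z0 v"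
    if z0: "z0 \<in> chart_image d" for z0 v
  proof -
    define A where "A = {i \<in> X. chart_inv d z0 \<in> fst (c i)}"
    define T where "T = (\<lambda>i. transition d (c i))"
    obtain Y where Y: "open Y" "z0 \<in> Y" "Y \<subseteq> chart_image d" "\<And>i. i \<in> A \<Longrightarrow> Y \<subseteq> snd d ` (fst d \<inter> fst (c i))"
      "\<And>z N \<epsilon> f. z \<in> Y \<Longrightarrow> weight_sum N \<epsilon> f (chart_inv d z)
         = exp (- N / \<epsilon>) + (\<Sum>i\<in>A. (cutoff i (T i z))\<^sup>2 * exp (f i (T i z) / \<epsilon>))"
      unfolding A_def T_def by (rule glue_local[OF d z0]) blast
    have AX: "i \<in> X" if "i \<in> A" for i using that by (simp add: A_def)
    have fA: "finite A" unfolding A_def using finite_X by simp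
    have sT: "smooth_on Y (T i)" if "i \<in> A" for i
      unfolding T_def by (rule smooth_on_subset[OF smooth_transition[OF d c[OF AX[OF that]]] Y(4)[OF that]])
    have s\<xi>: "smooth_on Y (\<lambda>z. cutoff i (T i z))" if "i \<in> A" for i
      by (rule smooth_on_compose[OF Y(1) open_UNIV _ sT[OF that] smooth_cutoff]) simp
    have sf: "smooth_on Y (\<lambda>z. f i (T i z))" if "i \<in> A" for i
      by (rule smooth_on_compose[OF Y(1) open_UNIV _ sT[OF that] f[OF AX[OF that]]]) simp
    define S where "S = (\<lambda>z. exp (- N / \<epsilon>) + (\<Sum>i\<in>A. (cutoff i (T i z))\<^sup>2 * exp (f i (T i z) / \<epsilon>)))"
    have S: "0 < S z" for z unfolding S_def by (intro add_pos_nonneg sum_nonneg) auto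
    have "smooth_on Y S"
      unfolding S_def
    proof (intro smooth_on_add smooth_on_const smooth_on_sum Y(1))
      fix i assume i: "i \<in> A"
      have "smooth_on Y (\<lambda>z. exp ((1 / \<epsilon>) * f i (T i z)))"
        by (rule smooth_on_compose[OF Y(1) open_UNIV _ smooth_on_cmult[OF Y(1) sf[OF i]] smooth_on_exp]) simp
      then show "smooth_on Y (\<lambda>z. (cutoff i (T i z))\<^sup>2 * exp (f i (T i z) / \<epsilon>))"
        unfolding power2_eq_square by (intro smooth_on_mult Y(1) s\<xi> i) simp
    qed
    from smooth_on_compose[OF Y(1) open_greaterThan _ this smooth_on_ln] S
    have sL: "smooth_on Y (\<lambda>z. \<epsilon> * ln (S z))"
      by (intro smooth_on_cmult Y(1)) auto
    have eq: "(glue N \<epsilon> f \<circ> chart_inv d) z = \<epsilon> * ln (S z)" if "z \<in> Y" for z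
      by (simp add: glue_def Y(5)[OF that] S_def)
    have sm: "smooth_on Y (glue N \<epsilon> f \<circ> chart_inv d)" using iffD2[OF smooth_on_cong[OF Y(1)] sL] eq by blast
    define h where "h = Re (hermitian_form (g d z0) v)"
    have h0: "0 \<le> h"
      using coefficients_pos_definite[OF d z0] unfolding pos_definite_def h_def
      by (cases "v = 0") (auto simp: hermitian_form_def less_imp_le)
    define w where "w = (\<lambda>i. exp (f i (T i z0) / \<epsilon>) / S z0)"
    have w0: "0 \<le> w i" for i unfolding w_def using S[of z0] by (simp add: less_imp_le)
    \<comment> \<open>The Levi form and the metric are invariant under the transition maps, so h
      also stands for the metric in the chart of i, and the assumptions apply at
      \<open>T i z0\<close> with this same h.\<close>
    have term_bound: "- 4 * (1 + \<epsilon>) * h * (w i * (cutoff i (T i z0))\<^sup>2) - 4 * \<epsilon> * exp 1 * h * C i \<le>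
       w i * ((cutoff i (T i z0))\<^sup>2 * levi (\<lambda>z. f i (T i z)) z0 v
         + \<epsilon> * (2 * cutoff i (T i z0) * levi (\<lambda>z. cutoff i (T i z)) z0 v
            - 2 * ((dird (\<lambda>z. cutoff i (T i z)) v z0)\<^sup>2 + (dird (\<lambda>z. cutoff i (T i z)) (\<i> *s v) z0)\<^sup>2)))"
      if i: "i \<in> A" for i
    proof -
      note ci = c[OF AX[OF i]]
      let ?V = "snd d ` (fst d \<inter> fst (c i))"
      have zV: "z0 \<in> ?V" using Y(2) Y(4)[OF i] by blast
      have hT: "holomorphic_map_on ?V (T i)" unfolding T_def by (rule holomorphic_transition[OF d ci])
      have sV: "smooth_on ?V (T i)" unfolding T_def by (rule smooth_transition[OF d ci])
      note oV = open_overlap[OF d ci]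
      define v' where "v' = dird (T i) v z0"
      have iv: "dird (T i) (\<i> *s v) z0 = \<i> *s v'" unfolding v'_def by (rule holomorphic_map_derivative(2)[OF hT zV])
      have h': "h = Re (hermitian_form (g (c i) (T i z0)) v')"
        unfolding h_def v'_def T_def by (subst coefficient_form_transform[OF d ci zV]) (rule refl)
      have l1: "levi (\<lambda>z. f i (T i z)) z0 v = levi (f i) (T i z0) v'" unfolding v'_def
        by (rule levi_compose[OF oV open_UNIV subset_UNIV hT sV f[OF AX[OF i]] zV])
      have l2: "levi (\<lambda>z. cutoff i (T i z)) z0 v = levi (cutoff i) (T i z0) v'" unfolding v'_def
        by (rule levi_compose[OF oV open_UNIV subset_UNIV hT sV smooth_cutoff zV])
      note dc = dird_compose[OF holomorphic_map_derivative(1)[OF hT zV] smooth_cutoff UNIV_I]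
      have d2: "dird (\<lambda>z. cutoff i (T i z)) v z0 = dird (cutoff i) v' (T i z0)"
        "dird (\<lambda>z. cutoff i (T i z)) (\<i> *s v) z0 = dird (cutoff i) (\<i> *s v') (T i z0)"
        using dc[of i v] dc[of i "\<i> *s v"] by (simp_all add: v'_def[symmetric] iv)
      have Ci: "0 \<le> C i" by (rule C(1)[OF AX[OF i]])
      have "- 4 * (1 + \<epsilon>) * h * (w i * (cutoff i (T i z0))\<^sup>2) - 4 * \<epsilon> * exp 1 * h * C i \<le>
         w i * ((cutoff i (T i z0))\<^sup>2 * levi (f i) (T i z0) v' + \<epsilon> * cutoff_error i (T i z0) v')"
      proof (cases "T i z0 \<in> disc i")
        case True
        have "- 4 * (1 + \<epsilon>) * h \<le> levi (f i) (T i z0) v'" unfolding h' by (rule levi_f[OF AX[OF i] True])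
        then have 1: "(w i * (cutoff i (T i z0))\<^sup>2) * (- 4 * (1 + \<epsilon>) * h) \<le> (w i * (cutoff i (T i z0))\<^sup>2) * levi (f i) (T i z0) v'"
          by (rule mult_left_mono) (simp add: w0)
        have we: "w i \<le> exp 1"
        proof -
          have x: "chart_inv d z0 \<in> fst (c i)" using i by (simp add: A_def)
          have "T i z0 = snd (c i) (chart_inv d z0)" by (simp add: T_def transition_def)
          then have "exp (f i (T i z0) / \<epsilon>) \<le> exp 1 * S z0"
            using weight[OF AX[OF i] x] True Y(5)[OF Y(2), of N \<epsilon> f] by (simp add: S_def)
          then show ?thesis using S[of z0] by (simp add: w_def field_simps)
        qed
        have "- 4 * C i * h \<le> cutoff_error i (T i z0) v'" unfolding h' by (rule C(2)[OF AX[OF i] True])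
        then have "w i * \<epsilon> * (- 4 * C i * h) \<le> w i * \<epsilon> * cutoff_error i (T i z0) v'"
          by (rule mult_left_mono) (use w0 \<epsilon> in simp)
        moreover have "w i * (4 * \<epsilon> * C i * h) \<le> exp 1 * (4 * \<epsilon> * C i * h)"
          by (rule mult_right_mono[OF we]) (use \<epsilon> Ci h0 in simp)
        ultimately show ?thesis using 1 by (simp add: algebra_simps)
      next
        case False
        then show ?thesis
          using cutoff_eq_0[OF AX[OF i] False] cutoff_error_outside[OF AX[OF i] False] \<epsilon> Ci h0 by simp
      qed
      then show ?thesis unfolding l1 l2 d2 cutoff_error_def .
    qed
    \<comment> \<open>Thus the bounds of the functions f i are averaged rather than added: the
      factor 1 + \<epsilon> is not multiplied by the number of charts.\<close>
    have sum1: "(\<Sum>i\<in>A. w i * (cutoff i (T i z0))\<^sup>2) \<le> 1"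
    proof -
      have "(\<Sum>i\<in>A. w i * (cutoff i (T i z0))\<^sup>2) = (\<Sum>i\<in>A. (cutoff i (T i z0))\<^sup>2 * exp (f i (T i z0) / \<epsilon>)) / S z0"
        by (simp add: w_def sum_divide_distrib mult.commute)
      also have "\<dots> \<le> 1" using S[of z0] by (simp add: S_def)
      finally show ?thesis .
    qed
    have sum2: "(\<Sum>i\<in>A. C i) \<le> (\<Sum>i\<in>X. C i)"
      by (rule sum_mono2[OF finite_X]) (auto simp: A_def C(1))
    have "- 4 * (1 + \<epsilon> + \<epsilon> * (exp 1 * (\<Sum>i\<in>X. C i))) * h
       \<le> - 4 * (1 + \<epsilon>) * h * (\<Sum>i\<in>A. w i * (cutoff i (T i z0))\<^sup>2) - 4 * \<epsilon> * exp 1 * h * (\<Sum>i\<in>A. C i)"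
    proof -
      have "(4 * (1 + \<epsilon>) * h) * (\<Sum>i\<in>A. w i * (cutoff i (T i z0))\<^sup>2) \<le> (4 * (1 + \<epsilon>) * h) * 1"
        by (rule mult_left_mono[OF sum1]) (use \<epsilon> h0 in simp)
      moreover have "(4 * \<epsilon> * exp 1 * h) * (\<Sum>i\<in>A. C i) \<le> (4 * \<epsilon> * exp 1 * h) * (\<Sum>i\<in>X. C i)"
        by (rule mult_left_mono[OF sum2]) (use \<epsilon> h0 in simp)
      ultimately show ?thesis by (simp add: algebra_simps)
    qed
    also have "\<dots> = (\<Sum>i\<in>A. - 4 * (1 + \<epsilon>) * h * (w i * (cutoff i (T i z0))\<^sup>2) - 4 * \<epsilon> * exp 1 * h * C i)"
      by (simp only: sum_subtractf sum_distrib_left)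
    also have "\<dots> \<le> (\<Sum>i\<in>A. w i * ((cutoff i (T i z0))\<^sup>2 * levi (\<lambda>z. f i (T i z)) z0 v
         + \<epsilon> * (2 * cutoff i (T i z0) * levi (\<lambda>z. cutoff i (T i z)) z0 v
            - 2 * ((dird (\<lambda>z. cutoff i (T i z)) v z0)\<^sup>2 + (dird (\<lambda>z. cutoff i (T i z)) (\<i> *s v) z0)\<^sup>2))))"
      by (rule sum_mono[OF term_bound])
    also have "\<dots> \<le> levi (\<lambda>z. \<epsilon> * ln (S z)) z0 v"
      unfolding w_def S_def
      by (rule levi_log_sum_exp[OF fA _ \<epsilon> Y(1,2) s\<xi> sf]) (use sL in \<open>simp_all add: S_def\<close>)
    also have "\<dots> = levi (glue N \<epsilon> f \<circ> chart_inv d) z0 v"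
      by (rule levi_cong[OF Y(1,2) eq, symmetric])
    finally show ?thesis using sm Y(1,2) unfolding h_def by blast
  qed
  show "smooth_on (chart_image d) (glue N \<epsilon> f \<circ> chart_inv d)"
    by (rule smooth_on_local) (use loc in blast)
  show "z0 \<in> chart_image d \<Longrightarrow> - 4 * (1 + \<epsilon> + \<epsilon> * (exp 1 * (\<Sum>i\<in>X. C i))) * Re (hermitian_form (g d z0) v) \<le> levi (glue N \<epsilon> f \<circ> chart_inv d) z0 v"
    using loc by blast
qed

end

section \<open>Local regularizations\<close>

locale psh_regularization = chart_cover atlas g X c r
  for atlas :: "('a::{t2_space, second_countable_topology}, 'n::finite) chart set" and g X c r +
  fixes u :: "'a \<Rightarrow> ereal" and B :: real
  assumes u: "u \<in> PSH atlas g" and B: "0 \<le> B" "u x \<le> ereal B"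
begin

definition shifted :: "'a \<Rightarrow> real" where
  "shifted x = real_of_ereal (u x) - B"

lemma measurable_shifted [measurable]: "shifted \<in> borel_measurable borel"
proof -
  have "u \<in> borel_measurable borel" using u upper_semicontinuous_measurable unfolding PSH_def by blast
  then show ?thesis unfolding shifted_def by measurable
qed

abbreviation big :: "'a \<Rightarrow> (complex^'n) set" where "big i \<equiv> ball (p i) (4 * r i)"

definition in_chart :: "'a \<Rightarrow> complex^'n \<Rightarrow> real" where
  "in_chart i = chart_function u B (c i) (cball (p i) (4 * r i))"

lemma in_chart_eq: "z \<in> big i \<Longrightarrow> in_chart i z = shifted (chart_inv (c i) z)"
  by (simp add: in_chart_def chart_function_def shifted_def)

lemma in_chart_nonpos: "in_chart i z \<le> 0"
  unfolding in_chart_def by (rule chart_function_nonpos[OF B])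

lemma integrable_in_chart: "i \<in> X \<Longrightarrow> integrable lborel (in_chart i)"
  unfolding in_chart_def by (intro integrable_chart_function u c compact_cball cball)

lemma big_subset: "i \<in> X \<Longrightarrow> big i \<subseteq> chart_image (c i)"
  using cball[of i] ball_subset_cball by blast

lemma disc_big: "i \<in> X \<Longrightarrow> disc i \<subseteq> big i"
  using r[of i] by auto

lemma quasi_psh_in_chart: "i \<in> X \<Longrightarrow> quasi_psh (big i) (\<lambda>z v. Re (hermitian_form (g (c i) z) v)) (in_chart i)"
  unfolding in_chart_def by (intro quasi_psh_chart_function u c compact_cball cball ball_subset_cball)

lemma continuous_form: "i \<in> X \<Longrightarrow> continuous_on (big i) (\<lambda>z. Re (hermitian_form (g (c i) z) v))"
  unfolding hermitian_form_def
  by (intro continuous_intros continuous_on_subset[OF continuous_coefficients[OF c] big_subset])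

definition smoothing :: "real \<Rightarrow> 'a \<Rightarrow> complex^'n \<Rightarrow> real" where
  "smoothing \<delta> i = mollify (in_chart i) \<delta>"

lemma smooth_smoothing: "i \<in> X \<Longrightarrow> 0 < \<delta> \<Longrightarrow> smooth_on UNIV (smoothing \<delta> i)"
  unfolding smoothing_def by (intro smooth_on_mollify integrable_in_chart)

text \<open>A mollification is an average over a small ball, on which f varies by less than \<tau>,
  uniformly for centres in the compact disc.\<close>

lemma smoothing_upper:
  assumes i: "i \<in> X" and f: "continuous_on UNIV f" "AE x in vol. shifted x + \<eta> \<le> f x" and "0 < \<tau>"
  shows "\<forall>\<^sub>F \<delta> in at_right 0. \<forall>z\<in>disc i. smoothing \<delta> i z \<le> f (chart_inv (c i) z) - \<eta> + \<tau>"
proof -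
  note ci = c[OF i]
  have cf: "continuous_on (big i) (\<lambda>z. f (chart_inv (c i) z))"
    by (rule continuous_on_compose2[OF f(1) continuous_on_subset[OF continuous_chart_inv[OF ci] big_subset[OF i]] subset_UNIV])
  obtain d where d: "0 < d" "\<And>z w. z \<in> disc i \<Longrightarrow> dist w z < d \<Longrightarrow>
      w \<in> big i \<and> dist (f (chart_inv (c i) w)) (f (chart_inv (c i) z)) < \<tau>"
    by (rule continuous_near_compact[OF compact_cball open_ball disc_big[OF i] cf \<open>0 < \<tau>\<close>]) blast
  have fm: "f \<in> borel_measurable borel" by (rule borel_measurable_continuous_onI[OF f(1)])
  have m: "{x. shifted x + \<eta> \<le> f x} \<in> sets borel" using fm by measurable
  have "AE x in vol. x \<in> fst (c i) \<longrightarrow> shifted x + \<eta> \<le> f x" using f(2) by (rule AE_mp) simp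
  with AE_vol_chart[OF ci m]
  have ae: "AE z in lborel. z \<in> chart_image (c i) \<longrightarrow> shifted (chart_inv (c i) z) + \<eta> \<le> f (chart_inv (c i) z)" by auto
  have "smoothing \<delta> i z \<le> f (chart_inv (c i) z) - \<eta> + \<tau>" if \<delta>: "0 < \<delta>" "\<delta> < d" and z: "z \<in> disc i" for \<delta> z
    unfolding smoothing_def
  proof (rule mollify_le[OF integrable_in_chart[OF i] \<delta>(1)])
    show "AE w in lborel. w \<in> ball z \<delta> \<longrightarrow> in_chart i w \<le> f (chart_inv (c i) z) - \<eta> + \<tau>"
      using ae
    proof (rule AE_mp, intro AE_I2 impI)
      fix w assume w: "w \<in> chart_image (c i) \<longrightarrow> shifted (chart_inv (c i) w) + \<eta> \<le> f (chart_inv (c i) w)" "w \<in> ball z \<delta>"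
      then have "dist w z < d" using \<delta>(2) by (simp add: dist_commute)
      from d(2)[OF z this] have "w \<in> big i" "f (chart_inv (c i) w) < f (chart_inv (c i) z) + \<tau>" by (auto simp: dist_real_def)
      then show "in_chart i w \<le> f (chart_inv (c i) z) - \<eta> + \<tau>"
        using w(1) big_subset[OF i] in_chart_eq[of w i] by auto
    qed
  qed
  then show ?thesis using d(1) by (auto simp: eventually_at_right_field)
qed

text \<open>The factor 1 + \<epsilon> accounts for the variation of the metric over a ball of radius
  \<delta>.\<close>

lemma smoothing_levi:
  assumes i: "i \<in> X" and "0 < \<epsilon>"
  shows "\<forall>\<^sub>F \<delta> in at_right 0. \<forall>z\<in>disc i. \<forall>v. - 4 * (1 + \<epsilon>) * Re (hermitian_form (g (c i) z) v) \<le> levi (smoothing \<delta> i) z v"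
proof -
  note ci = c[OF i]
  have pd: "pos_definite (g (c i) z)" if "z \<in> disc i" for z
    using coefficients_pos_definite[OF ci] disc_subset[OF i] that by blast
  obtain d where d: "0 < d" "\<And>z w v. z \<in> disc i \<Longrightarrow> dist w z < d \<Longrightarrow>
      w \<in> big i \<and> Re (hermitian_form (g (c i) w) v) \<le> (1 + \<epsilon>) * Re (hermitian_form (g (c i) z) v)"
    by (rule hermitian_form_near_compact[OF compact_cball open_ball disc_big[OF i]
          continuous_on_subset[OF continuous_coefficients[OF ci] big_subset[OF i]] pd \<open>0 < \<epsilon>\<close>]) blast+
  have "- 4 * (1 + \<epsilon>) * Re (hermitian_form (g (c i) z) v) \<le> levi (smoothing \<delta> i) z v"
    if \<delta>: "0 < \<delta>" "\<delta> < d" and z: "z \<in> disc i" for \<delta> z v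
  proof -
    have near: "dist w z < d" if "w \<in> cball z \<delta>" for w using that \<delta>(2) by (simp add: dist_commute)
    have "- 4 * ((1 + \<epsilon>) * Re (hermitian_form (g (c i) z) v)) \<le> levi (mollify (in_chart i) \<delta>) z v"
    proof (rule levi_mollify[OF integrable_in_chart[OF i] quasi_psh_in_chart[OF i] \<delta>(1)])
      show "cball z \<delta> \<subseteq> big i" using d(2)[OF z near] by blast
    qed (use continuous_form[OF i] d(2)[OF z near] in auto)
    then show ?thesis by (simp only: smoothing_def mult.assoc)
  qed
  then show ?thesis using d(1) by (auto simp: eventually_at_right_field)
qed

lemma smoothing_upper_bound:
  assumes i: "i \<in> X" and "1 \<le> C" "0 < \<eta>" "\<eta> < 1"
  shows "\<forall>\<^sub>F \<delta> in at_right 0. \<forall>z\<in>disc i. AE y in lborel. y \<in> ball z (C * \<delta>) \<longrightarrow> in_chart i y \<le> (1 - \<eta>) * smoothing \<delta> i z + \<eta>"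
proof -
  have "bounded (g (c i) ` cball (p i) (4 * r i))"
    by (intro compact_imp_bounded compact_continuous_image continuous_on_subset[OF continuous_coefficients[OF c[OF i]] cball[OF i]] compact_cball)
  then obtain M where M: "\<And>z. z \<in> cball (p i) (4 * r i) \<Longrightarrow> norm (g (c i) z) \<le> M" unfolding bounded_iff by blast
  have M0: "0 \<le> M" using order_trans[OF norm_ge_zero M[of "p i"]] r[OF i] by simp
  have le: "Re (hermitian_form (g (c i) z) v) \<le> ((real CARD('n))\<^sup>2 * M) * (norm v)\<^sup>2" if z: "z \<in> big i" for z v
  proof -
    have "norm (g (c i) z) \<le> M" using z by (intro M) auto
    then have "(real CARD('n))\<^sup>2 * norm (g (c i) z) * (norm v)\<^sup>2 \<le> ((real CARD('n))\<^sup>2 * M) * (norm v)\<^sup>2"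
      by (intro mult_right_mono mult_left_mono) auto
    then show ?thesis using hermitian_form_bound[of "g (c i) z" v] by linarith
  qed
  show ?thesis
    using quasi_psh_upper_bound[OF r[OF i] integrable_in_chart[OF i] in_chart_nonpos quasi_psh_in_chart[OF i] continuous_form[OF i] le _ assms(2-4)] M0
    by (auto simp: eventually_at_right_field smoothing_def)
qed

text \<open>With C = 1 the upper bound compares each centre with the points around it;
  \<open>AE_open_dense\<close> allows the centre to be the point itself.\<close>

lemma smoothing_AE_ge:
  assumes i: "i \<in> X" and \<eta>: "0 < \<eta>" "\<eta> < 1"
  shows "\<forall>\<^sub>F \<delta> in at_right 0. AE x in vol. x \<in> chart_ball (c i) (p i) (r i / 2) \<longrightarrow> shifted x \<le> (1 - \<eta>) * smoothing \<delta> i (snd (c i) x) + \<eta>"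
proof -
  note ci = c[OF i]
  have "\<forall>\<^sub>F \<delta> in at_right 0. \<forall>z\<in>disc i. AE y in lborel. y \<in> ball z (1 * \<delta>) \<longrightarrow> in_chart i y \<le> (1 - \<eta>) * smoothing \<delta> i z + \<eta>"
    by (rule smoothing_upper_bound[OF i _ \<eta>]) simp
  moreover have "\<forall>\<^sub>F \<delta>::real in at_right 0. 0 < \<delta>" by (rule eventually_at_right_less)
  ultimately show ?thesis
  proof eventually_elim
    case (elim \<delta>)
    define t where "t = (\<lambda>z. (1 - \<eta>) * smoothing \<delta> i z + \<eta>)"
    have ct: "continuous_on UNIV t" unfolding t_def
      by (intro continuous_intros smooth_on_continuous smooth_smoothing i elim(2))
    have sub: "ball (p i) (r i / 2) \<subseteq> disc i" "ball (p i) (r i / 2) \<subseteq> big i" using r[OF i] by auto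
    have ae: "AE y in lborel. y \<in> ball (p i) (r i / 2) \<longrightarrow> in_chart i y \<le> t y"
      by (rule AE_open_dense[OF _ open_ball elim(2) ct]) (use elim(1) sub in \<open>auto simp: t_def\<close>)
    define P where "P = (\<lambda>x. x \<in> chart_ball (c i) (p i) (r i / 2) \<longrightarrow> shifted x \<le> t (snd (c i) x))"
    have "{x. P x} \<in> sets borel"
    proof -
      have "continuous_on (fst (c i)) (\<lambda>x. t (snd (c i) x))"
        by (rule continuous_on_compose2[OF ct continuous_chart[OF ci] subset_UNIV])
      then have [measurable]: "(\<lambda>x. indicator (fst (c i)) x *\<^sub>R t (snd (c i) x)) \<in> borel_measurable borel"
        by (rule borel_measurable_continuous_on_indicator[rotated]) (rule borel_open[OF open_domain[OF ci]])
      have [measurable]: "chart_ball (c i) (p i) (r i / 2) \<in> sets borel" by (rule borel_open[OF open_chart_ball[OF ci]])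
      have "{x. P x} = {x. x \<in> chart_ball (c i) (p i) (r i / 2) \<longrightarrow> shifted x \<le> indicator (fst (c i)) x *\<^sub>R t (snd (c i) x)}"
        by (auto simp: P_def chart_ball_def)
      also have "\<dots> \<in> sets borel" by measurable
      finally show ?thesis .
    qed
    note tr = AE_vol_chart[OF ci this]
    have "AE z in lborel. z \<in> chart_image (c i) \<longrightarrow> P (chart_inv (c i) z)"
      using ae
    proof (rule AE_mp, intro AE_I2 impI)
      fix z assume z: "z \<in> ball (p i) (r i / 2) \<longrightarrow> in_chart i z \<le> t z" "z \<in> chart_image (c i)"
      show "P (chart_inv (c i) z)"
        unfolding P_def chart_ball_def using z sub(2) in_chart_eq[of z i] by (auto simp: chart_chart_inv[OF ci])
    qed
    then have "AE x in vol. x \<in> fst (c i) \<longrightarrow> P x" using tr by simp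
    then show ?case by (rule AE_mp) (auto simp: P_def t_def chart_ball_def)
  qed
qed

text \<open>Near the compact overlap of the discs the transition map is Lipschitz with some constant
  C, so it maps the ball of radius \<delta> into one of radius C \<delta>. There
  \<open>smoothing_upper_bound\<close> in the chart of j bounds the values, and averaging in the
  chart of i gives the claim.\<close>

lemma smoothing_compare:
  assumes i: "i \<in> X" and j: "j \<in> X" and \<eta>: "0 < \<eta>" "\<eta> < 1"
  shows "\<forall>\<^sub>F \<delta> in at_right 0. \<forall>x. x \<in> fst (c i) \<longrightarrow> x \<in> fst (c j) \<longrightarrow> snd (c i) x \<in> disc i \<longrightarrow> snd (c j) x \<in> disc j \<longrightarrow>
    smoothing \<delta> i (snd (c i) x) \<le> (1 - \<eta>) * smoothing \<delta> j (snd (c j) x) + \<eta>"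
proof -
  note ci = c[OF i] and cj = c[OF j]
  let ?T = "transition (c i) (c j)"
  define Q where "Q = chart_ball (c i) (p i) (4 * r i) \<inter> chart_ball (c j) (p j) (4 * r j)"
  define S where "S = snd (c i) ` Q"
  have Q: "open Q" "Q \<subseteq> fst (c i)" "Q \<subseteq> fst (c j)"
    unfolding Q_def by (intro open_Int open_chart_ball ci cj, auto simp: chart_ball_def)
  have oS: "open S" unfolding S_def by (rule open_chart_image[OF ci Q(1,2)])
  have sT: "smooth_on S ?T"
    by (rule smooth_on_subset[OF smooth_transition[OF ci cj]]) (use Q in \<open>auto simp: S_def\<close>)
  define D where "D = (\<lambda>i. chart_inv (c i) ` disc i)"
  have cD: "compact (D k)" if "k \<in> X" for k
    unfolding D_def by (intro compact_continuous_image compact_cball continuous_on_subset[OF continuous_chart_inv[OF c[OF that]] disc_subset[OF that]])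
  have D_iff: "x \<in> D k \<longleftrightarrow> x \<in> fst (c k) \<and> snd (c k) x \<in> disc k" if k: "k \<in> X" for x k
  proof
    assume "x \<in> D k"
    then obtain z where z: "z \<in> disc k" "x = chart_inv (c k) z" unfolding D_def by blast
    then have "z \<in> chart_image (c k)" using disc_subset[OF k] by blast
    then show "x \<in> fst (c k) \<and> snd (c k) x \<in> disc k" using z chart_inv_in[OF c[OF k]] chart_chart_inv[OF c[OF k]] by metis
  next
    assume "x \<in> fst (c k) \<and> snd (c k) x \<in> disc k"
    then show "x \<in> D k" unfolding D_def by (metis chart_inv_chart[OF c[OF k]] imageI)
  qed
  have DQ: "D i \<inter> D j \<subseteq> Q"
  proof
    fix x assume "x \<in> D i \<inter> D j"
    then show "x \<in> Q" using D_iff[OF i] D_iff[OF j] disc_big[OF i] disc_big[OF j] unfolding Q_def chart_ball_def by blast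
  qed
  have cDD: "compact (D i \<inter> D j)" by (rule compact_Int_closed[OF cD[OF i] compact_imp_closed[OF cD[OF j]]])
  have "D i \<inter> D j \<subseteq> fst (c i)" using DQ Q(2) by blast
  then have cK: "compact (snd (c i) ` (D i \<inter> D j))"
    by (rule compact_continuous_image[OF continuous_on_subset[OF continuous_chart[OF ci]] cDD])
  have KS: "snd (c i) ` (D i \<inter> D j) \<subseteq> S" unfolding S_def using DQ by blast
  obtain C d where C: "1 \<le> C" "0 < d" "\<And>z w. z \<in> snd (c i) ` (D i \<inter> D j) \<Longrightarrow> dist w z < d \<Longrightarrow> w \<in> S \<and> dist (?T w) (?T z) \<le> C * dist w z"
    by (rule smooth_on_lipschitz_near_compact[OF oS sT cK KS]) blast
  have "\<forall>\<^sub>F \<delta> in at_right 0. \<forall>z\<in>disc j. AE y in lborel. y \<in> ball z (C * \<delta>) \<longrightarrow> in_chart j y \<le> (1 - \<eta>) * smoothing \<delta> j z + \<eta>"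
    by (rule smoothing_upper_bound[OF j C(1) \<eta>])
  moreover have "\<forall>\<^sub>F \<delta>::real in at_right 0. 0 < \<delta>" by (rule eventually_at_right_less)
  moreover have "\<forall>\<^sub>F \<delta>::real in at_right 0. \<delta> < d" using C(2) by (auto simp: eventually_at_right_field)
  ultimately show ?thesis
  proof eventually_elim
    case (elim \<delta>)
    show ?case
    proof (intro allI impI)
      fix x assume x: "x \<in> fst (c i)" "x \<in> fst (c j)" "snd (c i) x \<in> disc i" "snd (c j) x \<in> disc j"
      define t where "t = (1 - \<eta>) * smoothing \<delta> j (snd (c j) x) + \<eta>"
      \<comment> \<open>Formulated on the manifold so that \<open>AE_vol_chart\<close> can carry the
        null set from the chart of j to that of i.\<close>
      define P where "P = (\<lambda>y. y \<in> chart_ball (c j) (p j) (4 * r j) \<longrightarrow> y \<in> chart_ball (c j) (snd (c j) x) (C * \<delta>) \<longrightarrow> shifted y \<le> t)"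
      have Pm: "{y. P y} \<in> sets borel"
      proof -
        have [measurable]: "chart_ball (c j) q s \<in> sets borel" for q s by (rule borel_open[OF open_chart_ball[OF cj]])
        show ?thesis unfolding P_def by measurable
      qed
      have "AE y in lborel. y \<in> ball (snd (c j) x) (C * \<delta>) \<longrightarrow> in_chart j y \<le> t"
        using elim(1) x(4) unfolding t_def by blast
      then have "AE y in lborel. y \<in> chart_image (c j) \<longrightarrow> P (chart_inv (c j) y)"
        by (rule AE_mp) (auto simp: P_def chart_ball_def chart_chart_inv[OF cj] in_chart_eq)
      then have "AE y in vol. y \<in> fst (c j) \<longrightarrow> P y" using AE_vol_chart[OF cj Pm] by simp
      then have "AE y in vol. y \<in> fst (c i) \<longrightarrow> P y" by (rule AE_mp) (auto simp: P_def chart_ball_def)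
      then have ae: "AE y in lborel. y \<in> chart_image (c i) \<longrightarrow> P (chart_inv (c i) y)" using AE_vol_chart[OF ci Pm] by simp
      have xD: "snd (c i) x \<in> snd (c i) ` (D i \<inter> D j)" using x D_iff[OF i] D_iff[OF j] by blast
      have Tx: "?T (snd (c i) x) = snd (c j) x" by (rule transition_chart[OF ci x(1)])
      have "smoothing \<delta> i (snd (c i) x) \<le> t"
        unfolding smoothing_def
      proof (rule mollify_le[OF integrable_in_chart[OF i] elim(2)])
        show "AE w in lborel. w \<in> ball (snd (c i) x) \<delta> \<longrightarrow> in_chart i w \<le> t"
          using ae
        proof (rule AE_mp, intro AE_I2 impI)
          fix w assume w: "w \<in> chart_image (c i) \<longrightarrow> P (chart_inv (c i) w)" "w \<in> ball (snd (c i) x) \<delta>"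
          then have dw: "dist w (snd (c i) x) < \<delta>" by (simp add: dist_commute)
          from C(3)[OF xD, of w] dw elim(3) Tx
          have wS: "w \<in> S" and dT: "dist (?T w) (snd (c j) x) \<le> C * dist w (snd (c i) x)" by auto
          from wS obtain y where y: "y \<in> Q" "w = snd (c i) y" unfolding S_def by blast
          have yi: "y \<in> fst (c i)" "y \<in> fst (c j)" using y(1) Q by auto
          have iw: "chart_inv (c i) w = y" unfolding y(2) by (rule chart_inv_chart[OF ci yi(1)])
          have "dist (snd (c j) y) (snd (c j) x) < C * \<delta>"
            using dT mult_strict_left_mono[OF dw, of C] C(1) unfolding y(2) transition_chart[OF ci yi(1)] by linarith
          then have "y \<in> chart_ball (c j) (snd (c j) x) (C * \<delta>)" using yi(2) by (simp add: chart_ball_def dist_commute)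
          moreover have "P y" using w(1) chart_in_image[OF yi(1)] iw y(2) by simp
          moreover have "in_chart i w = shifted y"
            using y(1) in_chart_eq[of w i] iw unfolding Q_def chart_ball_def y(2) by simp
          ultimately show "in_chart i w \<le> t" using y(1) unfolding P_def Q_def by simp
        qed
      qed
      then show "smoothing \<delta> i (snd (c i) x) \<le> (1 - \<eta>) * smoothing \<delta> j (snd (c j) x) + \<eta>" unfolding t_def .
    qed
  qed
qed

end

section \<open>The approximating sequence\<close>

context psh_regularization
begin

lemma shifted_nonpos: "shifted x \<le> 0"
  using B(2)[of x] B(1) by (cases "u x") (auto simp: shifted_def)

text \<open>The gap \<eta> is spent in eighths. The mollifications stay below f - 3\<eta>/4, and the
  number of summands costs \<eta>/8, so the glued function is at most f - 5\<eta>/8; from below it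
  misses \<open>shifted\<close> by at most \<eta>/8. It is raised by 3\<eta>/8, and the division by
  1 + k raises it by at most another \<eta>/8. Hence w \<le> f, and a gap of \<eta>/4 remains below
  w.\<close>

lemma regularization_step:
  assumes f: "continuous_on UNIV f" "\<And>x. f x \<le> 0" and \<eta>: "0 < \<eta>" "AE x in vol. shifted x + \<eta> \<le> f x"
  shows "\<exists>w \<eta>'. smooth_psh w \<and> 0 < \<eta>' \<and> (\<forall>x. w x \<le> f x) \<and> (AE x in vol. shifted x + \<eta>' \<le> w x)"
proof -
  have "bounded (range f)" by (intro compact_imp_bounded compact_continuous_image f(1) compact_space)
  then obtain N0 where N0: "\<And>x. \<bar>f x\<bar> \<le> N0" unfolding bounded_iff by auto
  have N0': "0 \<le> N0" using N0[of undefined] by linarith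
  \<comment> \<open>Large enough that f - 3\<eta>/4 stays above -N, so that the summand exp
    (-N/\<epsilon>) does not lift the glued function above f.\<close>
  define N where "N = N0 + \<eta> + 1"
  have N: "1 \<le> N" using N0' \<eta>(1) by (simp add: N_def)
  obtain C where C: "\<And>i. i \<in> X \<Longrightarrow> 0 \<le> C i"
    "\<And>i z v. i \<in> X \<Longrightarrow> z \<in> disc i \<Longrightarrow> - 4 * C i * Re (hermitian_form (g (c i) z) v) \<le> cutoff_error i z v"
    using cutoff_error_bound by metis
  define L where "L = 1 + exp 1 * (\<Sum>i\<in>X. C i)"
  have L: "1 \<le> L" unfolding L_def using C(1) by (simp add: sum_nonneg)
  define m where "m = 1 + real (card X)"
  have m: "1 \<le> m" by (simp add: m_def)
  \<comment> \<open>The three summands correspond to three losses, \<epsilon> from comparing charts,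
    \<epsilon> ln m from the number of summands and \<epsilon> L N from the final division;
    \<epsilon> is chosen to make their sum \<eta>/8.\<close>
  define D where "D = 1 + ln m + L * N"
  have lnm: "0 \<le> ln m" using m by simp
  have LN: "0 \<le> L * N" using L N by simp
  have D: "1 \<le> D" unfolding D_def using lnm LN by simp
  define \<epsilon> where "\<epsilon> = \<eta> / 8 / D"
  have \<epsilon>0: "0 < \<epsilon>" using \<eta>(1) D by (simp add: \<epsilon>_def)
  have \<epsilon>D: "\<epsilon> * D = \<eta> / 8" using D by (simp add: \<epsilon>_def)
  then have split: "\<epsilon> + \<epsilon> * ln m + \<epsilon> * (L * N) = \<eta> / 8" unfolding D_def by (simp add: algebra_simps)
  have nn: "0 \<le> \<epsilon> * ln m" "0 \<le> \<epsilon> * (L * N)" using \<epsilon>0 lnm LN by simp_all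
  have \<epsilon>1: "\<epsilon> \<le> \<eta> / 8" and \<epsilon>2: "\<epsilon> * ln m \<le> \<eta> / 8" and \<epsilon>3: "\<epsilon> * (L * N) \<le> \<eta> / 8" using split nn \<epsilon>0 by linarith+
  \<comment> \<open>The value (1 - \<theta>) a + \<theta> exceeds a by \<theta> (1 - a), which is
    unbounded as a tends to -\<infinity>. Replacing a by its maximum with -N limits the excess to
    \<theta> (1 + N) \<le> \<epsilon>.\<close>
  define \<theta> where "\<theta> = min (1 / 2) (\<epsilon> / (1 + N))"
  have \<theta>: "0 < \<theta>" "\<theta> < 1" "\<theta> * (1 + N) \<le> \<epsilon>"
  proof -
    show "0 < \<theta>" "\<theta> < 1" using \<epsilon>0 N by (auto simp: \<theta>_def)
    have "\<theta> * (1 + N) \<le> \<epsilon> / (1 + N) * (1 + N)" unfolding \<theta>_def using N by (intro mult_right_mono) auto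
    then show "\<theta> * (1 + N) \<le> \<epsilon>" using N by simp
  qed
  have \<theta>_max: "(1 - \<theta>) * a + \<theta> \<le> max a (- N) + \<epsilon>" for a
  proof -
    have "(1 - \<theta>) * a + \<theta> \<le> (1 - \<theta>) * max a (- N) + \<theta>" using \<theta>(2) by (simp add: mult_left_mono)
    also have "\<dots> = max a (- N) + \<theta> * (1 - max a (- N))" by (simp add: algebra_simps)
    also have "\<dots> \<le> max a (- N) + \<theta> * (1 + N)" using \<theta>(1) by (intro add_left_mono mult_left_mono) auto
    finally show ?thesis using \<theta>(3) by linarith
  qed
  have "\<forall>\<^sub>F \<delta>::real in at_right 0. 0 < \<delta>" by (rule eventually_at_right_less)
  moreover have "\<forall>\<^sub>F \<delta> in at_right 0. \<forall>i\<in>X. \<forall>z\<in>disc i. smoothing \<delta> i z \<le> f (chart_inv (c i) z) - \<eta> + \<eta> / 4"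
    by (rule eventually_ball_finite[OF finite_X]) (use smoothing_upper[OF _ f(1) \<eta>(2), of _ "\<eta> / 4"] \<eta>(1) in auto)
  moreover have "\<forall>\<^sub>F \<delta> in at_right 0. \<forall>i\<in>X. \<forall>z\<in>disc i. \<forall>v.
      - 4 * (1 + \<epsilon>) * Re (hermitian_form (g (c i) z) v) \<le> levi (smoothing \<delta> i) z v"
    by (rule eventually_ball_finite[OF finite_X]) (intro ballI smoothing_levi \<epsilon>0)
  moreover have "\<forall>\<^sub>F \<delta> in at_right 0. \<forall>i\<in>X. AE x in vol. x \<in> chart_ball (c i) (p i) (r i / 2) \<longrightarrow>
      shifted x \<le> (1 - \<theta>) * smoothing \<delta> i (snd (c i) x) + \<theta>"
    by (rule eventually_ball_finite[OF finite_X]) (intro ballI smoothing_AE_ge \<theta>)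
  moreover have "\<forall>\<^sub>F \<delta> in at_right 0. \<forall>i\<in>X. \<forall>j\<in>X. \<forall>x. x \<in> fst (c i) \<longrightarrow> x \<in> fst (c j) \<longrightarrow> snd (c i) x \<in> disc i \<longrightarrow> snd (c j) x \<in> disc j \<longrightarrow>
      smoothing \<delta> i (snd (c i) x) \<le> (1 - \<theta>) * smoothing \<delta> j (snd (c j) x) + \<theta>"
    by (rule eventually_ball_finite[OF finite_X], rule ballI, rule eventually_ball_finite[OF finite_X]) (intro ballI smoothing_compare \<theta>)
  ultimately have "\<forall>\<^sub>F \<delta>::real in at_right 0. 0 < \<delta> \<and>
      (\<forall>i\<in>X. \<forall>z\<in>disc i. smoothing \<delta> i z \<le> f (chart_inv (c i) z) - \<eta> + \<eta> / 4) \<and>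
      (\<forall>i\<in>X. \<forall>z\<in>disc i. \<forall>v. - 4 * (1 + \<epsilon>) * Re (hermitian_form (g (c i) z) v) \<le> levi (smoothing \<delta> i) z v) \<and>
      (\<forall>i\<in>X. AE x in vol. x \<in> chart_ball (c i) (p i) (r i / 2) \<longrightarrow> shifted x \<le> (1 - \<theta>) * smoothing \<delta> i (snd (c i) x) + \<theta>) \<and>
      (\<forall>i\<in>X. \<forall>j\<in>X. \<forall>x. x \<in> fst (c i) \<longrightarrow> x \<in> fst (c j) \<longrightarrow> snd (c i) x \<in> disc i \<longrightarrow> snd (c j) x \<in> disc j \<longrightarrow>
      smoothing \<delta> i (snd (c i) x) \<le> (1 - \<theta>) * smoothing \<delta> j (snd (c j) x) + \<theta>)"
    by (intro eventually_conj)
  from eventually_happens'[OF trivial_limit_at_right_real this] obtain \<delta> where \<delta>: "0 < \<delta>"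
    and upper: "\<And>i z. i \<in> X \<Longrightarrow> z \<in> disc i \<Longrightarrow> smoothing \<delta> i z \<le> f (chart_inv (c i) z) - \<eta> + \<eta> / 4"
    and levi_ge: "\<And>i z v. i \<in> X \<Longrightarrow> z \<in> disc i \<Longrightarrow> - 4 * (1 + \<epsilon>) * Re (hermitian_form (g (c i) z) v) \<le> levi (smoothing \<delta> i) z v"
    and lower: "\<And>i. i \<in> X \<Longrightarrow> AE x in vol. x \<in> chart_ball (c i) (p i) (r i / 2) \<longrightarrow> shifted x \<le> (1 - \<theta>) * smoothing \<delta> i (snd (c i) x) + \<theta>"
    and compare: "\<And>i j x. i \<in> X \<Longrightarrow> j \<in> X \<Longrightarrow> x \<in> fst (c i) \<Longrightarrow> x \<in> fst (c j) \<Longrightarrow> snd (c i) x \<in> disc i \<Longrightarrow> snd (c j) x \<in> disc j \<Longrightarrow>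
      smoothing \<delta> i (snd (c i) x) \<le> (1 - \<theta>) * smoothing \<delta> j (snd (c j) x) + \<theta>"
    by auto
  let ?W = "weight_sum N \<epsilon> (smoothing \<delta>)" and ?G = "glue N \<epsilon> (smoothing \<delta>)"
  have W_ge: "exp (max (smoothing \<delta> j (snd (c j) x)) (- N) / \<epsilon>) \<le> ?W x"
    if j: "j \<in> X" "x \<in> chart_ball (c j) (p j) (r j / 2)" for j x
  proof -
    have "partial_cutoff j x = 1" using j cutoff_eq_1[OF j(1)] by (auto simp: partial_cutoff_def chart_ball_def)
    then have "exp (smoothing \<delta> j (snd (c j) x) / \<epsilon>) \<le> (\<Sum>i\<in>X. (partial_cutoff i x)\<^sup>2 * exp (smoothing \<delta> i (snd (c i) x) / \<epsilon>))"
      using member_le_sum[OF j(1) _ finite_X, of "\<lambda>i. (partial_cutoff i x)\<^sup>2 * exp (smoothing \<delta> i (snd (c i) x) / \<epsilon>)"] by simp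
    moreover have "0 \<le> (\<Sum>i\<in>X. (partial_cutoff i x)\<^sup>2 * exp (smoothing \<delta> i (snd (c i) x) / \<epsilon>))"
      by (intro sum_nonneg) simp
    ultimately show ?thesis unfolding weight_sum_def by (auto simp: max_def add_increasing add_increasing2)
  qed
  have G_ge: "max (smoothing \<delta> j (snd (c j) x)) (- N) \<le> ?G x" if "j \<in> X" "x \<in> chart_ball (c j) (p j) (r j / 2)" for j x
  proof -
    have "max (smoothing \<delta> j (snd (c j) x)) (- N) / \<epsilon> \<le> ln (?W x)"
      using W_ge[OF that] weight_sum_pos[of N \<epsilon> "smoothing \<delta>" x] by (simp add: ln_ge_iff)
    then show ?thesis using \<epsilon>0 by (simp add: glue_def field_simps)
  qed
  have covered: "\<exists>j\<in>X. x \<in> chart_ball (c j) (p j) (r j / 2)" for x using cover by blast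
  \<comment> \<open>At every point some cutoff is 1. Any other mollification exceeds the larger of
    the corresponding one and -N by at most \<epsilon>, which after division by \<epsilon> becomes
    the factor exp 1.\<close>
  have weight: "exp (smoothing \<delta> i (snd (c i) x) / \<epsilon>) \<le> exp 1 * ?W x"
    if i: "i \<in> X" "x \<in> fst (c i)" "snd (c i) x \<in> disc i" for i x
  proof -
    obtain j where j: "j \<in> X" "x \<in> chart_ball (c j) (p j) (r j / 2)" using covered by blast
    then have xj: "x \<in> fst (c j)" "snd (c j) x \<in> disc j" using r[OF j(1)] by (auto simp: chart_ball_def)
    have "smoothing \<delta> i (snd (c i) x) \<le> max (smoothing \<delta> j (snd (c j) x)) (- N) + \<epsilon>"
      using compare[OF i(1) j(1) i(2) xj(1) i(3) xj(2)] \<theta>_max by (rule order_trans)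
    then have "smoothing \<delta> i (snd (c i) x) / \<epsilon> \<le> 1 + max (smoothing \<delta> j (snd (c j) x)) (- N) / \<epsilon>"
      using \<epsilon>0 by (simp add: field_simps)
    then have "exp (smoothing \<delta> i (snd (c i) x) / \<epsilon>) \<le> exp 1 * exp (max (smoothing \<delta> j (snd (c j) x)) (- N) / \<epsilon>)"
      by (simp flip: exp_add)
    also have "\<dots> \<le> exp 1 * ?W x" using W_ge[OF j] by simp
    finally show ?thesis .
  qed
  have G_le: "?G x \<le> f x - 5 * \<eta> / 8" for x
  proof -
    have le: "(partial_cutoff i x)\<^sup>2 * exp (smoothing \<delta> i (snd (c i) x) / \<epsilon>) \<le> exp ((f x - 3 * \<eta> / 4) / \<epsilon>)" if i: "i \<in> X" for i
    proof (cases "x \<in> fst (c i) \<and> snd (c i) x \<in> disc i")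
      case True
      have "smoothing \<delta> i (snd (c i) x) \<le> f x - \<eta> + \<eta> / 4"
        using upper[OF i, of "snd (c i) x"] True chart_inv_chart[OF c[OF i], of x] by simp
      then have "exp (smoothing \<delta> i (snd (c i) x) / \<epsilon>) \<le> exp ((f x - 3 * \<eta> / 4) / \<epsilon>)"
        using \<epsilon>0 by (simp add: divide_right_mono)
      moreover have "(partial_cutoff i x)\<^sup>2 \<le> 1"
        using step_nonneg step_le_1 by (simp add: partial_cutoff_def cutoff_def power_le_one)
      ultimately show ?thesis using mult_mono[of "(partial_cutoff i x)\<^sup>2" 1] by simp
    next
      case False
      then have "partial_cutoff i x = 0" using cutoff_eq_0[OF i] by (auto simp: partial_cutoff_def)
      then show ?thesis by simp
    qed
    have "- N \<le> f x - 3 * \<eta> / 4" using N0[of x] \<eta>(1) unfolding N_def by linarith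
    then have "exp (- N / \<epsilon>) \<le> exp ((f x - 3 * \<eta> / 4) / \<epsilon>)" using \<epsilon>0 by (simp only: exp_le_cancel_iff divide_right_mono)
    moreover have "(\<Sum>i\<in>X. (partial_cutoff i x)\<^sup>2 * exp (smoothing \<delta> i (snd (c i) x) / \<epsilon>)) \<le> (\<Sum>i\<in>X. exp ((f x - 3 * \<eta> / 4) / \<epsilon>))"
      by (rule sum_mono[OF le])
    ultimately have "?W x \<le> exp ((f x - 3 * \<eta> / 4) / \<epsilon>) + (\<Sum>i\<in>X. exp ((f x - 3 * \<eta> / 4) / \<epsilon>))"
      unfolding weight_sum_def by (rule add_mono)
    then have "?W x \<le> m * exp ((f x - 3 * \<eta> / 4) / \<epsilon>)" by (simp add: m_def distrib_right)
    then have "ln (?W x) \<le> ln (m * exp ((f x - 3 * \<eta> / 4) / \<epsilon>))"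
      using weight_sum_pos[of N \<epsilon> "smoothing \<delta>" x] by simp
    also have "\<dots> = ln m + (f x - 3 * \<eta> / 4) / \<epsilon>" using m by (simp add: ln_mult)
    finally have "?G x \<le> \<epsilon> * (ln m + (f x - 3 * \<eta> / 4) / \<epsilon>)" unfolding glue_def using \<epsilon>0 by simp
    also have "\<dots> = \<epsilon> * ln m + (f x - 3 * \<eta> / 4)" using \<epsilon>0 by (simp add: distrib_left)
    finally show ?thesis using \<epsilon>2 by linarith
  qed
  \<comment> \<open>The Levi form of the glued function is at least -4 (1 + k) times the metric;
    dividing by 1 + k restores the exact bound.\<close>
  define k where "k = \<epsilon> * L"
  have k: "0 < k" "k * N \<le> \<eta> / 8" using \<epsilon>0 L \<epsilon>3 by (simp_all add: k_def mult.assoc)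
  define w where "w = (\<lambda>x. (1 / (1 + k)) * (?G x + 3 * \<eta> / 8))"
  have G_N: "- N \<le> ?G x" for x using covered[of x] G_ge[of _ x] by (meson max.bounded_iff)
  \<comment> \<open>Since y \<ge> -N, division by 1 + k raises y by at most k N.\<close>
  have w_le: "w x \<le> f x" for x
  proof -
    define y where "y = ?G x + 3 * \<eta> / 8"
    have "0 \<le> y + N" using G_N[of x] \<eta>(1) unfolding y_def by linarith
    then have "0 \<le> k * (y + N) + k * (k * N)" using k(1) N by simp
    then have "y \<le> (y + k * N) * (1 + k)" by (simp add: algebra_simps)
    then have "w x \<le> y + k * N" unfolding w_def y_def[symmetric] using k(1) by (simp add: pos_divide_le_eq)
    then show ?thesis using G_le[of x] k(2) \<eta>(1) unfolding y_def by linarith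
  qed
  \<comment> \<open>Here f \<le> 0 enters: y is nonpositive, so division by 1 + k does not lower
    it.\<close>
  have w_ge: "?G x + 3 * \<eta> / 8 \<le> w x" for x
  proof -
    define y where "y = ?G x + 3 * \<eta> / 8"
    have "y \<le> 0" using G_le[of x] f(2)[of x] \<eta>(1) unfolding y_def by linarith
    then have "y * (1 + k) \<le> y" using k(1) by (simp add: algebra_simps mult_nonneg_nonpos)
    then show ?thesis unfolding w_def y_def[symmetric] using k(1) by (simp add: pos_le_divide_eq)
  qed
  have "smooth_on (chart_image d) (w \<circ> chart_inv d) \<and>
      (\<forall>z\<in>chart_image d. \<forall>v. - 4 * Re (hermitian_form (g d z) v) \<le> levi (w \<circ> chart_inv d) z v)" if d: "d \<in> atlas" for d
  proof -
    have sG: "smooth_on (chart_image d) (?G \<circ> chart_inv d)"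
      by (rule glue_smooth_psh(1)[OF _ \<epsilon>0 _ _ _ _ d]) (rule smooth_smoothing[OF _ \<delta>] levi_ge weight C; assumption)+
    have lG: "- 4 * (1 + k) * Re (hermitian_form (g d z) v) \<le> levi (?G \<circ> chart_inv d) z v" if "z \<in> chart_image d" for z v
    proof -
      have "- 4 * (1 + \<epsilon> + \<epsilon> * (exp 1 * (\<Sum>i\<in>X. C i))) * Re (hermitian_form (g d z) v) \<le> levi (?G \<circ> chart_inv d) z v"
        by (rule glue_smooth_psh(2)[OF _ \<epsilon>0 _ _ _ _ d that]) (rule smooth_smoothing[OF _ \<delta>] levi_ge weight C; assumption)+
      moreover have "1 + \<epsilon> + \<epsilon> * (exp 1 * (\<Sum>i\<in>X. C i)) = 1 + k" by (simp add: k_def L_def distrib_left)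
      ultimately show ?thesis by (simp only:)
    qed
    note od = open_image[OF d]
    have e: "w \<circ> chart_inv d = (\<lambda>z. (1 / (1 + k)) * ((?G \<circ> chart_inv d) z + 3 * \<eta> / 8))" by (simp add: w_def fun_eq_iff)
    have s1: "smooth_on (chart_image d) (\<lambda>z. (?G \<circ> chart_inv d) z + 3 * \<eta> / 8)"
      by (rule smooth_on_add[OF od sG smooth_on_const[OF od]])
    have "- 4 * Re (hermitian_form (g d z) v) \<le> levi (w \<circ> chart_inv d) z v" if z: "z \<in> chart_image d" for z v
    proof -
      have "levi (w \<circ> chart_inv d) z v = (1 / (1 + k)) * levi (?G \<circ> chart_inv d) z v"
        unfolding e levi_cmult[OF od s1 z] levi_add[OF od sG smooth_on_const[OF od] z] by (simp add: levi_const)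
      then have "(1 + k) * levi (w \<circ> chart_inv d) z v = levi (?G \<circ> chart_inv d) z v" using k(1) by simp
      then have "(1 + k) * (- 4 * Re (hermitian_form (g d z) v)) \<le> (1 + k) * levi (w \<circ> chart_inv d) z v"
        using lG[OF z, of v] by (simp add: algebra_simps)
      then show ?thesis using k(1) by (simp only: mult_le_cancel_left_pos)
    qed
    moreover have "smooth_on (chart_image d) (w \<circ> chart_inv d)" unfolding e by (rule smooth_on_cmult[OF od s1])
    ultimately show ?thesis by blast
  qed
  then have psh: "smooth_psh w" unfolding smooth_psh_def smooth_function_def by blast
  have "AE x in vol. \<forall>i\<in>X. x \<in> chart_ball (c i) (p i) (r i / 2) \<longrightarrow> shifted x \<le> (1 - \<theta>) * smoothing \<delta> i (snd (c i) x) + \<theta>"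
    using lower by (simp add: AE_ball_countable countable_finite[OF finite_X])
  then have "AE x in vol. shifted x + \<eta> / 4 \<le> w x"
  proof (rule AE_mp, intro AE_I2 impI)
    fix x assume *: "\<forall>i\<in>X. x \<in> chart_ball (c i) (p i) (r i / 2) \<longrightarrow> shifted x \<le> (1 - \<theta>) * smoothing \<delta> i (snd (c i) x) + \<theta>"
    obtain j where j: "j \<in> X" "x \<in> chart_ball (c j) (p j) (r j / 2)" using covered by blast
    then have "shifted x \<le> (1 - \<theta>) * smoothing \<delta> j (snd (c j) x) + \<theta>" using * by blast
    also have "\<dots> \<le> max (smoothing \<delta> j (snd (c j) x)) (- N) + \<epsilon>" by (rule \<theta>_max)
    also have "\<dots> \<le> ?G x + \<eta> / 8" using G_ge[OF j] \<epsilon>1 by linarith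
    finally show "shifted x + \<eta> / 4 \<le> w x" using w_ge[of x] by linarith
  qed
  then show ?thesis using psh w_le \<eta>(1) by (intro exI[of _ w] exI[of _ "\<eta> / 4"]) auto
qed

text \<open>A Urysohn function separates x from the complement of the open set where u < q + B. The
  factor 2 makes h equal to q on a whole neighbourhood of x, so that h can be indexed by a basis set
  and a rational q. Points with u = -\<infinity> are excepted, as \<open>shifted\<close> has the
  conventional value -B there.\<close>

lemma usc_bound_function:
  assumes "u x < ereal (q + B)" "q \<le> 0"
  obtains h W where "continuous_on UNIV h" "open W" "x \<in> W" "\<And>y. y \<in> W \<Longrightarrow> h y = q"
    "\<And>y. u y \<noteq> -\<infinity> \<Longrightarrow> shifted y \<le> h y"
proof -
  define Q where "Q = {y. u y < ereal (q + B)}"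
  have oQ: "open Q" using u unfolding Q_def PSH_def upper_semicontinuous_def by blast
  have "normal_space (euclidean :: 'a topology)"
  proof (rule compact_Hausdorff_or_regular_imp_normal_space)
    show "compact_space (euclidean :: 'a topology)" by (simp add: compact_space_def compact_space)
    have "Hausdorff_space (euclidean :: 'a topology)"
      unfolding Hausdorff_space_def disjnt_def by (simp, metis hausdorff)
    then show "Hausdorff_space (euclidean :: 'a topology) \<or> regular_space (euclidean :: 'a topology)" ..
  qed
  moreover have "closedin euclidean {x}" "closedin euclidean (- Q)" "disjnt {x} (- Q)"
    using oQ assms(1) by (auto simp: closedin_closed_eq disjnt_def Q_def closed_Compl)
  ultimately obtain \<phi> where \<phi>: "continuous_map euclidean (top_of_set {0..1::real}) \<phi>" "\<phi> ` {x} \<subseteq> {0}" "\<phi> ` (- Q) \<subseteq> {1}"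
    using Urysohn_lemma[of euclidean "{x}" "- Q" 0 1] by auto
  have c\<phi>: "continuous_on UNIV \<phi>" and \<phi>01: "0 \<le> \<phi> y" "\<phi> y \<le> 1" for y
    using \<phi>(1) by (auto simp: continuous_map_in_subtopology)
  define h where "h = (\<lambda>y. q * min 1 (2 * (1 - \<phi> y)))"
  show thesis
  proof (rule that[of h "{y. \<phi> y < 1 / 2}"])
    show "continuous_on UNIV h" unfolding h_def by (intro continuous_intros c\<phi>)
    show "open {y. \<phi> y < 1 / 2}" by (intro open_Collect_less c\<phi> continuous_on_const)
    show "x \<in> {y. \<phi> y < 1 / 2}" using \<phi>(2) by simp
    show "h y = q" if "y \<in> {y. \<phi> y < 1 / 2}" for y using that by (simp add: h_def min_def)
    show "shifted y \<le> h y" if "u y \<noteq> -\<infinity>" for y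
    proof (cases "y \<in> Q")
      case True
      then have "shifted y \<le> q" using that by (cases "u y") (auto simp: Q_def shifted_def)
      also have "q * 1 \<le> q * min 1 (2 * (1 - \<phi> y))" by (rule mult_left_mono_neg[OF _ assms(2)]) simp
      finally show ?thesis by (simp add: h_def)
    next
      case False
      then have "\<phi> y = 1" using \<phi>(3) by auto
      then show ?thesis using shifted_nonpos by (simp add: h_def)
    qed
  qed
qed

text \<open>Countability comes from choosing one majorant for each pair of a basis set and a
  rational value that admits one. The constants 1/(m + 1) create the positive gap that
  \<open>regularization_step\<close> requires.\<close>

lemma countable_upper_functions:
  "\<exists>\<G>. countable \<G> \<and> \<G> \<noteq> {} \<and> (\<forall>h\<in>\<G>. continuous_on UNIV h \<and> (\<exists>\<eta>>0. \<forall>x. u x \<noteq> -\<infinity> \<longrightarrow> shifted x + \<eta> \<le> h x)) \<and>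
     (\<forall>x e. u x \<noteq> -\<infinity> \<longrightarrow> 0 < e \<longrightarrow> (\<exists>h\<in>\<G>. h x < shifted x + e))"
proof -
  obtain \<B> :: "'a set set" where \<B>: "countable \<B>" "topological_basis \<B>" using ex_countable_basis by blast
  define good where "good = (\<lambda>b q h. continuous_on UNIV h \<and> (\<forall>y\<in>b. h y = q) \<and> (\<forall>y. u y \<noteq> -\<infinity> \<longrightarrow> shifted y \<le> h y))"
  define I where "I = {(b, q). b \<in> \<B> \<and> q \<in> \<rat> \<and> (\<exists>h. good b q h)}"
  have "I \<subseteq> \<B> \<times> \<rat>" unfolding I_def by blast
  then have cI: "countable I" using \<B>(1) countable_rat by (meson countable_SIGMA countable_subset)
  \<comment> \<open>The function 0 serves the points where \<open>shifted\<close> is 0; for them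
    there is no q with shifted x < q \<le> 0.\<close>
  define F where "F = insert (\<lambda>x. 0) ((\<lambda>(b, q). SOME h. good b q h) ` I)"
  have cF: "countable F" unfolding F_def using cI by simp
  have good: "good b q (SOME h. good b q h)" if I: "(b, q) \<in> I" for b q
  proof -
    obtain h where "good b q h" using I unfolding I_def by blast
    then show ?thesis by (rule someI[of "good b q"])
  qed
  have F: "continuous_on UNIV h \<and> (\<forall>y. u y \<noteq> -\<infinity> \<longrightarrow> shifted y \<le> h y)" if "h \<in> F" for h
    using that good shifted_nonpos unfolding F_def good_def by fastforce
  define \<G> where "\<G> = (\<lambda>(h, m) x. h x + 1 / (real m + 1)) ` (F \<times> UNIV)"
  have "countable \<G>" unfolding \<G>_def using cF by simp
  moreover have "\<G> \<noteq> {}" by (auto simp: \<G>_def F_def)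
  moreover have "continuous_on UNIV h \<and> (\<exists>\<eta>>0. \<forall>x. u x \<noteq> -\<infinity> \<longrightarrow> shifted x + \<eta> \<le> h x)" if "h \<in> \<G>" for h
  proof -
    obtain f m where h: "f \<in> F" "h = (\<lambda>x. f x + 1 / (real m + 1))" using \<open>h \<in> \<G>\<close> unfolding \<G>_def by auto
    have "0 < 1 / (real m + 1)" "\<forall>x. u x \<noteq> -\<infinity> \<longrightarrow> shifted x + 1 / (real m + 1) \<le> h x" using F[OF h(1)] h(2) by auto
    moreover have "continuous_on UNIV h" unfolding h(2) using F[OF h(1)] by (intro continuous_intros) auto
    ultimately show ?thesis by blast
  qed
  moreover have "\<exists>h\<in>\<G>. h x < shifted x + e" if x: "u x \<noteq> -\<infinity>" and e: "0 < e" for x e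
  proof -
    have "\<exists>f\<in>F. f x < shifted x + e / 2"
    proof (cases "shifted x = 0")
      case True
      then show ?thesis using e by (intro bexI[of _ "\<lambda>x. 0"]) (auto simp: F_def)
    next
      case False
      then have "shifted x < min 0 (shifted x + e / 2)" using shifted_nonpos[of x] e by auto
      then obtain q where q: "q \<in> \<rat>" "shifted x < q" "q < min 0 (shifted x + e / 2)" using Rats_dense_in_real by blast
      have "u x < ereal (q + B)" using q(2) x B(2)[of x] by (cases "u x") (auto simp: shifted_def)
      moreover have "q \<le> 0" using q(3) by simp
      ultimately obtain h W where h: "continuous_on UNIV h" "open W" "x \<in> W" "\<And>y. y \<in> W \<Longrightarrow> h y = q"
        "\<And>y. u y \<noteq> -\<infinity> \<Longrightarrow> shifted y \<le> h y" by (rule usc_bound_function) blast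
      obtain b where b: "b \<in> \<B>" "x \<in> b" "b \<subseteq> W" by (rule topological_basisE[OF \<B>(2) h(2,3)])
      have "good b q h" unfolding good_def using h b(3) by blast
      then have I: "(b, q) \<in> I" unfolding I_def using b(1) q(1) by blast
      have "(SOME h. good b q h) x = q" using good[OF I] b(2) unfolding good_def by blast
      moreover have "(SOME h. good b q h) \<in> F" unfolding F_def using I by force
      ultimately show ?thesis using q(3) by (intro bexI[of _ "SOME h. good b q h"]) auto
    qed
    then obtain f where f: "f \<in> F" "f x < shifted x + e / 2" by blast
    obtain m where m: "1 / (real m + 1) < e / 2"
      using reals_Archimedean[of "e / 2"] e by (auto simp: inverse_eq_divide add.commute)
    have "(\<lambda>x. f x + 1 / (real m + 1)) \<in> \<G>" unfolding \<G>_def using f(1) by force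
    then show ?thesis using f(2) m by (intro bexI[of _ "\<lambda>x. f x + 1 / (real m + 1)"]) auto
  qed
  ultimately show ?thesis by blast
qed

text \<open>Each new function is placed below the minimum of its predecessor and \<open>h n\<close>.
  The predecessor gives monotonicity; the functions \<open>h n\<close>, which come arbitrarily close
  to \<open>shifted\<close> at almost every point, squeeze the limit.\<close>

lemma decreasing_approximation:
  assumes "\<And>x. shifted x \<le> - 1"
  shows "\<exists>w. (\<forall>k. smooth_psh (w k)) \<and> (\<forall>k x. w (Suc k) x \<le> w k x) \<and> (AE x in vol. (\<lambda>k. w k x) \<longlonglongrightarrow> shifted x)"
proof -
  obtain \<G> where \<G>: "countable \<G>" "\<G> \<noteq> {}" "\<And>h. h \<in> \<G> \<Longrightarrow> continuous_on UNIV h"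
    "\<And>h. h \<in> \<G> \<Longrightarrow> \<exists>\<eta>>0. \<forall>x. u x \<noteq> -\<infinity> \<longrightarrow> shifted x + \<eta> \<le> h x"
    "\<And>x e. u x \<noteq> -\<infinity> \<Longrightarrow> 0 < e \<Longrightarrow> \<exists>h\<in>\<G>. h x < shifted x + e"
    using countable_upper_functions by metis
  define h where "h = from_nat_into \<G>"
  have h: "h n \<in> \<G>" for n unfolding h_def by (rule from_nat_into[OF \<G>(2)])
  define P where "P = (\<lambda>(n::nat) w. smooth_psh w \<and> (\<forall>x. w x \<le> 0) \<and> (\<exists>\<eta>>0. AE x in vol. shifted x + \<eta> \<le> w x))"
  have step: "\<exists>w'. P (Suc n) w' \<and> (\<forall>x. w' x \<le> w x \<and> w' x \<le> h n x)" if w: "P n w" for w n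
  proof -
    obtain \<eta> where \<eta>: "0 < \<eta>" "AE x in vol. shifted x + \<eta> \<le> w x" using w unfolding P_def by blast
    obtain \<eta>' where \<eta>': "0 < \<eta>'" "\<And>x. u x \<noteq> -\<infinity> \<Longrightarrow> shifted x + \<eta>' \<le> h n x" using \<G>(4)[OF h[of n]] by blast
    have cw: "continuous_on UNIV w" using w smooth_function_continuous unfolding P_def smooth_psh_def by blast
    have ct: "continuous_on UNIV (\<lambda>x. min (w x) (h n x))" by (rule continuous_on_min[OF cw \<G>(3)[OF h]])
    have le0: "min (w x) (h n x) \<le> 0" for x using w unfolding P_def by (simp add: min.coboundedI1)
    have "AE x in vol. shifted x + min \<eta> \<eta>' \<le> min (w x) (h n x)"
      using \<eta>(2) PSH_AE_finite[OF u]
    proof eventually_elim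
      case (elim x)
      then show ?case using \<eta>'(2)[of x] by linarith
    qed
    from regularization_step[OF ct le0 _ this] \<eta>(1) \<eta>'(1) obtain w' \<eta>'' where w': "smooth_psh w'" "0 < \<eta>''"
      "\<And>x. w' x \<le> min (w x) (h n x)" "AE x in vol. shifted x + \<eta>'' \<le> w' x" by auto
    have "w' x \<le> 0" for x using w'(3)[of x] le0[of x] by linarith
    then show ?thesis using w' unfolding P_def by (intro exI[of _ w']) auto
  qed
  have "\<exists>w. P 0 w"
  proof -
    \<comment> \<open>The sequence starts below the majorant 0 with gap 1, by the
      assumption.\<close>
    have "AE x in vol. shifted x + 1 \<le> 0" using assms by (intro AE_I2) (simp add: le_diff_eq[symmetric])
    from regularization_step[OF continuous_on_const order_refl _ this] show ?thesis unfolding P_def by auto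
  qed
  from dependent_nat_choice[of P "\<lambda>n w w'. \<forall>x. w' x \<le> w x \<and> w' x \<le> h n x", OF this step]
  obtain w where w: "\<And>n. P n (w n)" "\<And>n x. w (Suc n) x \<le> w n x" "\<And>n x. w (Suc n) x \<le> h n x" by blast
  have ge: "AE x in vol. shifted x \<le> w n x" for n
  proof -
    obtain \<eta> where "0 < \<eta>" "AE x in vol. shifted x + \<eta> \<le> w n x" using w(1)[of n] unfolding P_def by blast
    then show ?thesis by (elim AE_mp) (intro AE_I2 impI, linarith)
  qed
  have "AE x in vol. \<forall>n. shifted x \<le> w n x" using ge by (simp add: AE_all_countable)
  then have "AE x in vol. (\<lambda>k. w k x) \<longlonglongrightarrow> shifted x"
    using PSH_AE_finite[OF u]
  proof eventually_elim
    case (elim x)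
    show ?case
    proof (rule LIMSEQ_I)
      fix e :: real assume "0 < e"
      then obtain f where f: "f \<in> \<G>" "f x < shifted x + e" using \<G>(5)[OF elim(2)] by blast
      obtain n where n: "h n = f" using from_nat_into_surj[OF \<G>(1) f(1)] unfolding h_def by blast
      have dec: "decseq (\<lambda>k. w k x)" using w(2) by (simp add: decseq_Suc_iff)
      have "norm (w k x - shifted x) < e" if "Suc n \<le> k" for k
      proof -
        have "shifted x \<le> w k x" "w k x < shifted x + e"
          using elim(1) decseqD[OF dec that] w(3)[of n x] n f(2) by auto
        then show ?thesis by simp
      qed
      then show "\<exists>no. \<forall>k\<ge>no. norm (w k x - shifted x) < e" by blast
    qed
  qed
  then show ?thesis using w(1,2) unfolding P_def by blast
qed

end

theorem theorem7p1:
  fixes atlas :: "('a::{t2_space, second_countable_topology}, 'n::finite) chart set"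
    and g :: "('a, 'n) chart \<Rightarrow> complex^'n \<Rightarrow> complex^'n^'n"
    and u :: "'a \<Rightarrow> ereal"
  assumes "compact_kaehler_manifold atlas g"
    and "u \<in> PSH atlas g"
  shows "\<exists>v :: nat \<Rightarrow> 'a \<Rightarrow> real.
    (\<forall>k. smooth_function atlas (v k) \<and> (\<lambda>x. ereal (v k x)) \<in> PSH atlas g) \<and>
    (\<forall>k x. v (Suc k) x \<le> v k x) \<and>
    (AE x in kaehler_volume atlas g. (\<lambda>k. ereal (v k x)) \<longlonglongrightarrow> u x)"
proof -
  interpret compact_kaehler_manifold atlas g by fact
  obtain X c r where "chart_cover atlas g X c r" using chart_cover_exists by blast
  then interpret chart_cover atlas g X c r .
  obtain B0 where B0: "0 \<le> B0" "\<And>x. u x \<le> ereal B0" using PSH_bounded_above[OF assms(2)] by blast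
  \<comment> \<open>Exceeding the upper bound by 1 makes \<open>shifted\<close> at most -1
    everywhere, also where u is -\<infinity> and \<open>shifted\<close> is -(B0 + 1).\<close>
  have B1: "u x \<le> ereal (B0 + 1)" for x by (rule order_trans[OF B0(2)]) simp
  interpret psh_regularization atlas g X c r u "B0 + 1"
    by unfold_locales (use assms(2) B0(1) B1 in auto)
  have "shifted x \<le> - 1" for x using B0(2)[of x] B0(1) by (cases "u x") (auto simp: shifted_def)
  from decreasing_approximation[OF this] obtain w where w: "\<And>k. smooth_psh (w k)"
    "\<And>k x. w (Suc k) x \<le> w k x" "AE x in vol. (\<lambda>k. w k x) \<longlonglongrightarrow> shifted x" by blast
  define v where "v = (\<lambda>k x. w k x + (B0 + 1))"
  have v: "smooth_psh (v k)" for k unfolding v_def by (rule smooth_psh_add_const[OF w(1)])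
  have "AE x in vol. (\<lambda>k. ereal (v k x)) \<longlonglongrightarrow> u x"
    using w(3) PSH_AE_finite[OF assms(2)]
  proof eventually_elim
    case (elim x)
    have "\<bar>u x\<bar> \<noteq> \<infinity>" using elim(2) B0(2)[of x] by (cases "u x") auto
    then have e: "ereal (shifted x + (B0 + 1)) = u x" by (simp add: shifted_def ereal_real)
    have "(\<lambda>k. v k x) \<longlonglongrightarrow> shifted x + (B0 + 1)" unfolding v_def by (intro tendsto_add elim(1) tendsto_const)
    then have "(\<lambda>k. ereal (v k x)) \<longlonglongrightarrow> ereal (shifted x + (B0 + 1))" by (intro tendsto_intros)
    then show ?case unfolding e .
  qed
  moreover have "smooth_function atlas (v k)" for k using v unfolding smooth_psh_def by blast
  moreover have "(\<lambda>x. ereal (v k x)) \<in> PSH atlas g" for k by (rule smooth_psh_PSH[OF v])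
  moreover have "v (Suc k) x \<le> v k x" for k x unfolding v_def using w(2) by simp
  ultimately show ?thesis by blast
qed

end
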